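(* Let $\mathcal{D}_0=\{(X_i,Y_i,Z_i)\}_{i=1}^n$ be i.i.d. copies of $(X,Y,Z)$ with joint density $p_{X,Y,Z}$ on $\mathbb{R}^{d_X+d_Y+d_Z}$, suppose assumptions (A1), (A2), (A3) (stated in the context) hold, and fix $\alpha\in(0,1)$ and a weight function $a$. Let $p_{CPT}$ be the conditional permutation test $p$-value with $M$ permutations defined in the context. Then the test $\phi_{CPT}=\mathbf 1\{p_{CPT}<\alpha\}$ controls Type I error in finite samples: $\mathbb{P}_{H_0}(\phi_{CPT}=1)\le\alpha$, where $H_0$ is that $X$ and $Y$ are conditionally independent given $Z$. Moreover, if $M>(1-\alpha)/\alpha$, then $\lim_{n\to\infty}\mathbb{P}_{H_1}(\phi_{CPT}=1)=1$, where $H_1$ is that $X$ and $Y$ are not conditionally independent given $Z$.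
   Context: Marginals of $p_{X,Y,Z}$ are denoted $p_{X,Z},p_{Y,Z},p_Z$, etc. A weight function is a bounded measurable $a:\mathbb{R}^{d_Y}\times\mathbb{R}^{d_Z}\to[0,\infty)$ positive on the support of $p_{Y,Z}$. $\|\cdot\|$ is the Euclidean norm. Ball divergence: for probability measures $P,Q$ on $\mathbb{R}^d$, $\Theta^2(P,Q)=\int\int (P(\bar B)-Q(\bar B))^2\{dP(u)dP(v)+dQ(u)dQ(v)\}$ with $\bar B=\bar B(u,\|v-u\|)$ the closed ball of center $u$ and radius $\|v-u\|$. Test statistic: for a data set $\mathcal{D}=\{(X_i,Y_i,Z_i)\}_{i=1}^n$, kernel $K:[0,\infty)\to[0,\infty)$ and bandwidths $h_1,h_2>0$, let $$\tilde{\mathbb{P}}_{X|Y=y,Z=z}(A)=\frac{\sum_{i=1}^n K(\|(y,z)-(Y_i,Z_i)\|/h_1)\mathbf 1\{X_i\in A\}}{\sum_{i=1}^n K(\|(y,z)-(Y_i,Z_i)\|/h_1)},\qquad \tilde{\mathbb{P}}_{X|Z=z}(A)=\frac{\sum_{i=1}^n K(\|z-Z_i\|/h_2)\mathbf 1\{X_i\in A\}}{\sum_{i=1}^n K(\|z-Z_i\|/h_2)},$$ and $\hat\zeta_n(\mathcal{D})=\frac1n\sum_{s=1}^n\Theta^2(\tilde{\mathbb{P}}_{X|Y_s,Z_s},\tilde{\mathbb{P}}_{X|Z_s})\,a(Y_s,Z_s)$. Conditional permutation test: the conditional density $p(x|z)$ of $X$ given $Z=z$ is known. Given the data, generate permutations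 $\pi_1,\dots,\pi_M$ of $\{1,\dots,n\}$ independently from the distribution $$\mathbb{P}(\Pi=\pi\,|\,\mathcal{D}_0)=\frac{\prod_{\ell=1}^np(X_{\pi(\ell)}|Z_\ell)}{\sum_{\pi'\in S_n}\prod_{\ell=1}^np(X_{\pi'(\ell)}|Z_\ell)},$$ where $S_n$ is the set of permutations of $\{1,\dots,n\}$. Put $\mathcal{D}^{\pi_j}=\{(X_{\pi_j(i)},Y_i,Z_i)\}_{i=1}^n$ and $p_{CPT}=\frac{1+\sum_{j=1}^M\mathbf 1\{\hat\zeta_n(\mathcal{D}^{\pi_j})\ge\hat\zeta_n(\mathcal{D}_0)\}}{1+M}$. Niceness: a joint density $f(x,y)$ is nice with respect to $Y$ (its second argument) if, for any sequence $\delta_n\to0$, with $$R_n(x,y;u)=\frac1{\delta_n^2}\left\{\frac{f(x,y+\delta_n u)}{f(x,y)}-1-\delta_n\Big(\frac{\frac{\partial}{\partial y}f(x,y)}{f(x,y)}\Big)u^\top\right\},$$ the quantity $\sup_{u:\|u\|=1}\limsup_{n\to\infty}\int R_n(x,y;u)^2f(x,y)\,dx$ is uniformly bounded in $y$ (vectors are rows). (A1) $p_{X,Z}$ is nice with respect to $Z$, $p_{X,Y,Z}$ is nice with respect to $(Y,Z)$, and $p_{X,Y,Z}$ and its marginals are uniformly bounded. (A2) $K$ is uniformly bounded, non-negative, symmetric about zero, compactly supported, and $\int_{\mathbb{R}^d}K(\|u\|)du=1$, $\int_{\mathbb{R}^d}u^\top u\,K(\|u\|)du=\tau I_d$ for some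 constant $\tau>0$, where $d=d_Y+d_Z$ or $d=d_Z$ depending on the context in which $K$ is used. (A3) $h_1,h_2$ depend on $n$ such that, with $d_1=d_Y+d_Z$, $d_2=d_Z$: $h_1^{d_1}/h_2^{d_2}\to0$, $nh_i^{d_i}\to\infty$ and $nh_i^{d_i+4}\to0$ for $i=1,2$, as $n\to\infty$. *)

theory Defs
  imports "HOL-Probability.Probability"
begin

text \<open>
  A density on $R^{d_X+d_Y+d_Z}$ is a function on the product of three Euclidean spaces; products
  carry the Euclidean norm, so \<^typ>\<open>'y::euclidean_space \<times> 'z::euclidean_space\<close> plays the role of
  $R^{d_Y+d_Z}$.
\<close>

definition marg_XZ ::
  "('x::euclidean_space \<times> 'y::euclidean_space \<times> 'z::euclidean_space \<Rightarrow> real) \<Rightarrow> 'x \<times> 'z \<Rightarrow> real"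
  where "marg_XZ p = (\<lambda>(x, z). \<integral>y. p (x, y, z) \<partial>lborel)"

definition marg_YZ ::
  "('x::euclidean_space \<times> 'y::euclidean_space \<times> 'z::euclidean_space \<Rightarrow> real) \<Rightarrow> 'y \<times> 'z \<Rightarrow> real"
  where "marg_YZ p = (\<lambda>(y, z). \<integral>x. p (x, y, z) \<partial>lborel)"

definition marg_Z ::
  "('x::euclidean_space \<times> 'y::euclidean_space \<times> 'z::euclidean_space \<Rightarrow> real) \<Rightarrow> 'z \<Rightarrow> real"
  where "marg_Z p = (\<lambda>z. \<integral>(x, y). p (x, y, z) \<partial>lborel)"

definition cond_density ::
  "('x::euclidean_space \<times> 'y::euclidean_space \<times> 'z::euclidean_space \<Rightarrow> real) \<Rightarrow> 'x \<Rightarrow> 'z \<Rightarrow> real"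
  where "cond_density p x z = marg_XZ p (x, z) / marg_Z p z"

definition cond_pr :: "'w measure \<Rightarrow> 'w measure \<Rightarrow> 'w set \<Rightarrow> 'w \<Rightarrow> real"
  where "cond_pr \<Omega> F E = real_cond_exp \<Omega> F (indicator E)"

text \<open>Independence of \<open>X\<close> and \<open>Y\<close> conditionally on the sigma-algebra generated by \<open>Z\<close>.\<close>

definition cond_indep ::
  "'w measure \<Rightarrow> ('w \<Rightarrow> 'x::topological_space) \<Rightarrow> ('w \<Rightarrow> 'y::topological_space) \<Rightarrow>
   ('w \<Rightarrow> 'z::topological_space) \<Rightarrow> bool"
  where "cond_indep \<Omega> X Y Z \<longleftrightarrow>
    (let F = vimage_algebra (space \<Omega>) Z borel in
     \<forall>A\<in>sets borel. \<forall>B\<in>sets borel. AE \<omega> in \<Omega>.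
       cond_pr \<Omega> F {\<omega>\<in>space \<Omega>. X \<omega> \<in> A \<and> Y \<omega> \<in> B} \<omega> =
       cond_pr \<Omega> F {\<omega>\<in>space \<Omega>. X \<omega> \<in> A} \<omega> * cond_pr \<Omega> F {\<omega>\<in>space \<Omega>. Y \<omega> \<in> B} \<omega>)"

definition ball_divergence :: "'x::euclidean_space measure \<Rightarrow> 'x measure \<Rightarrow> real"
  where "ball_divergence P Q =
    (\<integral>v. \<integral>u. (measure P (cball u (norm (v - u))) - measure Q (cball u (norm (v - u))))\<^sup>2 \<partial>P \<partial>P) +
    (\<integral>v. \<integral>u. (measure P (cball u (norm (v - u))) - measure Q (cball u (norm (v - u))))\<^sup>2 \<partial>Q \<partial>Q)"

text \<open>
  The discrete measure with mass $w_i / \sum_j w_j$ at $x_i$.  If all weights vanish, it is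
  the zero measure, because of \<^prop>\<open>(0::real) / 0 = 0\<close>.
\<close>

definition weighted_empirical ::
  "nat \<Rightarrow> (nat \<Rightarrow> real) \<Rightarrow> (nat \<Rightarrow> 'x::euclidean_space) \<Rightarrow> 'x measure"
  where "weighted_empirical n w x =
    distr (point_measure {1..n} (\<lambda>i. ennreal (w i / (\<Sum>j=1..n. w j)))) borel x"

lemma measure_weighted_empirical:
  assumes "\<And>i. 0 \<le> w i" "A \<in> sets borel"
  shows "measure (weighted_empirical n w x) A =
    (\<Sum>i=1..n. w i * indicator A (x i)) / (\<Sum>i=1..n. w i)"
proof -
  let ?v = "\<lambda>i. w i / (\<Sum>j=1..n. w j)"
  have v0: "0 \<le> ?v i" for i
    using assms by (simp add: sum_nonneg)
  have "emeasure (weighted_empirical n w x) A = (\<Sum>i\<in>x -` A \<inter> {1..n}. ennreal (?v i))"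
    unfolding weighted_empirical_def using assms(2)
    by (subst emeasure_distr)
      (auto simp: space_point_measure measurable_point_measure_eq1 emeasure_point_measure_finite)
  also have "\<dots> = ennreal (\<Sum>i\<in>x -` A \<inter> {1..n}. ?v i)"
    using v0 by (simp add: sum_ennreal)
  also have "(\<Sum>i\<in>x -` A \<inter> {1..n}. ?v i) = (\<Sum>i=1..n. w i * indicator A (x i) / (\<Sum>j=1..n. w j))"
    by (intro sum.mono_neutral_cong_left) (auto simp: indicator_def)
  also have "\<dots> = (\<Sum>i=1..n. w i * indicator A (x i)) / (\<Sum>i=1..n. w i)"
    by (simp only: sum_divide_distrib)
  finally show ?thesis
    using assms(1) by (intro measure_eq_emeasure_eq_ennreal) (auto intro!: divide_nonneg_nonneg sum_nonneg)
qed

text \<open>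
  A data set of size \<open>n\<close> is given by the values $D_1,\dots,D_n$ of a function \<open>D\<close>.
\<close>

definition est_X_given_YZ ::
  "(real \<Rightarrow> real) \<Rightarrow> real \<Rightarrow> nat \<Rightarrow>
   (nat \<Rightarrow> 'x::euclidean_space \<times> 'y::euclidean_space \<times> 'z::euclidean_space) \<Rightarrow> 'y \<times> 'z \<Rightarrow> 'x measure"
  where "est_X_given_YZ K h n D yz =
    weighted_empirical n (\<lambda>i. K (norm (yz - snd (D i)) / h)) (\<lambda>i. fst (D i))"

definition est_X_given_Z ::
  "(real \<Rightarrow> real) \<Rightarrow> real \<Rightarrow> nat \<Rightarrow>
   (nat \<Rightarrow> 'x::euclidean_space \<times> 'y::euclidean_space \<times> 'z::euclidean_space) \<Rightarrow> 'z \<Rightarrow> 'x measure"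
  where "est_X_given_Z K h n D z =
    weighted_empirical n (\<lambda>i. K (norm (z - snd (snd (D i))) / h)) (\<lambda>i. fst (D i))"

definition zeta_hat ::
  "(real \<Rightarrow> real) \<Rightarrow> real \<Rightarrow> real \<Rightarrow> ('y::euclidean_space \<times> 'z::euclidean_space \<Rightarrow> real) \<Rightarrow> nat \<Rightarrow>
   (nat \<Rightarrow> 'x::euclidean_space \<times> 'y \<times> 'z) \<Rightarrow> real"
  where "zeta_hat K h1 h2 a n D =
    (1 / real n) * (\<Sum>s=1..n.
       ball_divergence (est_X_given_YZ K h1 n D (snd (D s))) (est_X_given_Z K h2 n D (snd (snd (D s))))
       * a (snd (D s)))"

definition permute_data ::
  "(nat \<Rightarrow> nat) \<Rightarrow> (nat \<Rightarrow> 'x \<times> 'y \<times> 'z) \<Rightarrow> nat \<Rightarrow> 'x \<times> 'y \<times> 'z"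
  where "permute_data \<pi> D = (\<lambda>i. (fst (D (\<pi> i)), snd (D i)))"

definition perm_prob ::
  "('x::euclidean_space \<times> 'y::euclidean_space \<times> 'z::euclidean_space \<Rightarrow> real) \<Rightarrow> nat \<Rightarrow>
   (nat \<Rightarrow> 'x \<times> 'y \<times> 'z) \<Rightarrow> (nat \<Rightarrow> nat) \<Rightarrow> real"
  where "perm_prob p n D \<pi> =
    (\<Prod>l=1..n. cond_density p (fst (D (\<pi> l))) (snd (snd (D l)))) /
    (\<Sum>\<pi>'\<in>{\<pi>'. \<pi>' permutes {1..n}}.
       \<Prod>l=1..n. cond_density p (fst (D (\<pi>' l))) (snd (snd (D l))))"

text \<open>
  The random permutations \<open>perms 1, \<dots>, perms M\<close> are, conditionally on the data $D_1,\dots,D_n$,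
  independent with the distribution \<^const>\<open>perm_prob\<close>.
\<close>

definition cpt_permutations ::
  "'w measure \<Rightarrow> ('x::euclidean_space \<times> 'y::euclidean_space \<times> 'z::euclidean_space \<Rightarrow> real) \<Rightarrow> nat \<Rightarrow>
   (nat \<Rightarrow> 'w \<Rightarrow> 'x \<times> 'y \<times> 'z) \<Rightarrow> nat \<Rightarrow> (nat \<Rightarrow> 'w \<Rightarrow> nat \<Rightarrow> nat) \<Rightarrow> bool"
  where "cpt_permutations \<Omega> p n D M perms \<longleftrightarrow>
    (let F = vimage_algebra (space \<Omega>) (\<lambda>\<omega>. \<lambda>i\<in>{1..n}. D i \<omega>) (PiM {1..n} (\<lambda>_. borel)) in
     (\<forall>j\<in>{1..M}. perms j \<in> measurable \<Omega> (count_space {\<pi>. \<pi> permutes {1..n}})) \<and>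
     (\<forall>\<sigma>. (\<forall>j\<in>{1..M}. \<sigma> j permutes {1..n}) \<longrightarrow>
       (AE \<omega> in \<Omega>. cond_pr \<Omega> F {\<omega>\<in>space \<Omega>. \<forall>j\<in>{1..M}. perms j \<omega> = \<sigma> j} \<omega> =
          (\<Prod>j=1..M. perm_prob p n (\<lambda>i. D i \<omega>) (\<sigma> j)))))"

definition p_CPT ::
  "((nat \<Rightarrow> 'x \<times> 'y \<times> 'z) \<Rightarrow> real) \<Rightarrow> nat \<Rightarrow> (nat \<Rightarrow> nat \<Rightarrow> nat) \<Rightarrow> (nat \<Rightarrow> 'x \<times> 'y \<times> 'z) \<Rightarrow> real"
  where "p_CPT stat M \<pi> D =
    (1 + (\<Sum>j=1..M. of_bool (stat (permute_data (\<pi> j) D) \<ge> stat D))) / (1 + real M)"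

definition phi_CPT ::
  "real \<Rightarrow> ((nat \<Rightarrow> 'x \<times> 'y \<times> 'z) \<Rightarrow> real) \<Rightarrow> nat \<Rightarrow> (nat \<Rightarrow> nat \<Rightarrow> nat) \<Rightarrow>
   (nat \<Rightarrow> 'x \<times> 'y \<times> 'z) \<Rightarrow> real"
  where "phi_CPT \<alpha> stat M \<pi> D = of_bool (p_CPT stat M \<pi> D < \<alpha>)"

definition weight_function ::
  "('x::euclidean_space \<times> 'y::euclidean_space \<times> 'z::euclidean_space \<Rightarrow> real) \<Rightarrow>
   ('y \<times> 'z \<Rightarrow> real) \<Rightarrow> bool"
  where "weight_function p a \<longleftrightarrow>
    a \<in> borel_measurable borel \<and> (\<forall>w. 0 \<le> a w) \<and> bounded (range a) \<and>
    (\<forall>w. 0 < marg_YZ p w \<longrightarrow> 0 < a w)"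

text \<open>
  The row vector of partial derivatives of $f(x,y)$ with respect to the coordinates of $y$.
\<close>

definition partial_grad ::
  "('x \<times> 'y::euclidean_space \<Rightarrow> real) \<Rightarrow> 'x \<Rightarrow> 'y \<Rightarrow> 'y"
  where "partial_grad f x y = (\<Sum>b\<in>Basis. deriv (\<lambda>t. f (x, y + t *\<^sub>R b)) 0 *\<^sub>R b)"

definition nice_remainder ::
  "('x \<times> 'y::euclidean_space \<Rightarrow> real) \<Rightarrow> real \<Rightarrow> 'x \<Rightarrow> 'y \<Rightarrow> 'y \<Rightarrow> real"
  where "nice_remainder f \<delta> x y u =
    1 / \<delta>\<^sup>2 * (f (x, y + \<delta> *\<^sub>R u) / f (x, y) - 1 - \<delta> * ((partial_grad f x y /\<^sub>R f (x, y)) \<bullet> u))"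

text \<open>
  The partial derivatives have to exist where they are divided by a nonzero $f(x,y)$.  Points with
  $f(x,y) = 0$ do not contribute to the integral, whose measure is $f(x,y)\,dx$.  The integral is
  taken in \<^typ>\<open>ennreal\<close>, so that being bounded includes being finite.
\<close>

definition nice :: "('x::euclidean_space \<times> 'y::euclidean_space \<Rightarrow> real) \<Rightarrow> bool"
  where "nice f \<longleftrightarrow>
    (\<forall>x y. f (x, y) \<noteq> 0 \<longrightarrow>
       (\<forall>b\<in>Basis. (\<lambda>t::real. f (x, y + t *\<^sub>R b)) differentiable (at 0))) \<and>
    (\<forall>\<delta>::nat \<Rightarrow> real. (\<forall>n. \<delta> n \<noteq> 0) \<and> \<delta> \<longlonglongrightarrow> 0 \<longrightarrow>
       (\<exists>C. \<forall>y. (SUP u\<in>sphere 0 1.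
          limsup (\<lambda>n. \<integral>\<^sup>+x. ennreal ((nice_remainder f (\<delta> n) x y u)\<^sup>2 * f (x, y)) \<partial>lborel)) \<le> ennreal C))"

text \<open>
  The marginals are again integrated in \<^typ>\<open>ennreal\<close>: a bound on the Bochner integral would
  not exclude infinite values, for which that integral is 0.
\<close>

definition bounded_marginals ::
  "('x::euclidean_space \<times> 'y::euclidean_space \<times> 'z::euclidean_space \<Rightarrow> real) \<Rightarrow> bool"
  where "bounded_marginals p \<longleftrightarrow> (\<exists>C.
    (\<forall>x y z. p (x, y, z) \<le> C) \<and>
    (\<forall>x y. (\<integral>\<^sup>+z. ennreal (p (x, y, z)) \<partial>lborel) \<le> ennreal C) \<and>
    (\<forall>x z. (\<integral>\<^sup>+y. ennreal (p (x, y, z)) \<partial>lborel) \<le> ennreal C) \<and>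
    (\<forall>y z. (\<integral>\<^sup>+x. ennreal (p (x, y, z)) \<partial>lborel) \<le> ennreal C) \<and>
    (\<forall>x. (\<integral>\<^sup>+(y, z). ennreal (p (x, y, z)) \<partial>lborel) \<le> ennreal C) \<and>
    (\<forall>y. (\<integral>\<^sup>+(x, z). ennreal (p (x, y, z)) \<partial>lborel) \<le> ennreal C) \<and>
    (\<forall>z. (\<integral>\<^sup>+(x, y). ennreal (p (x, y, z)) \<partial>lborel) \<le> ennreal C))"

definition assumption_A1 ::
  "('x::euclidean_space \<times> 'y::euclidean_space \<times> 'z::euclidean_space \<Rightarrow> real) \<Rightarrow> bool"
  where "assumption_A1 p \<longleftrightarrow> nice (marg_XZ p) \<and> nice p \<and> bounded_marginals p"

text \<open>
  The moment conditions on \<open>K\<close> in dimension $d$; the second one is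
  $\int u^\top u\, K(\|u\|)\,du = \tau I_d$ entry by entry.
\<close>

definition kernel_moments :: "'d::euclidean_space itself \<Rightarrow> (real \<Rightarrow> real) \<Rightarrow> bool"
  where "kernel_moments T K \<longleftrightarrow>
    (\<integral>u. K (norm (u::'d)) \<partial>lborel) = 1 \<and>
    (\<exists>\<tau>>0. \<forall>i\<in>Basis. \<forall>j\<in>Basis.
       (\<integral>u. (u \<bullet> i) * (u \<bullet> j) * K (norm (u::'d)) \<partial>lborel) = (if i = j then \<tau> else 0))"

text \<open>
  The one kernel \<open>K\<close> is used in dimensions $d_Y+d_Z$ and $d_Z$ and has to satisfy the moment
  conditions in both, with a \<open>\<tau>\<close> that may depend on the dimension.  This is no restriction on the
  shape of the kernel: replacing $K(r)$ by $cK(sr)$ and $h_i$ by $sh_i$ leaves the test unchanged.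
\<close>

definition assumption_A2 ::
  "'y::euclidean_space itself \<Rightarrow> 'z::euclidean_space itself \<Rightarrow> (real \<Rightarrow> real) \<Rightarrow> bool"
  where "assumption_A2 TY TZ K \<longleftrightarrow>
    K \<in> borel_measurable borel \<and> bounded (range K) \<and> (\<forall>t. 0 \<le> K t) \<and> (\<forall>t. K (- t) = K t) \<and>
    compact (closure {t. K t \<noteq> 0}) \<and>
    kernel_moments TYPE('y \<times> 'z) K \<and> kernel_moments TYPE('z) K"

definition assumption_A3 :: "nat \<Rightarrow> nat \<Rightarrow> (nat \<Rightarrow> real) \<Rightarrow> (nat \<Rightarrow> real) \<Rightarrow> bool"
  where "assumption_A3 d1 d2 h1 h2 \<longleftrightarrow>
    (\<lambda>n. h1 n ^ d1 / h2 n ^ d2) \<longlonglongrightarrow> 0 \<and>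
    filterlim (\<lambda>n. real n * h1 n ^ d1) at_top sequentially \<and>
    filterlim (\<lambda>n. real n * h2 n ^ d2) at_top sequentially \<and>
    (\<lambda>n. real n * h1 n ^ (d1 + 4)) \<longlonglongrightarrow> 0 \<and>
    (\<lambda>n. real n * h2 n ^ (d2 + 4)) \<longlonglongrightarrow> 0"

end

theory Submission
  imports Defs "HOL-Probability.Hoeffding"
begin

text \<open>
  Under conditional independence the data have density $\prod_i p(x_i|z_i)$ with respect to the
  product of Lebesgue measure and the law of $(Y,Z)$.  A permutation of the \<open>X\<close>-values drawn with the
  likelihood weights leaves this law invariant, so the original and the permuted data sets are exchangeable
  and the rank of the original statistic among all statistics bounds the level.

  For the power, if conditional independence fails, then some closed ball has different conditional
  probabilities given $(Y,Z)$ and given \<open>Z\<close> on a set of positive measure, and the \<open>L\<^sup>1\<close>-consistency of the kernel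
  estimates keeps the original statistic above a positive constant.  The statistic of the permuted
  data tends to 0: the divergence of its two weighted empirical measures at $(Y_s,Z_s)$ is at most the average
  loss of likelihood when $X_j$ and $X_k$ are exchanged, over \<open>j\<close> and \<open>k\<close> with $Z_j$ and $Z_k$ close to $Z_s$, and this
  loss is controlled by the \<open>L\<^sup>1\<close>-continuity of $t \mapsto p_{X,Z}(\cdot, \cdot + t)$.
\<close>

section \<open>Translations in $L^1$\<close>

text \<open>The permuted sample is not independent: its \<open>X\<close>-values are drawn without
  replacement from the observed ones, with weights that depend on all the data, so the consistency
  of the kernel estimates says nothing about it. What can be computed is the ratio of the weights of
  \<sigma> and of \<sigma> composed with a transposition, since all but two factors cancel. The
  expectation of the resulting loss is accessible because the resampling invariance also holds under
  the alternative, provided that it is applied to the pairs (X_i,Z_i): given \<open>Z\<close>,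
  \<open>X\<close> always has the density p(x|z). The obstacle is then the kernel weight at
  (Y_j,Z_j), for under the alternative Y_j is tied to X_j. It is removed by the boundedness of
  p_{X,Y,Z} on the event that p_{X,Z}(X_j,Z_j) is not small; the complementary event has small
  probability. The condition on \<open>M\<close> says exactly that the least possible p-value
  1/(1+M) is below \<alpha>.\<close>

lemma lborel_translate:
  fixes f :: "'a::euclidean_space \<Rightarrow> 'b::{banach, second_countable_topology}"
  assumes "integrable lborel f"
  shows "integrable lborel (\<lambda>x. f (x + t))" "(\<integral>x. f (x + t) \<partial>lborel) = (\<integral>x. f x \<partial>lborel)"
proof -
  have [measurable]: "f \<in> borel_measurable borel" using assms by auto
  have "integrable (distr lborel borel ((+) t)) f"
    using assms by (simp add: lborel_distr_plus)
  then show "integrable lborel (\<lambda>x. f (x + t))"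
    by (subst (asm) integrable_distr_eq) (auto simp: add.commute)
  have "(\<integral>x. f x \<partial>lborel) = (\<integral>x. f x \<partial>distr lborel borel ((+) t))"
    by (simp add: lborel_distr_plus)
  also have "\<dots> = (\<integral>x. f (x + t) \<partial>lborel)"
    by (subst integral_distr) (auto simp: add.commute)
  finally show "(\<integral>x. f (x + t) \<partial>lborel) = (\<integral>x. f x \<partial>lborel)" ..
qed

lemma nn_integral_lborel_translate:
  fixes f :: "'a::euclidean_space \<Rightarrow> ennreal"
  assumes [measurable]: "f \<in> borel_measurable borel"
  shows "(\<integral>\<^sup>+x. f (t + x) \<partial>lborel) = (\<integral>\<^sup>+x. f x \<partial>lborel)"
proof -
  have "(\<integral>\<^sup>+x. f x \<partial>lborel) = (\<integral>\<^sup>+x. f x \<partial>distr lborel borel ((+) t))"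
    by (simp add: lborel_distr_plus)
  also have "\<dots> = (\<integral>\<^sup>+x. f (t + x) \<partial>lborel)"
    by (subst nn_integral_distr) auto
  finally show ?thesis ..
qed

text \<open>Regularity of Lebesgue measure encloses \<open>A\<close> between a compact
  \<open>T\<close> and an open \<open>U\<close> that differ by a set of small measure. For shifts
  shorter than the distance from \<open>T\<close> to the complement of \<open>U\<close>, the points
  where \<open>A\<close> and its translate differ are covered by \<open>U - T\<close> and its
  translate.\<close>

lemma indicator_translation_L1:
  fixes A :: "'a::euclidean_space set"
  assumes A: "A \<in> sets borel" "emeasure lborel A < \<infinity>" and e: "0 < e"
  shows "\<exists>d>0. \<forall>t. norm t < d \<longrightarrow> (\<integral>x. \<bar>indicator A (x + t) - indicator A x\<bar> \<partial>lborel) < (e::real)"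
proof -
  obtain U where U: "open U" "A \<subseteq> U" "emeasure lborel (U - A) < ennreal (e/8)"
    using outer_regular_lborel[OF A(1), of "e/8"] e by auto
  \<comment> \<open>Inner regularity concerns finite measures, so it is applied to Lebesgue measure
    restricted to \<open>A\<close>.\<close>
  let ?M = "density lborel (indicator A)"
  have M: "sets ?M = sets borel" "emeasure ?M (space ?M) \<noteq> \<infinity>"
    using A by (auto simp: emeasure_density)
  have "emeasure ?M A = (SUP K \<in> {K. K \<subseteq> A \<and> compact K}. emeasure ?M K)"
    using inner_regular[OF M A(1)] .
  moreover have mA: "emeasure ?M A = emeasure lborel A"
    using A by (simp add: emeasure_density flip: indicator_inter_arith)
  ultimately have sup: "emeasure lborel A = (SUP K \<in> {K. K \<subseteq> A \<and> compact K}. emeasure ?M K)" by simp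
  have "\<exists>T. T \<subseteq> A \<and> compact T \<and> emeasure lborel A < emeasure ?M T + ennreal (e/8)"
  proof (cases "emeasure lborel A = 0")
    case True then show ?thesis using e by (intro exI[of _ "{}"]) auto
  next
    case False
    then have "emeasure lborel A - ennreal (e/8) < emeasure lborel A"
      using A(2) e by (intro ennreal_between) (auto simp: zero_less_iff_neq_zero)
    then obtain T where T: "T \<subseteq> A" "compact T" "emeasure lborel A - ennreal (e/8) < emeasure ?M T"
      unfolding sup less_SUP_iff by auto
    have "emeasure ?M T \<le> emeasure lborel A"
      unfolding mA[symmetric] using T A by (intro emeasure_mono) auto
    then obtain t where t: "emeasure ?M T = ennreal t" "0 \<le> t"
      using A(2) by (cases "emeasure ?M T") auto
    obtain r where r: "emeasure lborel A = ennreal r" "0 \<le> r"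
      using A(2) by (cases "emeasure lborel A") auto
    have "ennreal (r - e/8) < ennreal t" using T(3) t r e by (simp add: ennreal_minus)
    then have "r - e/8 < t" by (metis ennreal_leI linorder_not_less)
    then have "emeasure lborel A < emeasure ?M T + ennreal (e/8)"
      using t r e by (simp add: ennreal_less_iff flip: ennreal_plus)
    then show ?thesis using T by auto
  qed
  then obtain T where T: "T \<subseteq> A" "compact T" "emeasure lborel A < emeasure ?M T + ennreal (e/8)" by auto
  have Tb[measurable]: "T \<in> sets borel" using T(2) by (simp add: compact_imp_closed borel_closed)
  have Ub[measurable]: "U \<in> sets borel" using U(1) by auto
  note A(1)[measurable]
  have "emeasure ?M T = emeasure lborel T"
    using T(1) A by (simp add: emeasure_density flip: indicator_inter_arith) (metis inf.absorb_iff2)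
  with T(3) have T3: "emeasure lborel A < emeasure lborel T + ennreal (e/8)" by simp
  have fin: "emeasure lborel U < \<infinity>"
  proof -
    have "emeasure lborel U = emeasure lborel A + emeasure lborel (U - A)"
      using U(2) by (subst plus_emeasure) (auto simp: Un_absorb1)
    also have "\<dots> < \<infinity>" using A(2) U(3) by (auto intro!: ennreal_add_less_top less_trans[OF U(3)])
    finally show ?thesis .
  qed
  have finT: "emeasure lborel T < \<infinity>" 
    using le_less_trans[OF emeasure_mono[OF T(1)] A(2)] by simp
  have mU: "measure lborel U - measure lborel A < e/8"
  proof -
    have "measure lborel (U - A) = measure lborel U - measure lborel A"
      using U(2) fin A by (intro measure_Diff) auto
    moreover have "measure lborel (U - A) < e/8"
      using U(3) e by (metis emeasure_eq_ennreal_measure ennreal_less_iff measure_nonneg top.extremum_strict)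
    ultimately show ?thesis by simp
  qed
  have mT: "measure lborel A - measure lborel T < e/8"
  proof -
    have "ennreal (measure lborel A) < ennreal (measure lborel T) + ennreal (e/8)"
      using T3 finT A by (simp add: emeasure_eq_ennreal_measure)
    then have "ennreal (measure lborel A) < ennreal (measure lborel T + e/8)"
      using e by (simp flip: ennreal_plus)
    then show ?thesis by (simp add: ennreal_less_iff)
  qed
  obtain d where d: "d > 0" "\<And>x y. x \<in> T \<Longrightarrow> y \<notin> U \<Longrightarrow> d \<le> dist x y"
  proof -
    have "T \<inter> - U = {}" "closed (- U)" using U(1,2) T(1) by auto
    from separate_compact_closed[OF T(2) this(2,1)] show ?thesis using that by auto
  qed
  let ?g = "\<lambda>x. indicator U x - indicator T x :: real"
  have ig: "integrable lborel ?g" using fin finT by (intro Bochner_Integration.integrable_diff integrable_real_indicator) auto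
  have "(\<integral>x. \<bar>indicator A (x + t) - indicator A x\<bar> \<partial>lborel) < e" if t: "norm t < d" for t
  proof -
    \<comment> \<open>Suppose exactly one of \<open>x\<close> and \<open>x + t\<close> lies in
      \<open>A\<close>, say \<open>x\<close>. Either \<open>x\<close> is outside \<open>T\<close>,
      which \<open>?g x\<close> counts, or \<open>x + t\<close> is in \<open>U\<close> but not in
      \<open>T\<close>, which \<open>?g (x + t)\<close> counts.\<close>
    have b: "\<bar>indicator A (x + t) - indicator A x\<bar> \<le> ?g x + ?g (x + t)" for x
    proof -
      have "x + t \<in> U" if "x \<in> T" using d(2)[OF that, of "x+t"] t by (force simp: dist_norm)
      moreover have "x \<in> U" if "x + t \<in> T" using d(2)[OF that, of "x"] t by (force simp: dist_norm)
      ultimately show ?thesis using T(1) U(2) by (auto simp: indicator_def)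
    qed
    have "(\<integral>x. \<bar>indicator A (x + t) - indicator A x\<bar> \<partial>lborel) \<le> (\<integral>x. ?g x + ?g (x + t) \<partial>lborel)"
      by (intro integral_mono' Bochner_Integration.integrable_add ig lborel_translate(1)[OF ig] b
        order_trans[OF abs_ge_zero b])
    also have "\<dots> = (\<integral>x. ?g x \<partial>lborel) + (\<integral>x. ?g x \<partial>lborel)"
      by (subst Bochner_Integration.integral_add[OF ig lborel_translate(1)[OF ig]])
        (use lborel_translate(2)[OF ig, of t] in simp)
    also have "(\<integral>x. ?g x \<partial>lborel) = measure lborel U - measure lborel T"
      using fin finT by (subst Bochner_Integration.integral_diff) auto
    finally show ?thesis using mU mT e by linarith
  qed
  with d(1) show ?thesis by auto
qed

text \<open>Induction over integrable functions. In the limit step an approximation error has the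
  same norm after translation, so \<open>f\<close> inherits the modulus of one simple approximant up
  to two such errors.\<close>

lemma L1_translation_continuous:
  fixes f :: "'a::euclidean_space \<Rightarrow> real"
  assumes "integrable lborel f" "0 < e"
  shows "\<exists>d>0. \<forall>t. norm t < d \<longrightarrow> (\<integral>x. \<bar>f (x + t) - f x\<bar> \<partial>lborel) < e"
  using assms
proof (induction arbitrary: e rule: integrable_induct)
  case (base A c)
  from base have A: "A \<in> sets borel" "emeasure lborel A < \<infinity>" by auto
  obtain d where d: "d > 0" "\<And>t. norm t < d \<Longrightarrow> (\<integral>x. \<bar>indicator A (x + t) - indicator A x\<bar> \<partial>lborel) < e / (\<bar>c\<bar> + 1)"
    using indicator_translation_L1[OF A, of "e / (\<bar>c\<bar> + 1)"] base(3) by (auto simp: field_simps)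
  have "(\<integral>x. \<bar>indicator A (x + t) *\<^sub>R c - indicator A x *\<^sub>R c\<bar> \<partial>lborel) < e" if "norm t < d" for t
  proof -
    have "(\<integral>x. \<bar>indicator A (x + t) *\<^sub>R c - indicator A x *\<^sub>R c\<bar> \<partial>lborel) =
      (\<integral>x. \<bar>indicator A (x + t) - indicator A x\<bar> * \<bar>c\<bar> \<partial>lborel)"
      by (intro Bochner_Integration.integral_cong) (auto simp: indicator_def)
    also have "\<dots> = (\<integral>x. \<bar>indicator A (x + t) - indicator A x\<bar> \<partial>lborel) * \<bar>c\<bar>" by simp
    also have "\<dots> \<le> e / (\<bar>c\<bar> + 1) * \<bar>c\<bar>" using d(2)[OF that] by (intro mult_right_mono) auto
    also have "\<dots> < e" using base(3) by (simp add: field_simps)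
    finally show ?thesis .
  qed
  with d(1) show ?case by auto
next
  case (add f g)
  obtain d1 where d1: "d1 > 0" "\<And>t. norm t < d1 \<Longrightarrow> (\<integral>x. \<bar>f (x + t) - f x\<bar> \<partial>lborel) < e/2"
    using add(3)[of "e/2"] add.prems by auto
  obtain d2 where d2: "d2 > 0" "\<And>t. norm t < d2 \<Longrightarrow> (\<integral>x. \<bar>g (x + t) - g x\<bar> \<partial>lborel) < e/2"
    using add(4)[of "e/2"] add.prems by auto
  have "(\<integral>x. \<bar>(f (x + t) + g (x + t)) - (f x + g x)\<bar> \<partial>lborel) < e" if "norm t < min d1 d2" for t
  proof -
    note i = add(1) lborel_translate(1)[OF add(1), of t] add(2) lborel_translate(1)[OF add(2), of t]
    have "(\<integral>x. \<bar>(f (x + t) + g (x + t)) - (f x + g x)\<bar> \<partial>lborel) \<le>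
        (\<integral>x. \<bar>f (x + t) - f x\<bar> + \<bar>g (x + t) - g x\<bar> \<partial>lborel)"
      using i by (intro integral_mono) auto
    also have "\<dots> = (\<integral>x. \<bar>f (x + t) - f x\<bar> \<partial>lborel) + (\<integral>x. \<bar>g (x + t) - g x\<bar> \<partial>lborel)"
      using i by (intro Bochner_Integration.integral_add) auto
    finally show ?thesis using d1(2)[of t] d2(2)[of t] that by auto
  qed
  with d1(1) d2(1) show ?case by (intro exI[of _ "min d1 d2"]) auto
next
  case (lim f s)
  have "(\<lambda>i. \<integral>x. \<bar>s i x - f x\<bar> \<partial>lborel) \<longlonglongrightarrow> (\<integral>x. \<bar>f x - f x\<bar> \<partial>(lborel::'a measure))"
  \<comment> \<open>The simple functions supplied by \<open>integrable_induct\<close> satisfy |s_i|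
    \<le> 2|f|, whence the majorant 3|f| of the difference.\<close>
  proof (rule integral_dominated_convergence[where w="\<lambda>x. 3 * \<bar>f x\<bar>"])
    show "AE x in lborel. (\<lambda>i. \<bar>s i x - f x\<bar>) \<longlonglongrightarrow> \<bar>f x - f x\<bar>"
      using lim.hyps(2) by (intro AE_I2 tendsto_rabs tendsto_diff tendsto_const) auto
    show "AE x in lborel. norm \<bar>s i x - f x\<bar> \<le> 3 * \<bar>f x\<bar>" for i
      using lim.hyps(3)[of _ i] by (intro AE_I2) (smt (verit) real_norm_def space_lborel UNIV_I)
  qed (use lim in auto)
  then have "eventually (\<lambda>i. (\<integral>x. \<bar>s i x - f x\<bar> \<partial>lborel) < e/3) sequentially"
    using lim.prems by (intro order_tendstoD(2)[of _ 0]) auto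
  then obtain i where i: "(\<integral>x. \<bar>s i x - f x\<bar> \<partial>lborel) < e/3" by (auto simp: eventually_sequentially)
  obtain d where d: "d > 0" "\<And>t. norm t < d \<Longrightarrow> (\<integral>x. \<bar>s i (x + t) - s i x\<bar> \<partial>lborel) < e/3"
    using lim.IH[of "e/3" i] lim.prems by auto
  have "(\<integral>x. \<bar>f (x + t) - f x\<bar> \<partial>lborel) < e" if t: "norm t < d" for t
  proof -
    have id: "integrable lborel (\<lambda>x. \<bar>s i x - f x\<bar>)" using lim by auto
    note j = lim.hyps(1)[of i] lborel_translate(1)[OF lim.hyps(1)[of i], of t] lim.hyps(4) lborel_translate(1)[OF lim.hyps(4), of t]
    have "(\<integral>x. \<bar>f (x + t) - f x\<bar> \<partial>lborel) \<le>
        (\<integral>x. (\<bar>s i (x + t) - f (x + t)\<bar> + \<bar>s i x - f x\<bar>) + \<bar>s i (x + t) - s i x\<bar> \<partial>lborel)"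
      using j by (intro integral_mono) auto
    also have "\<dots> = ((\<integral>x. \<bar>s i (x + t) - f (x + t)\<bar> \<partial>lborel) + (\<integral>x. \<bar>s i x - f x\<bar> \<partial>lborel))
        + (\<integral>x. \<bar>s i (x + t) - s i x\<bar> \<partial>lborel)"
      using j by simp
    also have "(\<integral>x. \<bar>s i (x + t) - f (x + t)\<bar> \<partial>lborel) = (\<integral>x. \<bar>s i x - f x\<bar> \<partial>lborel)"
      using lborel_translate(2)[OF id, of t] .
    finally show ?thesis using i d(2)[OF t] by linarith
  qed
  with d(1) show ?case by auto
qed

lemma L1_translation_continuous_nn:
  fixes f :: "'a::euclidean_space \<Rightarrow> real"
  assumes "integrable lborel f" "0 < e"
  shows "\<exists>d>0. \<forall>t. norm t < d \<longrightarrow> (\<integral>\<^sup>+x. ennreal \<bar>f (x + t) - f x\<bar> \<partial>lborel) \<le> ennreal e"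
proof -
  obtain d where d: "d>0" "\<And>t. norm t < d \<Longrightarrow> (\<integral>x. \<bar>f (x + t) - f x\<bar> \<partial>lborel) < e"
    using L1_translation_continuous[OF assms] by auto
  have "(\<integral>\<^sup>+x. ennreal \<bar>f (x + t) - f x\<bar> \<partial>lborel) \<le> ennreal e" if "norm t < d" for t
    using d(2)[OF that] assms lborel_translate(1)[OF assms(1), of t]
    by (subst nn_integral_eq_integral) (auto intro!: ennreal_leI)
  with d(1) show ?thesis by auto
qed

section \<open>Closed balls determine a measure\<close>

definition msupport :: "'a::metric_space measure \<Rightarrow> 'a set"
  where "msupport P = {x. \<forall>e>0. 0 < measure P (ball x e)}"

lemma closed_msupport:
  assumes "finite_measure P" "sets P = sets borel"
  shows "closed (msupport P)"
proof -
  interpret finite_measure P by fact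
  have "open (- msupport P)"
  proof (subst open_contains_ball, safe)
    fix x assume "x \<notin> msupport P"
    then obtain e where e: "e > 0" "measure P (ball x e) = 0"
      by (auto simp: msupport_def not_less measure_le_0_iff)
    have "y \<notin> msupport P" if y: "y \<in> ball x (e/2)" for y
    proof -
      have "ball y (e/2) \<subseteq> ball x e"
        using y by (intro subsetI) (auto simp: dist_commute intro: dist_triangle_half_l)
      then have "measure P (ball y (e/2)) \<le> measure P (ball x e)"
        using assms(2) by (intro finite_measure_mono) auto
      then have "\<not> 0 < measure P (ball y (e/2))" using e by simp
      then show ?thesis unfolding msupport_def using e(1) half_gt_zero by blast
    qed
    then show "\<exists>e>0. ball x e \<subseteq> - msupport P" using e by (intro exI[of _ "e/2"]) auto
  qed
  then show ?thesis by (simp add: closed_def)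
qed

text \<open>Every point outside the support has a null neighbourhood. A countable basis reduces the
  complement of the support to a union of countably many null sets.\<close>

lemma null_outside_msupport:
  fixes P :: "'a::{metric_space, second_countable_topology} measure"
  assumes "finite_measure P" "sets P = sets borel"
  shows "- msupport P \<in> null_sets P"
proof -
  interpret finite_measure P by fact
  obtain B :: "'a set set" where B: "countable B" "topological_basis B"
    using ex_countable_basis by auto
  let ?B = "{U \<in> B. U \<in> null_sets P}"
  have "- msupport P \<subseteq> \<Union>?B"
  proof
    fix x assume "x \<in> - msupport P"
    then obtain e where e: "e > 0" "measure P (ball x e) = 0"
      by (auto simp: msupport_def not_less measure_le_0_iff)
    obtain U where U: "U \<in> B" "x \<in> U" "U \<subseteq> ball x e"
      using topological_basisE[OF B(2), of "ball x e" x] e by auto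
    have "U \<in> null_sets P"
    proof (rule null_sets_subset[OF _ _ U(3)])
      show "ball x e \<in> null_sets P" using e assms(2)
        by (intro null_setsI) (auto simp: emeasure_eq_measure)
      show "U \<in> sets P" using topological_basis_open[OF B(2) U(1)] assms(2) by auto
    qed
    then show "x \<in> \<Union>?B" using U by auto
  qed
  moreover have "\<Union>?B \<in> null_sets P"
  proof -
    have "(\<Union>U\<in>?B. U) \<in> null_sets P"
      using B(1) by (intro null_sets_UN') (auto intro: countable_subset[of _ B])
    then show ?thesis by simp
  qed
  moreover have "- msupport P \<in> sets P" using closed_msupport[OF assms] assms(2) by auto
  ultimately show ?thesis by (intro null_sets_subset[of "\<Union>?B" P "- msupport P"])
qed

text \<open>The balls with centre and a boundary point in the support form a Vitali cover.\<close>

lemma measure_le_on_open_of_ball_agreement: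
  fixes P Q :: "'a::euclidean_space measure"
  assumes P: "finite_measure P" "sets P = sets borel" and Q: "finite_measure Q" "sets Q = sets borel"
    and ac: "null_sets lborel \<subseteq> null_sets P"
    and agree: "\<And>u v. u \<in> msupport P \<Longrightarrow> v \<in> msupport P \<Longrightarrow>
      emeasure P (cball u (dist u v)) = emeasure Q (cball u (dist u v))"
    and U: "open U"
  shows "emeasure P U \<le> emeasure Q U"
proof -
  interpret P: finite_measure P by fact
  define S where "S = U \<inter> msupport P"
  define I where "I = {(u, v). u \<in> msupport P \<and> v \<in> msupport P \<and> u \<noteq> v \<and> cball u (dist u v) \<subseteq> U}"
  have Sb: "S \<in> sets borel"
    unfolding S_def using closed_msupport[OF P] U by auto
  have cover: "\<exists>i. i \<in> I \<and> x \<in> cball (fst i) (dist (fst i) (snd i)) \<and> dist (fst i) (snd i) < d"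
    if x: "x \<in> S" and d: "0 < d" for x d
  proof -
    obtain e where e: "e > 0" "cball x e \<subseteq> U" using U x by (auto simp: S_def open_contains_cball)
    define r where "r = min d e"
    have r: "r > 0" "r \<le> d" "r \<le> e" using d e by (auto simp: r_def)
    \<comment> \<open>Absolute continuity makes the single point \<open>x\<close> null, so a small
      ball around a support point cannot meet the support in its centre alone. The second point
      \<open>v\<close> then gives an admissible ball of arbitrarily small positive radius.\<close>
    have "\<exists>v\<in>msupport P. v \<noteq> x \<and> v \<in> ball x r"
    proof (rule ccontr)
      assume "\<not> ?thesis"
      then have "ball x r \<subseteq> - msupport P \<union> {x}" by auto
      moreover have "- msupport P \<union> {x} \<in> null_sets P"
        using null_outside_msupport[OF P] ac countable_imp_null_set_lborel[of "{x}"]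
        by (intro null_sets.Un) auto
      ultimately have "measure P (ball x r) = 0"
        using P(2) null_sets_subset[of "- msupport P \<union> {x}" P "ball x r"] by (auto simp: measure_def null_sets_def)
      then show False using x r(1) by (force simp: S_def msupport_def)
    qed
    then obtain v where v: "v \<in> msupport P" "v \<noteq> x" "dist x v < r" by auto
    have "cball x (dist x v) \<subseteq> U" using v(3) r e by (intro order_trans[OF _ e(2)]) auto
    then show ?thesis using v x r by (intro exI[of _ "(x, v)"]) (auto simp: I_def S_def)
  qed
  have pos: "0 < dist (fst i) (snd i)" if "i \<in> I" for i using that by (auto simp: I_def)
  obtain C where C: "countable C" "C \<subseteq> I"
     "pairwise (\<lambda>i j. disjnt (cball (fst i) (dist (fst i) (snd i))) (cball (fst j) (dist (fst j) (snd j)))) C"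
     "negligible (S - (\<Union>i \<in> C. cball (fst i) (dist (fst i) (snd i))))"
    by (rule Vitali_covering_theorem_cballs[of I "\<lambda>i. dist (fst i) (snd i)" S fst, OF pos cover])
  let ?B = "\<lambda>i. cball (fst i) (dist (fst i) (snd i)) :: 'a set"
  have UNb: "(\<Union>i\<in>C. ?B i) \<in> sets borel" using C(1) by auto
  have "S - (\<Union>i\<in>C. ?B i) \<in> null_sets lborel"
    using C(4) Sb UNb null_sets_completion_iff[of "S - (\<Union>i\<in>C. ?B i)" lborel]
    unfolding negligible_iff_null_sets by (simp only: sets_lborel sets.Diff)
  then have n1: "S - (\<Union>i\<in>C. ?B i) \<in> null_sets P" using ac by auto
  have n2: "U - S \<in> null_sets P"
  proof (rule null_sets_subset[OF null_outside_msupport[OF P]])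
    show "U - S \<in> sets P" unfolding P(2) by (intro sets.Diff Sb borel_open[OF U])
    show "U - S \<subseteq> - msupport P" by (auto simp: S_def)
  qed
  have dj: "disjoint_family_on ?B C"
    using C(3) by (auto simp: disjoint_family_on_def pairwise_def disjnt_def)
  \<comment> \<open>Up to \<open>P\<close>-null sets, \<open>U\<close> is the disjoint union of the
    selected balls, on each of which \<open>P\<close> and \<open>Q\<close> agree; under
    \<open>Q\<close> these balls merely fit into \<open>U\<close>, which is why only an inequality
    results.\<close>
  have "U \<subseteq> (\<Union>i\<in>C. ?B i) \<union> ((S - (\<Union>i\<in>C. ?B i)) \<union> (U - S))" by auto
  then have "emeasure P U \<le> emeasure P ((\<Union>i\<in>C. ?B i) \<union> ((S - (\<Union>i\<in>C. ?B i)) \<union> (U - S)))"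
    using U Sb UNb P(2) by (intro emeasure_mono) auto
  also have "\<dots> = emeasure P (\<Union>i\<in>C. ?B i)"
    using UNb P(2) by (intro emeasure_Un_null_set null_sets.Un n1 n2) auto
  also have "\<dots> = (\<integral>\<^sup>+i. emeasure P (?B i) \<partial>count_space C)"
    using C(1) dj P(2) by (intro emeasure_UN_countable) auto
  also have "\<dots> = (\<integral>\<^sup>+i. emeasure Q (?B i) \<partial>count_space C)"
    using C(2) by (intro nn_integral_cong) (auto simp: I_def intro!: agree)
  also have "\<dots> = emeasure Q (\<Union>i\<in>C. ?B i)"
    using C(1) dj Q(2) by (intro emeasure_UN_countable[symmetric]) auto
  also have "\<dots> \<le> emeasure Q U"
  proof (intro emeasure_mono UN_least)
    fix i assume "i \<in> C"
    then have "i \<in> I" using C(2) by auto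
    then show "?B i \<subseteq> U" by (auto simp: I_def case_prod_beta)
  qed (use U Q(2) in auto)
  finally show ?thesis .
qed

text \<open>Outer regularity extends the inequality to all Borel sets. It holds for a set and for
  its complement, and both total masses are one, so it is an equality.\<close>

lemma eq_of_le_on_open:
  fixes P Q :: "'a::{second_countable_topology, complete_space} measure"
  assumes P: "prob_space P" "sets P = sets borel" and Q: "prob_space Q" "sets Q = sets borel"
    and le: "\<And>U. open U \<Longrightarrow> emeasure P U \<le> emeasure Q U"
  shows "P = Q"
proof -
  interpret P: prob_space P by fact
  interpret Q: prob_space Q by fact
  have le': "emeasure P A \<le> emeasure Q A" if A: "A \<in> sets borel" for A
  proof -
    have "emeasure P A \<le> (INF U \<in> {U. A \<subseteq> U \<and> open U}. emeasure Q U)"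
      using A P(2) by (intro INF_greatest) (auto intro!: order_trans[OF emeasure_mono le])
    also have "\<dots> = emeasure Q A"
      using outer_regular[OF Q(2) _ A] Q.emeasure_space_1 by simp
    finally show ?thesis .
  qed
  have sp: "space P = UNIV" "space Q = UNIV" using P(2) Q(2) by (auto dest: sets_eq_imp_space_eq)
  have "emeasure P A = emeasure Q A" if A: "A \<in> sets P" for A
  proof -
    have "measure P A \<le> measure Q A" "measure P (space P - A) \<le> measure Q (space Q - A)"
      using le'[of A] le'[of "UNIV - A"] A P(2) by (auto simp: P.emeasure_eq_measure Q.emeasure_eq_measure sp)
    then have "measure P A = measure Q A"
      using A P(2) Q(2) by (simp add: P.prob_compl Q.prob_compl)
    then show ?thesis by (simp add: P.emeasure_eq_measure Q.emeasure_eq_measure)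
  qed
  then show ?thesis by (intro measure_eqI) (auto simp: P(2) Q(2))
qed

text \<open>A form of "\<open>P\<close> gives more mass than \<open>Q\<close> to the ball around
  \<open>u\<close> through \<open>v\<close>" that is stable under perturbation: if centre and
  boundary point move by less than \<open>r\<close>, the radius changes by less than 2r, so the
  moved ball still lies between the shrunk and the enlarged ball.\<close>

definition separates :: "'a::euclidean_space measure \<Rightarrow> 'a measure \<Rightarrow> 'a \<Rightarrow> 'a \<Rightarrow> real \<Rightarrow> bool"
  where "separates P Q u v r \<longleftrightarrow> measure Q (cball u (dist u v + 3 * r)) < measure P (cball u (dist u v - 3 * r))"

text \<open>The masses of smaller concentric closed balls increase to the mass of the open ball, and
  absolute continuity makes the sphere null.\<close>

lemma cball_measure_left_limit:
  fixes P :: "'a::euclidean_space measure"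
  assumes P: "finite_measure P" "sets P = sets borel" and ac: "null_sets lborel \<subseteq> null_sets P"
    and c: "c < measure P (cball u R)"
  shows "\<exists>e>0. c < measure P (cball u (R - e))"
proof -
  interpret finite_measure P by fact
  have "(\<lambda>n. measure P (cball u (R - 1 / real (Suc n)))) \<longlonglongrightarrow> measure P (\<Union>n. cball u (R - 1 / real (Suc n)))"
  proof (rule finite_Lim_measure_incseq)
    show "incseq (\<lambda>n. cball u (R - 1 / real (Suc n)))"
      by (intro monoI subset_cball) (simp add: frac_le)
    show "range (\<lambda>n. cball u (R - 1 / real (Suc n))) \<subseteq> sets P"
      unfolding P(2) by (intro image_subsetI borel_closed closed_cball)
  qed
  moreover have "(\<Union>n. cball u (R - 1 / real (Suc n))) = ball u R"
  proof safe
    fix x n assume "x \<in> cball u (R - 1 / real (Suc n))"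
    moreover have "0 < 1 / real (Suc n)" by simp
    ultimately show "x \<in> ball u R" by (simp only: mem_cball mem_ball)
  next
    fix x assume "x \<in> ball u R"
    then have "0 < R - dist u x" by simp
    then obtain n where "1 / real (Suc n) < R - dist u x" using nat_approx_posE by (metis inverse_eq_divide)
    then show "x \<in> (\<Union>n. cball u (R - 1 / real (Suc n)))" by (intro UN_I[of n]) auto
  qed
  moreover have "measure P (cball u R) = measure P (ball u R)"
  proof -
    have "sphere u R \<in> null_sets lborel"
      using negligible_sphere[of u R] by (simp add: negligible_iff_null_sets null_sets_completion_iff borel_closed)
    then have "sphere u R \<in> null_sets P" using ac by auto
    moreover have "cball u R = ball u R \<union> sphere u R" by auto
    ultimately show ?thesis using P(2) by (simp add: measure_Un_null_set)
  qed
  ultimately have "eventually (\<lambda>n. c < measure P (cball u (R - 1 / real (Suc n)))) sequentially"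
    using c by (intro order_tendstoD(1)) auto
  then obtain n where "c < measure P (cball u (R - 1 / real (Suc n)))" by (auto simp: eventually_sequentially)
  then show ?thesis by (intro exI[of _ "1 / real (Suc n)"]) auto
qed

lemma cball_measure_right_limit:
  fixes P :: "'a::euclidean_space measure"
  assumes P: "finite_measure P" "sets P = sets borel"
    and c: "measure P (cball u R) < c"
  shows "\<exists>e>0. measure P (cball u (R + e)) < c"
proof -
  interpret finite_measure P by fact
  have "(\<lambda>n. measure P (cball u (R + 1 / real (Suc n)))) \<longlonglongrightarrow> measure P (\<Inter>n. cball u (R + 1 / real (Suc n)))"
  proof (rule finite_Lim_measure_decseq)
    show "decseq (\<lambda>n. cball u (R + 1 / real (Suc n)))"
      by (intro antimonoI subset_cball) (simp add: frac_le)
    show "range (\<lambda>n. cball u (R + 1 / real (Suc n))) \<subseteq> sets P"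
      unfolding P(2) by (intro image_subsetI borel_closed closed_cball)
  qed
  moreover have "(\<Inter>n. cball u (R + 1 / real (Suc n))) = cball u R"
  proof safe
    fix x assume x: "x \<in> (\<Inter>n. cball u (R + 1 / real (Suc n)))"
    show "x \<in> cball u R"
    proof (rule ccontr)
      assume "x \<notin> cball u R"
      then have "0 < dist u x - R" by simp
      then obtain n where "1 / real (Suc n) < dist u x - R" using nat_approx_posE by (metis inverse_eq_divide)
      with x show False by (auto dest!: spec[of _ n])
    qed
  next
    fix x and n :: nat assume "x \<in> cball u R"
    moreover have "0 < 1 / real (Suc n)" by simp
    ultimately show "x \<in> cball u (R + 1 / real (Suc n))" by (simp only: mem_cball)
  qed
  ultimately have "eventually (\<lambda>n. measure P (cball u (R + 1 / real (Suc n))) < c) sequentially"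
    using c by (intro order_tendstoD(2)) auto
  then obtain n where "measure P (cball u (R + 1 / real (Suc n))) < c" by (auto simp: eventually_sequentially)
  then show ?thesis by (intro exI[of _ "1 / real (Suc n)"]) auto
qed

text \<open>The mass of a ball can be compared strictly even after a small change of the radius in
  either direction. This room is spent on moving centre and boundary point into \<open>D\<close>,
  which is later taken countable so that exceptional null sets can be united.\<close>

lemma separates_dense:
  fixes P Q :: "'a::euclidean_space measure"
  assumes P: "finite_measure P" "sets P = sets borel" and Q: "finite_measure Q" "sets Q = sets borel"
    and ac: "null_sets lborel \<subseteq> null_sets P"
    and lt: "measure Q (cball u0 (dist u0 v0)) < measure P (cball u0 (dist u0 v0))"
    and D: "\<And>U :: 'a set. open U \<Longrightarrow> U \<noteq> {} \<Longrightarrow> \<exists>d\<in>D. d \<in> U"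
  obtains u v n where "u \<in> D" "v \<in> D" "u0 \<in> ball u (1 / real (Suc n))" "v0 \<in> ball v (1 / real (Suc n))"
    "separates P Q u v (1 / real (Suc n))"
proof -
  interpret P: finite_measure P by fact
  interpret Q: finite_measure Q by fact
  define R where "R = dist u0 v0"
  obtain e1 where e1: "e1 > 0" "measure Q (cball u0 R) < measure P (cball u0 (R - e1))"
    using cball_measure_left_limit[OF P ac] lt unfolding R_def by metis
  obtain e2 where e2: "e2 > 0" "measure Q (cball u0 (R + e2)) < measure P (cball u0 (R - e1))"
    using cball_measure_right_limit[OF Q e1(2)] by metis
  \<comment> \<open>The distance of \<open>u\<close> and \<open>v\<close> differs from
    \<open>R\<close> by less than 2r, the centre moves by less than \<open>r\<close>, and
    \<open>separates\<close> adds 3r: altogether less than 6r.\<close>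
  obtain n where n: "1 / real (Suc n) < min e1 e2 / 6"
    using nat_approx_posE[of "min e1 e2 / 6"] e1(1) e2(1) by (metis inverse_eq_divide zero_less_divide_iff min_less_iff_conj zero_less_numeral)
  define r where "r = 1 / real (Suc n)"
  have r: "r > 0" by (simp add: r_def)
  have n6: "6 * r < e1" "6 * r < e2" using n unfolding r_def[symmetric] by auto
  obtain u where u: "u \<in> D" "u \<in> ball u0 r" using D[of "ball u0 r"] r by auto
  obtain v where v: "v \<in> D" "v \<in> ball v0 r" using D[of "ball v0 r"] r by auto
  have d: "dist u u0 < r" "dist v v0 < r" using u v by (auto simp: dist_commute)
  have dd: "\<bar>dist u v - R\<bar> < 2 * r"
    using d dist_triangle[of u v u0] dist_triangle[of u0 v v0] dist_triangle[of u0 v0 u] dist_triangle[of u v0 v]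
    by (simp add: R_def dist_commute)
  have s1: "cball u (dist u v + 3 * r) \<subseteq> cball u0 (R + e2)"
  proof
    fix x assume "x \<in> cball u (dist u v + 3 * r)"
    then show "x \<in> cball u0 (R + e2)"
      using d dd n6 dist_triangle[of u0 x u] by (simp add: dist_commute)
  qed
  have s2: "cball u0 (R - e1) \<subseteq> cball u (dist u v - 3 * r)"
  proof
    fix x assume "x \<in> cball u0 (R - e1)"
    then show "x \<in> cball u (dist u v - 3 * r)"
      using d dd n6 dist_triangle[of u x u0] by (simp add: dist_commute)
  qed
  have "measure Q (cball u (dist u v + 3 * r)) \<le> measure Q (cball u0 (R + e2))"
    using s1 Q(2) by (intro Q.finite_measure_mono) auto
  also note e2(2)
  also have "measure P (cball u0 (R - e1)) \<le> measure P (cball u (dist u v - 3 * r))"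
    using s2 P(2) by (intro P.finite_measure_mono) auto
  finally have "separates P Q u v r" by (simp add: separates_def)
  moreover have "u0 \<in> ball u r" "v0 \<in> ball v r" using d by auto
  ultimately show ?thesis using that u v by (simp add: r_def)
qed

text \<open>If \<open>P\<close> and \<open>Q\<close> agreed on all balls with centre and boundary
  point in the support of \<open>P\<close>, the covering argument would give \<open>P = Q\<close>. A
  ball on which they differ is moved into \<open>D\<close>; as the new points stay close to support
  points, the balls around them have positive mass under \<open>P\<close>.\<close>

lemma ball_separation:
  fixes P Q :: "'a::euclidean_space measure"
  assumes P: "prob_space P" "sets P = sets borel" and Q: "prob_space Q" "sets Q = sets borel"
    and ac: "null_sets lborel \<subseteq> null_sets P" "null_sets lborel \<subseteq> null_sets Q"
    and ne: "P \<noteq> Q"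
    and D: "\<And>U :: 'a set. open U \<Longrightarrow> U \<noteq> {} \<Longrightarrow> \<exists>d\<in>D. d \<in> U"
  obtains u v n where "u \<in> D" "v \<in> D"
    "0 < measure P (ball u (1 / real (Suc n)))" "0 < measure P (ball v (1 / real (Suc n)))"
    "separates P Q u v (1 / real (Suc n)) \<or> separates Q P u v (1 / real (Suc n))"
proof -
  interpret P: prob_space P by fact
  interpret Q: prob_space Q by fact
  have fin: "finite_measure P" "finite_measure Q" by unfold_locales
  have "\<exists>u0\<in>msupport P. \<exists>v0\<in>msupport P. measure P (cball u0 (dist u0 v0)) \<noteq> measure Q (cball u0 (dist u0 v0))"
  proof (rule ccontr)
    assume "\<not> ?thesis"
    then have "emeasure P U \<le> emeasure Q U" if "open U" for U
      using that by (intro measure_le_on_open_of_ball_agreement[OF fin(1) P(2) fin(2) Q(2) ac(1)])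
        (auto simp: P.emeasure_eq_measure Q.emeasure_eq_measure)
    then show False using eq_of_le_on_open[OF P Q] ne by auto
  qed
  then obtain u0 v0 where uv: "u0 \<in> msupport P" "v0 \<in> msupport P"
    "measure P (cball u0 (dist u0 v0)) \<noteq> measure Q (cball u0 (dist u0 v0))" by auto
  have "\<exists>u v n. u \<in> D \<and> v \<in> D \<and> u0 \<in> ball u (1 / real (Suc n)) \<and> v0 \<in> ball v (1 / real (Suc n)) \<and>
    (separates P Q u v (1 / real (Suc n)) \<or> separates Q P u v (1 / real (Suc n)))"
  proof (cases "measure Q (cball u0 (dist u0 v0)) < measure P (cball u0 (dist u0 v0))")
    case True
    from separates_dense[OF fin(1) P(2) fin(2) Q(2) ac(1) True D] show ?thesis by blast
  next
    case False
    then have "measure P (cball u0 (dist u0 v0)) < measure Q (cball u0 (dist u0 v0))" using uv(3) by auto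
    from separates_dense[OF fin(2) Q(2) fin(1) P(2) ac(2) this D] show ?thesis by blast
  qed
  then obtain u v n where *: "u \<in> D" "v \<in> D" "u0 \<in> ball u (1 / real (Suc n))" "v0 \<in> ball v (1 / real (Suc n))"
    "separates P Q u v (1 / real (Suc n)) \<or> separates Q P u v (1 / real (Suc n))" by blast
  have "0 < measure P (ball w r)" if w: "w0 \<in> msupport P" "w0 \<in> ball w r" for w w0 r
  proof -
    obtain e where e: "e > 0" "ball w0 e \<subseteq> ball w r" using w(2) open_ball open_contains_ball by metis
    have "0 < measure P (ball w0 e)" using w e by (auto simp: msupport_def)
    also have "\<dots> \<le> measure P (ball w r)" using e P(2) by (intro P.finite_measure_mono) auto
    finally show ?thesis .
  qed
  then show ?thesis using that * uv by blast
qed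

section \<open>Ball divergence of weighted empirical measures\<close>

text \<open>The ball divergence of two discrete measures with masses \<open>c\<close> and
  \<open>c'\<close> on the common points \<open>x\<close>. Masses and points are kept apart because
  a permutation of the \<open>X\<close>-values moves the points and leaves the masses in
  place.\<close>

definition bdiv :: "nat set \<Rightarrow> (nat \<Rightarrow> real) \<Rightarrow> (nat \<Rightarrow> real) \<Rightarrow> (nat \<Rightarrow> 'x::euclidean_space) \<Rightarrow> real"
  where "bdiv I c c' x = (\<Sum>v\<in>I. \<Sum>u\<in>I. (c v * c u + c' v * c' u) *
    (\<Sum>i\<in>I. (c i - c' i) * of_bool (dist (x u) (x i) \<le> dist (x u) (x v)))\<^sup>2)"

lemma integral_weighted_empirical:
  fixes f :: "'x::euclidean_space \<Rightarrow> real"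
  assumes w: "\<And>i. 0 \<le> w i" and [measurable]: "f \<in> borel_measurable borel"
  shows "(\<integral>t. f t \<partial>weighted_empirical n w x) = (\<Sum>i=1..n. w i / (\<Sum>j=1..n. w j) * f (x i))"
proof -
  let ?P = "point_measure {1..n} (\<lambda>i. ennreal (w i / (\<Sum>j=1..n. w j)))"
  have m: "x \<in> measurable ?P borel" by (simp add: measurable_point_measure_eq1)
  have "(\<integral>t. f t \<partial>weighted_empirical n w x) = (\<integral>i. f (x i) \<partial>?P)"
    unfolding weighted_empirical_def using m by (intro integral_distr) auto
  also have "\<dots> = (\<Sum>i=1..n. w i / (\<Sum>j=1..n. w j) * f (x i))"
    using w by (subst lebesgue_integral_point_measure_finite) (auto intro!: divide_nonneg_nonneg sum_nonneg)
  finally show ?thesis .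
qed

lemma ball_divergence_weighted_empirical:
  fixes x :: "nat \<Rightarrow> 'x::euclidean_space"
  assumes w: "\<And>i. 0 \<le> w i" "\<And>i. 0 \<le> w' i"
  shows "ball_divergence (weighted_empirical n w x) (weighted_empirical n w' x) =
    bdiv {1..n} (\<lambda>i. w i / (\<Sum>j=1..n. w j)) (\<lambda>i. w' i / (\<Sum>j=1..n. w' j)) x"
proof -
  let ?P = "weighted_empirical n w x" and ?Q = "weighted_empirical n w' x"
  let ?c = "\<lambda>i. w i / (\<Sum>j=1..n. w j)" and ?c' = "\<lambda>i. w' i / (\<Sum>j=1..n. w' j)"
  define g where "g u v = (\<Sum>i=1..n. (?c i - ?c' i) * of_bool (dist u (x i) \<le> dist u v))\<^sup>2" for u v
  have g: "(measure ?P (cball u (norm (v - u))) - measure ?Q (cball u (norm (v - u))))\<^sup>2 = g u v" for u v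
  proof -
    have "measure (weighted_empirical n ww x) (cball u (norm (v - u))) =
      (\<Sum>i=1..n. ww i / (\<Sum>j=1..n. ww j) * of_bool (dist u (x i) \<le> dist u v))"
      if "\<And>i. 0 \<le> ww i" for ww
      unfolding measure_weighted_empirical[OF that borel_closed[OF closed_cball]] sum_divide_distrib
      by (intro sum.cong) (simp_all only: indicator_def mem_cball dist_norm norm_minus_commute times_divide_eq_left)
    from this[OF w(1)] this[OF w(2)] show ?thesis
      unfolding g_def left_diff_distrib sum_subtractf by simp
  qed
  have [measurable]: "(\<lambda>u. g u v) \<in> borel_measurable borel" for v unfolding g_def by measurable
  have inner: "(\<integral>u. g u v \<partial>weighted_empirical n ww x) = (\<Sum>i=1..n. ww i / (\<Sum>j=1..n. ww j) * g (x i) v)"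
    if "\<And>i. 0 \<le> ww i" for ww v
    using that by (rule integral_weighted_empirical) measurable
  have [measurable]: "(\<lambda>v. g u v) \<in> borel_measurable borel" for u unfolding g_def by measurable
  have outer: "(\<integral>v. \<integral>u. g u v \<partial>weighted_empirical n ww x \<partial>weighted_empirical n ww x) =
     (\<Sum>v=1..n. \<Sum>u=1..n. ww v / (\<Sum>j=1..n. ww j) * (ww u / (\<Sum>j=1..n. ww j)) * g (x u) (x v))"
    if "\<And>i. 0 \<le> ww i" for ww
    using that by (simp only: inner, subst integral_weighted_empirical)
      (auto simp: sum_distrib_left mult_ac)
  have "ball_divergence ?P ?Q =
    (\<Sum>v=1..n. \<Sum>u=1..n. ?c v * ?c u * g (x u) (x v)) + (\<Sum>v=1..n. \<Sum>u=1..n. ?c' v * ?c' u * g (x u) (x v))"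
    unfolding ball_divergence_def g outer[OF w(1)] outer[OF w(2)] ..
  also have "\<dots> = bdiv {1..n} ?c ?c' x"
    unfolding bdiv_def g_def sum.distrib[symmetric] distrib_right ..
  finally show ?thesis .
qed

lemma bdiv_nonneg:
  assumes "\<And>i. 0 \<le> c i" "\<And>i. 0 \<le> c' i"
  shows "0 \<le> bdiv I c c' x"
  unfolding bdiv_def using assms by (intro sum_nonneg mult_nonneg_nonneg add_nonneg_nonneg) auto

lemma sum_diff_bool_bound:
  fixes c c' :: "nat \<Rightarrow> real"
  assumes "finite I" "\<And>i. 0 \<le> c i" "\<And>i. 0 \<le> c' i" "(\<Sum>i\<in>I. c i) \<le> 1" "(\<Sum>i\<in>I. c' i) \<le> 1"
  shows "\<bar>\<Sum>i\<in>I. (c i - c' i) * of_bool (p i)\<bar> \<le> 1"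
proof -
  have "0 \<le> (\<Sum>i\<in>I. d i * of_bool (p i)) \<and> (\<Sum>i\<in>I. d i * of_bool (p i)) \<le> 1"
    if "\<And>i. 0 \<le> d i" "(\<Sum>i\<in>I. d i) \<le> 1" for d :: "nat \<Rightarrow> real"
    using that by (intro conjI sum_nonneg order_trans[OF sum_mono that(2)]) auto
  from this[OF assms(2,4)] this[OF assms(3,5)]
  have "\<bar>(\<Sum>i\<in>I. c i * of_bool (p i)) - (\<Sum>i\<in>I. c' i * of_bool (p i))\<bar> \<le> 1"
    by linarith
  then show ?thesis by (simp only: left_diff_distrib sum_subtractf)
qed

text \<open>The squared differences are at most one, and each of the two product measures has mass
  at most one. The masses are only bounded by one because normalised kernel weights are all 0 if
  their denominator vanishes.\<close>

lemma bdiv_le_2: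
  assumes "finite I" "\<And>i. 0 \<le> c i" "\<And>i. 0 \<le> c' i" "(\<Sum>i\<in>I. c i) \<le> 1" "(\<Sum>i\<in>I. c' i) \<le> 1"
  shows "bdiv I c c' x \<le> 2"
proof -
  have "bdiv I c c' x \<le> (\<Sum>v\<in>I. \<Sum>u\<in>I. (c v * c u + c' v * c' u) * 1)"
    unfolding bdiv_def using assms
    by (intro sum_mono mult_left_mono iffD2[OF abs_square_le_1] sum_diff_bool_bound) auto
  also have "\<dots> = (\<Sum>i\<in>I. c i) * (\<Sum>i\<in>I. c i) + (\<Sum>i\<in>I. c' i) * (\<Sum>i\<in>I. c' i)"
    by (simp add: sum_product sum.distrib)
  also have "\<dots> \<le> 1 * 1 + 1 * 1" using assms by (intro add_mono mult_mono sum_nonneg) auto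
  finally show ?thesis by simp
qed

text \<open>Only pairs with \<open>x u\<close> near \<open>u0\<close> and \<open>x v\<close> near
  \<open>v0\<close> are kept. For these the ball around \<open>x u\<close> through
  \<open>x v\<close> contains the shrunk ball around \<open>u0\<close> and is contained in the
  enlarged one, so the two masses differ by at least \<open>t\<close>.\<close>

lemma bdiv_lower:
  fixes x :: "nat \<Rightarrow> 'x::euclidean_space" and c c' :: "nat \<Rightarrow> real" and I :: "nat set"
  defines "Cm \<equiv> \<lambda>c A. \<Sum>i\<in>I. c i * indicator A (x i)"
  assumes fin: "finite I" and c: "\<And>i. 0 \<le> c i" "\<And>i. 0 \<le> c' i" and t: "0 \<le> t"
    and sep: "t \<le> Cm c (cball u0 (dist u0 v0 - 3 * r)) - Cm c' (cball u0 (dist u0 v0 + 3 * r)) \<or>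
      t \<le> Cm c' (cball u0 (dist u0 v0 - 3 * r)) - Cm c (cball u0 (dist u0 v0 + 3 * r))"
  shows "Cm c (ball u0 r) * Cm c (ball v0 r) * t\<^sup>2 \<le> bdiv I c c' x"
proof -
  let ?d = "\<lambda>u v. \<Sum>i\<in>I. (c i - c' i) * of_bool (dist (x u) (x i) \<le> dist (x u) (x v))"
  have key: "t \<le> \<bar>?d u v\<bar>" if u: "x u \<in> ball u0 r" and v: "x v \<in> ball v0 r" for u v
  proof -
    have dd: "\<bar>dist (x u) (x v) - dist u0 v0\<bar> < 2 * r"
      using u v dist_triangle[of "x u" "x v" u0] dist_triangle[of u0 "x v" v0] dist_triangle[of u0 v0 "x u"]
        dist_triangle[of "x u" v0 "x v"]
      by (simp add: dist_commute)
    have lo: "dist (x u) (x i) \<le> dist (x u) (x v)" if "x i \<in> cball u0 (dist u0 v0 - 3 * r)" for i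
      using that u dd dist_triangle[of "x u" "x i" u0] by (simp add: dist_commute)
    have hi: "x i \<in> cball u0 (dist u0 v0 + 3 * r)" if "dist (x u) (x i) \<le> dist (x u) (x v)" for i
      using that u dd dist_triangle[of u0 "x i" "x u"] by (simp add: dist_commute)
    have l: "Cm e (cball u0 (dist u0 v0 - 3 * r)) \<le> (\<Sum>i\<in>I. e i * of_bool (dist (x u) (x i) \<le> dist (x u) (x v)))"
      and h: "(\<Sum>i\<in>I. e i * of_bool (dist (x u) (x i) \<le> dist (x u) (x v))) \<le> Cm e (cball u0 (dist u0 v0 + 3 * r))"
      if "\<And>i. 0 \<le> e i" for e :: "nat \<Rightarrow> real"
      unfolding Cm_def using that lo hi by (auto intro!: sum_mono mult_left_mono simp: indicator_def)
    have "?d u v = (\<Sum>i\<in>I. c i * of_bool (dist (x u) (x i) \<le> dist (x u) (x v))) -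
      (\<Sum>i\<in>I. c' i * of_bool (dist (x u) (x i) \<le> dist (x u) (x v)))"
      by (simp add: left_diff_distrib sum_subtractf)
    then show ?thesis using sep l[of c, OF c(1)] h[of c, OF c(1)] l[of c', OF c(2)] h[of c', OF c(2)] by linarith
  qed
  have "Cm c (ball u0 r) * Cm c (ball v0 r) * t\<^sup>2 =
    (\<Sum>v\<in>I. \<Sum>u\<in>I. c v * c u * (indicator (ball u0 r) (x u) * indicator (ball v0 r) (x v) * t\<^sup>2))"
    unfolding mult.commute[of "Cm c (ball u0 r)"] unfolding Cm_def sum_product
    unfolding sum_distrib_right
    by (intro sum.cong refl) (simp only: mult_ac)
  also have "\<dots> \<le> bdiv I c c' x"
    unfolding bdiv_def
  proof (intro sum_mono mult_mono add_nonneg_nonneg)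
    fix v u
    show "indicator (ball u0 r) (x u) * indicator (ball v0 r) (x v) * t\<^sup>2 \<le> (?d u v)\<^sup>2"
      using key[of u v] t by (auto simp: indicator_def abs_le_square_iff[symmetric])
    show "c v * c u \<le> c v * c u + c' v * c' u" using c by simp
  qed (use c in auto)
  finally show ?thesis .
qed

section \<open>Exchanging two indices in the ball divergence\<close>

lemma sum_permutes_compose_transpose:
  fixes f :: "(nat \<Rightarrow> nat) \<Rightarrow> real"
  assumes "j \<in> I" "k \<in> I"
  shows "(\<Sum>\<sigma> | \<sigma> permutes I. f (\<sigma> \<circ> Transposition.transpose j k)) = (\<Sum>\<sigma> | \<sigma> permutes I. f \<sigma>)"
  by (rule sum.reindex_bij_witness[where i="\<lambda>\<sigma>. \<sigma> \<circ> Transposition.transpose j k" and j="\<lambda>\<sigma>. \<sigma> \<circ> Transposition.transpose j k"])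
    (auto simp: o_assoc[symmetric] intro!: permutes_compose permutes_swap_id assms)

text \<open>Summation by parts over the group: substituting \<sigma> composed with the transposition
  in half of the terms moves the difference from \<open>g\<close> to \<open>P\<close>. The same
  substitution shows that positive and negative parts of the differences of \<open>P\<close> have
  equal sums, so one of them bounds the absolute value.\<close>

lemma swap_difference_bound:
  fixes P g :: "(nat \<Rightarrow> nat) \<Rightarrow> real"
  assumes jk: "j \<in> I" "k \<in> I" and g: "\<And>\<sigma>. 0 \<le> g \<sigma>" "\<And>\<sigma>. g \<sigma> \<le> 1"
  shows "\<bar>\<Sum>\<sigma> | \<sigma> permutes I. P \<sigma> * (g \<sigma> - g (\<sigma> \<circ> Transposition.transpose j k))\<bar> \<le>
    (\<Sum>\<sigma> | \<sigma> permutes I. max 0 (P \<sigma> - P (\<sigma> \<circ> Transposition.transpose j k)))"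
proof -
  let ?T = "\<lambda>\<sigma>. \<sigma> \<circ> Transposition.transpose j k"
  have TT[simp]: "?T (?T \<sigma>) = \<sigma>" for \<sigma> by (simp add: o_assoc[symmetric])
  have "(\<Sum>\<sigma> | \<sigma> permutes I. P \<sigma> * g (?T \<sigma>)) = (\<Sum>\<sigma> | \<sigma> permutes I. P (?T \<sigma>) * g \<sigma>)"
    using sum_permutes_compose_transpose[OF jk, of "\<lambda>\<sigma>. P \<sigma> * g (?T \<sigma>)"] by simp
  then have eq: "(\<Sum>\<sigma> | \<sigma> permutes I. P \<sigma> * (g \<sigma> - g (?T \<sigma>))) = (\<Sum>\<sigma> | \<sigma> permutes I. (P \<sigma> - P (?T \<sigma>)) * g \<sigma>)"
    by (simp add: right_diff_distrib left_diff_distrib sum_subtractf)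
  have up: "(P \<sigma> - P (?T \<sigma>)) * g \<sigma> \<le> max 0 (P \<sigma> - P (?T \<sigma>))" for \<sigma>
    using g[of \<sigma>] mult_left_le[of "g \<sigma>" "P \<sigma> - P (?T \<sigma>)"] mult_nonpos_nonneg[of "P \<sigma> - P (?T \<sigma>)" "g \<sigma>"]
    by (cases "0 \<le> P \<sigma> - P (?T \<sigma>)") auto
  have lo: "- max 0 (P (?T \<sigma>) - P \<sigma>) \<le> (P \<sigma> - P (?T \<sigma>)) * g \<sigma>" for \<sigma>
    using g[of \<sigma>] mult_left_le[of "g \<sigma>" "P (?T \<sigma>) - P \<sigma>"] mult_nonneg_nonneg[of "P \<sigma> - P (?T \<sigma>)" "g \<sigma>"]
    by (cases "0 \<le> P \<sigma> - P (?T \<sigma>)") (auto simp: left_diff_distrib)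
  have "(\<Sum>\<sigma> | \<sigma> permutes I. max 0 (P (?T \<sigma>) - P \<sigma>)) = (\<Sum>\<sigma> | \<sigma> permutes I. max 0 (P \<sigma> - P (?T \<sigma>)))"
    using sum_permutes_compose_transpose[OF jk, of "\<lambda>\<sigma>. max 0 (P (?T \<sigma>) - P \<sigma>)"] by simp
  moreover have "- (\<Sum>\<sigma> | \<sigma> permutes I. max 0 (P (?T \<sigma>) - P \<sigma>)) \<le> (\<Sum>\<sigma> | \<sigma> permutes I. (P \<sigma> - P (?T \<sigma>)) * g \<sigma>)"
    unfolding sum_negf[symmetric] by (intro sum_mono lo)
  moreover have "(\<Sum>\<sigma> | \<sigma> permutes I. (P \<sigma> - P (?T \<sigma>)) * g \<sigma>) \<le> (\<Sum>\<sigma> | \<sigma> permutes I. max 0 (P \<sigma> - P (?T \<sigma>)))"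
    by (intro sum_mono up)
  ultimately show ?thesis unfolding eq by linarith
qed

text \<open>
  Since both weight vectors have mass one, a difference of weighted means is an average of
  differences $b_j - b_k$, and each of these is antisymmetric under exchanging \<open>j\<close> and \<open>k\<close>.
\<close>

lemma permuted_bdiv_bound:
  fixes x :: "nat \<Rightarrow> 'x::euclidean_space" and P :: "(nat \<Rightarrow> nat) \<Rightarrow> real"
  assumes fin: "finite I" and c: "\<And>i. 0 \<le> c i" "\<And>i. 0 \<le> c' i" "(\<Sum>i\<in>I. c i) = 1" "(\<Sum>i\<in>I. c' i) = 1"
    and \<kappa>: "\<And>i. c i \<le> \<kappa>" "\<And>i. c' i \<le> \<kappa>"
    and P: "\<And>\<sigma>. 0 \<le> P \<sigma>" "(\<Sum>\<sigma> | \<sigma> permutes I. P \<sigma>) \<le> 1"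
  shows "(\<Sum>\<sigma> | \<sigma> permutes I. P \<sigma> * bdiv I c c' (\<lambda>i. x (\<sigma> i))) \<le>
    4 * ((\<Sum>j\<in>I. \<Sum>k\<in>I. c j * c' k *
      (\<Sum>\<sigma> | \<sigma> permutes I. max 0 (P \<sigma> - P (\<sigma> \<circ> Transposition.transpose j k)))) + 6 * \<kappa>)"
proof -
  let ?S = "{\<sigma>. \<sigma> permutes I}"
  define \<rho> where "\<rho> j k = (\<Sum>\<sigma> | \<sigma> permutes I. max 0 (P \<sigma> - P (\<sigma> \<circ> Transposition.transpose j k)))" for j k
  define R where "R = (\<Sum>j\<in>I. \<Sum>k\<in>I. c j * c' k * \<rho> j k)"
  define b where "b \<sigma> u v i = (of_bool (dist (x (\<sigma> u)) (x (\<sigma> i)) \<le> dist (x (\<sigma> u)) (x (\<sigma> v))) :: real)"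
    for \<sigma> :: "nat \<Rightarrow> nat" and u v i :: nat
  define E where "E u v i j k = (\<Sum>\<sigma>\<in>?S. P \<sigma> * (b \<sigma> u v i * (b \<sigma> u v j - b \<sigma> u v k)))" for u v i j k
  define A where "A u v = c v * c u + c' v * c' u" for u v
  define G where "G u v i = (\<Sum>j\<in>I. \<Sum>k\<in>I. c j * c' k * E u v i j k)" for u v i
  have \<rho>0: "0 \<le> \<rho> j k" for j k unfolding \<rho>_def by (intro sum_nonneg) auto
  have A0: "0 \<le> A u v" for u v unfolding A_def using c by simp
  have \<kappa>0: "0 \<le> \<kappa>" using c(1) \<kappa>(1) order_trans by blast
  have b01: "0 \<le> b \<sigma> u v i" "b \<sigma> u v i \<le> 1" for \<sigma> u v i by (auto simp: b_def)
  \<comment> \<open>The exchange of \<open>j\<close> and \<open>k\<close> turns b_i b_k into b_i b_j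
    only if neither index is among \<open>u\<close>, \<open>v\<close>, \<open>i\<close>, because
    otherwise it also moves the ball or the point \<open>i\<close>. Coinciding indices are estimated
    trivially by 1.\<close>
  have E_bound: "\<bar>E u v i j k\<bar> \<le> \<rho> j k + of_bool (j \<in> {u, v, i}) + of_bool (k \<in> {u, v, i})"
    if jk: "j \<in> I" "k \<in> I" for u v i j k
  proof (cases "j \<in> {u, v, i} \<or> k \<in> {u, v, i}")
    case True
    have "\<bar>E u v i j k\<bar> \<le> (\<Sum>\<sigma>\<in>?S. P \<sigma> * 1)"
      unfolding E_def
    proof (intro order_trans[OF sum_abs] sum_mono)
      fix \<sigma> show "\<bar>P \<sigma> * (b \<sigma> u v i * (b \<sigma> u v j - b \<sigma> u v k))\<bar> \<le> P \<sigma> * 1"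
        unfolding abs_mult using P(1)[of \<sigma>] by (auto intro!: mult_mono simp: b_def)
    qed
    then have "\<bar>E u v i j k\<bar> \<le> 1" using P(2) by simp
    then show ?thesis using True \<rho>0[of j k] by auto
  next
    case False
    let ?T = "Transposition.transpose j k"
    have "b \<sigma> u v i * b \<sigma> u v k = b (\<sigma> \<circ> ?T) u v i * b (\<sigma> \<circ> ?T) u v j" for \<sigma>
      using False by (auto simp: b_def Transposition.transpose_def)
    then have "E u v i j k = (\<Sum>\<sigma> | \<sigma> permutes I. P \<sigma> * (b \<sigma> u v i * b \<sigma> u v j - b (\<sigma> \<circ> ?T) u v i * b (\<sigma> \<circ> ?T) u v j))"
      by (simp add: E_def right_diff_distrib)
    also have "\<bar>\<dots>\<bar> \<le> \<rho> j k"
      unfolding \<rho>_def using b01 by (intro swap_difference_bound jk mult_nonneg_nonneg mult_le_one) auto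
    finally show ?thesis by auto
  qed
  \<comment> \<open>Three exceptional indices carry mass at most 3\<kappa> under each of
    \<open>c\<close> and \<open>c'\<close>; together this is the 6\<kappa> of the statement.\<close>
  have ssum: "(\<Sum>j\<in>I. e j * of_bool (j \<in> {u, v, i})) \<le> 3 * \<kappa>" if "\<And>j. 0 \<le> e j" "\<And>j. e j \<le> \<kappa>" for e :: "nat \<Rightarrow> real" and u v i
  proof -
    have "(\<Sum>j\<in>I. e j * of_bool (j \<in> {u, v, i})) = (\<Sum>j\<in>I \<inter> {u, v, i}. e j)"
      using fin by (simp add: sum.inter_restrict if_distrib of_bool_def cong: if_cong)
    also have "\<dots> \<le> (\<Sum>j\<in>I \<inter> {u, v, i}. \<kappa>)" using that by (intro sum_mono) auto
    also have "\<dots> = real (card (I \<inter> {u, v, i})) * \<kappa>" by simp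
    also have "\<dots> \<le> 3 * \<kappa>"
    proof (intro mult_right_mono \<kappa>0)
      have "card (I \<inter> {u, v, i}) \<le> card {u, v, i}" by (intro card_mono) auto
      also have "\<dots> \<le> 3" by (simp add: card_insert_if)
      finally show "real (card (I \<inter> {u, v, i})) \<le> 3" by simp
    qed
    finally show ?thesis .
  qed
  have G_bound: "\<bar>G u v i\<bar> \<le> R + 6 * \<kappa>" for u v i
  proof -
    let ?e = "\<lambda>j. of_bool (j \<in> {u, v, i}) :: real"
    have t: "\<bar>c j * c' k * E u v i j k\<bar> \<le> c j * c' k * (\<rho> j k + ?e j + ?e k)" if "j \<in> I" "k \<in> I" for j k
      unfolding abs_mult abs_of_nonneg[OF c(1)] abs_of_nonneg[OF c(2)]
      using c E_bound[OF that] by (intro mult_left_mono mult_nonneg_nonneg) auto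
    have "\<bar>G u v i\<bar> \<le> (\<Sum>j\<in>I. \<bar>\<Sum>k\<in>I. c j * c' k * E u v i j k\<bar>)"
      unfolding G_def by (rule sum_abs)
    also have "\<dots> \<le> (\<Sum>j\<in>I. \<Sum>k\<in>I. c j * c' k * (\<rho> j k + ?e j + ?e k))"
      by (intro sum_mono order_trans[OF sum_abs] t)
    also have "\<dots> = R + (\<Sum>j\<in>I. \<Sum>k\<in>I. c j * c' k * ?e j) + (\<Sum>j\<in>I. \<Sum>k\<in>I. c j * c' k * ?e k)"
      unfolding R_def by (simp only: distrib_left sum.distrib)
    also have "(\<Sum>j\<in>I. \<Sum>k\<in>I. c j * c' k * ?e j) = (\<Sum>j\<in>I. c j * ?e j) * (\<Sum>k\<in>I. c' k)"
      unfolding sum_product by (intro sum.cong refl) (simp only: mult_ac)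
    also have "(\<Sum>j\<in>I. \<Sum>k\<in>I. c j * c' k * ?e k) = (\<Sum>j\<in>I. c j) * (\<Sum>k\<in>I. c' k * ?e k)"
      unfolding sum_product by (intro sum.cong refl) (simp only: mult_ac)
    also have "R + (\<Sum>j\<in>I. c j * ?e j) * (\<Sum>k\<in>I. c' k) + (\<Sum>j\<in>I. c j) * (\<Sum>k\<in>I. c' k * ?e k) \<le> R + 3 * \<kappa> + 3 * \<kappa>"
      using ssum[of c u v i, OF c(1) \<kappa>(1)] ssum[of c' u v i, OF c(2) \<kappa>(2)]
      unfolding c(3,4) mult_1 mult_1_right by linarith
    finally show ?thesis by simp
  qed
  \<comment> \<open>Only one of the two factors of the square is rewritten as a double average of
    b_j - b_k; the other one stays as the sum over \<open>i\<close>.\<close>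
  have sq: "(\<Sum>i\<in>I. (c i - c' i) * b \<sigma> u v i)\<^sup>2 =
      (\<Sum>i\<in>I. (c i - c' i) * (\<Sum>j\<in>I. \<Sum>k\<in>I. c j * c' k * (b \<sigma> u v i * (b \<sigma> u v j - b \<sigma> u v k))))" for \<sigma> u v
  proof -
    have "(\<Sum>j\<in>I. \<Sum>k\<in>I. c j * c' k * (b \<sigma> u v j - b \<sigma> u v k)) =
       (\<Sum>j\<in>I. c j * b \<sigma> u v j) * (\<Sum>k\<in>I. c' k) - (\<Sum>j\<in>I. c j) * (\<Sum>k\<in>I. c' k * b \<sigma> u v k)"
    proof -
      have "(\<Sum>j\<in>I. \<Sum>k\<in>I. c j * c' k * (b \<sigma> u v j - b \<sigma> u v k)) =
        (\<Sum>j\<in>I. \<Sum>k\<in>I. (c j * b \<sigma> u v j) * c' k) - (\<Sum>j\<in>I. \<Sum>k\<in>I. c j * (c' k * b \<sigma> u v k))"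
        by (simp only: right_diff_distrib sum_subtractf mult_ac)
      then show ?thesis unfolding sum_product .
    qed
    then have D: "(\<Sum>j\<in>I. \<Sum>k\<in>I. c j * c' k * (b \<sigma> u v j - b \<sigma> u v k)) = (\<Sum>i\<in>I. (c i - c' i) * b \<sigma> u v i)"
      unfolding c(3,4) mult_1 mult_1_right left_diff_distrib sum_subtractf .
    show ?thesis
    proof -
      let ?X = "\<Sum>j\<in>I. \<Sum>k\<in>I. c j * c' k * (b \<sigma> u v j - b \<sigma> u v k)"
      have "(\<Sum>i\<in>I. (c i - c' i) * b \<sigma> u v i)\<^sup>2 = (\<Sum>i\<in>I. (c i - c' i) * b \<sigma> u v i) * ?X"
        unfolding power2_eq_square D ..
      also have "\<dots> = (\<Sum>i\<in>I. (c i - c' i) * (b \<sigma> u v i * ?X))"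
        by (subst sum_distrib_right) (simp only: mult.assoc)
      also have "\<dots> = (\<Sum>i\<in>I. (c i - c' i) * (\<Sum>j\<in>I. \<Sum>k\<in>I. c j * c' k * (b \<sigma> u v i * (b \<sigma> u v j - b \<sigma> u v k))))"
      proof (intro sum.cong refl arg_cong2[of _ _ _ _ "(*)"])
        fix i
        show "b \<sigma> u v i * ?X = (\<Sum>j\<in>I. \<Sum>k\<in>I. c j * c' k * (b \<sigma> u v i * (b \<sigma> u v j - b \<sigma> u v k)))"
          unfolding sum_distrib_left by (intro sum.cong refl) (rule mult.left_commute)
      qed
      finally show ?thesis .
    qed
  qed
  have "(\<Sum>\<sigma>\<in>?S. P \<sigma> * bdiv I c c' (\<lambda>i. x (\<sigma> i))) =
     (\<Sum>\<sigma>\<in>?S. \<Sum>v\<in>I. \<Sum>u\<in>I. \<Sum>i\<in>I. \<Sum>j\<in>I. \<Sum>k\<in>I. P \<sigma> *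
        (A u v * ((c i - c' i) * (c j * c' k * (b \<sigma> u v i * (b \<sigma> u v j - b \<sigma> u v k))))))"
    unfolding bdiv_def A_def[symmetric] b_def[symmetric] sq sum_distrib_left ..
  also have "\<dots> = (\<Sum>v\<in>I. \<Sum>u\<in>I. \<Sum>i\<in>I. \<Sum>j\<in>I. \<Sum>k\<in>I. \<Sum>\<sigma>\<in>?S. P \<sigma> *
        (A u v * ((c i - c' i) * (c j * c' k * (b \<sigma> u v i * (b \<sigma> u v j - b \<sigma> u v k))))))"
    by (simp only: sum.swap[where A=I and B="?S"])
  also have "\<dots> = (\<Sum>v\<in>I. \<Sum>u\<in>I. A u v * (\<Sum>i\<in>I. (c i - c' i) * G u v i))"
    unfolding G_def E_def sum_distrib_left by (intro sum.cong refl) (simp only: mult_ac)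
  \<comment> \<open>The sum of |c_i - c'_i| is at most 2, and the factors \<open>A u v\<close> sum
    to 2 as well: this is the origin of the factor 4.\<close>
  also have "\<dots> \<le> (\<Sum>v\<in>I. \<Sum>u\<in>I. A u v * (2 * (R + 6 * \<kappa>)))"
  proof (intro sum_mono mult_left_mono A0)
    fix u v
    have "(\<Sum>i\<in>I. (c i - c' i) * G u v i) \<le> (\<Sum>i\<in>I. (c i + c' i) * (R + 6 * \<kappa>))"
    proof (intro sum_mono)
      fix i
      have "(c i - c' i) * G u v i \<le> \<bar>c i - c' i\<bar> * \<bar>G u v i\<bar>" by (metis abs_ge_self abs_mult)
      also have "\<dots> \<le> (c i + c' i) * (R + 6 * \<kappa>)"
        using c(1)[of i] c(2)[of i] G_bound by (intro mult_mono) auto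
      finally show "(c i - c' i) * G u v i \<le> (c i + c' i) * (R + 6 * \<kappa>)" .
    qed
    also have "\<dots> = 2 * (R + 6 * \<kappa>)" using c by (simp add: sum.distrib flip: sum_distrib_right)
    finally show "(\<Sum>i\<in>I. (c i - c' i) * G u v i) \<le> 2 * (R + 6 * \<kappa>)" .
  qed
  also have "\<dots> = (\<Sum>v\<in>I. \<Sum>u\<in>I. A u v) * (2 * (R + 6 * \<kappa>))" by (simp add: sum_distrib_right)
  also have "(\<Sum>v\<in>I. \<Sum>u\<in>I. A u v) = (\<Sum>i\<in>I. c i) * (\<Sum>i\<in>I. c i) + (\<Sum>i\<in>I. c' i) * (\<Sum>i\<in>I. c' i)"
    unfolding A_def by (simp add: sum_product sum.distrib)
  also have "\<dots> = 2" using c by simp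
  finally show ?thesis by (simp add: R_def \<rho>_def)
qed

section \<open>Permutations drawn with likelihood weights\<close>

text \<open>The second component is left abstract, since the construction is used with (Y,Z) for the
  level and with \<open>Z\<close> alone for the power. Positions are permuted, so this is a right
  action and compositions appear in the order of \<open>permute_fst_permute_fst\<close>.\<close>

definition permute_fst :: "(nat \<Rightarrow> nat) \<Rightarrow> (nat \<Rightarrow> 'x \<times> 'w) \<Rightarrow> nat \<Rightarrow> 'x \<times> 'w"
  where "permute_fst \<sigma> d = (\<lambda>i. (fst (d (\<sigma> i)), snd (d i)))"

lemma permute_fst_permute_fst: "permute_fst \<sigma> (permute_fst \<tau> d) = permute_fst (\<tau> \<circ> \<sigma>) d"
  by (simp add: permute_fst_def)

lemma permute_fst_id: "permute_fst id d = d"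
  by (simp add: permute_fst_def)

lemma measurable_permute_fst:
  assumes \<sigma>: "\<sigma> permutes I"
  shows "permute_fst \<sigma> \<in> measurable (PiM I (\<lambda>_. M \<Otimes>\<^sub>M N)) (PiM I (\<lambda>_. M \<Otimes>\<^sub>M N))"
proof (rule measurable_PiM_single')
  fix i assume i: "i \<in> I"
  then have "\<sigma> i \<in> I" using permutes_in_image[OF \<sigma>] by auto
  then have [measurable]: "(\<lambda>d. d (\<sigma> i)) \<in> measurable (PiM I (\<lambda>_. M \<Otimes>\<^sub>M N)) (M \<Otimes>\<^sub>M N)"
    "(\<lambda>d. d i) \<in> measurable (PiM I (\<lambda>_. M \<Otimes>\<^sub>M N)) (M \<Otimes>\<^sub>M N)"
    using i by (auto intro: measurable_component_singleton)
  show "(\<lambda>d. permute_fst \<sigma> d i) \<in> measurable (PiM I (\<lambda>_. M \<Otimes>\<^sub>M N)) (M \<Otimes>\<^sub>M N)"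
    unfolding permute_fst_def by measurable
next
  show "permute_fst \<sigma> \<in> space (PiM I (\<lambda>_. M \<Otimes>\<^sub>M N)) \<rightarrow> (\<Pi>\<^sub>E i\<in>I. space (M \<Otimes>\<^sub>M N))"
  proof
    fix d assume d: "d \<in> space (PiM I (\<lambda>_. M \<Otimes>\<^sub>M N))"
    have "permute_fst \<sigma> d i \<in> space (M \<Otimes>\<^sub>M N)" if "i \<in> I" for i
      using d permutes_in_image[OF \<sigma>, of i] that
      by (auto simp: permute_fst_def space_PiM space_pair_measure PiE_iff mem_Times_iff)
    \<comment> \<open>Outside \<open>I\<close> the permutation fixes \<open>i\<close>, so both
      components come from \<open>d i = undefined\<close> and reassemble to
      \<open>undefined\<close>.\<close>
    moreover have "permute_fst \<sigma> d i = undefined" if "i \<notin> I" for i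
      using d that permutes_not_in[OF \<sigma> that] by (auto simp: permute_fst_def space_PiM PiE_def extensional_def)
    ultimately show "permute_fst \<sigma> d \<in> (\<Pi>\<^sub>E i\<in>I. space (M \<Otimes>\<^sub>M N))" by auto
  qed
qed

lemma indicator_PiE_eq_prod:
  assumes "finite I" "d \<in> extensional I"
  shows "indicator (Pi\<^sub>E I A) d = (\<Prod>i\<in>I. indicator (A i) (d i) :: ennreal)"
proof (cases "\<forall>i\<in>I. d i \<in> A i")
  case False
  then obtain i where i: "i \<in> I" "d i \<notin> A i" by auto
  then have "(\<Prod>i\<in>I. indicator (A i) (d i) :: ennreal) = 0"
    using assms(1) by (intro prod_zero) (auto intro!: bexI[of _ i])
  then show ?thesis using i by (auto simp: indicator_def PiE_iff)
qed (use assms in \<open>auto simp: indicator_def PiE_iff\<close>)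

lemma sum_permutes_compose_left:
  assumes "\<tau> permutes I"
  shows "(\<Sum>\<sigma> | \<sigma> permutes I. f (\<tau> \<circ> \<sigma>)) = (\<Sum>\<sigma> | \<sigma> permutes I. f \<sigma>)"
  by (rule sum.reindex_bij_witness[where i="\<lambda>\<sigma>. inv \<tau> \<circ> \<sigma>" and j="\<lambda>\<sigma>. \<tau> \<circ> \<sigma>"])
    (use assms in \<open>auto simp: o_assoc permutes_inv_o intro!: permutes_compose permutes_inv\<close>)

lemma sum_permutes_inv:
  "(\<Sum>\<sigma> | \<sigma> permutes I. f (inv \<sigma>)) = (\<Sum>\<sigma> | \<sigma> permutes I. f \<sigma>)"
  by (rule sum.reindex_bij_witness[where i=inv and j=inv])
    (auto simp: permutes_inv_inv intro!: permutes_inv)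

text \<open>\<open>q\<close> plays the role of the conditional density of the first component given
  the second, \<open>N\<close> that of the law of the second component. The instances are
  \<open>qXYZ\<close> with \<open>lawYZ\<close>, which describes the data under conditional
  independence, and \<open>qXZ\<close> with \<open>lawZ\<close>, which describes the pairs (X,Z) in
  any case.\<close>

locale permutation_model =
  fixes I :: "nat set" and M :: "'x measure" and N :: "'w measure" and q :: "'x \<times> 'w \<Rightarrow> real"
  assumes fin: "finite I" and sM: "sigma_finite_measure M" and sN: "sigma_finite_measure N"
    and q_meas[measurable]: "q \<in> borel_measurable (M \<Otimes>\<^sub>M N)" and q_nonneg: "\<And>e. 0 \<le> q e"
begin

abbreviation "base \<equiv> PiM I (\<lambda>_. M \<Otimes>\<^sub>M N)"

sublocale M: sigma_finite_measure M by (rule sM)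
sublocale N: sigma_finite_measure N by (rule sN)
sublocale MN: pair_sigma_finite M N ..
sublocale PM: product_sigma_finite "\<lambda>_::nat. M" by standard
sublocale PN: product_sigma_finite "\<lambda>_::nat. N" by standard
sublocale PB: product_sigma_finite "\<lambda>_::nat. M \<Otimes>\<^sub>M N"
  unfolding product_sigma_finite_def using MN.sigma_finite_measure_axioms by simp

text \<open>Checked on boxes: by Fubini the integral over the first components factors for fixed
  second components, and relabelling the factors by the inverse of \<sigma> removes the
  permutation.\<close>

lemma distr_zip:
  assumes \<sigma>: "\<sigma> permutes I"
  shows "distr (PiM I (\<lambda>_. M) \<Otimes>\<^sub>M PiM I (\<lambda>_. N)) base (\<lambda>(x, w). \<lambda>i\<in>I. (x (\<sigma> i), w i)) = base"
    (is "distr ?P _ ?z = _")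
proof (rule PB.PiM_eqI[OF fin])
  interpret PMs: sigma_finite_measure "PiM I (\<lambda>_. M)" by (rule PM.sigma_finite[OF fin])
  interpret PNs: sigma_finite_measure "PiM I (\<lambda>_. N)" by (rule PN.sigma_finite[OF fin])
  interpret pair_sigma_finite "PiM I (\<lambda>_. M)" "PiM I (\<lambda>_. N)" ..
  have \<sigma>I: "\<sigma> i \<in> I" if "i \<in> I" for i using that permutes_in_image[OF \<sigma>] by auto
  have z[measurable]: "?z \<in> measurable ?P base"
    unfolding case_prod_beta by (intro measurable_restrict) (use \<sigma>I in measurable)
  fix A assume A: "\<And>i. i \<in> I \<Longrightarrow> A i \<in> sets (M \<Otimes>\<^sub>M N)"
  have Pm[measurable]: "Pi\<^sub>E I A \<in> sets base" using A fin by (intro sets_PiM_I_finite) auto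
  have "emeasure (distr ?P base ?z) (Pi\<^sub>E I A) = (\<integral>\<^sup>+p. indicator (Pi\<^sub>E I A) (?z p) \<partial>?P)"
    by (subst nn_integral_distr[OF z, symmetric]) auto
  also have "\<dots> = (\<integral>\<^sup>+p. (\<Prod>i\<in>I. indicator (A i) (fst p (\<sigma> i), snd p i)) \<partial>?P)"
    using fin by (intro nn_integral_cong) (auto simp: case_prod_beta indicator_PiE_eq_prod intro!: prod.cong)
  also have "\<dots> = (\<integral>\<^sup>+w. \<integral>\<^sup>+x. (\<Prod>i\<in>I. indicator (A i) (x (\<sigma> i), w i)) \<partial>PiM I (\<lambda>_. M) \<partial>PiM I (\<lambda>_. N))"
  proof (subst nn_integral_snd[symmetric])
    show "(\<lambda>p. \<Prod>i\<in>I. indicator (A i) (fst p (\<sigma> i), snd p i) :: ennreal) \<in> borel_measurable ?P"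
    proof (intro borel_measurable_prod_ennreal)
      fix i assume i: "i \<in> I"
      note A[OF i, measurable]
      have [measurable]: "(\<lambda>p. fst p (\<sigma> i)) \<in> measurable ?P M" "(\<lambda>p. snd p i) \<in> measurable ?P N"
        using i \<sigma>I[OF i] by measurable
      show "(\<lambda>p. indicator (A i) (fst p (\<sigma> i), snd p i) :: ennreal) \<in> borel_measurable ?P" by measurable
    qed
  qed auto
  also have "\<dots> = (\<integral>\<^sup>+w. (\<Prod>i\<in>I. \<integral>\<^sup>+t. indicator (A i) (t, w i) \<partial>M) \<partial>PiM I (\<lambda>_. N))"
  proof (intro nn_integral_cong)
    fix w assume w: "w \<in> space (PiM I (\<lambda>_. N))"
    have inv: "inv \<sigma> permutes I" using \<sigma> by (rule permutes_inv)
    have iI: "inv \<sigma> i \<in> I" if "i \<in> I" for i using that permutes_in_image[OF inv] by auto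
    have "(\<integral>\<^sup>+x. (\<Prod>i\<in>I. indicator (A i) (x (\<sigma> i), w i)) \<partial>PiM I (\<lambda>_. M)) =
      (\<integral>\<^sup>+x. (\<Prod>i\<in>I. indicator (A (inv \<sigma> i)) (x i, w (inv \<sigma> i)) :: ennreal) \<partial>PiM I (\<lambda>_. M))"
      using prod.permute[OF inv, of "\<lambda>i. indicator (A i) (_ (\<sigma> i), w i)"]
      by (intro nn_integral_cong) (subst prod.permute[OF inv], simp add: o_def permutes_inverses[OF \<sigma>])
    also have "\<dots> = (\<Prod>i\<in>I. \<integral>\<^sup>+t. indicator (A (inv \<sigma> i)) (t, w (inv \<sigma> i)) \<partial>M)"
    proof (rule PM.product_nn_integral_prod[OF fin])
      fix i assume "i \<in> I"
      then have [measurable]: "A (inv \<sigma> i) \<in> sets (M \<Otimes>\<^sub>M N)" and "w (inv \<sigma> i) \<in> space N"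
        using A iI w by (auto simp: space_PiM)
      then show "(\<lambda>t. indicator (A (inv \<sigma> i)) (t, w (inv \<sigma> i)) :: ennreal) \<in> borel_measurable M"
        by measurable
    qed
    also have "\<dots> = (\<Prod>i\<in>I. \<integral>\<^sup>+t. indicator (A i) (t, w i) \<partial>M)"
      by (subst (2) prod.permute[OF inv]) (simp add: o_def)
    finally show "(\<integral>\<^sup>+x. (\<Prod>i\<in>I. indicator (A i) (x (\<sigma> i), w i)) \<partial>PiM I (\<lambda>_. M)) =
      (\<Prod>i\<in>I. \<integral>\<^sup>+t. indicator (A i) (t, w i) \<partial>M)" .
  qed
  also have "\<dots> = (\<Prod>i\<in>I. \<integral>\<^sup>+w. \<integral>\<^sup>+t. indicator (A i) (t, w) \<partial>M \<partial>N)"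
  proof (rule PN.product_nn_integral_prod[OF fin])
    fix i assume i: "i \<in> I"
    note A[OF i, measurable]
    show "(\<lambda>w. \<integral>\<^sup>+t. indicator (A i) (t, w) \<partial>M) \<in> borel_measurable N" by measurable
  qed
  also have "\<dots> = (\<Prod>i\<in>I. emeasure (M \<Otimes>\<^sub>M N) (A i))"
    using A by (intro prod.cong refl) (subst MN.nn_integral_snd, auto)
  finally show "emeasure (distr ?P base ?z) (Pi\<^sub>E I A) = (\<Prod>i\<in>I. emeasure (M \<Otimes>\<^sub>M N) (A i))" .
qed simp

lemma distr_permute_fst:
  assumes \<sigma>: "\<sigma> permutes I"
  shows "distr base base (permute_fst \<sigma>) = base"
proof -
  let ?P = "PiM I (\<lambda>_. M) \<Otimes>\<^sub>M PiM I (\<lambda>_. N)"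
  let ?z = "\<lambda>\<sigma> (x, w). \<lambda>i\<in>I. (x (\<sigma> i), w i)"
  have \<sigma>I: "\<sigma> i \<in> I" if "i \<in> I" for i using that permutes_in_image[OF \<sigma>] by auto
  have z[measurable]: "?z id \<in> measurable ?P base"
    unfolding case_prod_beta by (intro measurable_restrict) measurable
  have "distr base base (permute_fst \<sigma>) = distr (distr ?P base (?z id)) base (permute_fst \<sigma>)"
    by (simp only: distr_zip[OF permutes_id])
  also have "\<dots> = distr ?P base (permute_fst \<sigma> \<circ> ?z id)"
    by (rule distr_distr[OF measurable_permute_fst[OF \<sigma>] z])
  also have "permute_fst \<sigma> \<circ> ?z id = ?z \<sigma>"
    using \<sigma>I permutes_not_in[OF \<sigma>] by (auto simp: permute_fst_def fun_eq_iff restrict_def)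
  also have "distr ?P base (?z \<sigma>) = base" by (rule distr_zip[OF \<sigma>])
  finally show ?thesis .
qed

lemma nn_integral_permute_fst:
  assumes \<sigma>: "\<sigma> permutes I" and [measurable]: "f \<in> borel_measurable base"
  shows "(\<integral>\<^sup>+d. f (permute_fst \<sigma> d) \<partial>base) = (\<integral>\<^sup>+d. f d \<partial>base)"
  by (subst (2) distr_permute_fst[OF \<sigma>, symmetric], subst nn_integral_distr)
    (auto intro!: measurable_permute_fst \<sigma>)

definition lik :: "(nat \<Rightarrow> 'x \<times> 'w) \<Rightarrow> real" where "lik d = (\<Prod>i\<in>I. q (d i))"

definition perm_weight :: "(nat \<Rightarrow> nat) \<Rightarrow> (nat \<Rightarrow> 'x \<times> 'w) \<Rightarrow> real"
  where "perm_weight \<sigma> d = lik (permute_fst \<sigma> d) / (\<Sum>\<tau> | \<tau> permutes I. lik (permute_fst \<tau> d))"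

lemma lik_meas[measurable]: "lik \<in> borel_measurable base"
  unfolding lik_def by measurable

lemma lik_nonneg: "0 \<le> lik d"
  unfolding lik_def by (intro prod_nonneg) (simp add: q_nonneg)

lemma perm_weight_nonneg: "0 \<le> perm_weight \<sigma> d"
  unfolding perm_weight_def by (intro divide_nonneg_nonneg sum_nonneg lik_nonneg)

lemma perm_weight_meas[measurable]:
  assumes "\<sigma> permutes I"
  shows "perm_weight \<sigma> \<in> borel_measurable base"
proof -
  have [measurable]: "(\<lambda>d. lik (permute_fst \<tau> d)) \<in> borel_measurable base" if "\<tau> permutes I" for \<tau>
    by (rule measurable_compose[OF measurable_permute_fst[OF that] lik_meas])
  show ?thesis unfolding perm_weight_def using assms
    by (intro borel_measurable_divide borel_measurable_sum) auto
qed

lemma sum_lik_permute_fst: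
  assumes "\<tau> permutes I"
  shows "(\<Sum>\<sigma> | \<sigma> permutes I. lik (permute_fst \<sigma> (permute_fst \<tau> d))) = (\<Sum>\<sigma> | \<sigma> permutes I. lik (permute_fst \<sigma> d))"
  unfolding permute_fst_permute_fst
  using sum_permutes_compose_left[OF assms, of "\<lambda>\<sigma>. lik (permute_fst \<sigma> d)"] .

text \<open>The normalising sum runs over the whole orbit of the data and is therefore the same for
  the permuted data.\<close>

lemma perm_weight_permute_fst:
  assumes "\<tau> permutes I"
  shows "perm_weight \<sigma> (permute_fst \<tau> d) = perm_weight (\<tau> \<circ> \<sigma>) d"
  unfolding perm_weight_def sum_lik_permute_fst[OF assms] unfolding permute_fst_permute_fst ..

lemma sum_perm_weight_le_1: "(\<Sum>\<sigma> | \<sigma> permutes I. perm_weight \<sigma> d) \<le> 1"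
  unfolding perm_weight_def sum_divide_distrib[symmetric] by simp

text \<open>Data with vanishing normalising sum have all weights equal to 0. They are harmless,
  because the identity contributes \<open>lik d\<close> to that sum, so their likelihood vanishes
  too.\<close>

lemma lik_sum_perm_weight: "lik d * (\<Sum>\<sigma> | \<sigma> permutes I. perm_weight \<sigma> d) = lik d"
proof (cases "lik d = 0")
  case False
  have "lik d \<le> (\<Sum>\<sigma> | \<sigma> permutes I. lik (permute_fst \<sigma> d))"
    using member_le_sum[of id "{\<sigma>. \<sigma> permutes I}" "\<lambda>\<sigma>. lik (permute_fst \<sigma> d)"] fin
    by (auto simp: permute_fst_id lik_nonneg permutes_id finite_permutations)
  then have "(\<Sum>\<sigma> | \<sigma> permutes I. lik (permute_fst \<sigma> d)) \<noteq> 0"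
    using False lik_nonneg[of d] by linarith
  then show ?thesis unfolding perm_weight_def sum_divide_distrib[symmetric] by simp
qed simp

text \<open>Reversibility of the resampling step. The base measure is invariant under each
  permutation; after the change of variables, the permutation \<sigma> carries the weight of its
  inverse, and summation over the group leaves the total weight, which is one wherever the
  likelihood is positive.\<close>

lemma nn_integral_random_permutation:
  fixes \<Phi> :: "(nat \<Rightarrow> 'x \<times> 'w) \<Rightarrow> ennreal"
  assumes [measurable]: "\<Phi> \<in> borel_measurable base"
  shows "(\<integral>\<^sup>+d. ennreal (lik d) * (\<Sum>\<sigma> | \<sigma> permutes I. ennreal (perm_weight \<sigma> d) * \<Phi> (permute_fst \<sigma> d)) \<partial>base) =
    (\<integral>\<^sup>+d. ennreal (lik d) * \<Phi> d \<partial>base)"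
proof -
  have [measurable]: "(\<lambda>d. \<Phi> (permute_fst \<tau> d)) \<in> borel_measurable base" if "\<tau> permutes I" for \<tau>
    by (rule measurable_compose[OF measurable_permute_fst[OF that] assms])
  have "(\<integral>\<^sup>+d. ennreal (lik d) * (\<Sum>\<sigma> | \<sigma> permutes I. ennreal (perm_weight \<sigma> d) * \<Phi> (permute_fst \<sigma> d)) \<partial>base) =
    (\<Sum>\<sigma> | \<sigma> permutes I. \<integral>\<^sup>+d. ennreal (lik d) * (ennreal (perm_weight \<sigma> d) * \<Phi> (permute_fst \<sigma> d)) \<partial>base)"
    unfolding sum_distrib_left by (intro nn_integral_sum) simp
  also have "\<dots> = (\<Sum>\<sigma> | \<sigma> permutes I. \<integral>\<^sup>+d. ennreal (lik d) * (ennreal (perm_weight (inv \<sigma>) d) * \<Phi> d) \<partial>base)"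
  proof (intro sum.cong refl)
    fix \<sigma> assume "\<sigma> \<in> {\<sigma>. \<sigma> permutes I}"
    then have \<sigma>: "\<sigma> permutes I" and i\<sigma>: "inv \<sigma> permutes I" by (auto intro: permutes_inv)
    have "(\<integral>\<^sup>+d. ennreal (lik d) * (ennreal (perm_weight \<sigma> d) * \<Phi> (permute_fst \<sigma> d)) \<partial>base) =
      (\<integral>\<^sup>+d. ennreal (lik (permute_fst (inv \<sigma>) d)) *
        (ennreal (perm_weight \<sigma> (permute_fst (inv \<sigma>) d)) * \<Phi> (permute_fst \<sigma> (permute_fst (inv \<sigma>) d))) \<partial>base)"
      using \<sigma> by (intro nn_integral_permute_fst[OF i\<sigma>, symmetric]) measurable
    also have "\<dots> = (\<integral>\<^sup>+d. ennreal (lik (permute_fst (inv \<sigma>) d) * perm_weight id d) * \<Phi> d \<partial>base)"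
      unfolding perm_weight_permute_fst[OF i\<sigma>] permute_fst_permute_fst permutes_inv_o(2)[OF \<sigma>] permute_fst_id
      by (simp add: ennreal_mult lik_nonneg perm_weight_nonneg mult.assoc)
    also have "\<dots> = (\<integral>\<^sup>+d. ennreal (lik d) * (ennreal (perm_weight (inv \<sigma>) d) * \<Phi> d) \<partial>base)"
    proof (intro nn_integral_cong)
      fix d
      \<comment> \<open>Detailed balance: both sides have the numerator
        \<open>lik d * lik (permute_fst (inv \<sigma>) d)\<close> and the same orbit sum as
        denominator.\<close>
      have "lik (permute_fst (inv \<sigma>) d) * perm_weight id d = lik d * perm_weight (inv \<sigma>) d"
        by (simp add: perm_weight_def permute_fst_id)
      then show "ennreal (lik (permute_fst (inv \<sigma>) d) * perm_weight id d) * \<Phi> d =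
        ennreal (lik d) * (ennreal (perm_weight (inv \<sigma>) d) * \<Phi> d)"
        by (simp add: ennreal_mult lik_nonneg perm_weight_nonneg mult.assoc)
    qed
    finally show "(\<integral>\<^sup>+d. ennreal (lik d) * (ennreal (perm_weight \<sigma> d) * \<Phi> (permute_fst \<sigma> d)) \<partial>base) =
      (\<integral>\<^sup>+d. ennreal (lik d) * (ennreal (perm_weight (inv \<sigma>) d) * \<Phi> d) \<partial>base)" .
  qed
  also have "\<dots> = (\<Sum>\<sigma> | \<sigma> permutes I. \<integral>\<^sup>+d. ennreal (lik d) * (ennreal (perm_weight \<sigma> d) * \<Phi> d) \<partial>base)"
    by (rule sum_permutes_inv)
  also have "\<dots> = (\<integral>\<^sup>+d. (\<Sum>\<sigma> | \<sigma> permutes I. ennreal (lik d) * (ennreal (perm_weight \<sigma> d) * \<Phi> d)) \<partial>base)"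
    by (intro nn_integral_sum[symmetric]) simp
  also have "\<dots> = (\<integral>\<^sup>+d. ennreal (lik d * (\<Sum>\<sigma> | \<sigma> permutes I. perm_weight \<sigma> d)) * \<Phi> d \<partial>base)"
    by (intro nn_integral_cong)
      (simp add: ennreal_mult lik_nonneg sum_nonneg perm_weight_nonneg sum_ennreal[symmetric]
        sum_distrib_left sum_distrib_right mult.assoc del: sum_ennreal)
  finally show ?thesis unfolding lik_sum_perm_weight .
qed

lemma distr_iid:
  assumes "prob_space \<Omega>" and "I \<noteq> {}" and ind: "prob_space.indep_vars \<Omega> (\<lambda>_. M \<Otimes>\<^sub>M N) E I"
    and law: "\<And>i. i \<in> I \<Longrightarrow> distr \<Omega> (M \<Otimes>\<^sub>M N) (E i) = density (M \<Otimes>\<^sub>M N) (\<lambda>e. ennreal (q e))"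
  shows "distr \<Omega> base (\<lambda>\<omega>. \<lambda>i\<in>I. E i \<omega>) = density base (\<lambda>d. ennreal (lik d))"
proof -
  interpret prob_space \<Omega> by fact
  have rv: "E i \<in> measurable \<Omega> (M \<Otimes>\<^sub>M N)" if "i \<in> I" for i
    using ind that by (auto simp: indep_vars_def)
  let ?D = "density (M \<Otimes>\<^sub>M N) (\<lambda>e. ennreal (q e))"
  have pD: "prob_space ?D" 
  proof -
    obtain i where "i \<in> I" using assms(2) by auto
    then show ?thesis using prob_space_distr[OF rv] law by metis
  qed
  interpret D: prob_space ?D by (rule pD)
  interpret PD: product_sigma_finite "\<lambda>_::nat. ?D" by standard
  have "distr \<Omega> base (\<lambda>\<omega>. \<lambda>i\<in>I. E i \<omega>) = PiM I (\<lambda>i. distr \<Omega> (M \<Otimes>\<^sub>M N) (E i))"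
    using indep_vars_iff_distr_eq_PiM'[OF assms(2), where M'="\<lambda>_. M \<Otimes>\<^sub>M N" and X=E] rv ind by auto
  also have "\<dots> = PiM I (\<lambda>_. ?D)" using law by (intro PiM_cong) auto
  also have "\<dots> = density base (\<lambda>d. ennreal (lik d))"
  proof (rule PD.PiM_eqI[OF fin, symmetric])
    show "sets (density base (\<lambda>d. ennreal (lik d))) = sets (PiM I (\<lambda>_. ?D))"
      by (simp cong: sets_PiM_cong)
    fix A assume "\<And>i. i \<in> I \<Longrightarrow> A i \<in> sets ?D"
    then have A: "\<And>i. i \<in> I \<Longrightarrow> A i \<in> sets (M \<Otimes>\<^sub>M N)" by simp
    then have [measurable]: "Pi\<^sub>E I A \<in> sets base" using fin by (intro sets_PiM_I_finite) auto
    have "emeasure (density base (\<lambda>d. ennreal (lik d))) (Pi\<^sub>E I A) =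
      (\<integral>\<^sup>+d. ennreal (lik d) * indicator (Pi\<^sub>E I A) d \<partial>base)"
      by (intro emeasure_density) measurable
    also have "\<dots> = (\<integral>\<^sup>+d. (\<Prod>i\<in>I. ennreal (q (d i)) * indicator (A i) (d i)) \<partial>base)"
    proof (intro nn_integral_cong)
      fix d assume d: "d \<in> space base"
      have "indicator (Pi\<^sub>E I A) d = (\<Prod>i\<in>I. indicator (A i) (d i) :: ennreal)"
        using fin d by (intro indicator_PiE_eq_prod) (auto simp: space_PiM PiE_def)
      then show "ennreal (lik d) * indicator (Pi\<^sub>E I A) d = (\<Prod>i\<in>I. ennreal (q (d i)) * indicator (A i) (d i))"
        by (simp add: lik_def prod.distrib prod_ennreal q_nonneg)
    qed
    also have "\<dots> = (\<Prod>i\<in>I. \<integral>\<^sup>+e. ennreal (q e) * indicator (A i) e \<partial>(M \<Otimes>\<^sub>M N))"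
    proof (rule PB.product_nn_integral_prod[OF fin])
      fix i assume i: "i \<in> I"
      note A[OF i, measurable]
      show "(\<lambda>e. ennreal (q e) * indicator (A i) e) \<in> borel_measurable (M \<Otimes>\<^sub>M N)" by measurable
    qed
    also have "\<dots> = (\<Prod>i\<in>I. emeasure ?D (A i))"
      using A by (intro prod.cong refl) (auto simp: emeasure_density)
    finally show "emeasure (density base (\<lambda>d. ennreal (lik d))) (Pi\<^sub>E I A) = (\<Prod>i\<in>I. emeasure ?D (A i))" .
  qed
  finally show ?thesis .
qed

end

section \<open>Ranks of exchangeable values\<close>

lemma card_small_rank:
  fixes s :: "'j \<Rightarrow> real" and \<beta> :: real
  assumes "finite J" "0 \<le> \<beta>"
  shows "real (card {i\<in>J. real (card {j\<in>J. s i \<le> s j}) < \<beta>}) \<le> \<beta>"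
proof (cases "{i\<in>J. real (card {j\<in>J. s i \<le> s j}) < \<beta>} = {}")
  case False
  let ?A = "{i\<in>J. real (card {j\<in>J. s i \<le> s j}) < \<beta>}"
  have "finite ?A" using assms(1) by simp
  \<comment> \<open>Take the smallest value among the low-ranked ones. Every low-ranked element is
    counted in its rank, which is below \<beta>; ties are counted on both sides.\<close>
  from arg_min_if_finite[OF this False, of s]
  obtain m where m: "m \<in> ?A" "\<And>i. i \<in> ?A \<Longrightarrow> s m \<le> s i"
    by (metis (no_types, lifting) not_less)
  have "card ?A \<le> card {j\<in>J. s m \<le> s j}"
    using m assms(1) by (intro card_mono) auto
  then have "real (card ?A) \<le> real (card {j\<in>J. s m \<le> s j})" by simp
  moreover have "real (card {j\<in>J. s m \<le> s j}) < \<beta>" using m(1) by simp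
  ultimately show ?thesis by linarith
next
  case True
  show ?thesis unfolding True using assms(2) by simp
qed

text \<open>The m+1 draws are independent with common weights \<open>P\<close>, so transposing
  positions shows that each of them is equally likely to have low rank, while at most \<alpha>(1+m)
  positions can have low rank at once. Total weight at most one is enough, which covers degenerate
  data whose permutation weights are all 0.\<close>

lemma exchangeable_rank_bound:
  fixes P :: "'s \<Rightarrow> real" and t :: "'s \<Rightarrow> real"
  assumes S: "finite S" and P: "\<And>s. 0 \<le> P s" "(\<Sum>s\<in>S. P s) \<le> 1" and \<alpha>: "0 < \<alpha>"
  shows "(\<Sum>\<tau>\<in>{0..m} \<rightarrow>\<^sub>E S. (\<Prod>j\<in>{0..m}. P (\<tau> j)) *
    of_bool (real (card {j\<in>{0..m}. t (\<tau> 0) \<le> t (\<tau> j)}) < \<alpha> * (1 + real m))) \<le> \<alpha>"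
proof -
  define J where "J = {0..m}"
  have finJ: "finite J" by (simp add: J_def)
  define W where "W \<tau> = (\<Prod>j\<in>J. P (\<tau> j))" for \<tau> :: "nat \<Rightarrow> 's"
  define B where "B i \<tau> = (of_bool (real (card {j\<in>J. t (\<tau> i) \<le> t (\<tau> j)}) < \<alpha> * (1 + real m)) :: real)" for i \<tau>
  have W0: "0 \<le> W \<tau>" for \<tau> unfolding W_def by (intro prod_nonneg) (simp add: P)
  have sym: "(\<Sum>\<tau>\<in>J \<rightarrow>\<^sub>E S. W \<tau> * B i \<tau>) = (\<Sum>\<tau>\<in>J \<rightarrow>\<^sub>E S. W \<tau> * B 0 \<tau>)" if i: "i \<in> J" for i
  proof -
    define T where "T = Transposition.transpose 0 i"
    have T: "T permutes J" unfolding T_def using i by (intro permutes_swap_id) (auto simp: J_def)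
    have TT: "T \<circ> T = id" by (simp add: T_def)
    have WT: "W (\<tau> \<circ> T) = W \<tau>" for \<tau>
      unfolding W_def using prod.permute[OF T, of "\<lambda>j. P (\<tau> j)"] by (simp add: o_def)
    have BT: "B i (\<tau> \<circ> T) = B 0 \<tau>" for \<tau>
    proof -
      have "card {j\<in>J. t (\<tau> 0) \<le> t (\<tau> j)} = card (T ` {j\<in>J. t (\<tau> 0) \<le> t (\<tau> j)})"
        using permutes_inj_on[OF T] by (intro card_image[symmetric])
      also have "T ` {j\<in>J. t (\<tau> 0) \<le> t (\<tau> j)} = {j\<in>J. t (\<tau> 0) \<le> t (\<tau> (T j))}"
      proof safe
        fix j assume "j \<in> J" then show "T j \<in> J" using permutes_in_image[OF T] by simp
      next
        fix j assume "t (\<tau> 0) \<le> t (\<tau> j)" then show "t (\<tau> 0) \<le> t (\<tau> (T (T j)))"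
          using fun_cong[OF TT, of j] by simp
      next
        fix j assume "j \<in> J" "t (\<tau> 0) \<le> t (\<tau> (T j))"
        then show "j \<in> T ` {j\<in>J. t (\<tau> 0) \<le> t (\<tau> j)}"
          using permutes_in_image[OF T] fun_cong[OF TT, of j] by (intro image_eqI[of _ _ "T j"]) auto
      qed
      finally show ?thesis unfolding B_def by (simp add: T_def)
    qed
    have mem: "\<tau> \<circ> T \<in> J \<rightarrow>\<^sub>E S" if "\<tau> \<in> J \<rightarrow>\<^sub>E S" for \<tau>
      using that permutes_in_image[OF T] permutes_not_in[OF T] by (auto simp: PiE_iff extensional_def)
    have TT': "(\<tau> \<circ> T) \<circ> T = \<tau>" for \<tau> :: "nat \<Rightarrow> 's" by (simp only: comp_assoc TT comp_id)
    have BT': "B 0 (\<tau> \<circ> T) = B i \<tau>" for \<tau>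
      using BT[of "\<tau> \<circ> T"] by (simp only: TT')
    show ?thesis
      by (rule sum.reindex_bij_witness[where i="\<lambda>\<tau>. \<tau> \<circ> T" and j="\<lambda>\<tau>. \<tau> \<circ> T"])
        (simp_all only: mem WT BT' TT')
  qed
  have "(1 + real m) * (\<Sum>\<tau>\<in>J \<rightarrow>\<^sub>E S. W \<tau> * B 0 \<tau>) = (\<Sum>i\<in>J. \<Sum>\<tau>\<in>J \<rightarrow>\<^sub>E S. W \<tau> * B i \<tau>)"
  proof -
    have "(\<Sum>i\<in>J. \<Sum>\<tau>\<in>J \<rightarrow>\<^sub>E S. W \<tau> * B i \<tau>) = (\<Sum>i\<in>J. \<Sum>\<tau>\<in>J \<rightarrow>\<^sub>E S. W \<tau> * B 0 \<tau>)"
      by (intro sum.cong refl sym)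
    also have "\<dots> = real (card J) * (\<Sum>\<tau>\<in>J \<rightarrow>\<^sub>E S. W \<tau> * B 0 \<tau>)" by (rule sum_constant)
    also have "real (card J) = 1 + real m" by (simp add: J_def)
    finally show ?thesis ..
  qed
  also have "\<dots> = (\<Sum>\<tau>\<in>J \<rightarrow>\<^sub>E S. W \<tau> * (\<Sum>i\<in>J. B i \<tau>))"
    by (subst sum.swap) (simp add: sum_distrib_left)
  also have "\<dots> \<le> (\<Sum>\<tau>\<in>J \<rightarrow>\<^sub>E S. W \<tau> * (\<alpha> * (1 + real m)))"
  proof (intro sum_mono mult_left_mono W0)
    fix \<tau>
    have "(\<Sum>i\<in>J. B i \<tau>) = real (card {i\<in>J. real (card {j\<in>J. t (\<tau> i) \<le> t (\<tau> j)}) < \<alpha> * (1 + real m)})"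
    proof -
      have "(\<Sum>i\<in>J. B i \<tau>) = real (card (J \<inter> {i. real (card {j\<in>J. t (\<tau> i) \<le> t (\<tau> j)}) < \<alpha> * (1 + real m)}))"
        unfolding B_def by (subst sum_of_bool_eq) (simp_all add: finJ)
      also have "J \<inter> {i. real (card {j\<in>J. t (\<tau> i) \<le> t (\<tau> j)}) < \<alpha> * (1 + real m)} =
        {i\<in>J. real (card {j\<in>J. t (\<tau> i) \<le> t (\<tau> j)}) < \<alpha> * (1 + real m)}" by auto
      finally show ?thesis .
    qed
    also have "\<dots> \<le> \<alpha> * (1 + real m)"
      using \<alpha> by (intro card_small_rank[OF finJ]) simp
    finally show "(\<Sum>i\<in>J. B i \<tau>) \<le> \<alpha> * (1 + real m)" .
  qed
  also have "\<dots> = (\<Sum>\<tau>\<in>J \<rightarrow>\<^sub>E S. W \<tau>) * (\<alpha> * (1 + real m))" by (simp add: sum_distrib_right)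
  also have "(\<Sum>\<tau>\<in>J \<rightarrow>\<^sub>E S. W \<tau>) = (\<Prod>j\<in>J. \<Sum>s\<in>S. P s)"
    unfolding W_def using S by (intro prod_sum_PiE[symmetric] finJ)
  also have "\<dots> * (\<alpha> * (1 + real m)) \<le> 1 * (\<alpha> * (1 + real m))"
    using \<alpha> P by (intro mult_right_mono prod_le_1) (auto intro: sum_nonneg)
  finally show ?thesis by (simp add: J_def W_def B_def)
qed

section \<open>Independent samples and smoothing kernels\<close>

lemma (in prob_space) nn_integral_indep3:
  assumes ind: "indep_vars (\<lambda>_. S) E J" and J: "i \<in> J" "j \<in> J" "k \<in> J" "i \<noteq> j" "i \<noteq> k" "j \<noteq> k"
    and law: "\<And>i. i \<in> J \<Longrightarrow> distr M S (E i) = L"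
    and f[measurable]: "(\<lambda>(a, b, c). f a b c) \<in> borel_measurable (S \<Otimes>\<^sub>M (S \<Otimes>\<^sub>M S))"
  shows "(\<integral>\<^sup>+\<omega>. f (E i \<omega>) (E j \<omega>) (E k \<omega>) \<partial>M) = (\<integral>\<^sup>+a. \<integral>\<^sup>+b. \<integral>\<^sup>+c. f a b c \<partial>L \<partial>L \<partial>L)"
proof -
  let ?I = "{i, j, k}"
  have rv[measurable]: "E l \<in> measurable M S" if "l \<in> J" for l
    using ind that by (auto simp: indep_vars_def)
  have pL: "prob_space L" using prob_space_distr[OF rv[OF J(1)]] law J(1) by simp
  have sL[measurable_cong]: "sets L = sets S" using law[OF J(1)] by auto
  interpret L: prob_space L by (rule pL)
  interpret P: product_sigma_finite "\<lambda>_::'b. L" by standard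
  have ind': "indep_vars (\<lambda>_. S) E ?I" by (rule indep_vars_subset[OF ind]) (use J in auto)
  have "distr M (PiM ?I (\<lambda>_. S)) (\<lambda>x. \<lambda>l\<in>?I. E l x) = PiM ?I (\<lambda>l. distr M S (E l))"
    by (rule iffD1[OF indep_vars_iff_distr_eq_PiM' ind']) (use rv J in auto)
  also have "\<dots> = PiM ?I (\<lambda>_. L)" using law J by (intro PiM_cong) auto
  finally have D: "distr M (PiM ?I (\<lambda>_. S)) (\<lambda>x. \<lambda>l\<in>?I. E l x) = PiM ?I (\<lambda>_. L)" .
  have m[measurable]: "(\<lambda>d. f (d i) (d j) (d k)) \<in> borel_measurable (PiM ?I (\<lambda>_. S))"
  proof -
    have "(\<lambda>d. (d i, d j, d k)) \<in> measurable (PiM ?I (\<lambda>_. S)) (S \<Otimes>\<^sub>M (S \<Otimes>\<^sub>M S))" by measurable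
    from measurable_compose[OF this f] show ?thesis by simp
  qed
  have r[measurable]: "(\<lambda>x. \<lambda>l\<in>?I. E l x) \<in> measurable M (PiM ?I (\<lambda>_. S))"
    using rv J by (intro measurable_restrict) auto
  have "(\<integral>\<^sup>+\<omega>. f (E i \<omega>) (E j \<omega>) (E k \<omega>) \<partial>M) = (\<integral>\<^sup>+d. f (d i) (d j) (d k) \<partial>distr M (PiM ?I (\<lambda>_. S)) (\<lambda>x. \<lambda>l\<in>?I. E l x))"
    by (subst nn_integral_distr) (use J in auto)
  also have "\<dots> = (\<integral>\<^sup>+d. f (d i) (d j) (d k) \<partial>PiM ?I (\<lambda>_. L))" unfolding D ..
  also have "\<dots> = (\<integral>\<^sup>+a. \<integral>\<^sup>+d. f a (d j) (d k) \<partial>PiM {j, k} (\<lambda>_. L) \<partial>L)"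
  proof (subst P.product_nn_integral_insert_rev)
    have "PiM ?I (\<lambda>_. L) = PiM ?I (\<lambda>_. L)" ..
    show "(\<lambda>d. f (d i) (d j) (d k)) \<in> borel_measurable (PiM ?I (\<lambda>_. L))"
      using m by (simp cong: measurable_cong_sets sets_PiM_cong add: sL)
  qed (use J in auto)
  also have "\<dots> = (\<integral>\<^sup>+a. \<integral>\<^sup>+b. \<integral>\<^sup>+d. f a b (d k) \<partial>PiM {k} (\<lambda>_. L) \<partial>L \<partial>L)"
  proof (intro nn_integral_cong)
    fix a assume a: "a \<in> space L"
    then have aS: "a \<in> space S" using sL by (metis sets_eq_imp_space_eq)
    have "(\<lambda>d. f a (d j) (d k)) \<in> borel_measurable (PiM {j, k} (\<lambda>_. S))"
    proof -
      have "(\<lambda>d. (a, d j, d k)) \<in> measurable (PiM {j, k} (\<lambda>_. S)) (S \<Otimes>\<^sub>M (S \<Otimes>\<^sub>M S))" using aS by measurable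
      from measurable_compose[OF this f] show ?thesis by simp
    qed
    then have "(\<lambda>d. f a (d j) (d k)) \<in> borel_measurable (PiM {j, k} (\<lambda>_. L))"
      by (simp cong: measurable_cong_sets sets_PiM_cong add: sL)
    then show "(\<integral>\<^sup>+d. f a (d j) (d k) \<partial>PiM {j, k} (\<lambda>_. L)) = (\<integral>\<^sup>+b. \<integral>\<^sup>+d. f a b (d k) \<partial>PiM {k} (\<lambda>_. L) \<partial>L)"
      using J by (subst P.product_nn_integral_insert_rev) auto
  qed
  also have "\<dots> = (\<integral>\<^sup>+a. \<integral>\<^sup>+b. \<integral>\<^sup>+c. f a b c \<partial>L \<partial>L \<partial>L)"
  proof (intro nn_integral_cong)
    fix a b assume "a \<in> space L" "b \<in> space L"
    then have aS: "a \<in> space S" "b \<in> space S" using sL by (metis sets_eq_imp_space_eq)+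
    have "(\<lambda>c. f a b c) \<in> borel_measurable S"
    proof -
      have "(\<lambda>c. (a, b, c)) \<in> measurable S (S \<Otimes>\<^sub>M (S \<Otimes>\<^sub>M S))" using aS by measurable
      from measurable_compose[OF this f] show ?thesis by simp
    qed
    then have "(\<lambda>c. f a b c) \<in> borel_measurable L" by (simp cong: measurable_cong_sets add: sL)
    then show "(\<integral>\<^sup>+d. f a b (d k) \<partial>PiM {k} (\<lambda>_. L)) = (\<integral>\<^sup>+c. f a b c \<partial>L)"
      by (intro P.product_nn_integral_singleton)
  qed
  finally show ?thesis .
qed

lemma (in prob_space) distr_indep3:
  assumes ind: "indep_vars (\<lambda>_. S) E J" and J: "i \<in> J" "j \<in> J" "k \<in> J" "i \<noteq> j" "i \<noteq> k" "j \<noteq> k"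
    and law: "\<And>i. i \<in> J \<Longrightarrow> distr M S (E i) = L"
  shows "distr M (S \<Otimes>\<^sub>M (S \<Otimes>\<^sub>M S)) (\<lambda>\<omega>. (E i \<omega>, E j \<omega>, E k \<omega>)) = L \<Otimes>\<^sub>M (L \<Otimes>\<^sub>M L)"
proof (rule measure_eqI)
  have rv[measurable]: "E l \<in> measurable M S" if "l \<in> J" for l
    using ind that by (auto simp: indep_vars_def)
  have pL: "prob_space L" using prob_space_distr[OF rv[OF J(1)]] law J(1) by simp
  have sL: "sets L = sets S" using law[OF J(1)] by auto
  interpret L: prob_space L by (rule pL)
  interpret LL: pair_sigma_finite L L ..
  interpret LLp: prob_space "L \<Otimes>\<^sub>M L" by (rule prob_space_pair) (rule pL)+
  show s: "sets (distr M (S \<Otimes>\<^sub>M (S \<Otimes>\<^sub>M S)) (\<lambda>\<omega>. (E i \<omega>, E j \<omega>, E k \<omega>))) = sets (L \<Otimes>\<^sub>M (L \<Otimes>\<^sub>M L))"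
    by (simp cong: sets_pair_measure_cong add: sL)
  fix A assume "A \<in> sets (distr M (S \<Otimes>\<^sub>M (S \<Otimes>\<^sub>M S)) (\<lambda>\<omega>. (E i \<omega>, E j \<omega>, E k \<omega>)))"
  then have A[measurable]: "A \<in> sets (S \<Otimes>\<^sub>M (S \<Otimes>\<^sub>M S))" by simp
  have AL: "A \<in> sets (L \<Otimes>\<^sub>M (L \<Otimes>\<^sub>M L))" using A by (simp cong: sets_pair_measure_cong add: sL)
  have "emeasure (distr M (S \<Otimes>\<^sub>M (S \<Otimes>\<^sub>M S)) (\<lambda>\<omega>. (E i \<omega>, E j \<omega>, E k \<omega>))) A =
    (\<integral>\<^sup>+\<omega>. indicator A (E i \<omega>, E j \<omega>, E k \<omega>) \<partial>M)"
    using J by (subst nn_integral_indicator[symmetric]) (auto simp: nn_integral_distr simp del: nn_integral_indicator)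
  also have "\<dots> = (\<integral>\<^sup>+a. \<integral>\<^sup>+b. \<integral>\<^sup>+c. indicator A (a, b, c) \<partial>L \<partial>L \<partial>L)"
    by (rule nn_integral_indep3[OF ind J law]) (auto simp: case_prod_beta)
  also have "\<dots> = (\<integral>\<^sup>+a. \<integral>\<^sup>+bc. indicator A (a, bc) \<partial>(L \<Otimes>\<^sub>M L) \<partial>L)"
  proof (intro nn_integral_cong)
    fix a assume "a \<in> space L"
    from measurable_compose[OF measurable_Pair1'[OF this] borel_measurable_indicator[OF AL]]
    have "(\<lambda>bc. indicator A (a, bc) :: ennreal) \<in> borel_measurable (L \<Otimes>\<^sub>M L)" .
    from L.nn_integral_fst[OF this]
    show "(\<integral>\<^sup>+b. \<integral>\<^sup>+c. indicator A (a, b, c) \<partial>L \<partial>L) = (\<integral>\<^sup>+bc. indicator A (a, bc) \<partial>(L \<Otimes>\<^sub>M L))" by simp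
  qed
  also have "\<dots> = emeasure (L \<Otimes>\<^sub>M (L \<Otimes>\<^sub>M L)) A"
    using sigma_finite_measure.emeasure_pair_measure[OF prob_space_imp_sigma_finite[OF LLp.prob_space_axioms] AL]
    by simp
  finally show "emeasure (distr M (S \<Otimes>\<^sub>M (S \<Otimes>\<^sub>M S)) (\<lambda>\<omega>. (E i \<omega>, E j \<omega>, E k \<omega>))) A =
     emeasure (L \<Otimes>\<^sub>M (L \<Otimes>\<^sub>M L)) A" .
qed

lemma (in prob_space) nn_integral_indep2:
  assumes ind: "indep_vars (\<lambda>_. S) E J" and J: "i \<in> J" "j \<in> J" "i \<noteq> j"
    and law: "\<And>i. i \<in> J \<Longrightarrow> distr M S (E i) = L"
    and f[measurable]: "(\<lambda>(a, b). f a b) \<in> borel_measurable (S \<Otimes>\<^sub>M S)"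
  shows "(\<integral>\<^sup>+\<omega>. f (E i \<omega>) (E j \<omega>) \<partial>M) = (\<integral>\<^sup>+a. \<integral>\<^sup>+b. f a b \<partial>L \<partial>L)"
proof -
  let ?I = "{i, j}"
  have rv[measurable]: "E l \<in> measurable M S" if "l \<in> J" for l
    using ind that by (auto simp: indep_vars_def)
  have pL: "prob_space L" using prob_space_distr[OF rv[OF J(1)]] law J(1) by simp
  have sL: "sets L = sets S" using law[OF J(1)] by auto
  interpret L: prob_space L by (rule pL)
  interpret P: product_sigma_finite "\<lambda>_::'b. L" by standard
  have ind': "indep_vars (\<lambda>_. S) E ?I" by (rule indep_vars_subset[OF ind]) (use J in auto)
  have "distr M (PiM ?I (\<lambda>_. S)) (\<lambda>x. \<lambda>l\<in>?I. E l x) = PiM ?I (\<lambda>l. distr M S (E l))"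
    by (rule iffD1[OF indep_vars_iff_distr_eq_PiM' ind']) (use rv J in auto)
  also have "\<dots> = PiM ?I (\<lambda>_. L)" using law J by (intro PiM_cong) auto
  finally have D: "distr M (PiM ?I (\<lambda>_. S)) (\<lambda>x. \<lambda>l\<in>?I. E l x) = PiM ?I (\<lambda>_. L)" .
  have m[measurable]: "(\<lambda>d. f (d i) (d j)) \<in> borel_measurable (PiM ?I (\<lambda>_. S))"
  proof -
    have "(\<lambda>d. (d i, d j)) \<in> measurable (PiM ?I (\<lambda>_. S)) (S \<Otimes>\<^sub>M S)" by measurable
    from measurable_compose[OF this f] show ?thesis by simp
  qed
  have r[measurable]: "(\<lambda>x. \<lambda>l\<in>?I. E l x) \<in> measurable M (PiM ?I (\<lambda>_. S))"
    using rv J by (intro measurable_restrict) auto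
  have "(\<integral>\<^sup>+\<omega>. f (E i \<omega>) (E j \<omega>) \<partial>M) = (\<integral>\<^sup>+d. f (d i) (d j) \<partial>distr M (PiM ?I (\<lambda>_. S)) (\<lambda>x. \<lambda>l\<in>?I. E l x))"
    by (subst nn_integral_distr) (use J in auto)
  also have "\<dots> = (\<integral>\<^sup>+d. f (d i) (d j) \<partial>PiM ?I (\<lambda>_. L))" unfolding D ..
  also have "\<dots> = (\<integral>\<^sup>+a. \<integral>\<^sup>+d. f a (d j) \<partial>PiM {j} (\<lambda>_. L) \<partial>L)"
  proof (subst P.product_nn_integral_insert_rev)
    show "(\<lambda>d. f (d i) (d j)) \<in> borel_measurable (PiM ?I (\<lambda>_. L))"
      using m by (simp cong: measurable_cong_sets sets_PiM_cong add: sL)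
  qed (use J in auto)
  also have "\<dots> = (\<integral>\<^sup>+a. \<integral>\<^sup>+b. f a b \<partial>L \<partial>L)"
  proof (intro nn_integral_cong)
    fix a assume "a \<in> space L"
    then have aS: "a \<in> space S" using sL by (metis sets_eq_imp_space_eq)
    have "(\<lambda>c. f a c) \<in> borel_measurable S"
      using measurable_compose[OF measurable_Pair1'[OF aS] f] by simp
    then have "(\<lambda>c. f a c) \<in> borel_measurable L" by (simp cong: measurable_cong_sets add: sL)
    then show "(\<integral>\<^sup>+d. f a (d j) \<partial>PiM {j} (\<lambda>_. L)) = (\<integral>\<^sup>+c. f a c \<partial>L)"
      by (intro P.product_nn_integral_singleton)
  qed
  finally show ?thesis .
qed

lemma (in prob_space) nn_integral_indep1:
  assumes rv: "E \<in> measurable M S" and law: "distr M S E = L" and f: "f \<in> borel_measurable S"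
  shows "(\<integral>\<^sup>+\<omega>. f (E \<omega>) \<partial>M) = (\<integral>\<^sup>+a. f a \<partial>L)"
  unfolding law[symmetric] using f by (subst nn_integral_distr[OF rv]) auto

lemma nn_integral_lborel_affine:
  fixes f :: "'d::euclidean_space \<Rightarrow> ennreal"
  assumes [measurable]: "f \<in> borel_measurable borel" and h: "0 < h"
  shows "(\<integral>\<^sup>+v. f (u + h *\<^sub>R v) \<partial>lborel) = (\<integral>\<^sup>+v. f v * ennreal (1 / h ^ DIM('d)) \<partial>lborel)"
proof -
  have "(\<integral>\<^sup>+v. f v * ennreal (1 / h ^ DIM('d)) \<partial>lborel) =
    (\<integral>\<^sup>+v. f v * ennreal (1 / h ^ DIM('d)) \<partial>density (distr lborel borel (\<lambda>x. u + h *\<^sub>R x)) (\<lambda>_. ennreal (\<bar>h\<bar> ^ DIM('d))))"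
    using lborel_affine[of h u] h by simp
  also have "\<dots> = (\<integral>\<^sup>+v. ennreal (h ^ DIM('d)) * (f (u + h *\<^sub>R v) * ennreal (1 / h ^ DIM('d))) \<partial>lborel)"
    using h by (subst nn_integral_density) (auto simp: nn_integral_distr)
  also have "\<dots> = (\<integral>\<^sup>+v. f (u + h *\<^sub>R v) \<partial>lborel)"
  proof (intro nn_integral_cong)
    fix v
    have "ennreal (h ^ DIM('d)) * ennreal (1 / h ^ DIM('d)) = 1"
      using h by (simp flip: ennreal_mult' add: ennreal_1)
    then show "ennreal (h ^ DIM('d)) * (f (u + h *\<^sub>R v) * ennreal (1 / h ^ DIM('d))) = f (u + h *\<^sub>R v)"
      by (metis mult.commute mult.left_commute mult.right_neutral)
  qed
  finally show ?thesis ..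
qed

section \<open>Kernel smoothing and the mean error of kernel estimates\<close>

locale smoothing_kernel =
  fixes K :: "real \<Rightarrow> real" and \<kappa> R :: real and T :: "'d::euclidean_space itself"
  assumes K_meas[measurable]: "K \<in> borel_measurable borel" and K_nonneg: "\<And>t. 0 \<le> K t" and K_le: "\<And>t. K t \<le> \<kappa>"
    and K_supp: "\<And>t. K t \<noteq> 0 \<Longrightarrow> \<bar>t\<bar> \<le> R" and K_int: "(\<integral>\<^sup>+u. ennreal (K (norm (u::'d))) \<partial>lborel) = 1"
    and \<kappa>_pos: "0 < \<kappa>" and R_pos: "0 < R"
begin

text \<open>The division by h^d gives the kernel integral one in its second argument; it cancels in
  the normalised weights of the statistic.\<close>

definition Kh :: "real \<Rightarrow> 'd \<Rightarrow> 'd \<Rightarrow> real" where "Kh h u v = K (norm (u - v) / h) / h ^ DIM('d)"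

lemma Kh_meas[measurable]: "(\<lambda>x. Kh h (f x) (g x)) \<in> borel_measurable N"
  if [measurable]: "f \<in> borel_measurable N" "g \<in> borel_measurable N"
  unfolding Kh_def by measurable

lemma Kh_nonneg: "0 < h \<Longrightarrow> 0 \<le> Kh h u v" by (simp add: Kh_def K_nonneg)

lemma Kh_le: "0 < h \<Longrightarrow> Kh h u v \<le> \<kappa> / h ^ DIM('d)"
  unfolding Kh_def by (intro divide_right_mono K_le) auto

lemma Kh_commute: "Kh h u v = Kh h v u" by (simp add: Kh_def norm_minus_commute)

lemma nn_integral_Kh:
  assumes [measurable]: "f \<in> borel_measurable borel" and h: "0 < h"
  shows "(\<integral>\<^sup>+v. ennreal (Kh h u v) * f v \<partial>lborel) = (\<integral>\<^sup>+v. ennreal (K (norm v)) * f (u + h *\<^sub>R v) \<partial>lborel)"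
proof -
  have "(\<integral>\<^sup>+v. ennreal (K (norm v)) * f (u + h *\<^sub>R v) \<partial>lborel) =
    (\<integral>\<^sup>+v. (\<lambda>x. ennreal (K (norm (u - x) / h)) * f x) (u + h *\<^sub>R v) \<partial>lborel)"
    using h by (intro nn_integral_cong) simp
  also have "\<dots> = (\<integral>\<^sup>+v. ennreal (K (norm (u - v) / h)) * f v * ennreal (1 / h ^ DIM('d)) \<partial>lborel)"
    using h by (subst nn_integral_lborel_affine) auto
  also have "\<dots> = (\<integral>\<^sup>+v. ennreal (Kh h u v) * f v \<partial>lborel)"
  proof (intro nn_integral_cong)
    fix v
    have "ennreal (Kh h u v) = ennreal (K (norm (u - v) / h)) * ennreal (1 / h ^ DIM('d))"
      using h by (simp add: Kh_def K_nonneg flip: ennreal_mult)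
    then show "ennreal (K (norm (u - v) / h)) * f v * ennreal (1 / h ^ DIM('d)) = ennreal (Kh h u v) * f v"
      by (simp add: mult_ac)
  qed
  finally show ?thesis ..
qed

lemma nn_integral_Kh_1: "0 < h \<Longrightarrow> (\<integral>\<^sup>+v. ennreal (Kh h u v) \<partial>lborel) = 1"
  using nn_integral_Kh[of "\<lambda>_. 1" h u] K_int by simp

lemma K_integrable: "integrable lborel (\<lambda>u::'d. K (norm u))" "(\<integral>u. K (norm (u::'d)) \<partial>lborel) = 1"
proof -
  show i: "integrable lborel (\<lambda>u::'d. K (norm u))"
    using K_int by (intro integrableI_nonneg) (auto simp: K_nonneg)
  show "(\<integral>u. K (norm (u::'d)) \<partial>lborel) = 1"
    using nn_integral_eq_integral[OF i] K_int K_nonneg by (simp add: integral_nonneg_AE)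
qed

text \<open>The mean of a kernel estimate of \<open>g\<close>, with the bandwidth moved from the
  kernel into the argument of \<open>g\<close>.\<close>

definition smooth :: "real \<Rightarrow> ('d \<Rightarrow> real) \<Rightarrow> 'd \<Rightarrow> real"
  where "smooth h g u = (\<integral>v. K (norm v) * g (u + h *\<^sub>R v) \<partial>lborel)"

lemma smooth_facts:
  assumes [measurable]: "g \<in> borel_measurable borel" and g: "\<And>u. 0 \<le> g u" "\<And>u. g u \<le> C"
  shows "integrable lborel (\<lambda>v. K (norm v) * g (u + h *\<^sub>R v))" "0 \<le> smooth h g u" "smooth h g u \<le> C"
proof -
  have b: "K (norm v) * g (u + h *\<^sub>R v) \<le> C * K (norm v)" for v
    using g(2)[of "u + h *\<^sub>R v"] K_nonneg[of "norm v"]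
    by (subst mult.commute[of C]) (intro mult_left_mono)
  have C0: "0 \<le> C" using g(1)[of 0] g(2)[of 0] by linarith
  show i: "integrable lborel (\<lambda>v. K (norm v) * g (u + h *\<^sub>R v))"
  proof (rule Bochner_Integration.integrable_bound[OF integrable_mult_right[OF K_integrable(1), of C]])
    show "AE v in lborel. norm (K (norm v) * g (u + h *\<^sub>R v)) \<le> norm (C * K (norm v))"
      using b g(1) K_nonneg C0 by (intro AE_I2) simp
  qed measurable
  show "0 \<le> smooth h g u" unfolding smooth_def by (intro integral_nonneg_AE) (auto simp: g K_nonneg)
  have "smooth h g u \<le> (\<integral>v. C * K (norm (v::'d)) \<partial>lborel)"
    unfolding smooth_def using b K_integrable by (intro integral_mono[OF i]) auto
  then show "smooth h g u \<le> C" using K_integrable by simp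
qed

lemma smooth_meas[measurable]:
  assumes [measurable]: "g \<in> borel_measurable borel"
  shows "smooth h g \<in> borel_measurable borel"
  unfolding smooth_def by measurable

text \<open>By Fubini the bias is an average of the mean distances between \<open>g\<close> and its
  translates by h v, and the support of the kernel confines these shifts to norm at most hR.\<close>

lemma smooth_L1:
  assumes [measurable]: "g \<in> borel_measurable borel" and g: "\<And>u. 0 \<le> g u" "\<And>u. g u \<le> C"
    and h: "0 < h" and \<delta>: "h * R < \<delta>"
    and tc: "\<And>t. norm t < \<delta> \<Longrightarrow> (\<integral>\<^sup>+u. ennreal \<bar>g (u + t) - g u\<bar> \<partial>lborel) \<le> ennreal \<epsilon>"
  shows "(\<integral>\<^sup>+u. ennreal \<bar>smooth h g u - g u\<bar> \<partial>lborel) \<le> ennreal \<epsilon>"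
proof -
  have "(\<integral>\<^sup>+u. ennreal \<bar>smooth h g u - g u\<bar> \<partial>lborel) \<le>
    (\<integral>\<^sup>+u. \<integral>\<^sup>+v. ennreal (K (norm v)) * ennreal \<bar>g (u + h *\<^sub>R v) - g u\<bar> \<partial>lborel \<partial>lborel)"
  proof (intro nn_integral_mono)
    fix u
    note i = smooth_facts(1)[of g C u h, OF _ g] K_integrable
    have "smooth h g u - g u = (\<integral>v. K (norm v) * g (u + h *\<^sub>R v) - K (norm v) * g u \<partial>lborel)"
      unfolding smooth_def using i by (subst Bochner_Integration.integral_diff) auto
    then have "ennreal \<bar>smooth h g u - g u\<bar> \<le> (\<integral>\<^sup>+v. ennreal (norm (K (norm v) * g (u + h *\<^sub>R v) - K (norm v) * g u)) \<partial>lborel)"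
      using i by (simp only: real_norm_def[symmetric]) (intro integral_norm_bound_ennreal, auto)
    also have "\<dots> = (\<integral>\<^sup>+v. ennreal (K (norm v)) * ennreal \<bar>g (u + h *\<^sub>R v) - g u\<bar> \<partial>lborel)"
      by (intro nn_integral_cong) (simp add: K_nonneg abs_mult ennreal_mult flip: right_diff_distrib)
    finally show "ennreal \<bar>smooth h g u - g u\<bar> \<le> (\<integral>\<^sup>+v. ennreal (K (norm v)) * ennreal \<bar>g (u + h *\<^sub>R v) - g u\<bar> \<partial>lborel)" .
  qed
  also have "\<dots> = (\<integral>\<^sup>+v. \<integral>\<^sup>+u. ennreal (K (norm v)) * ennreal \<bar>g (u + h *\<^sub>R v) - g u\<bar> \<partial>lborel \<partial>lborel)"
    by (intro lborel_pair.Fubini') measurable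
  also have "\<dots> \<le> (\<integral>\<^sup>+v. ennreal (K (norm (v::'d))) * ennreal \<epsilon> \<partial>lborel)"
  proof (intro nn_integral_mono)
    fix v :: 'd
    show "(\<integral>\<^sup>+u. ennreal (K (norm v)) * ennreal \<bar>g (u + h *\<^sub>R v) - g u\<bar> \<partial>lborel) \<le> ennreal (K (norm v)) * ennreal \<epsilon>"
    proof (cases "K (norm v) = 0")
      case False
      then have "norm v \<le> R" using K_supp[of "norm v"] by simp
      then have "norm (h *\<^sub>R v) < \<delta>" using h \<delta> by (simp add: le_less_trans[OF mult_left_mono[of "norm v" R h]])
      from tc[OF this] show ?thesis by (subst nn_integral_cmult) (auto intro: mult_left_mono)
    qed simp
  qed
  also have "\<dots> = ennreal \<epsilon>" using K_int by (subst nn_integral_multc) auto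
  finally show ?thesis .
qed

end

text \<open>\<open>g\<close> is the density of the image under \<open>w\<close> of the law weighted
  by \<phi>. With \<phi> the indicator of the event that \<open>X\<close> lies in \<open>A\<close>,
  it is the numerator of a conditional probability; with \<phi> = 1 it is the marginal density. The
  assumption \<open>dom\<close> is the boundedness of the density of \<open>w\<close>.\<close>

locale kernel_sample = smoothing_kernel K \<kappa> R T + prob_space \<Omega>
  for K :: "real \<Rightarrow> real" and \<kappa> R :: real and T :: "'d::euclidean_space itself" and \<Omega> :: "'o measure" +
  fixes S :: "'a measure" and E :: "nat \<Rightarrow> 'o \<Rightarrow> 'a" and L :: "'a measure" and w :: "'a \<Rightarrow> 'd"
    and \<phi> :: "'a \<Rightarrow> real" and g :: "'d \<Rightarrow> real" and C :: real
  assumes ind: "indep_vars (\<lambda>_. S) E {1..}"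
    and law: "\<And>i. i \<in> {1..} \<Longrightarrow> distr \<Omega> S (E i) = L"
    and w_meas[measurable]: "w \<in> measurable S borel"
    and \<phi>_meas[measurable]: "\<phi> \<in> borel_measurable S" and \<phi>01: "\<And>e. 0 \<le> \<phi> e" "\<And>e. \<phi> e \<le> 1"
    and g_meas[measurable]: "g \<in> borel_measurable borel" and g0: "\<And>u. 0 \<le> g u" and gC: "\<And>u. g u \<le> C"
    and g_int: "integrable lborel g"
    and dens: "\<And>\<psi>. \<psi> \<in> borel_measurable borel \<Longrightarrow>
      (\<integral>\<^sup>+e. ennreal (\<phi> e) * \<psi> (w e) \<partial>L) = (\<integral>\<^sup>+u. ennreal (g u) * \<psi> u \<partial>lborel)"
    and dom: "\<And>\<psi>. \<psi> \<in> borel_measurable borel \<Longrightarrow>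
      (\<integral>\<^sup>+e. \<psi> (w e) \<partial>L) \<le> ennreal C * (\<integral>\<^sup>+u. \<psi> u \<partial>lborel)"
    and C_pos: "0 < C"
begin

lemma E_meas[measurable]: "i \<in> {1..} \<Longrightarrow> E i \<in> measurable \<Omega> S"
  using ind by (auto simp: indep_vars_def)

lemma prob_L: "prob_space L"
  using prob_space_distr[OF E_meas[of 1]] law[of 1] by simp

lemma sets_L[measurable_cong]: "sets L = sets S"
  using law[of 1] by auto

lemma smooth_g: "0 \<le> smooth h g u" "smooth h g u \<le> C"
  using smooth_facts[of g C] g0 gC by auto

lemma nn_integral_kernel:
  assumes h: "0 < h"
  shows "(\<integral>\<^sup>+e. ennreal (Kh h u (w e) * \<phi> e) \<partial>L) = ennreal (smooth h g u)"
proof -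
  have "(\<integral>\<^sup>+e. ennreal (Kh h u (w e) * \<phi> e) \<partial>L) = (\<integral>\<^sup>+e. ennreal (\<phi> e) * ennreal (Kh h u (w e)) \<partial>L)"
    using h by (intro nn_integral_cong) (simp add: ennreal_mult Kh_nonneg \<phi>01 mult.commute)
  also have "\<dots> = (\<integral>\<^sup>+v. ennreal (Kh h u v) * ennreal (g v) \<partial>lborel)"
    by (subst dens) (auto simp: mult.commute)
  also have "\<dots> = (\<integral>\<^sup>+v. ennreal (K (norm v) * g (u + h *\<^sub>R v)) \<partial>lborel)"
    using h by (subst nn_integral_Kh) (auto simp: ennreal_mult K_nonneg g0)
  also have "\<dots> = ennreal (smooth h g u)"
    unfolding smooth_def using smooth_facts(1)[of g C u h] g0 gC
    by (intro nn_integral_eq_integral) (auto simp: K_nonneg)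
  finally show ?thesis .
qed

text \<open>By \<open>integral_dev\<close> this has mean 0 in \<open>b\<close> for every
  \<open>a\<close>. Given the evaluation point, the summands of the estimation error are thus
  centred and independent, hence uncorrelated.\<close>

definition dev :: "real \<Rightarrow> 'a \<Rightarrow> 'a \<Rightarrow> real"
  where "dev h a b = Kh h (w a) (w b) * \<phi> b - smooth h g (w a)"

lemma dev_meas[measurable]: "(\<lambda>x. dev h (f1 x) (f2 x)) \<in> borel_measurable N"
  if [measurable]: "f1 \<in> measurable N S" "f2 \<in> measurable N S"
  unfolding dev_def by measurable

lemma kernel_bounds:
  assumes h: "0 < h"
  shows "0 \<le> Kh h u v * \<phi> b" "Kh h u v * \<phi> b \<le> \<kappa> / h ^ DIM('d)"
proof -
  show "0 \<le> Kh h u v * \<phi> b" using h by (simp add: Kh_nonneg \<phi>01)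
  have "Kh h u v * \<phi> b \<le> \<kappa> / h ^ DIM('d) * 1"
    using h \<kappa>_pos by (intro mult_mono Kh_le \<phi>01) auto
  then show "Kh h u v * \<phi> b \<le> \<kappa> / h ^ DIM('d)" by simp
qed

lemma abs_dev_le:
  assumes h: "0 < h"
  shows "\<bar>dev h a b\<bar> \<le> \<kappa> / h ^ DIM('d) + C"
  using kernel_bounds[OF h, of "w a" "w b" b] smooth_g[of h "w a"] unfolding dev_def by linarith

lemma integral_dev:
  assumes h: "0 < h"
  shows "(\<integral>b. dev h a b \<partial>L) = 0"
proof -
  interpret L: prob_space L by (rule prob_L)
  have [measurable]: "(\<lambda>b. Kh h (w a) (w b) * \<phi> b) \<in> borel_measurable L" by measurable
  have i: "integrable L (\<lambda>b. Kh h (w a) (w b) * \<phi> b)"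
    using kernel_bounds[OF h] by (intro L.integrable_const_bound[where B="\<kappa> / h ^ DIM('d)"]) auto
  have "ennreal (\<integral>b. Kh h (w a) (w b) * \<phi> b \<partial>L) = ennreal (smooth h g (w a))"
    using nn_integral_eq_integral[OF i] nn_integral_kernel[OF h, of "w a"] kernel_bounds[OF h] by simp
  then have "(\<integral>b. Kh h (w a) (w b) * \<phi> b \<partial>L) = smooth h g (w a)"
    using smooth_g kernel_bounds[OF h] by (subst (asm) ennreal_inj) (auto intro!: integral_nonneg_AE)
  then show ?thesis unfolding dev_def using i by (simp add: L.prob_space)
qed

lemma expectation_dev_dev:
  assumes h: "0 < h" and s: "s \<in> {1..}" "i \<in> {1..}" "j \<in> {1..}" "s \<noteq> i" "s \<noteq> j" "i \<noteq> j"
  shows "expectation (\<lambda>\<omega>. dev h (E s \<omega>) (E i \<omega>) * dev h (E s \<omega>) (E j \<omega>)) = 0"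
proof -
  interpret L: prob_space L by (rule prob_L)
  interpret LL: pair_prob_space L L ..
  interpret LLp: pair_prob_space L "L \<Otimes>\<^sub>M L" ..
  let ?f = "\<lambda>(a, b, c). dev h a b * dev h a c"
  let ?B = "\<kappa> / h ^ DIM('d) + C"
  have B0: "0 \<le> ?B" using h \<kappa>_pos C_pos by simp
  have m: "?f \<in> borel_measurable (S \<Otimes>\<^sub>M (S \<Otimes>\<^sub>M S))" by measurable
  have "expectation (\<lambda>\<omega>. dev h (E s \<omega>) (E i \<omega>) * dev h (E s \<omega>) (E j \<omega>)) =
    integral\<^sup>L (distr \<Omega> (S \<Otimes>\<^sub>M (S \<Otimes>\<^sub>M S)) (\<lambda>\<omega>. (E s \<omega>, E i \<omega>, E j \<omega>))) ?f"
    using s by (subst integral_distr[OF _ m]) auto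
  also have "\<dots> = integral\<^sup>L (L \<Otimes>\<^sub>M (L \<Otimes>\<^sub>M L)) ?f"
    using s by (subst distr_indep3[OF ind _ _ _ _ _ _ law]) auto
  also have "\<dots> = (\<integral>a. (\<integral>bc. ?f (a, bc) \<partial>(L \<Otimes>\<^sub>M L)) \<partial>L)"
  proof (rule LLp.integral_fst'[symmetric])
    show "integrable (L \<Otimes>\<^sub>M (L \<Otimes>\<^sub>M L)) ?f"
    proof (rule LLp.integrable_const_bound[where B="?B * ?B"])
      show "AE x in L \<Otimes>\<^sub>M (L \<Otimes>\<^sub>M L). norm (?f x) \<le> ?B * ?B"
        by (intro AE_I2) (auto simp: abs_mult intro!: mult_mono abs_dev_le[OF h] B0)
      show "?f \<in> borel_measurable (L \<Otimes>\<^sub>M (L \<Otimes>\<^sub>M L))" by measurable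
    qed
  qed
  also have "\<dots> = (\<integral>a. 0 \<partial>L)"
  proof (intro Bochner_Integration.integral_cong refl)
    fix a assume "a \<in> space L"
    then have a: "a \<in> space S" using sets_L by (metis sets_eq_imp_space_eq)
    have [measurable]: "(\<lambda>b. dev h a b) \<in> borel_measurable L" using a by measurable
    have "(\<integral>bc. ?f (a, bc) \<partial>(L \<Otimes>\<^sub>M L)) = (\<integral>b. \<integral>c. dev h a b * dev h a c \<partial>L \<partial>L)"
    proof (subst LL.integral_fst'[symmetric])
      show "integrable (L \<Otimes>\<^sub>M L) (\<lambda>bc. ?f (a, bc))"
      proof (rule LL.integrable_const_bound[where B="?B * ?B"])
        show "AE x in L \<Otimes>\<^sub>M L. norm (?f (a, x)) \<le> ?B * ?B"
          by (intro AE_I2) (auto simp: abs_mult intro!: mult_mono abs_dev_le[OF h] B0)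
        show "(\<lambda>bc. ?f (a, bc)) \<in> borel_measurable (L \<Otimes>\<^sub>M L)" unfolding case_prod_beta using a by measurable
      qed
    qed simp
    also have "\<dots> = 0" by (simp add: integral_dev[OF h])
    finally show "(\<integral>bc. ?f (a, bc) \<partial>(L \<Otimes>\<^sub>M L)) = 0" .
  qed
  finally show ?thesis by simp
qed

lemma integrable_dev_dev:
  assumes h: "0 < h" and s: "s \<in> {1..}" "i \<in> {1..}" "j \<in> {1..}"
  shows "integrable \<Omega> (\<lambda>\<omega>. dev h (E s \<omega>) (E i \<omega>) * dev h (E s \<omega>) (E j \<omega>))"
proof (rule integrable_const_bound[where B="(\<kappa> / h ^ DIM('d) + C) * (\<kappa> / h ^ DIM('d) + C)"])
  show "AE \<omega> in \<Omega>. norm (dev h (E s \<omega>) (E i \<omega>) * dev h (E s \<omega>) (E j \<omega>)) \<le> (\<kappa> / h ^ DIM('d) + C) * (\<kappa> / h ^ DIM('d) + C)"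
    using h \<kappa>_pos C_pos by (intro AE_I2) (auto simp: abs_mult intro!: mult_mono abs_dev_le[OF h])
qed (use s in measurable)

text \<open>In the square of the kernel one factor is bounded by its maximum and the other one has
  mean at most \<open>C\<close>. The second moment is then of order h^(-d) and not h^(-2d), which is
  what makes n h^d \<rightarrow> \<infinity> sufficient.\<close>

lemma expectation_dev_square:
  assumes h: "0 < h" and s: "s \<in> {1..}" "i \<in> {1..}" "s \<noteq> i"
  shows "expectation (\<lambda>\<omega>. dev h (E s \<omega>) (E i \<omega>) * dev h (E s \<omega>) (E i \<omega>)) \<le> 2 * \<kappa> * C / h ^ DIM('d) + 2 * C\<^sup>2"
proof -
  note E_meas[OF s(1), measurable] E_meas[OF s(2), measurable]
  let ?k = "\<lambda>\<omega>. Kh h (w (E s \<omega>)) (w (E i \<omega>)) * \<phi> (E i \<omega>)"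
  let ?B = "\<kappa> / h ^ DIM('d)"
  have ik: "integrable \<Omega> ?k"
    using kernel_bounds[OF h] by (intro integrable_const_bound[where B="?B"]) auto
  have "(\<integral>\<^sup>+\<omega>. ennreal (?k \<omega>) \<partial>\<Omega>) = (\<integral>\<^sup>+a. \<integral>\<^sup>+b. ennreal (Kh h (w a) (w b) * \<phi> b) \<partial>L \<partial>L)"
    using s by (intro nn_integral_indep2[OF ind _ _ _ law, where f="\<lambda>a b. ennreal (Kh h (w a) (w b) * \<phi> b)"]) auto
  also have "\<dots> \<le> (\<integral>\<^sup>+a. ennreal C \<partial>L)"
    unfolding nn_integral_kernel[OF h] by (intro nn_integral_mono ennreal_leI smooth_g)
  also have "\<dots> = ennreal C" using prob_space.emeasure_space_1[OF prob_L] by simp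
  finally have Ek: "expectation ?k \<le> C"
    using kernel_bounds[OF h] C_pos by (subst (asm) nn_integral_eq_integral[OF ik]) auto
  have "expectation (\<lambda>\<omega>. dev h (E s \<omega>) (E i \<omega>) * dev h (E s \<omega>) (E i \<omega>)) \<le> expectation (\<lambda>\<omega>. 2 * ?B * ?k \<omega> + 2 * C\<^sup>2)"
  proof (rule integral_mono[OF integrable_dev_dev[OF h s(1) s(2) s(2)]])
    show "integrable \<Omega> (\<lambda>\<omega>. 2 * ?B * ?k \<omega> + 2 * C\<^sup>2)" using ik by simp
    fix \<omega>
    let ?b = "smooth h g (w (E s \<omega>))"
    have "dev h (E s \<omega>) (E i \<omega>) * dev h (E s \<omega>) (E i \<omega>) \<le> 2 * (?k \<omega> * ?k \<omega>) + 2 * (?b * ?b)"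
      unfolding dev_def using sum_squares_bound[of "?k \<omega>" "- ?b"] zero_le_square[of "?k \<omega> + ?b"] by (simp add: algebra_simps power2_eq_square)
    also have "\<dots> \<le> 2 * (?B * ?k \<omega>) + 2 * (C * C)"
      using kernel_bounds[OF h, of "w (E s \<omega>)" "w (E i \<omega>)" "E i \<omega>"] smooth_g[of h "w (E s \<omega>)"] C_pos
      by (intro add_mono mult_left_mono mult_mono mult_right_mono) auto
    finally show "dev h (E s \<omega>) (E i \<omega>) * dev h (E s \<omega>) (E i \<omega>) \<le> 2 * ?B * ?k \<omega> + 2 * C\<^sup>2"
      by (simp add: power2_eq_square)
  qed
  also have "\<dots> = 2 * ?B * expectation ?k + 2 * C\<^sup>2" using ik by (simp add: prob_space)
  also have "\<dots> \<le> 2 * ?B * C + 2 * C\<^sup>2" using Ek h \<kappa>_pos by (intro add_mono mult_left_mono) auto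
  finally show ?thesis by simp
qed

text \<open>Orthogonality leaves only the diagonal of the second moment. The inequality |x| \<le>
  t/2 + x^2/(2t) passes from the second moment to the first.\<close>

lemma mean_dev_L1:
  assumes h: "0 < h" and s: "s \<in> {1..n}" and t: "0 < t"
    and V: "(2 * \<kappa> * C / h ^ DIM('d) + 2 * C\<^sup>2) / real n \<le> t\<^sup>2"
  shows "(\<integral>\<^sup>+\<omega>. ennreal \<bar>(\<Sum>i\<in>{1..n} - {s}. dev h (E s \<omega>) (E i \<omega>)) / real n\<bar> \<partial>\<Omega>) \<le> ennreal t"
proof -
  let ?I = "{1..n} - {s}"
  let ?X = "\<lambda>\<omega>. (\<Sum>i\<in>?I. dev h (E s \<omega>) (E i \<omega>)) / real n"
  let ?V = "2 * \<kappa> * C / h ^ DIM('d) + 2 * C\<^sup>2"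
  have n: "0 < real n" using s by auto
  have V0: "0 \<le> ?V" using h \<kappa>_pos C_pos by simp
  have sq: "(?X \<omega>)\<^sup>2 = (\<Sum>i\<in>?I. \<Sum>j\<in>?I. dev h (E s \<omega>) (E i \<omega>) * dev h (E s \<omega>) (E j \<omega>)) / (real n)\<^sup>2" for \<omega>
    by (simp only: power_divide) (simp only: power2_eq_square sum_product)
  have int: "integrable \<Omega> (\<lambda>\<omega>. dev h (E s \<omega>) (E i \<omega>) * dev h (E s \<omega>) (E j \<omega>))" if "i \<in> ?I" "j \<in> ?I" for i j
    using that s by (intro integrable_dev_dev[OF h]) auto
  have iX: "integrable \<Omega> (\<lambda>\<omega>. (?X \<omega>)\<^sup>2)" unfolding sq using int by (intro integrable_divide Bochner_Integration.integrable_sum) auto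
  have "expectation (\<lambda>\<omega>. (?X \<omega>)\<^sup>2) =
    (\<Sum>i\<in>?I. \<Sum>j\<in>?I. expectation (\<lambda>\<omega>. dev h (E s \<omega>) (E i \<omega>) * dev h (E s \<omega>) (E j \<omega>))) / (real n)\<^sup>2"
  proof -
    have "expectation (\<lambda>\<omega>. \<Sum>i\<in>?I. \<Sum>j\<in>?I. dev h (E s \<omega>) (E i \<omega>) * dev h (E s \<omega>) (E j \<omega>)) =
      (\<Sum>i\<in>?I. expectation (\<lambda>\<omega>. \<Sum>j\<in>?I. dev h (E s \<omega>) (E i \<omega>) * dev h (E s \<omega>) (E j \<omega>)))"
      by (intro Bochner_Integration.integral_sum Bochner_Integration.integrable_sum int)
    also have "\<dots> = (\<Sum>i\<in>?I. \<Sum>j\<in>?I. expectation (\<lambda>\<omega>. dev h (E s \<omega>) (E i \<omega>) * dev h (E s \<omega>) (E j \<omega>)))"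
      by (intro sum.cong refl Bochner_Integration.integral_sum int)
    finally show ?thesis unfolding sq by simp
  qed
  also have "\<dots> \<le> (\<Sum>i\<in>?I. \<Sum>j\<in>?I. if i = j then ?V else 0) / (real n)\<^sup>2"
  proof (intro divide_right_mono sum_mono)
    fix i j assume ij: "i \<in> ?I" "j \<in> ?I"
    show "expectation (\<lambda>\<omega>. dev h (E s \<omega>) (E i \<omega>) * dev h (E s \<omega>) (E j \<omega>)) \<le> (if i = j then ?V else 0)"
      using expectation_dev_dev[OF h, of s i j] expectation_dev_square[OF h, of s i] ij s by auto
  qed simp
  also have "(\<Sum>i\<in>?I. \<Sum>j\<in>?I. if i = j then ?V else 0) = (\<Sum>i\<in>?I. ?V)"
    by (intro sum.cong refl) simp
  also have "\<dots> = real (n - 1) * ?V" using s by simp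
  also have "real (n - 1) * ?V / (real n)\<^sup>2 \<le> real n * ?V / (real n)\<^sup>2"
    using V0 by (intro divide_right_mono mult_right_mono) auto
  also have "\<dots> = ?V / real n" using n by (simp add: power2_eq_square)
  finally have EX2: "expectation (\<lambda>\<omega>. (?X \<omega>)\<^sup>2) \<le> t\<^sup>2" using V by linarith
  have "(\<integral>\<^sup>+\<omega>. ennreal \<bar>?X \<omega>\<bar> \<partial>\<Omega>) \<le> (\<integral>\<^sup>+\<omega>. ennreal (t / 2 + (?X \<omega>)\<^sup>2 / (2 * t)) \<partial>\<Omega>)"
  proof (intro nn_integral_mono ennreal_leI)
    fix \<omega>
    have "\<bar>x\<bar> \<le> t / 2 + x\<^sup>2 / (2 * t)" for x :: real
    proof -
      have "(t - \<bar>x\<bar>)\<^sup>2 = t * t - 2 * t * \<bar>x\<bar> + x\<^sup>2" by (simp add: power2_eq_square algebra_simps)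
      then have "2 * t * \<bar>x\<bar> \<le> t * t + x\<^sup>2" using zero_le_power2[of "t - \<bar>x\<bar>"] by linarith
      then show ?thesis using t by (simp add: field_simps power2_eq_square)
    qed
    then show "\<bar>?X \<omega>\<bar> \<le> t / 2 + (?X \<omega>)\<^sup>2 / (2 * t)" .
  qed
  also have "\<dots> = ennreal (expectation (\<lambda>\<omega>. t / 2 + (?X \<omega>)\<^sup>2 / (2 * t)))"
    using iX t by (intro nn_integral_eq_integral) auto
  also have "expectation (\<lambda>\<omega>. t / 2 + (?X \<omega>)\<^sup>2 / (2 * t)) = t / 2 + expectation (\<lambda>\<omega>. (?X \<omega>)\<^sup>2) / (2 * t)"
    using iX by (subst Bochner_Integration.integral_add) (auto simp: prob_space)
  also have "\<dots> \<le> t / 2 + t\<^sup>2 / (2 * t)" using EX2 t by (intro add_mono divide_right_mono) auto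
  also have "\<dots> = t" using t by (simp add: power2_eq_square)
  finally show ?thesis using ennreal_leI by (auto intro: order_trans)
qed

text \<open>The estimate is evaluated at an observation of the sample itself, so the summand
  \<open>i = s\<close> has to be separated from the others. What remains is a centred sum and the
  bias, which the boundedness of the density of \<open>w\<close> reduces to an integral over
  Lebesgue measure.\<close>

lemma kernel_estimate_L1:
  assumes h: "\<And>n. 0 < h n" and h0: "h \<longlonglongrightarrow> 0"
    and nh: "filterlim (\<lambda>n. real n * h n ^ DIM('d)) at_top sequentially" and \<epsilon>: "0 < \<epsilon>"
  shows "\<exists>n0\<ge>1. \<forall>n\<ge>n0. \<forall>s\<in>{1..n}.
    (\<integral>\<^sup>+\<omega>. ennreal \<bar>(\<Sum>i=1..n. Kh (h n) (w (E s \<omega>)) (w (E i \<omega>)) * \<phi> (E i \<omega>)) / real n - g (w (E s \<omega>))\<bar> \<partial>\<Omega>) \<le> ennreal \<epsilon>"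
proof -
  interpret L: prob_space L by (rule prob_L)
  obtain \<delta> where \<delta>: "\<delta> > 0" "\<And>t. norm t < \<delta> \<Longrightarrow> (\<integral>\<^sup>+u. ennreal \<bar>g (u + t) - g u\<bar> \<partial>lborel) \<le> ennreal (\<epsilon> / (4 * C))"
    using L1_translation_continuous_nn[OF g_int, of "\<epsilon> / (4 * C)"] \<epsilon> C_pos by auto
  have inv: "(\<lambda>n. inverse (real n * h n ^ DIM('d))) \<longlonglongrightarrow> 0"
    using nh by (rule tendsto_inverse_0_at_top)
  have l1: "(\<lambda>n. h n * R) \<longlonglongrightarrow> 0 * R" by (intro tendsto_mult h0 tendsto_const)
  have l2: "(\<lambda>n. 2 * \<kappa> * C * inverse (real n * h n ^ DIM('d)) + 2 * C\<^sup>2 * inverse (real n)) \<longlonglongrightarrow> 2 * \<kappa> * C * 0 + 2 * C\<^sup>2 * 0"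
    by (intro tendsto_add tendsto_mult inv tendsto_const lim_inverse_n)
  have l3: "(\<lambda>n. \<kappa> * inverse (real n * h n ^ DIM('d)) + C * inverse (real n)) \<longlonglongrightarrow> \<kappa> * 0 + C * 0"
    by (intro tendsto_add tendsto_mult inv tendsto_const lim_inverse_n)
  have "eventually (\<lambda>n. h n * R < \<delta>) sequentially" using l1 \<delta>(1) by (intro order_tendstoD) auto
  moreover have "eventually (\<lambda>n. 2 * \<kappa> * C * inverse (real n * h n ^ DIM('d)) + 2 * C\<^sup>2 * inverse (real n) < (\<epsilon>/4)\<^sup>2) sequentially"
    using l2 \<epsilon> by (intro order_tendstoD) auto
  moreover have "eventually (\<lambda>n. \<kappa> * inverse (real n * h n ^ DIM('d)) + C * inverse (real n) < \<epsilon>/4) sequentially"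
    using l3 \<epsilon> by (intro order_tendstoD) auto
  ultimately have "eventually (\<lambda>n. h n * R < \<delta> \<and> 2 * \<kappa> * C * inverse (real n * h n ^ DIM('d)) + 2 * C\<^sup>2 * inverse (real n) < (\<epsilon>/4)\<^sup>2 \<and>
      \<kappa> * inverse (real n * h n ^ DIM('d)) + C * inverse (real n) < \<epsilon>/4) sequentially"
    by eventually_elim simp
  then obtain n0 where n0: "\<And>n. n \<ge> n0 \<Longrightarrow> h n * R < \<delta> \<and>
      2 * \<kappa> * C * inverse (real n * h n ^ DIM('d)) + 2 * C\<^sup>2 * inverse (real n) < (\<epsilon>/4)\<^sup>2 \<and>
      \<kappa> * inverse (real n * h n ^ DIM('d)) + C * inverse (real n) < \<epsilon>/4"
    by (auto simp: eventually_sequentially)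
  have "(\<integral>\<^sup>+\<omega>. ennreal \<bar>(\<Sum>i=1..n. Kh (h n) (w (E s \<omega>)) (w (E i \<omega>)) * \<phi> (E i \<omega>)) / real n - g (w (E s \<omega>))\<bar> \<partial>\<Omega>) \<le> ennreal \<epsilon>"
    if n: "n \<ge> n0" and s: "s \<in> {1..n}" for n s
  proof -
    let ?h = "h n" and ?I = "{1..n} - {s}"
    note hn = h[of n]
    note E_meas[of s, measurable]
    have s1: "s \<in> {1..}" and npos: "0 < real n" using s by auto
    let ?X = "\<lambda>\<omega>. (\<Sum>i\<in>?I. dev ?h (E s \<omega>) (E i \<omega>)) / real n"
    \<comment> \<open>The own term is at most \<kappa>/(n h^d), and averaging n-1 instead of n
      copies of the smoothed value costs at most C/n; both fit into one quarter of
      \<epsilon>.\<close>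
    have pw: "\<bar>(\<Sum>i=1..n. Kh ?h (w (E s \<omega>)) (w (E i \<omega>)) * \<phi> (E i \<omega>)) / real n - g (w (E s \<omega>))\<bar> \<le>
      \<epsilon>/4 + \<bar>?X \<omega>\<bar> + \<bar>smooth ?h g (w (E s \<omega>)) - g (w (E s \<omega>))\<bar>" for \<omega>
    proof -
      let ?k = "\<lambda>i. Kh ?h (w (E s \<omega>)) (w (E i \<omega>)) * \<phi> (E i \<omega>)" and ?b = "smooth ?h g (w (E s \<omega>))"
      have "(\<Sum>i=1..n. ?k i) = ?k s + (\<Sum>i\<in>?I. ?k i)" using s by (simp add: sum.remove)
      also have "(\<Sum>i\<in>?I. ?k i) = (\<Sum>i\<in>?I. dev ?h (E s \<omega>) (E i \<omega>)) + (\<Sum>i\<in>?I. ?b)"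
        by (simp add: dev_def sum_subtractf)
      also have "(\<Sum>i\<in>?I. ?b) = real n * ?b - ?b"
        using s npos by (simp add: of_nat_diff left_diff_distrib)
      finally have sum: "(\<Sum>i=1..n. ?k i) = ?k s + ((\<Sum>i\<in>?I. dev ?h (E s \<omega>) (E i \<omega>)) + (real n * ?b - ?b))" .
      have eq: "(\<Sum>i=1..n. ?k i) / real n = ?k s / real n + ?X \<omega> + (?b - ?b / real n)"
        unfolding sum using npos by (simp add: add_divide_distrib diff_divide_distrib)
      have "0 \<le> ?k s / real n" "?k s / real n \<le> \<kappa> / ?h ^ DIM('d) / real n"
        using kernel_bounds[OF hn, of "w (E s \<omega>)" "w (E s \<omega>)" "E s \<omega>"] npos
        by (auto intro!: divide_right_mono simp del: divide_divide_eq_left)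
      moreover have "\<kappa> / ?h ^ DIM('d) / real n = \<kappa> * inverse (real n * ?h ^ DIM('d))" by (simp add: divide_simps)
      moreover have "0 \<le> ?b / real n" "?b / real n \<le> C * inverse (real n)"
        using smooth_g[of ?h "w (E s \<omega>)"] npos by (auto simp: divide_inverse intro!: mult_right_mono)
      ultimately show ?thesis using n0[OF n] unfolding eq by linarith
    qed
    have m3: "(\<lambda>\<omega>. ennreal \<bar>?X \<omega>\<bar>) \<in> borel_measurable \<Omega>"
    proof -
      have "?X \<in> borel_measurable \<Omega>"
        using s1 by (intro borel_measurable_divide borel_measurable_sum dev_meas E_meas) auto
      then show ?thesis by measurable
    qed
    have "(\<integral>\<^sup>+\<omega>. ennreal \<bar>(\<Sum>i=1..n. Kh ?h (w (E s \<omega>)) (w (E i \<omega>)) * \<phi> (E i \<omega>)) / real n - g (w (E s \<omega>))\<bar> \<partial>\<Omega>) \<le>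
      (\<integral>\<^sup>+\<omega>. ennreal (\<epsilon>/4) + ennreal \<bar>?X \<omega>\<bar> + ennreal \<bar>smooth ?h g (w (E s \<omega>)) - g (w (E s \<omega>))\<bar> \<partial>\<Omega>)"
      using pw \<epsilon> by (intro nn_integral_mono) (simp add: ennreal_leI flip: ennreal_plus)
    also have "\<dots> = ennreal (\<epsilon>/4) + (\<integral>\<^sup>+\<omega>. ennreal \<bar>?X \<omega>\<bar> \<partial>\<Omega>) +
      (\<integral>\<^sup>+\<omega>. ennreal \<bar>smooth ?h g (w (E s \<omega>)) - g (w (E s \<omega>))\<bar> \<partial>\<Omega>)"
      using s1 m3 by (subst nn_integral_add, simp, simp, subst nn_integral_add) (auto simp: emeasure_space_1)
    also have "\<dots> \<le> ennreal (\<epsilon>/4) + ennreal (\<epsilon>/4) + ennreal (\<epsilon>/4)"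
    proof (intro add_mono order_refl)
      have "(2 * \<kappa> * C / ?h ^ DIM('d) + 2 * C\<^sup>2) / real n = 2 * \<kappa> * C * inverse (real n * ?h ^ DIM('d)) + 2 * C\<^sup>2 * inverse (real n)"
        by (simp add: divide_simps add_divide_distrib)
      then show "(\<integral>\<^sup>+\<omega>. ennreal \<bar>?X \<omega>\<bar> \<partial>\<Omega>) \<le> ennreal (\<epsilon>/4)"
        using n0[OF n] \<epsilon> by (intro mean_dev_L1[OF hn s]) auto
      have "(\<integral>\<^sup>+\<omega>. ennreal \<bar>smooth ?h g (w (E s \<omega>)) - g (w (E s \<omega>))\<bar> \<partial>\<Omega>) =
        (\<integral>\<^sup>+e. ennreal \<bar>smooth ?h g (w e) - g (w e)\<bar> \<partial>L)"
        using s1 by (intro nn_integral_indep1[OF _ law]) auto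
      also have "\<dots> \<le> ennreal C * (\<integral>\<^sup>+u. ennreal \<bar>smooth ?h g u - g u\<bar> \<partial>lborel)"
        by (rule dom) measurable
      also have "\<dots> \<le> ennreal C * ennreal (\<epsilon> / (4 * C))"
        using n0[OF n] by (intro mult_left_mono smooth_L1[OF g_meas g0 gC hn _ \<delta>(2)]) auto
      also have "\<dots> = ennreal (\<epsilon>/4)" using C_pos \<epsilon> by (simp flip: ennreal_mult)
      finally show "(\<integral>\<^sup>+\<omega>. ennreal \<bar>smooth ?h g (w (E s \<omega>)) - g (w (E s \<omega>))\<bar> \<partial>\<Omega>) \<le> ennreal (\<epsilon>/4)" .
    qed
    also have "\<dots> = ennreal (3 * \<epsilon> / 4)" using \<epsilon> by (simp flip: ennreal_plus)
    also have "\<dots> \<le> ennreal \<epsilon>" using \<epsilon> by (intro ennreal_leI) auto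
    finally show ?thesis .
  qed
  then show ?thesis by (intro exI[of _ "max n0 1"]) auto
qed

end

section \<open>Marginal densities and conditional distributions\<close>

lemma borel_fst_snd[measurable]:
  "(fst :: 'a::second_countable_topology \<times> 'b::second_countable_topology \<Rightarrow> 'a) \<in> measurable borel borel"
  "(snd :: 'a \<times> 'b \<Rightarrow> 'b) \<in> measurable borel borel"
  unfolding borel_prod[symmetric] by measurable

lemma nn_integral_lborel_prod:
  fixes f :: "'a::euclidean_space \<times> 'b::euclidean_space \<Rightarrow> ennreal"
  assumes [measurable]: "f \<in> borel_measurable borel"
  shows "(\<integral>\<^sup>+w. f w \<partial>lborel) = (\<integral>\<^sup>+a. \<integral>\<^sup>+b. f (a, b) \<partial>lborel \<partial>lborel)"
    "(\<integral>\<^sup>+w. f w \<partial>lborel) = (\<integral>\<^sup>+b. \<integral>\<^sup>+a. f (a, b) \<partial>lborel \<partial>lborel)"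
proof -
  have m: "f \<in> borel_measurable (lborel \<Otimes>\<^sub>M lborel)" by (simp add: lborel_prod)
  show "(\<integral>\<^sup>+w. f w \<partial>lborel) = (\<integral>\<^sup>+a. \<integral>\<^sup>+b. f (a, b) \<partial>lborel \<partial>lborel)"
    using lborel.nn_integral_fst[OF m] by (simp add: lborel_prod)
  show "(\<integral>\<^sup>+w. f w \<partial>lborel) = (\<integral>\<^sup>+b. \<integral>\<^sup>+a. f (a, b) \<partial>lborel \<partial>lborel)"
    using lborel_pair.nn_integral_snd[OF m] by (simp add: lborel_prod)
qed

lemma measure_eqI_rectangles:
  fixes P Q :: "('a::second_countable_topology \<times> 'b::second_countable_topology) measure"
  assumes s: "sets P = sets borel" "sets Q = sets borel" and fin: "finite_measure P"
    and eq: "\<And>A B. A \<in> sets borel \<Longrightarrow> B \<in> sets borel \<Longrightarrow> emeasure P (A \<times> B) = emeasure Q (A \<times> B)"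
  shows "P = Q"
proof (rule measure_eqI_generator_eq[where E="{A \<times> B | A B. A \<in> sets borel \<and> B \<in> sets borel}" and \<Omega>=UNIV and A="\<lambda>_. UNIV"])
  show "Int_stable {A \<times> B | A B. A \<in> sets (borel :: 'a measure) \<and> B \<in> sets (borel :: 'b measure)}"
    using Int_stable_pair_measure_generator[of "borel :: 'a measure" "borel :: 'b measure"] by simp
  have sg: "sets (borel :: ('a \<times> 'b) measure) = sigma_sets UNIV {A \<times> B | A B. A \<in> sets borel \<and> B \<in> sets borel}"
    unfolding borel_prod[symmetric] sets_pair_measure by simp
  show "sets P = sigma_sets UNIV {A \<times> B | A B. A \<in> sets borel \<and> B \<in> sets borel}"
    "sets Q = sigma_sets UNIV {A \<times> B | A B. A \<in> sets borel \<and> B \<in> sets borel}" using s sg by auto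
  show "range (\<lambda>_::nat. UNIV) \<subseteq> {A \<times> B | A B. A \<in> sets (borel :: 'a measure) \<and> B \<in> sets (borel :: 'b measure)}"
    by (auto intro!: exI[of _ UNIV])
  show "emeasure P UNIV \<noteq> \<infinity>" using finite_measure.emeasure_finite[OF fin] by auto
qed (use eq in auto)

locale joint_density =
  fixes p :: "'x::euclidean_space \<times> 'y::euclidean_space \<times> 'z::euclidean_space \<Rightarrow> real" and C :: real
  assumes p_meas[measurable]: "p \<in> borel_measurable borel" and p0: "\<And>w. 0 \<le> p w"
    and p_int: "(\<integral>\<^sup>+w. ennreal (p w) \<partial>lborel) = 1" and C_pos: "0 < C" and pC: "\<And>w. p w \<le> C"
    and int_y: "\<And>x z. (\<integral>\<^sup>+y. ennreal (p (x, y, z)) \<partial>lborel) \<le> ennreal C"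
    and int_x: "\<And>y z. (\<integral>\<^sup>+x. ennreal (p (x, y, z)) \<partial>lborel) \<le> ennreal C"
    and int_xy: "\<And>z. (\<integral>\<^sup>+(x, y). ennreal (p (x, y, z)) \<partial>lborel) \<le> ennreal C"
begin

abbreviation "law \<equiv> density lborel (\<lambda>w. ennreal (p w))"
abbreviation "lawXZ \<equiv> density lborel (\<lambda>w. ennreal (marg_XZ p w))"
abbreviation "lawYZ \<equiv> density lborel (\<lambda>w. ennreal (marg_YZ p w))"
abbreviation "lawZ \<equiv> density lborel (\<lambda>z. ennreal (marg_Z p z))"
abbreviation "qXZ \<equiv> \<lambda>e. cond_density p (fst e) (snd e)"
abbreviation "qXYZ \<equiv> \<lambda>e :: 'x \<times> 'y \<times> 'z. cond_density p (fst e) (snd (snd e))"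

lemma ennreal_integral:
  assumes "f \<in> borel_measurable N" "\<And>x. 0 \<le> f x" "(\<integral>\<^sup>+x. ennreal (f x) \<partial>N) \<le> ennreal B"
  shows "ennreal (\<integral>x. f x \<partial>N) = (\<integral>\<^sup>+x. ennreal (f x) \<partial>N)"
proof -
  have "integrable N f"
    using assms le_less_trans[OF assms(3) ennreal_less_top] by (intro integrableI_nonneg) auto
  from nn_integral_eq_integral[OF this] show ?thesis using assms by simp
qed

lemma marg_XZ_eq: "ennreal (marg_XZ p (x, z)) = (\<integral>\<^sup>+y. ennreal (p (x, y, z)) \<partial>lborel)"
  unfolding marg_XZ_def split using int_y by (intro ennreal_integral) (auto simp: p0)

lemma marg_YZ_eq: "ennreal (marg_YZ p (y, z)) = (\<integral>\<^sup>+x. ennreal (p (x, y, z)) \<partial>lborel)"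
  unfolding marg_YZ_def split using int_x by (intro ennreal_integral) (auto simp: p0)

lemma marg_Z_eq: "ennreal (marg_Z p z) = (\<integral>\<^sup>+(x, y). ennreal (p (x, y, z)) \<partial>lborel)"
proof -
  have "ennreal (\<integral>w. p (fst w, snd w, z) \<partial>(lborel :: ('x \<times> 'y) measure)) = (\<integral>\<^sup>+w. ennreal (p (fst w, snd w, z)) \<partial>(lborel :: ('x \<times> 'y) measure))"
    using int_xy[of z] unfolding case_prod_beta' by (intro ennreal_integral[where B=C]) (auto simp: p0)
  then show ?thesis unfolding marg_Z_def case_prod_beta' .
qed

lemma marg_nonneg: "0 \<le> marg_XZ p xz" "0 \<le> marg_YZ p yz" "0 \<le> marg_Z p z"
  unfolding marg_XZ_def marg_YZ_def marg_Z_def case_prod_beta by (auto intro!: integral_nonneg_AE simp: p0)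

lemma marg_le: "marg_XZ p xz \<le> C" "marg_YZ p yz \<le> C" "marg_Z p z \<le> C"
proof -
  have "ennreal (marg_XZ p (fst xz, snd xz)) \<le> ennreal C" unfolding marg_XZ_eq by (rule int_y)
  then show "marg_XZ p xz \<le> C" using C_pos by (simp add: ennreal_le_iff)
  have "ennreal (marg_YZ p (fst yz, snd yz)) \<le> ennreal C" unfolding marg_YZ_eq by (rule int_x)
  then show "marg_YZ p yz \<le> C" using C_pos by (simp add: ennreal_le_iff)
  have "ennreal (marg_Z p z) \<le> ennreal C" unfolding marg_Z_eq by (rule int_xy)
  then show "marg_Z p z \<le> C" using C_pos by (simp add: ennreal_le_iff)
qed

lemma marg_meas[measurable]:
  "marg_XZ p \<in> borel_measurable borel" "marg_YZ p \<in> borel_measurable borel" "marg_Z p \<in> borel_measurable borel"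
  unfolding marg_XZ_def marg_YZ_def marg_Z_def case_prod_beta by measurable

lemma marg_Z_eq_x: "ennreal (marg_Z p z) = (\<integral>\<^sup>+x. ennreal (marg_XZ p (x, z)) \<partial>lborel)"
  unfolding marg_Z_eq marg_XZ_eq by (subst nn_integral_lborel_prod(1)) (auto simp: case_prod_beta)

lemma marg_Z_eq_y: "ennreal (marg_Z p z) = (\<integral>\<^sup>+y. ennreal (marg_YZ p (y, z)) \<partial>lborel)"
  unfolding marg_Z_eq marg_YZ_eq by (subst nn_integral_lborel_prod(2)) (auto simp: case_prod_beta)

lemma nn_integral_joint:
  fixes f :: "'x \<times> 'y \<times> 'z \<Rightarrow> ennreal"
  assumes [measurable]: "f \<in> borel_measurable borel"
  shows "(\<integral>\<^sup>+e. f e \<partial>law) =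
    (\<integral>\<^sup>+z. \<integral>\<^sup>+y. \<integral>\<^sup>+x. ennreal (p (x, y, z)) * f (x, y, z) \<partial>lborel \<partial>lborel \<partial>lborel)"
  by (simp add: nn_integral_density nn_integral_lborel_prod(2))

lemma nn_integral_joint_XZ:
  fixes f :: "'x \<times> 'z \<Rightarrow> ennreal"
  assumes [measurable]: "f \<in> borel_measurable borel"
  shows "(\<integral>\<^sup>+e. f (fst e, snd (snd e)) \<partial>law) =
    (\<integral>\<^sup>+w. ennreal (marg_XZ p w) * f w \<partial>lborel)"
proof -
  have "(\<integral>\<^sup>+e. f (fst e, snd (snd e)) \<partial>law) =
    (\<integral>\<^sup>+z. \<integral>\<^sup>+y. \<integral>\<^sup>+x. ennreal (p (x, y, z)) * f (x, z) \<partial>lborel \<partial>lborel \<partial>lborel)"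
    by (subst nn_integral_joint) auto
  also have "\<dots> = (\<integral>\<^sup>+z. \<integral>\<^sup>+x. \<integral>\<^sup>+y. ennreal (p (x, y, z)) * f (x, z) \<partial>lborel \<partial>lborel \<partial>lborel)"
    by (intro nn_integral_cong lborel_pair.Fubini') measurable
  also have "\<dots> = (\<integral>\<^sup>+w. ennreal (marg_XZ p w) * f w \<partial>lborel)"
    by (subst nn_integral_lborel_prod(2)) (auto simp: marg_XZ_eq nn_integral_multc)
  finally show ?thesis .
qed

lemma nn_integral_joint_YZ:
  fixes f :: "'y \<times> 'z \<Rightarrow> ennreal"
  assumes [measurable]: "f \<in> borel_measurable borel"
  shows "(\<integral>\<^sup>+e. f (snd e) \<partial>law) = (\<integral>\<^sup>+w. ennreal (marg_YZ p w) * f w \<partial>lborel)"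
proof -
  have "(\<integral>\<^sup>+e. f (snd e) \<partial>law) =
    (\<integral>\<^sup>+z. \<integral>\<^sup>+y. \<integral>\<^sup>+x. ennreal (p (x, y, z)) * f (y, z) \<partial>lborel \<partial>lborel \<partial>lborel)"
    by (subst nn_integral_joint) auto
  also have "\<dots> = (\<integral>\<^sup>+w. ennreal (marg_YZ p w) * f w \<partial>lborel)"
    by (subst nn_integral_lborel_prod(2)) (auto simp: marg_YZ_eq nn_integral_multc)
  finally show ?thesis .
qed

lemma nn_integral_joint_Z:
  fixes f :: "'z \<Rightarrow> ennreal"
  assumes [measurable]: "f \<in> borel_measurable borel"
  shows "(\<integral>\<^sup>+e. f (snd (snd e)) \<partial>law) = (\<integral>\<^sup>+z. ennreal (marg_Z p z) * f z \<partial>lborel)"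
  by (subst nn_integral_joint_YZ)
    (auto simp: nn_integral_lborel_prod(2) nn_integral_multc marg_Z_eq_y)

lemma marg_int: "(\<integral>\<^sup>+w. ennreal (marg_YZ p w) \<partial>lborel) = 1" "(\<integral>\<^sup>+w. ennreal (marg_XZ p w) \<partial>lborel) = 1"
  "(\<integral>\<^sup>+w. ennreal (marg_Z p w) \<partial>lborel) = 1"
  using nn_integral_joint_YZ[of "\<lambda>_. 1"] nn_integral_joint_XZ[of "\<lambda>_. 1"] nn_integral_joint_Z[of "\<lambda>_. 1"] p_int
  by (auto simp: emeasure_density)

lemma marg_integrable: "integrable lborel (marg_YZ p)" "integrable lborel (marg_XZ p)" "integrable lborel (marg_Z p)"
  using marg_int by (auto intro!: integrableI_nonneg simp: marg_nonneg)

text \<open>The numerator of the conditional probability of \<open>A\<close> given (Y,Z). Estimates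
  and comparisons are made for numerators and marginal densities separately, and quotients are
  formed only where the denominators are bounded below.\<close>

definition numYZ :: "'x set \<Rightarrow> 'y \<times> 'z \<Rightarrow> real"
  where "numYZ A w = (\<integral>x. p (x, w) * indicator A x \<partial>lborel)"

definition numZ :: "'x set \<Rightarrow> 'z \<Rightarrow> real"
  where "numZ A z = (\<integral>x. marg_XZ p (x, z) * indicator A x \<partial>lborel)"

lemma numYZ_meas[measurable]:
  assumes [measurable]: "A \<in> sets borel"
  shows "numYZ A \<in> borel_measurable borel"
  unfolding numYZ_def by measurable

lemma numZ_meas[measurable]:
  assumes [measurable]: "A \<in> sets borel"
  shows "numZ A \<in> borel_measurable borel"
  unfolding numZ_def by measurable

lemma numYZ_eq:
  assumes [measurable]: "A \<in> sets borel"
  shows "ennreal (numYZ A w) = (\<integral>\<^sup>+x. ennreal (p (x, w)) * indicator A x \<partial>lborel)"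
proof -
  have "(\<integral>\<^sup>+x. ennreal (p (x, w) * indicator A x) \<partial>lborel) \<le> (\<integral>\<^sup>+x. ennreal (p (x, w)) \<partial>lborel)"
    by (intro nn_integral_mono) (auto simp: indicator_def)
  also have "\<dots> \<le> ennreal C" using int_x[of "fst w" "snd w"] by simp
  finally have "ennreal (numYZ A w) = (\<integral>\<^sup>+x. ennreal (p (x, w) * indicator A x) \<partial>lborel)"
    unfolding numYZ_def by (intro ennreal_integral) (auto simp: p0)
  then show ?thesis by (simp add: ennreal_mult p0 ennreal_indicator)
qed

lemma numZ_eq:
  assumes [measurable]: "A \<in> sets borel"
  shows "ennreal (numZ A z) = (\<integral>\<^sup>+x. ennreal (marg_XZ p (x, z)) * indicator A x \<partial>lborel)"
proof -
  have "(\<integral>\<^sup>+x. ennreal (marg_XZ p (x, z) * indicator A x) \<partial>lborel) \<le> (\<integral>\<^sup>+x. ennreal (marg_XZ p (x, z)) \<partial>lborel)"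
    by (intro nn_integral_mono) (auto simp: indicator_def)
  also have "\<dots> \<le> ennreal C" unfolding marg_Z_eq_x[symmetric] using marg_le by (intro ennreal_leI) auto
  finally have "ennreal (numZ A z) = (\<integral>\<^sup>+x. ennreal (marg_XZ p (x, z) * indicator A x) \<partial>lborel)"
    unfolding numZ_def by (intro ennreal_integral) (auto simp: marg_nonneg)
  then show ?thesis by (simp add: ennreal_mult marg_nonneg ennreal_indicator)
qed

lemma num_nonneg: "0 \<le> numYZ A w" "0 \<le> numZ A z"
  unfolding numYZ_def numZ_def by (auto intro!: integral_nonneg_AE simp: p0 marg_nonneg)

lemma num_le: "A \<in> sets borel \<Longrightarrow> numYZ A w \<le> marg_YZ p w" "A \<in> sets borel \<Longrightarrow> numZ A z \<le> marg_Z p z"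
proof -
  assume [measurable]: "A \<in> sets borel"
  have "ennreal (numYZ A w) \<le> ennreal (marg_YZ p (fst w, snd w))"
    unfolding numYZ_eq[OF \<open>A \<in> sets borel\<close>] marg_YZ_eq by (intro nn_integral_mono) (auto simp: indicator_def)
  then show "numYZ A w \<le> marg_YZ p w" by (simp add: ennreal_le_iff marg_nonneg)
  have "ennreal (numZ A z) \<le> ennreal (marg_Z p z)"
    unfolding numZ_eq[OF \<open>A \<in> sets borel\<close>] marg_Z_eq_x by (intro nn_integral_mono) (auto simp: indicator_def)
  then show "numZ A z \<le> marg_Z p z" by (simp add: ennreal_le_iff marg_nonneg)
qed

lemma numZ_eq_y:
  assumes A[measurable]: "A \<in> sets borel"
  shows "ennreal (numZ A z) = (\<integral>\<^sup>+y. ennreal (numYZ A (y, z)) \<partial>lborel)"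
  unfolding numZ_eq[OF A] numYZ_eq[OF A] marg_XZ_eq
  by (subst lborel_pair.Fubini') (auto simp: nn_integral_multc)

definition condYZ :: "'y \<times> 'z \<Rightarrow> 'x measure"
  where "condYZ w = density lborel (\<lambda>x. ennreal (p (x, w) / marg_YZ p w))"

definition condZ :: "'z \<Rightarrow> 'x measure"
  where "condZ z = density lborel (\<lambda>x. ennreal (marg_XZ p (x, z) / marg_Z p z))"

lemma cond_emeasure:
  assumes [measurable]: "A \<in> sets borel"
  shows "0 < marg_YZ p w \<Longrightarrow> emeasure (condYZ w) A = ennreal (numYZ A w / marg_YZ p w)"
    "0 < marg_Z p z \<Longrightarrow> emeasure (condZ z) A = ennreal (numZ A z / marg_Z p z)"
proof -
  assume pos: "0 < marg_YZ p w"
  have "emeasure (condYZ w) A = (\<integral>\<^sup>+x. (ennreal (p (x, w)) * indicator A x) * ennreal (1 / marg_YZ p w) \<partial>lborel)"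
    unfolding condYZ_def using pos
    by (subst emeasure_density) (auto simp: p0 intro!: nn_integral_cong simp flip: ennreal_mult' split: split_indicator)
  also have "\<dots> = ennreal (numYZ A w) * ennreal (1 / marg_YZ p w)"
    by (subst nn_integral_multc) (auto simp: numYZ_eq)
  finally show "emeasure (condYZ w) A = ennreal (numYZ A w / marg_YZ p w)"
    using pos by (simp add: num_nonneg flip: ennreal_mult)
next
  assume pos: "0 < marg_Z p z"
  have "emeasure (condZ z) A = (\<integral>\<^sup>+x. (ennreal (marg_XZ p (x, z)) * indicator A x) * ennreal (1 / marg_Z p z) \<partial>lborel)"
    unfolding condZ_def using pos
    by (subst emeasure_density) (auto simp: marg_nonneg intro!: nn_integral_cong simp flip: ennreal_mult' split: split_indicator)
  also have "\<dots> = ennreal (numZ A z) * ennreal (1 / marg_Z p z)"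
    by (subst nn_integral_multc) (auto simp: numZ_eq)
  finally show "emeasure (condZ z) A = ennreal (numZ A z / marg_Z p z)"
    using pos by (simp add: num_nonneg flip: ennreal_mult)
qed

lemma num_UNIV: "numYZ UNIV w = marg_YZ p w" "numZ UNIV z = marg_Z p z"
proof -
  have "ennreal (numYZ UNIV w) = ennreal (marg_YZ p (fst w, snd w))" using numYZ_eq[of UNIV w] marg_YZ_eq[of "fst w" "snd w"] by simp
  then show "numYZ UNIV w = marg_YZ p w" by (simp add: ennreal_inj num_nonneg marg_nonneg)
  have "ennreal (numZ UNIV z) = ennreal (marg_Z p z)" using numZ_eq[of UNIV z] marg_Z_eq_x[of z] by simp
  then show "numZ UNIV z = marg_Z p z" by (simp add: ennreal_inj num_nonneg marg_nonneg)
qed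

lemma cond_prob_space:
  "0 < marg_YZ p w \<Longrightarrow> prob_space (condYZ w)" "0 < marg_Z p z \<Longrightarrow> prob_space (condZ z)"
proof -
  assume pos: "0 < marg_YZ p w"
  have "space (condYZ w) = UNIV" by (simp add: condYZ_def)
  then show "prob_space (condYZ w)"
    using cond_emeasure(1)[of UNIV w] pos by (intro prob_spaceI) (simp add: num_UNIV)
next
  assume pos: "0 < marg_Z p z"
  have "space (condZ z) = UNIV" by (simp add: condZ_def)
  then show "prob_space (condZ z)"
    using cond_emeasure(2)[of UNIV z] pos by (intro prob_spaceI) (simp add: num_UNIV)
qed

lemma cond_sets: "sets (condYZ w) = sets borel" "sets (condZ z) = sets borel"
  by (auto simp: condYZ_def condZ_def)

lemma cond_ac: "null_sets lborel \<subseteq> null_sets (condYZ w)" "null_sets lborel \<subseteq> null_sets (condZ z)"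
  using absolutely_continuousI_density[of "\<lambda>x. ennreal (p (x, w) / marg_YZ p w)" lborel]
    absolutely_continuousI_density[of "\<lambda>x. ennreal (marg_XZ p (x, z) / marg_Z p z)" lborel]
  by (auto simp: condYZ_def condZ_def absolutely_continuous_def)

end

section \<open>Conditional independence in terms of densities\<close>

locale cond_model = joint_density p C + prob_space \<Omega>
  for p :: "'x::euclidean_space \<times> 'y::euclidean_space \<times> 'z::euclidean_space \<Rightarrow> real" and C :: real
    and \<Omega> :: "'w measure" +
  fixes X :: "'w \<Rightarrow> 'x" and Y :: "'w \<Rightarrow> 'y" and Z :: "'w \<Rightarrow> 'z"
  assumes XYZ_meas[measurable]: "(\<lambda>\<omega>. (X \<omega>, Y \<omega>, Z \<omega>)) \<in> measurable \<Omega> borel"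
    and law_XYZ: "distr \<Omega> borel (\<lambda>\<omega>. (X \<omega>, Y \<omega>, Z \<omega>)) = density lborel (\<lambda>w. ennreal (p w))"
begin

lemma X_meas[measurable]: "X \<in> measurable \<Omega> borel"
  using measurable_compose[OF XYZ_meas borel_fst_snd(1)] by simp

lemma YZ_meas[measurable]: "(\<lambda>\<omega>. (Y \<omega>, Z \<omega>)) \<in> measurable \<Omega> borel"
  using measurable_compose[OF XYZ_meas borel_fst_snd(2)] by simp

lemma Y_meas[measurable]: "Y \<in> measurable \<Omega> borel"
  using measurable_compose[OF YZ_meas borel_fst_snd(1)] by simp

lemma Z_meas[measurable]: "Z \<in> measurable \<Omega> borel"
  using measurable_compose[OF YZ_meas borel_fst_snd(2)] by simp

lemma nn_integral_XYZ:
  assumes [measurable]: "f \<in> borel_measurable borel"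
  shows "(\<integral>\<^sup>+\<omega>. f (X \<omega>, Y \<omega>, Z \<omega>) \<partial>\<Omega>) = (\<integral>\<^sup>+e. f e \<partial>law)"
  unfolding law_XYZ[symmetric] by (subst nn_integral_distr) auto

definition joint_num :: "'x set \<Rightarrow> 'y set \<Rightarrow> 'z \<Rightarrow> real"
  where "joint_num A B z = (\<integral>y. numYZ A (y, z) * indicator B y \<partial>lborel)"

lemma joint_num_eq:
  assumes [measurable]: "A \<in> sets borel" "B \<in> sets borel"
  shows "ennreal (joint_num A B z) = (\<integral>\<^sup>+y. ennreal (numYZ A (y, z)) * indicator B y \<partial>lborel)"
proof -
  have "(\<integral>\<^sup>+y. ennreal (numYZ A (y, z) * indicator B y) \<partial>lborel) \<le> (\<integral>\<^sup>+y. ennreal (marg_YZ p (y, z)) \<partial>lborel)"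
    by (intro nn_integral_mono) (auto simp: indicator_def intro!: ennreal_leI num_le)
  also have "\<dots> \<le> ennreal C" unfolding marg_Z_eq_y[symmetric] using marg_le by (intro ennreal_leI) auto
  finally have "ennreal (joint_num A B z) = (\<integral>\<^sup>+y. ennreal (numYZ A (y, z) * indicator B y) \<partial>lborel)"
    unfolding joint_num_def by (intro ennreal_integral) (auto simp: num_nonneg)
  then show ?thesis by (simp add: ennreal_mult num_nonneg ennreal_indicator)
qed

lemma joint_num_meas[measurable]:
  assumes [measurable]: "A \<in> sets borel" "B \<in> sets borel"
  shows "joint_num A B \<in> borel_measurable borel"
  unfolding joint_num_def by measurable

lemma joint_num_nonneg: "0 \<le> joint_num A B z"
  unfolding joint_num_def by (auto intro!: integral_nonneg_AE simp: num_nonneg)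

lemma joint_num_le:
  assumes [measurable]: "A \<in> sets borel" "B \<in> sets borel"
  shows "joint_num A B z \<le> marg_Z p z"
proof -
  have "ennreal (joint_num A B z) \<le> (\<integral>\<^sup>+y. ennreal (marg_YZ p (y, z)) \<partial>lborel)"
    unfolding joint_num_eq[OF assms] by (intro nn_integral_mono) (auto simp: indicator_def intro!: ennreal_leI num_le)
  also have "\<dots> = ennreal (marg_Z p z)" by (rule marg_Z_eq_y[symmetric])
  finally show ?thesis by (simp add: ennreal_le_iff marg_nonneg)
qed

text \<open>An explicit version of the conditional probability of X in \<open>A\<close> and Y in
  \<open>B\<close>, given Z = z.\<close>

definition ratio :: "'x set \<Rightarrow> 'y set \<Rightarrow> 'z \<Rightarrow> real"
  where "ratio A B z = joint_num A B z / marg_Z p z"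

lemma ratio_meas[measurable]:
  assumes [measurable]: "A \<in> sets borel" "B \<in> sets borel"
  shows "ratio A B \<in> borel_measurable borel"
  unfolding ratio_def by measurable

lemma ratio01:
  assumes [measurable]: "A \<in> sets borel" "B \<in> sets borel"
  shows "0 \<le> ratio A B z" "ratio A B z \<le> 1" "marg_Z p z * ratio A B z = joint_num A B z"
  using joint_num_nonneg[of A B z] joint_num_le[OF assms, of z] marg_nonneg(3)[of z]
  by (auto simp: ratio_def divide_le_eq_1)

lemma emeasure_XYZ:
  assumes [measurable]: "A \<in> sets borel" "B \<in> sets borel" "D \<in> sets borel"
  shows "emeasure \<Omega> {\<omega>\<in>space \<Omega>. X \<omega> \<in> A \<and> Y \<omega> \<in> B \<and> Z \<omega> \<in> D} =
    (\<integral>\<^sup>+z. ennreal (joint_num A B z) * indicator D z \<partial>lborel)"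
proof -
  have "emeasure \<Omega> {\<omega>\<in>space \<Omega>. X \<omega> \<in> A \<and> Y \<omega> \<in> B \<and> Z \<omega> \<in> D} =
    (\<integral>\<^sup>+\<omega>. indicator {\<omega>\<in>space \<Omega>. X \<omega> \<in> A \<and> Y \<omega> \<in> B \<and> Z \<omega> \<in> D} \<omega> \<partial>\<Omega>)"
    by (intro nn_integral_indicator[symmetric]) measurable
  also have "\<dots> = (\<integral>\<^sup>+\<omega>. (\<lambda>(x, y, z). indicator A x * indicator B y * indicator D z) (X \<omega>, Y \<omega>, Z \<omega>) \<partial>\<Omega>)"
    by (intro nn_integral_cong) (auto simp: indicator_def)
  also have "\<dots> = (\<integral>\<^sup>+z. \<integral>\<^sup>+y. \<integral>\<^sup>+x. ennreal (p (x, y, z)) * (indicator A x * indicator B y * indicator D z) \<partial>lborel \<partial>lborel \<partial>lborel)"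
    by (subst nn_integral_XYZ, simp add: case_prod_beta, subst nn_integral_joint) (auto simp: case_prod_beta)
  also have "\<dots> = (\<integral>\<^sup>+z. \<integral>\<^sup>+y. ennreal (numYZ A (y, z)) * indicator B y * indicator D z \<partial>lborel \<partial>lborel)"
    by (simp add: numYZ_eq nn_integral_multc mult.assoc[symmetric])
  also have "\<dots> = (\<integral>\<^sup>+z. ennreal (joint_num A B z) * indicator D z \<partial>lborel)"
    by (simp add: joint_num_eq nn_integral_multc)
  finally show ?thesis .
qed

abbreviation "sigmaZ \<equiv> vimage_algebra (space \<Omega>) Z borel"

lemma subalgebra_sigmaZ: "subalgebra \<Omega> sigmaZ"
proof -
  have "sets sigmaZ \<subseteq> sets \<Omega>"
    by (subst sets_vimage_algebra2) (auto intro: measurable_sets[OF Z_meas])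
  then show ?thesis by (simp add: subalgebra_def)
qed

text \<open>The defining property of conditional expectation is tested on the sets on which
  \<open>Z\<close> lies in a Borel set \<open>D\<close>; there both sides are the integral of
  \<open>joint_num A B\<close> over \<open>D\<close>.\<close>

lemma cond_pr_ratio:
  assumes A[measurable]: "A \<in> sets borel" and B[measurable]: "B \<in> sets borel"
  shows "AE \<omega> in \<Omega>. cond_pr \<Omega> sigmaZ {\<omega>\<in>space \<Omega>. X \<omega> \<in> A \<and> Y \<omega> \<in> B} \<omega> = ratio A B (Z \<omega>)"
proof -
  interpret F: finite_measure_subalgebra \<Omega> sigmaZ
    using subalgebra_sigmaZ by unfold_locales
  let ?E = "{\<omega>\<in>space \<Omega>. X \<omega> \<in> A \<and> Y \<omega> \<in> B}"
  have E[measurable]: "?E \<in> sets \<Omega>" by measurable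
  show ?thesis
    unfolding cond_pr_def
  proof (rule F.real_cond_exp_charact)
    show "integrable \<Omega> (indicator ?E :: _ \<Rightarrow> real)"
      by (intro integrable_real_indicator E) (simp add: less_top[symmetric])
    show "integrable \<Omega> (\<lambda>\<omega>. ratio A B (Z \<omega>))"
      using ratio01[OF A B] by (intro integrable_const_bound[where B=1]) auto
    show "(\<lambda>\<omega>. ratio A B (Z \<omega>)) \<in> borel_measurable sigmaZ"
      by (rule measurable_compose[OF measurable_vimage_algebra1]) auto
    fix S assume "S \<in> sets sigmaZ"
    then obtain D where D[measurable]: "D \<in> sets borel" and S: "S = Z -` D \<inter> space \<Omega>"
      by (subst (asm) sets_vimage_algebra2) auto
    have [measurable]: "S \<in> sets \<Omega>" unfolding S by measurable
    have "ennreal (\<integral>\<omega>\<in>S. indicator ?E \<omega> \<partial>\<Omega>) = ennreal (measure \<Omega> (S \<inter> ?E))"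
      unfolding set_lebesgue_integral_def by (simp add: indicator_inter_arith[symmetric])
    also have "\<dots> = emeasure \<Omega> {\<omega>\<in>space \<Omega>. X \<omega> \<in> A \<and> Y \<omega> \<in> B \<and> Z \<omega> \<in> D}"
      unfolding emeasure_eq_measure[symmetric] S by (intro arg_cong[of _ _ "emeasure \<Omega>"]) auto
    also have "\<dots> = (\<integral>\<^sup>+z. ennreal (joint_num A B z) * indicator D z \<partial>lborel)" by (rule emeasure_XYZ) auto
    also have "\<dots> = (\<integral>\<^sup>+z. ennreal (marg_Z p z) * (ennreal (ratio A B z) * indicator D z) \<partial>lborel)"
    proof (intro nn_integral_cong)
      fix z
      have "ennreal (joint_num A B z) = ennreal (marg_Z p z) * ennreal (ratio A B z)"
        unfolding ratio01(3)[OF A B, of z, symmetric] by (intro ennreal_mult marg_nonneg ratio01[OF A B])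
      then show "ennreal (joint_num A B z) * indicator D z = ennreal (marg_Z p z) * (ennreal (ratio A B z) * indicator D z)"
        by (simp add: mult.assoc)
    qed
    also have "\<dots> = (\<integral>\<^sup>+e. ennreal (ratio A B (snd (snd e))) * indicator D (snd (snd e)) \<partial>law)"
      by (subst nn_integral_joint_Z) auto
    also have "\<dots> = (\<integral>\<^sup>+\<omega>. ennreal (ratio A B (Z \<omega>)) * indicator D (Z \<omega>) \<partial>\<Omega>)"
      by (subst nn_integral_XYZ[symmetric]) auto
    also have "\<dots> = (\<integral>\<^sup>+\<omega>. ennreal (indicator S \<omega> * ratio A B (Z \<omega>)) \<partial>\<Omega>)"
      by (intro nn_integral_cong) (auto simp: S indicator_def)
    also have "\<dots> = ennreal (\<integral>\<omega>\<in>S. ratio A B (Z \<omega>) \<partial>\<Omega>)"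
    proof -
      have "integrable \<Omega> (\<lambda>\<omega>. indicator S \<omega> * ratio A B (Z \<omega>))"
      proof (rule integrable_const_bound[where B=1])
        show "AE \<omega> in \<Omega>. norm (indicator S \<omega> * ratio A B (Z \<omega>)) \<le> 1"
          using ratio01[OF A B] by (intro AE_I2) (simp add: indicator_def)
      qed measurable
      then show ?thesis
        unfolding set_lebesgue_integral_def using ratio01[OF A B]
        by (subst nn_integral_eq_integral) (auto intro!: AE_I2)
    qed
    finally show "(\<integral>\<omega>\<in>S. indicator ?E \<omega> \<partial>\<Omega>) = (\<integral>\<omega>\<in>S. ratio A B (Z \<omega>) \<partial>\<Omega>)"
      using ratio01[OF A B] unfolding set_lebesgue_integral_def
      by (subst (asm) ennreal_inj) (auto intro!: integral_nonneg_AE)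
  qed
qed

lemma cond_indep_iff:
  "cond_indep \<Omega> X Y Z \<longleftrightarrow> (\<forall>A\<in>sets borel. \<forall>B\<in>sets borel.
    AE \<omega> in \<Omega>. ratio A B (Z \<omega>) = ratio A UNIV (Z \<omega>) * ratio UNIV B (Z \<omega>))"
proof -
  have "(AE \<omega> in \<Omega>. cond_pr \<Omega> sigmaZ {\<omega>\<in>space \<Omega>. X \<omega> \<in> A \<and> Y \<omega> \<in> B} \<omega> =
      cond_pr \<Omega> sigmaZ {\<omega>\<in>space \<Omega>. X \<omega> \<in> A} \<omega> * cond_pr \<Omega> sigmaZ {\<omega>\<in>space \<Omega>. Y \<omega> \<in> B} \<omega>) \<longleftrightarrow>
      (AE \<omega> in \<Omega>. ratio A B (Z \<omega>) = ratio A UNIV (Z \<omega>) * ratio UNIV B (Z \<omega>))"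
    if A: "A \<in> sets borel" and B: "B \<in> sets borel" for A B
  proof -
    have "AE \<omega> in \<Omega>. cond_pr \<Omega> sigmaZ {\<omega>\<in>space \<Omega>. X \<omega> \<in> A} \<omega> = ratio A UNIV (Z \<omega>)"
      using cond_pr_ratio[OF A, of UNIV] by simp
    moreover have "AE \<omega> in \<Omega>. cond_pr \<Omega> sigmaZ {\<omega>\<in>space \<Omega>. Y \<omega> \<in> B} \<omega> = ratio UNIV B (Z \<omega>)"
      using cond_pr_ratio[OF _ B, of UNIV] by simp
    moreover note cond_pr_ratio[OF A B]
    ultimately have "AE \<omega> in \<Omega>. (cond_pr \<Omega> sigmaZ {\<omega>\<in>space \<Omega>. X \<omega> \<in> A \<and> Y \<omega> \<in> B} \<omega> =
      cond_pr \<Omega> sigmaZ {\<omega>\<in>space \<Omega>. X \<omega> \<in> A} \<omega> * cond_pr \<Omega> sigmaZ {\<omega>\<in>space \<Omega>. Y \<omega> \<in> B} \<omega>) \<longleftrightarrow>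
      (ratio A B (Z \<omega>) = ratio A UNIV (Z \<omega>) * ratio UNIV B (Z \<omega>))"
      by eventually_elim simp
    then show ?thesis by (rule eventually_subst)
  qed
  then show ?thesis unfolding cond_indep_def Let_def by simp
qed

lemma joint_num_UNIV_left: "B \<in> sets borel \<Longrightarrow> ennreal (joint_num UNIV B z) = (\<integral>\<^sup>+y. ennreal (marg_YZ p (y, z)) * indicator B y \<partial>lborel)"
  by (simp add: joint_num_eq num_UNIV)

lemma joint_num_UNIV_right: "A \<in> sets borel \<Longrightarrow> joint_num A UNIV z = numZ A z"
  using joint_num_eq[of A UNIV z] numZ_eq_y[of A z] ennreal_inj[OF joint_num_nonneg[of A UNIV z] num_nonneg(2)[of A z]] by simp

lemma AE_Z_iff:
  assumes [measurable]: "Measurable.pred borel Q"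
  shows "(AE \<omega> in \<Omega>. Q (Z \<omega>)) \<longleftrightarrow> (AE z in lborel. 0 < marg_Z p z \<longrightarrow> Q z)"
proof -
  have "(AE \<omega> in \<Omega>. Q (Z \<omega>)) \<longleftrightarrow> (\<integral>\<^sup>+\<omega>. indicator {z. \<not> Q z} (Z \<omega>) \<partial>\<Omega>) = 0"
    by (subst nn_integral_0_iff_AE) (auto simp: indicator_def)
  also have "(\<integral>\<^sup>+\<omega>. indicator {z. \<not> Q z} (Z \<omega>) \<partial>\<Omega>) = (\<integral>\<^sup>+z. ennreal (marg_Z p z) * indicator {z. \<not> Q z} z \<partial>lborel)"
    using nn_integral_XYZ[of "\<lambda>e. indicator {z. \<not> Q z} (snd (snd e))"] by (simp add: nn_integral_joint_Z)
  also have "\<dots> = 0 \<longleftrightarrow> (AE z in lborel. 0 < marg_Z p z \<longrightarrow> Q z)"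
    by (subst nn_integral_0_iff_AE) (auto simp: indicator_def ennreal_eq_0_iff not_le intro!: AE_cong)
  finally show ?thesis .
qed

text \<open>The form in which the null hypothesis is used: the joint law has the density p(x|z) with
  respect to Lebesgue measure times the law of (Y,Z), as \<open>permutation_model\<close> requires.
  The two measures are compared on triple rectangles, where conditional independence is the product
  formula for \<open>ratio\<close>.\<close>

lemma law_of_cond_indep:
  assumes ci: "cond_indep \<Omega> X Y Z"
  shows "distr \<Omega> borel (\<lambda>\<omega>. (X \<omega>, Y \<omega>, Z \<omega>)) =
    density (lborel \<Otimes>\<^sub>M lawYZ) (\<lambda>e. ennreal (cond_density p (fst e) (snd (snd e))))"
    (is "?P = ?Q")
proof -
  let ?\<nu> = "lawYZ"
  have cd[measurable]: "qXYZ \<in> borel_measurable (borel :: ('x \<times> 'y \<times> 'z) measure)"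
    unfolding cond_density_def by measurable
  have sB: "sets (lborel \<Otimes>\<^sub>M ?\<nu>) = sets (borel :: ('x \<times> 'y \<times> 'z) measure)"
  proof -
    have "sets (lborel \<Otimes>\<^sub>M ?\<nu>) = sets ((borel :: 'x measure) \<Otimes>\<^sub>M (borel :: ('y \<times> 'z) measure))"
      by (intro sets_pair_measure_cong) auto
    then show ?thesis by (simp only: borel_prod)
  qed
  have sQ: "sets ?Q = sets borel" using sB by simp
  have pn: "prob_space ?\<nu>" using marg_int(1) by (intro prob_spaceI) (simp add: emeasure_density)
  interpret N: prob_space ?\<nu> by (rule pn)
  interpret LN: pair_sigma_finite lborel ?\<nu> ..
  have cd': "(\<lambda>e. ennreal (cond_density p (fst e) (snd (snd e)))) \<in> borel_measurable (lborel \<Otimes>\<^sub>M ?\<nu>)"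
    using cd unfolding measurable_cong_sets[OF sB refl] by measurable
  have emQ: "emeasure ?Q (A \<times> W) = (\<integral>\<^sup>+w. ennreal (marg_YZ p w) * ((\<integral>\<^sup>+x. ennreal (cond_density p x (snd w)) * indicator A x \<partial>lborel) * indicator W w) \<partial>lborel)"
    if [measurable]: "A \<in> sets borel" "W \<in> sets borel" for A W
  proof -
    have "emeasure ?Q (A \<times> W) = (\<integral>\<^sup>+e. ennreal (cond_density p (fst e) (snd (snd e))) * indicator (A \<times> W) e \<partial>(lborel \<Otimes>\<^sub>M ?\<nu>))"
      using cd' by (intro emeasure_density) auto
    also have "\<dots> = (\<integral>\<^sup>+w. \<integral>\<^sup>+x. ennreal (cond_density p x (snd w)) * indicator (A \<times> W) (x, w) \<partial>lborel \<partial>?\<nu>)"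
      using cd' by (subst LN.nn_integral_snd[symmetric]) auto
    also have "\<dots> = (\<integral>\<^sup>+w. (\<integral>\<^sup>+x. ennreal (cond_density p x (snd w)) * indicator A x \<partial>lborel) * indicator W w \<partial>?\<nu>)"
      by (intro nn_integral_cong) (auto simp: indicator_times split: split_indicator)
    also have "\<dots> = (\<integral>\<^sup>+w. ennreal (marg_YZ p w) * ((\<integral>\<^sup>+x. ennreal (cond_density p x (snd w)) * indicator A x \<partial>lborel) * indicator W w) \<partial>lborel)"
      unfolding cond_density_def by (subst nn_integral_density) auto
    finally show ?thesis .
  qed
  have cdA: "(\<integral>\<^sup>+x. ennreal (cond_density p x z) * indicator A x \<partial>lborel) = ennreal (ratio A UNIV z)"
    if A[measurable]: "A \<in> sets borel" for A z
  proof -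
    have "(\<integral>\<^sup>+x. ennreal (cond_density p x z) * indicator A x \<partial>lborel) = (\<integral>\<^sup>+x. ennreal (1 / marg_Z p z) * (ennreal (marg_XZ p (x, z)) * indicator A x) \<partial>lborel)"
      by (intro nn_integral_cong) (simp add: cond_density_def marg_nonneg mult.assoc[symmetric] flip: ennreal_mult)
    also have "\<dots> = ennreal (1 / marg_Z p z) * ennreal (numZ A z)"
      by (subst nn_integral_cmult) (auto simp: numZ_eq)
    also have "\<dots> = ennreal (ratio A UNIV z)"
      by (simp add: ratio_def joint_num_UNIV_right A marg_nonneg num_nonneg flip: ennreal_mult)
    finally show ?thesis .
  qed
  have rect: "emeasure ?P (A \<times> (B \<times> D)) = emeasure ?Q (A \<times> (B \<times> D))"
    if A[measurable]: "A \<in> sets borel" and B[measurable]: "B \<in> sets borel" and D[measurable]: "D \<in> sets borel" for A B D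
  proof -
    have "emeasure ?P (A \<times> (B \<times> D)) = emeasure \<Omega> {\<omega>\<in>space \<Omega>. X \<omega> \<in> A \<and> Y \<omega> \<in> B \<and> Z \<omega> \<in> D}"
      by (subst emeasure_distr) (auto intro!: arg_cong[of _ _ "emeasure \<Omega>"] borel_Times)
    also have "\<dots> = (\<integral>\<^sup>+z. ennreal (joint_num A B z) * indicator D z \<partial>lborel)" by (rule emeasure_XYZ) auto
    also have "\<dots> = (\<integral>\<^sup>+z. ennreal (ratio A UNIV z) * ennreal (joint_num UNIV B z) * indicator D z \<partial>lborel)"
    proof (rule nn_integral_cong_AE)
      have "AE \<omega> in \<Omega>. ratio A B (Z \<omega>) = ratio A UNIV (Z \<omega>) * ratio UNIV B (Z \<omega>)"
        using ci A B unfolding cond_indep_iff by auto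
      then have "AE z in lborel. 0 < marg_Z p z \<longrightarrow> ratio A B z = ratio A UNIV z * ratio UNIV B z"
        by (subst (asm) AE_Z_iff) auto
      then show "AE z in lborel. ennreal (joint_num A B z) * indicator D z = ennreal (ratio A UNIV z) * ennreal (joint_num UNIV B z) * indicator D z"
      proof eventually_elim
        case (elim z)
        have "joint_num A B z = ratio A UNIV z * joint_num UNIV B z"
        proof (cases "marg_Z p z = 0")
          case True
          then show ?thesis using joint_num_le[OF A B, of z] joint_num_le[OF _ B, of UNIV z] joint_num_nonneg[of A B z] joint_num_nonneg[of UNIV B z] by simp
        next
          case False
          then have "0 < marg_Z p z" using marg_nonneg(3)[of z] by linarith
          then have "ratio A B z = ratio A UNIV z * ratio UNIV B z" using elim by simp
          then show ?thesis using False by (simp add: ratio_def field_simps)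
        qed
        then show ?case by (simp add: ennreal_mult joint_num_nonneg ratio01 A B)
      qed
    qed
    also have "\<dots> = (\<integral>\<^sup>+z. \<integral>\<^sup>+y. ennreal (marg_YZ p (y, z)) * (ennreal (ratio A UNIV z) * indicator (B \<times> D) (y, z)) \<partial>lborel \<partial>lborel)"
      by (intro nn_integral_cong)
        (simp add: joint_num_UNIV_left B indicator_times nn_integral_cmult[symmetric] nn_integral_multc[symmetric] mult_ac)
    also have "\<dots> = (\<integral>\<^sup>+w. ennreal (marg_YZ p w) * (ennreal (ratio A UNIV (snd w)) * indicator (B \<times> D) w) \<partial>lborel)"
    proof -
      have [measurable]: "B \<times> D \<in> sets borel" by (intro borel_Times B D)
      show ?thesis by (subst nn_integral_lborel_prod(2)) auto
    qed
    also have "\<dots> = emeasure ?Q (A \<times> (B \<times> D))"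
      using A B D by (subst emQ) (auto simp: cdA borel_Times)
    finally show ?thesis .
  qed
  have slice: "emeasure ?P (A \<times> W) = emeasure ?Q (A \<times> W)" if A[measurable]: "A \<in> sets borel" and W: "W \<in> sets borel" for A and W :: "('y \<times> 'z) set"
  proof -
    \<comment> \<open>Nested products take two extensions: for fixed \<open>A\<close> both sides are
      finite measures of the set of (Y,Z)-values and are determined by rectangles B x D; the outer
      rectangles come afterwards.\<close>
    let ?PA = "distr (density ?P (indicator (A \<times> UNIV))) borel snd" and ?QA = "distr (density ?Q (indicator (A \<times> UNIV))) borel snd"
    have AU: "A \<times> (UNIV :: ('y \<times> 'z) set) \<in> sets borel" by (intro borel_Times) auto
    have e: "emeasure (distr (density R (indicator (A \<times> UNIV))) borel snd) V = emeasure R (A \<times> V)"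
      if R: "sets R = sets (borel :: ('x \<times> 'y \<times> 'z) measure)" and V: "V \<in> sets borel" for R V
    proof -
      have spR: "space R = UNIV" using sets_eq_imp_space_eq[OF R] by simp
      have m: "snd \<in> measurable (density R (indicator (A \<times> UNIV))) borel"
        using borel_fst_snd(2) R by (auto cong: measurable_cong_sets)
      have AU': "A \<times> UNIV \<in> sets R" "snd -` V \<in> sets R" using R AU measurable_sets[OF borel_fst_snd(2) V] by auto
      have "emeasure (distr (density R (indicator (A \<times> UNIV))) borel snd) V = emeasure (density R (indicator (A \<times> UNIV))) (snd -` V)"
        by (subst emeasure_distr[OF m V]) (simp add: spR)
      also have "\<dots> = (\<integral>\<^sup>+e. indicator (A \<times> UNIV) e * indicator (snd -` V) e \<partial>R)"
        by (rule emeasure_density[OF borel_measurable_indicator[OF AU'(1)] AU'(2)])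
      also have "\<dots> = (\<integral>\<^sup>+e. indicator (A \<times> V) e \<partial>R)" by (intro nn_integral_cong) (auto simp: indicator_def)
      also have "\<dots> = emeasure R (A \<times> V)"
      proof (rule nn_integral_indicator)
        show "A \<times> V \<in> sets R" unfolding R by (intro borel_Times A V)
      qed
      finally show ?thesis .
    qed
    interpret P: prob_space ?P by (rule prob_space_distr[OF XYZ_meas])
    have sP: "sets ?P = sets borel" by simp
    have "?PA = ?QA"
    proof (rule measure_eqI_rectangles)
      show "finite_measure ?PA"
      proof (rule finite_measureI)
        have "emeasure ?PA (space ?PA) = emeasure ?P (A \<times> UNIV)"
          using e[OF sP, of UNIV] by simp
        then show "emeasure ?PA (space ?PA) \<noteq> \<infinity>" by simp
      qed
      fix B D assume B: "B \<in> sets (borel :: 'y measure)" and D: "D \<in> sets (borel :: 'z measure)"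
      have BD: "B \<times> D \<in> sets borel" by (intro borel_Times B D)
      show "emeasure ?PA (B \<times> D) = emeasure ?QA (B \<times> D)"
        unfolding e[OF sP BD] e[OF sQ BD] by (rule rect[OF A B D])
    qed simp_all
    then have "emeasure ?PA W = emeasure ?QA W" by simp
    then show ?thesis unfolding e[OF sP W] e[OF sQ W] .
  qed
  show ?thesis
  proof (rule measure_eqI_rectangles)
    show "finite_measure ?P" using prob_space_distr[OF XYZ_meas] by (rule prob_space.finite_measure)
    show "sets ?Q = sets borel" by (rule sQ)
  qed (simp_all add: slice)
qed

text \<open>The property \<open>separates\<close> for the two conditional distributions, in either
  order and with the marginal densities multiplied out. The two small balls must have positive mass
  because the lower bound of \<open>bdiv_lower\<close> contains their masses as factors.\<close>

definition separated :: "'x \<Rightarrow> 'x \<Rightarrow> real \<Rightarrow> 'y \<times> 'z \<Rightarrow> bool"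
  where "separated u v r w \<longleftrightarrow> 0 < marg_YZ p w \<and> 0 < marg_Z p (snd w) \<and>
    0 < numYZ (ball u r) w \<and> 0 < numYZ (ball v r) w \<and>
    (numZ (cball u (dist u v + 3 * r)) (snd w) * marg_YZ p w < numYZ (cball u (dist u v - 3 * r)) w * marg_Z p (snd w) \<or>
     numYZ (cball u (dist u v + 3 * r)) w * marg_Z p (snd w) < numZ (cball u (dist u v - 3 * r)) (snd w) * marg_YZ p w)"

lemma cond_measure:
  assumes "A \<in> sets borel"
  shows "0 < marg_YZ p w \<Longrightarrow> measure (condYZ w) A = numYZ A w / marg_YZ p w"
    "0 < marg_Z p z \<Longrightarrow> measure (condZ z) A = numZ A z / marg_Z p z"
  using cond_emeasure[OF assms] by (simp_all add: measure_def num_nonneg)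

text \<open>Where both marginal densities are positive, the absence of a separating ball forces the
  conditional distributions to coincide; elsewhere both products vanish.\<close>

lemma separated_or_eq:
  assumes D: "\<And>U :: 'x set. open U \<Longrightarrow> U \<noteq> {} \<Longrightarrow> \<exists>d\<in>D. d \<in> U"
    and n: "\<And>u v n. u \<in> D \<Longrightarrow> v \<in> D \<Longrightarrow> \<not> separated u v (1 / real (Suc n)) w"
    and A: "A \<in> sets borel"
  shows "numYZ A w * marg_Z p (snd w) = numZ A (snd w) * marg_YZ p w"
proof (cases "0 < marg_YZ p w \<and> 0 < marg_Z p (snd w)")
  case True
  then have y: "0 < marg_YZ p w" and z: "0 < marg_Z p (snd w)" by auto
  have "condYZ w = condZ (snd w)"
  proof (rule ccontr)
    assume "condYZ w \<noteq> condZ (snd w)"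
    from ball_separation[OF cond_prob_space(1)[OF y] cond_sets(1) cond_prob_space(2)[OF z] cond_sets(2) cond_ac this D]
    obtain u v n where uv: "u \<in> D" "v \<in> D"
      "0 < measure (condYZ w) (ball u (1 / real (Suc n)))" "0 < measure (condYZ w) (ball v (1 / real (Suc n)))"
      "separates (condYZ w) (condZ (snd w)) u v (1 / real (Suc n)) \<or> separates (condZ (snd w)) (condYZ w) u v (1 / real (Suc n))"
      by metis
    have "separated u v (1 / real (Suc n)) w"
      using uv(3-5) y z unfolding separated_def separates_def
      by (simp only: cond_measure(1)[OF _ y] cond_measure(2)[OF _ z] borel_open[OF open_ball] borel_closed[OF closed_cball])
        (simp add: divide_simps zero_less_mult_iff mult_ac)
    then show False using n uv by blast
  qed
  then have "measure (condYZ w) A = measure (condZ (snd w)) A" by simp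
  then show ?thesis using y z by (simp add: cond_measure A field_simps)
next
  case False
  then consider "marg_YZ p w = 0" | "marg_Z p (snd w) = 0"
    using marg_nonneg(2)[of w] marg_nonneg(3)[of "snd w"] by linarith
  then show ?thesis
    using num_le(1)[OF A, of w] num_le(2)[OF A, of "snd w"] num_nonneg(1)[of A w] num_nonneg(2)[of A "snd w"]
    by cases auto
qed

text \<open>For almost every \<open>z\<close> the proportionality holds for almost all
  \<open>y\<close>; integrated over \<open>y\<close> in \<open>B\<close>, it becomes the product
  formula for \<open>ratio\<close>.\<close>

lemma cond_indep_if_proportional:
  assumes pr: "\<And>A. A \<in> sets borel \<Longrightarrow> AE w in lborel. numYZ A w * marg_Z p (snd w) = numZ A (snd w) * marg_YZ p w"
  shows "cond_indep \<Omega> X Y Z"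
  unfolding cond_indep_iff
proof (intro ballI)
  fix A :: "'x set" and B :: "'y set" assume A[measurable]: "A \<in> sets borel" and B[measurable]: "B \<in> sets borel"
  have "AE w in lborel \<Otimes>\<^sub>M lborel. numYZ A w * marg_Z p (snd w) = numZ A (snd w) * marg_YZ p w"
    using pr[OF A] by (subst lborel_prod)
  from lborel_pair.AE_pair[OF this]
  have "AE y in lborel. AE z in lborel. numYZ A (y, z) * marg_Z p z = numZ A z * marg_YZ p (y, z)" by simp
  \<comment> \<open>The integration is over \<open>y\<close> at fixed \<open>z\<close>, so the
    exceptional set must be sliced with \<open>z\<close> outside.\<close>
  then have "AE z in lborel. AE y in lborel. numYZ A (y, z) * marg_Z p z = numZ A z * marg_YZ p (y, z)"
  proof (subst (asm) lborel_pair.AE_commute)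
    show "{x \<in> space (lborel \<Otimes>\<^sub>M lborel). numYZ A (fst x, snd x) * marg_Z p (snd x) = numZ A (snd x) * marg_YZ p (fst x, snd x)}
      \<in> sets (lborel \<Otimes>\<^sub>M lborel)"
      unfolding lborel_prod by measurable
  qed simp
  then have "AE z in lborel. 0 < marg_Z p z \<longrightarrow> ratio A B z = ratio A UNIV z * ratio UNIV B z"
  proof eventually_elim
    case (elim z)
    have "ennreal (joint_num A B z * marg_Z p z) = (\<integral>\<^sup>+y. ennreal (numYZ A (y, z)) * indicator B y * ennreal (marg_Z p z) \<partial>lborel)"
      by (subst nn_integral_multc) (auto simp: joint_num_eq[symmetric] ennreal_mult joint_num_nonneg marg_nonneg)
    also have "\<dots> = (\<integral>\<^sup>+y. ennreal (numZ A z) * (ennreal (marg_YZ p (y, z)) * indicator B y) \<partial>lborel)"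
    proof (rule nn_integral_cong_AE)
      show "AE y in lborel. ennreal (numYZ A (y, z)) * indicator B y * ennreal (marg_Z p z) =
        ennreal (numZ A z) * (ennreal (marg_YZ p (y, z)) * indicator B y)"
        using elim
      proof eventually_elim
        case (elim y)
        have "ennreal (numYZ A (y, z)) * ennreal (marg_Z p z) = ennreal (numZ A z) * ennreal (marg_YZ p (y, z))"
          using elim by (simp add: num_nonneg marg_nonneg flip: ennreal_mult)
        then show ?case by (simp add: indicator_def)
      qed
    qed
    also have "\<dots> = ennreal (numZ A z * joint_num UNIV B z)"
      by (subst nn_integral_cmult) (auto simp: joint_num_UNIV_left[symmetric] ennreal_mult joint_num_nonneg num_nonneg)
    finally have "joint_num A B z * marg_Z p z = numZ A z * joint_num UNIV B z"
      by (subst (asm) ennreal_inj) (auto intro!: mult_nonneg_nonneg joint_num_nonneg num_nonneg marg_nonneg)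
    then show ?case by (auto simp: ratio_def joint_num_UNIV_right A field_simps)
  qed
  then show "AE \<omega> in \<Omega>. ratio A B (Z \<omega>) = ratio A UNIV (Z \<omega>) * ratio UNIV B (Z \<omega>)"
    by (subst AE_Z_iff) auto
qed

text \<open>Countability of the candidates: if every ball with centre and boundary point in a
  countable dense set separated only on a null set, almost all points would have no separating ball
  at all and conditional independence would follow.\<close>

lemma not_cond_indep_separated:
  assumes nci: "\<not> cond_indep \<Omega> X Y Z"
  obtains u v r where "0 < r" "\<not> (AE w in lborel. \<not> separated u v r w)"
proof -
  obtain D :: "'x set" where D: "countable D" "\<And>U. open U \<Longrightarrow> U \<noteq> {} \<Longrightarrow> \<exists>d\<in>D. d \<in> U"
    using countable_dense_setE by blast
  have "\<exists>u\<in>D. \<exists>v\<in>D. \<exists>n. \<not> (AE w in lborel. \<not> separated u v (1 / real (Suc n)) w)"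
  proof (rule ccontr)
    assume "\<not> ?thesis"
    then have "AE w in lborel. \<forall>u\<in>D. \<forall>v\<in>D. \<forall>n. \<not> separated u v (1 / real (Suc n)) w"
      by (simp add: AE_ball_countable[OF D(1)] AE_all_countable)
    then have "AE w in lborel. numYZ A w * marg_Z p (snd w) = numZ A (snd w) * marg_YZ p w" if "A \<in> sets borel" for A
      by eventually_elim (intro separated_or_eq[OF D(2)] that, auto)
    then show False using cond_indep_if_proportional nci by blast
  qed
  then obtain u v n where "\<not> (AE w in lborel. \<not> separated u v (1 / real (Suc n)) w)" by blast
  then show ?thesis using that[of "1 / real (Suc n)" u v] by simp
qed

end

section \<open>The test statistic and the rejection event\<close>

lemma zeta_hat_bdiv:
  assumes K: "\<And>t. 0 \<le> K t"
  shows "zeta_hat K h1 h2 a n D = (1 / real n) * (\<Sum>s=1..n. bdiv {1..n}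
      (\<lambda>i. K (norm (snd (D s) - snd (D i)) / h1) / (\<Sum>j=1..n. K (norm (snd (D s) - snd (D j)) / h1)))
      (\<lambda>i. K (norm (snd (snd (D s)) - snd (snd (D i))) / h2) / (\<Sum>j=1..n. K (norm (snd (snd (D s)) - snd (snd (D j))) / h2)))
      (\<lambda>i. fst (D i)) * a (snd (D s)))"
  unfolding zeta_hat_def est_X_given_YZ_def est_X_given_Z_def
  using K by (simp add: ball_divergence_weighted_empirical)

text \<open>Data sets are functions on all natural numbers, whereas measurability lives on the
  product over {1..n}; this allows restricting them.\<close>

lemma zeta_hat_cong:
  assumes K: "\<And>t. 0 \<le> K t" and D: "\<And>i. i \<in> {1..n} \<Longrightarrow> D i = D' i"
  shows "zeta_hat K h1 h2 a n D = zeta_hat K h1 h2 a n D'"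
  unfolding zeta_hat_bdiv[of K, OF K] bdiv_def using D
  by (intro arg_cong[of _ _ "(*) (1 / real n)"] sum.cong refl arg_cong2[of _ _ _ _ "(*)"]
      arg_cong2[of _ _ _ _ "(+)"] arg_cong2[of _ _ _ _ "(/)"] arg_cong2[of _ _ _ _ "(-)"] arg_cong[of _ _ "\<lambda>x. x\<^sup>2"]) auto

lemma zeta_hat_measurable:
  fixes a :: "'y::euclidean_space \<times> 'z::euclidean_space \<Rightarrow> real"
  assumes K: "\<And>t. 0 \<le> K t" and [measurable]: "K \<in> borel_measurable borel" "a \<in> borel_measurable borel"
  shows "(\<lambda>D. zeta_hat K h1 h2 a n D) \<in> borel_measurable (PiM {1..n} (\<lambda>_. borel :: ('x::euclidean_space \<times> 'y \<times> 'z) measure))"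
proof -
  let ?P = "PiM {1..n} (\<lambda>_. borel :: ('x \<times> 'y \<times> 'z) measure)"
  have c: "(\<lambda>D. D i) \<in> borel_measurable ?P" if "i \<in> {1..n}" for i
    using that by (rule measurable_component_singleton)
  have f: "(\<lambda>D. fst (D i)) \<in> borel_measurable ?P" and s: "(\<lambda>D. snd (D i)) \<in> borel_measurable ?P"
    and ss: "(\<lambda>D. snd (snd (D i))) \<in> borel_measurable ?P" if "i \<in> {1..n}" for i
    using measurable_compose[OF c[OF that] borel_fst_snd(1)] measurable_compose[OF c[OF that] borel_fst_snd(2)]
      measurable_compose[OF measurable_compose[OF c[OF that] borel_fst_snd(2)] borel_fst_snd(2)] by auto
  have m1: "(\<lambda>D. K (norm (snd (D s) - snd (D i)) / h1)) \<in> borel_measurable ?P"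
    and m2: "(\<lambda>D. K (norm (snd (snd (D s)) - snd (snd (D i))) / h2)) \<in> borel_measurable ?P"
    and ma: "(\<lambda>D. a (snd (D s))) \<in> borel_measurable ?P" if "s \<in> {1..n}" "i \<in> {1..n}" for s i
  proof -
    note [measurable] = s[OF that(1)] s[OF that(2)] ss[OF that(1)] ss[OF that(2)]
    show "(\<lambda>D. K (norm (snd (D s) - snd (D i)) / h1)) \<in> borel_measurable ?P"
      "(\<lambda>D. K (norm (snd (snd (D s)) - snd (snd (D i))) / h2)) \<in> borel_measurable ?P"
      "(\<lambda>D. a (snd (D s))) \<in> borel_measurable ?P" by measurable
  qed
  have mb: "(\<lambda>D. of_bool (dist (fst (D u)) (fst (D i)) \<le> dist (fst (D u)) (fst (D v))) :: real) \<in> borel_measurable ?P"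
    if "u \<in> {1..n}" "i \<in> {1..n}" "v \<in> {1..n}" for u i v
  proof -
    have "{D \<in> space ?P. dist (fst (D u)) (fst (D i)) \<le> dist (fst (D u)) (fst (D v))} \<in> sets ?P"
      by (intro borel_measurable_le borel_measurable_dist f that)
    then have [measurable]: "Measurable.pred ?P (\<lambda>D. dist (fst (D u)) (fst (D i)) \<le> dist (fst (D u)) (fst (D v)))"
      by (simp add: pred_def)
    show ?thesis by measurable
  qed
  show ?thesis
    unfolding zeta_hat_bdiv[of K, OF K] bdiv_def
    by (intro borel_measurable_times borel_measurable_const borel_measurable_sum borel_measurable_add
      borel_measurable_power borel_measurable_diff borel_measurable_divide m1 m2 mb ma)
qed

section \<open>The rejection probability given the data\<close>

context permutation_model
begin

text \<open>Rejection by the test for fixed data and fixed permutations; \<open>phi_CPT_iff\<close>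
  makes the connection.\<close>

definition rank_event :: "((nat \<Rightarrow> 'x \<times> 'w) \<Rightarrow> real) \<Rightarrow> real \<Rightarrow> nat \<Rightarrow> (nat \<Rightarrow> nat \<Rightarrow> nat) \<Rightarrow> (nat \<Rightarrow> 'x \<times> 'w) \<Rightarrow> bool"
  where "rank_event T \<alpha> m \<tau> d \<longleftrightarrow> (1 + (\<Sum>j=1..m. of_bool (T (permute_fst (\<tau> j) d) \<ge> T d))) / (1 + real m) < \<alpha>"

text \<open>The conditional probability of rejection given the data, written as a finite sum over
  all outcomes of the \<open>m\<close> independent draws.\<close>

definition rejection :: "((nat \<Rightarrow> 'x \<times> 'w) \<Rightarrow> real) \<Rightarrow> real \<Rightarrow> nat \<Rightarrow> (nat \<Rightarrow> 'x \<times> 'w) \<Rightarrow> real"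
  where "rejection T \<alpha> m d = (\<Sum>\<tau>\<in>{1..m} \<rightarrow>\<^sub>E {\<sigma>. \<sigma> permutes I}.
    (\<Prod>j=1..m. perm_weight (\<tau> j) d) * of_bool (rank_event T \<alpha> m \<tau> d))"

lemma rejection_nonneg: "0 \<le> rejection T \<alpha> m d"
  unfolding rejection_def by (intro sum_nonneg mult_nonneg_nonneg prod_nonneg) (auto simp: perm_weight_nonneg)

lemma rejection_meas:
  assumes [measurable]: "T \<in> borel_measurable base"
  shows "rejection T \<alpha> m \<in> borel_measurable base"
  unfolding rejection_def
proof (intro borel_measurable_sum borel_measurable_times borel_measurable_prod)
  fix \<tau> j assume "\<tau> \<in> {1..m} \<rightarrow>\<^sub>E {\<sigma>. \<sigma> permutes I}" "j \<in> {1..m}"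
  then have "\<tau> j permutes I" by (auto simp: PiE_iff)
  then show "perm_weight (\<tau> j) \<in> borel_measurable base" by (rule perm_weight_meas)
next
  fix \<tau> assume \<tau>: "\<tau> \<in> {1..m} \<rightarrow>\<^sub>E {\<sigma>. \<sigma> permutes I}"
  have "(\<lambda>d. of_bool (T (permute_fst (\<tau> j) d) \<ge> T d) :: real) \<in> borel_measurable base" if j: "j \<in> {1..m}" for j
  proof -
    have m: "(\<lambda>d. T (permute_fst (\<tau> j) d)) \<in> borel_measurable base"
      using \<tau> j by (intro measurable_compose[OF measurable_permute_fst assms]) (auto simp: PiE_iff)
    have "{d\<in>space base. T d \<le> T (permute_fst (\<tau> j) d)} \<in> sets base" by (rule borel_measurable_le[OF assms m])
    then have [measurable]: "Measurable.pred base (\<lambda>d. T d \<le> T (permute_fst (\<tau> j) d))" by (simp add: pred_def)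
    show ?thesis by measurable
  qed
  then have [measurable]: "(\<lambda>d. \<Sum>j=1..m. of_bool (T (permute_fst (\<tau> j) d) \<ge> T d) :: real) \<in> borel_measurable base"
    by (intro borel_measurable_sum)
  show "(\<lambda>d. of_bool (rank_event T \<alpha> m \<tau> d) :: real) \<in> borel_measurable base"
    unfolding rank_event_def by measurable
qed

text \<open>Drawing \<tau> with the weights of the permuted data is the same as drawing \<sigma>
  composed with \<tau> with the weights of the original data. After this translation all statistics
  and all weights refer to the same data \<open>d\<close>.\<close>

lemma rejection_permute_fst:
  assumes \<sigma>: "\<sigma> permutes I"
  shows "rejection T \<alpha> m (permute_fst \<sigma> d) = (\<Sum>\<tau>\<in>{1..m} \<rightarrow>\<^sub>E {\<sigma>. \<sigma> permutes I}. (\<Prod>j=1..m. perm_weight (\<tau> j) d) *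
    of_bool ((1 + (\<Sum>j=1..m. of_bool (T (permute_fst (\<tau> j) d) \<ge> T (permute_fst \<sigma> d)))) / (1 + real m) < \<alpha>))"
proof -
  let ?c = "\<lambda>\<sigma> \<tau>. \<lambda>j\<in>{1..m}. \<sigma> \<circ> \<tau> j"
  let ?S = "{1..m} \<rightarrow>\<^sub>E {\<sigma>. \<sigma> permutes I}"
  have i\<sigma>: "inv \<sigma> permutes I" using \<sigma> by (rule permutes_inv)
  have mem: "?c \<rho> \<tau> \<in> ?S" if "\<rho> permutes I" "\<tau> \<in> ?S" for \<rho> \<tau>
    using that by (auto simp: PiE_iff intro: permutes_compose)
  have cc: "?c \<rho> (?c \<rho>' \<tau>) = \<tau>" if "\<rho> \<circ> \<rho>' = id" "\<tau> \<in> ?S" for \<rho> \<rho>' \<tau>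
    using that by (auto simp: fun_eq_iff PiE_iff extensional_def o_assoc)
  show ?thesis
    unfolding rejection_def rank_event_def permute_fst_permute_fst perm_weight_permute_fst[OF \<sigma>]
    by (rule sum.reindex_bij_witness[where i="?c (inv \<sigma>)" and j="?c \<sigma>"])
      (use mem[OF \<sigma>] mem[OF i\<sigma>] cc[OF permutes_inv_o(1)[OF \<sigma>]] cc[OF permutes_inv_o(2)[OF \<sigma>]] in simp_all)
qed

text \<open>The permutation that produces the data is treated as draw number 0. It has the same
  weights as the \<open>m\<close> further draws, so the bound on ranks of m+1 exchangeable values
  applies.\<close>

lemma sum_rejection_le:
  assumes \<alpha>: "0 < \<alpha>"
  shows "(\<Sum>\<sigma> | \<sigma> permutes I. perm_weight \<sigma> d * rejection T \<alpha> m (permute_fst \<sigma> d)) \<le> \<alpha>"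
proof -
  let ?S = "{\<sigma>. \<sigma> permutes I}"
  let ?t = "\<lambda>\<sigma>. T (permute_fst \<sigma> d)"
  have fS: "finite ?S" using fin by (rule finite_permutations)
  let ?g = "\<lambda>\<tau>. (\<Prod>j\<in>{0..m}. perm_weight (\<tau> j) d) *
    of_bool (real (card {j\<in>{0..m}. ?t (\<tau> 0) \<le> ?t (\<tau> j)}) < \<alpha> * (1 + real m))"
  have i0: "{0..m} = insert 0 {1..m}" by auto
  \<comment> \<open>The summand 1 in the numerator of the p-value is draw 0, which counts itself in
    its own rank.\<close>
  have trm: "perm_weight \<sigma> d * ((\<Prod>j=1..m. perm_weight (\<tau> j) d) *
    of_bool ((1 + (\<Sum>j=1..m. of_bool (?t (\<tau> j) \<ge> ?t \<sigma>))) / (1 + real m) < \<alpha>)) = ?g (\<tau>(0 := \<sigma>))" for \<sigma> \<tau>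
  proof -
    have "(\<Prod>j\<in>{0..m}. perm_weight ((\<tau>(0 := \<sigma>)) j) d) = perm_weight \<sigma> d * (\<Prod>j=1..m. perm_weight (\<tau> j) d)"
      unfolding i0 by (subst prod.insert) auto
    moreover have "real (card {j\<in>{0..m}. ?t ((\<tau>(0 := \<sigma>)) 0) \<le> ?t ((\<tau>(0 := \<sigma>)) j)}) = 1 + (\<Sum>j=1..m. of_bool (?t (\<tau> j) \<ge> ?t \<sigma>))"
    proof -
      have "{j\<in>{0..m}. ?t ((\<tau>(0 := \<sigma>)) 0) \<le> ?t ((\<tau>(0 := \<sigma>)) j)} = insert 0 ({1..m} \<inter> {j. ?t \<sigma> \<le> ?t (\<tau> j)})" by auto
      then show ?thesis by (simp add: card_insert_if)
    qed
    ultimately show ?thesis by (simp add: divide_less_eq mult.assoc)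
  qed
  have "(\<Sum>\<sigma>\<in>?S. perm_weight \<sigma> d * rejection T \<alpha> m (permute_fst \<sigma> d)) =
    (\<Sum>\<sigma>\<in>?S. \<Sum>\<tau>\<in>{1..m} \<rightarrow>\<^sub>E ?S. ?g (\<tau>(0 := \<sigma>)))"
    using rejection_permute_fst by (intro sum.cong refl) (simp only: mem_Collect_eq sum_distrib_left trm)
  also have "\<dots> = (\<Sum>(\<sigma>, \<tau>)\<in>?S \<times> ({1..m} \<rightarrow>\<^sub>E ?S). ?g (\<tau>(0 := \<sigma>)))"
    by (rule sum.cartesian_product)
  also have "\<dots> = (\<Sum>\<tau>\<in>{0..m} \<rightarrow>\<^sub>E ?S. ?g \<tau>)"
  proof -
    have inj: "inj_on (\<lambda>(\<sigma>, \<tau>). \<tau>(0 := \<sigma>)) (?S \<times> ({1..m} \<rightarrow>\<^sub>E ?S))"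
      using inj_combinator[of 0 "{1..m}" "\<lambda>_. ?S"] by auto
    have "{0..m} \<rightarrow>\<^sub>E ?S = (\<lambda>(\<sigma>, \<tau>). \<tau>(0 := \<sigma>)) ` (?S \<times> ({1..m} \<rightarrow>\<^sub>E ?S))"
      unfolding i0 by (rule PiE_insert_eq)
    then have "(\<Sum>\<tau>\<in>{0..m} \<rightarrow>\<^sub>E ?S. ?g \<tau>) = (\<Sum>x\<in>?S \<times> ({1..m} \<rightarrow>\<^sub>E ?S). ?g ((\<lambda>(\<sigma>, \<tau>). \<tau>(0 := \<sigma>)) x))"
      using sum.reindex[OF inj, of ?g] by (simp only: o_def)
    also have "\<dots> = (\<Sum>(\<sigma>, \<tau>)\<in>?S \<times> ({1..m} \<rightarrow>\<^sub>E ?S). ?g (\<tau>(0 := \<sigma>)))"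
      by (intro sum.cong refl) (simp only: case_prod_beta)
    finally show ?thesis ..
  qed
  also have "\<dots> \<le> \<alpha>"
    using fS \<alpha> by (intro exchangeable_rank_bound) (auto simp: perm_weight_nonneg sum_perm_weight_le_1)
  finally show ?thesis .
qed

text \<open>Invariance under a random permutation replaces the data by permuted data; the average
  over that permutation is then bounded pointwise by \<open>sum_rejection_le\<close>.\<close>

lemma rejection_probability_le:
  assumes T: "T \<in> borel_measurable base" and \<alpha>: "0 < \<alpha>" and total: "(\<integral>\<^sup>+d. ennreal (lik d) \<partial>base) = 1"
  shows "(\<integral>\<^sup>+d. ennreal (lik d) * ennreal (rejection T \<alpha> m d) \<partial>base) \<le> ennreal \<alpha>"
proof -
  have [measurable]: "rejection T \<alpha> m \<in> borel_measurable base" by (rule rejection_meas[OF T])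
  have "(\<integral>\<^sup>+d. ennreal (lik d) * ennreal (rejection T \<alpha> m d) \<partial>base) =
    (\<integral>\<^sup>+d. ennreal (lik d) * (\<Sum>\<sigma> | \<sigma> permutes I. ennreal (perm_weight \<sigma> d) * ennreal (rejection T \<alpha> m (permute_fst \<sigma> d))) \<partial>base)"
    by (rule nn_integral_random_permutation[symmetric]) measurable
  also have "\<dots> \<le> (\<integral>\<^sup>+d. ennreal (lik d) * ennreal \<alpha> \<partial>base)"
  proof (intro nn_integral_mono mult_left_mono)
    fix d
    have "(\<Sum>\<sigma> | \<sigma> permutes I. ennreal (perm_weight \<sigma> d) * ennreal (rejection T \<alpha> m (permute_fst \<sigma> d))) =
      ennreal (\<Sum>\<sigma> | \<sigma> permutes I. perm_weight \<sigma> d * rejection T \<alpha> m (permute_fst \<sigma> d))"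
      by (subst sum_ennreal[symmetric]) (auto simp: ennreal_mult perm_weight_nonneg rejection_nonneg)
    also have "\<dots> \<le> ennreal \<alpha>" by (intro ennreal_leI sum_rejection_le \<alpha>)
    finally show "(\<Sum>\<sigma> | \<sigma> permutes I. ennreal (perm_weight \<sigma> d) * ennreal (rejection T \<alpha> m (permute_fst \<sigma> d))) \<le> ennreal \<alpha>" .
  qed simp
  also have "\<dots> = ennreal \<alpha>" using total by (subst nn_integral_multc) auto
  finally show ?thesis .
qed

end

section \<open>Integrating the conditional law of the permutations\<close>

lemma perm_prob_restrict:
  assumes "\<sigma> permutes {1..n}"
  shows "perm_prob p n (\<lambda>i\<in>{1..n}. D i) \<sigma> = perm_prob p n D \<sigma>"
proof -
  have "(\<Prod>l=1..n. cond_density p (fst ((\<lambda>i\<in>{1..n}. D i) (\<tau> l))) (snd (snd ((\<lambda>i\<in>{1..n}. D i) l)))) =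
    (\<Prod>l=1..n. cond_density p (fst (D (\<tau> l))) (snd (snd (D l))))" if "\<tau> permutes {1..n}" for \<tau>
  proof (intro prod.cong refl)
    fix l assume l: "l \<in> {1..n}"
    then have "\<tau> l \<in> {1..n}" using permutes_in_image[OF that] by simp
    then show "cond_density p (fst ((\<lambda>i\<in>{1..n}. D i) (\<tau> l))) (snd (snd ((\<lambda>i\<in>{1..n}. D i) l))) =
      cond_density p (fst (D (\<tau> l))) (snd (snd (D l)))" using l by simp
  qed
  then show ?thesis unfolding perm_prob_def using assms by simp
qed

text \<open>The permutations take finitely many values, so the event splits into disjoint pieces on
  which they are constant. On each piece the condition on the data is measurable with respect to the
  conditioning sigma-algebra, and the conditional law may be inserted.\<close>

lemma emeasure_cpt_event:
  fixes D :: "nat \<Rightarrow> 'w \<Rightarrow> 'x::euclidean_space \<times> 'y::euclidean_space \<times> 'z::euclidean_space"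
  assumes prob: "prob_space \<Omega>" and perms: "cpt_permutations \<Omega> p n D M \<pi>"
    and D: "\<And>i. i \<in> {1..n} \<Longrightarrow> D i \<in> measurable \<Omega> borel"
    and Q: "\<And>\<sigma>. \<sigma> \<in> {1..M} \<rightarrow>\<^sub>E {\<sigma>. \<sigma> permutes {1..n}} \<Longrightarrow> Measurable.pred (PiM {1..n} (\<lambda>_. borel)) (Q \<sigma>)"
    and pp0: "\<And>d \<sigma>. 0 \<le> perm_prob p n d \<sigma>"
    and ppm: "\<And>\<sigma>. \<sigma> permutes {1..n} \<Longrightarrow> (\<lambda>d. perm_prob p n d \<sigma>) \<in> borel_measurable (PiM {1..n} (\<lambda>_. borel))"
  shows "{\<omega>\<in>space \<Omega>. Q (\<lambda>j\<in>{1..M}. \<pi> j \<omega>) (\<lambda>i\<in>{1..n}. D i \<omega>)} \<in> sets \<Omega>"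
    "emeasure \<Omega> {\<omega>\<in>space \<Omega>. Q (\<lambda>j\<in>{1..M}. \<pi> j \<omega>) (\<lambda>i\<in>{1..n}. D i \<omega>)} =
     (\<integral>\<^sup>+\<omega>. ennreal (\<Sum>\<sigma>\<in>{1..M} \<rightarrow>\<^sub>E {\<sigma>. \<sigma> permutes {1..n}}.
        (\<Prod>j=1..M. perm_prob p n (\<lambda>i\<in>{1..n}. D i \<omega>) (\<sigma> j)) * of_bool (Q \<sigma> (\<lambda>i\<in>{1..n}. D i \<omega>))) \<partial>\<Omega>)"
proof -
  interpret prob_space \<Omega> by fact
  let ?S = "{\<sigma>. \<sigma> permutes {1..n}}"
  let ?T = "{1..M} \<rightarrow>\<^sub>E ?S"
  let ?d = "\<lambda>\<omega>. \<lambda>i\<in>{1..n}. D i \<omega>"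
  let ?PB = "PiM {1..n} (\<lambda>_. borel) :: (nat \<Rightarrow> 'x \<times> 'y \<times> 'z) measure"
  let ?F = "vimage_algebra (space \<Omega>) ?d ?PB"
  have dm[measurable]: "?d \<in> measurable \<Omega> ?PB" using D by (intro measurable_restrict) auto
  have dF: "?d \<in> measurable ?F ?PB" by (rule measurable_vimage_algebra1) (use measurable_space[OF dm] in auto)
  have sub: "subalgebra \<Omega> ?F"
  proof -
    have "?d \<in> space \<Omega> \<rightarrow> space ?PB" using measurable_space[OF dm] by auto
    then have "sets ?F \<subseteq> sets \<Omega>" using measurable_sets[OF dm] by (simp only: sets_vimage_algebra2) blast
    then show ?thesis by (simp add: subalgebra_def)
  qed
  interpret F: finite_measure_subalgebra \<Omega> ?F using sub by unfold_locales
  have \<pi>m: "\<pi> j \<in> measurable \<Omega> (count_space ?S)" if "j \<in> {1..M}" for j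
    using perms that unfolding cpt_permutations_def Let_def by blast
  have fT: "finite ?T" by (intro finite_PiE finite_permutations) auto
  define A where "A \<sigma> = {\<omega>\<in>space \<Omega>. \<forall>j\<in>{1..M}. \<pi> j \<omega> = \<sigma> j}" for \<sigma>
  define B where "B \<sigma> = {\<omega>\<in>space \<Omega>. Q \<sigma> (?d \<omega>)}" for \<sigma>
  have A[measurable]: "A \<sigma> \<in> sets \<Omega>" if "\<sigma> \<in> ?T" for \<sigma>
  proof -
    have "{\<omega>\<in>space \<Omega>. \<pi> j \<omega> = \<sigma> j} \<in> sets \<Omega>" if j: "j \<in> {1..M}" for j
    proof -
      have "{\<omega>\<in>space \<Omega>. \<pi> j \<omega> = \<sigma> j} = \<pi> j -` {\<sigma> j} \<inter> space \<Omega>" by auto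
      also have "\<dots> \<in> sets \<Omega>" using \<open>\<sigma> \<in> ?T\<close> j by (intro measurable_sets[OF \<pi>m[OF j]]) (auto simp: PiE_iff)
      finally show ?thesis .
    qed
    then show ?thesis unfolding A_def by (intro sets.sets_Collect_finite_All) auto
  qed
  have BF: "B \<sigma> \<in> sets ?F" and B[measurable]: "B \<sigma> \<in> sets \<Omega>" if "\<sigma> \<in> ?T" for \<sigma>
  proof -
    have "Measurable.pred ?F (\<lambda>\<omega>. Q \<sigma> (?d \<omega>))" by (rule measurable_compose[OF dF Q[OF that]])
    then show "B \<sigma> \<in> sets ?F" unfolding B_def pred_def by simp
    then show "B \<sigma> \<in> sets \<Omega>" using sub by (auto simp: subalgebra_def)
  qed
  have event: "{\<omega>\<in>space \<Omega>. Q (\<lambda>j\<in>{1..M}. \<pi> j \<omega>) (?d \<omega>)} = (\<Union>\<sigma>\<in>?T. A \<sigma> \<inter> B \<sigma>)"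
  proof (intro set_eqI iffI)
    fix \<omega> assume \<omega>: "\<omega> \<in> {\<omega>\<in>space \<Omega>. Q (\<lambda>j\<in>{1..M}. \<pi> j \<omega>) (?d \<omega>)}"
    then have "(\<lambda>j\<in>{1..M}. \<pi> j \<omega>) \<in> ?T" using measurable_space[OF \<pi>m] by auto
    then show "\<omega> \<in> (\<Union>\<sigma>\<in>?T. A \<sigma> \<inter> B \<sigma>)" using \<omega> by (intro UN_I[of "\<lambda>j\<in>{1..M}. \<pi> j \<omega>"]) (auto simp: A_def B_def)
  next
    fix \<omega> assume "\<omega> \<in> (\<Union>\<sigma>\<in>?T. A \<sigma> \<inter> B \<sigma>)"
    then obtain \<sigma> where \<sigma>: "\<sigma> \<in> ?T" "\<omega> \<in> A \<sigma>" "\<omega> \<in> B \<sigma>" by auto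
    then have "(\<lambda>j\<in>{1..M}. \<pi> j \<omega>) = \<sigma>" by (auto simp: A_def fun_eq_iff PiE_iff extensional_def)
    then show "\<omega> \<in> {\<omega>\<in>space \<Omega>. Q (\<lambda>j\<in>{1..M}. \<pi> j \<omega>) (?d \<omega>)}" using \<sigma> by (auto simp: B_def)
  qed
  then show "{\<omega>\<in>space \<Omega>. Q (\<lambda>j\<in>{1..M}. \<pi> j \<omega>) (?d \<omega>)} \<in> sets \<Omega>"
    using fT A B by (auto intro!: sets.finite_UN)
  have dj: "disjoint_family_on (\<lambda>\<sigma>. A \<sigma> \<inter> B \<sigma>) ?T"
    unfolding disjoint_family_on_def
  proof (intro ballI impI)
    fix \<sigma> \<tau> assume st: "\<sigma> \<in> ?T" "\<tau> \<in> ?T" "\<sigma> \<noteq> \<tau>"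
    show "A \<sigma> \<inter> B \<sigma> \<inter> (A \<tau> \<inter> B \<tau>) = {}"
    proof (rule ccontr)
      assume "A \<sigma> \<inter> B \<sigma> \<inter> (A \<tau> \<inter> B \<tau>) \<noteq> {}"
      then have "\<forall>j\<in>{1..M}. \<sigma> j = \<tau> j" by (auto simp: A_def)
      then have "\<sigma> = \<tau>" using st(1,2) by (intro PiE_ext[of \<sigma> "{1..M}" "\<lambda>_. ?S"]) auto
      then show False using st by simp
    qed
  qed
  have step: "emeasure \<Omega> (A \<sigma> \<inter> B \<sigma>) = (\<integral>\<^sup>+\<omega>. ennreal ((\<Prod>j=1..M. perm_prob p n (?d \<omega>) (\<sigma> j)) * of_bool (Q \<sigma> (?d \<omega>))) \<partial>\<Omega>)"
    if \<sigma>: "\<sigma> \<in> ?T" for \<sigma>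
  proof -
    have Am: "A \<sigma> \<in> sets \<Omega>" and Bm: "B \<sigma> \<in> sets \<Omega>" using A[OF \<sigma>] B[OF \<sigma>] by auto
    have iA: "integrable \<Omega> (\<lambda>\<omega>. indicator (B \<sigma>) \<omega> * indicator (A \<sigma>) \<omega> :: real)"
      using Am Bm by (intro integrable_const_bound[where B=1]) (auto simp: indicator_def)
    have fm: "(indicator (B \<sigma>) :: _ \<Rightarrow> real) \<in> borel_measurable ?F" using BF[OF \<sigma>] by (rule borel_measurable_indicator)
    have gm: "(indicator (A \<sigma>) :: _ \<Rightarrow> real) \<in> borel_measurable \<Omega>" using Am by (rule borel_measurable_indicator)
    note I = F.real_cond_exp_intg[OF iA fm gm]
    have ae: "AE \<omega> in \<Omega>. real_cond_exp \<Omega> ?F (indicator (A \<sigma>)) \<omega> = (\<Prod>j=1..M. perm_prob p n (?d \<omega>) (\<sigma> j))"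
    proof -
      have sp: "\<forall>j\<in>{1..M}. \<sigma> j permutes {1..n}" using \<sigma> by (auto simp: PiE_iff)
      then have "AE \<omega> in \<Omega>. cond_pr \<Omega> ?F {\<omega>\<in>space \<Omega>. \<forall>j\<in>{1..M}. \<pi> j \<omega> = \<sigma> j} \<omega> = (\<Prod>j=1..M. perm_prob p n (\<lambda>i. D i \<omega>) (\<sigma> j))"
        using perms unfolding cpt_permutations_def Let_def by blast
      moreover have "(\<Prod>j=1..M. perm_prob p n (\<lambda>i. D i \<omega>) (\<sigma> j)) = (\<Prod>j=1..M. perm_prob p n (?d \<omega>) (\<sigma> j))" for \<omega>
        using sp by (intro prod.cong refl perm_prob_restrict[symmetric]) auto
      ultimately show ?thesis unfolding cond_pr_def A_def by simp
    qed
    have "emeasure \<Omega> (A \<sigma> \<inter> B \<sigma>) = ennreal (\<integral>\<omega>. indicator (B \<sigma>) \<omega> * indicator (A \<sigma>) \<omega> \<partial>\<Omega>)"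
      using Am Bm by (simp add: emeasure_eq_measure indicator_inter_arith[symmetric] Int_commute)
    \<comment> \<open>\<open>B \<sigma>\<close> is determined by the data alone, so the indicator of
      \<open>A \<sigma>\<close> may be replaced by its conditional expectation.\<close>
    also have "\<dots> = ennreal (\<integral>\<omega>. indicator (B \<sigma>) \<omega> * real_cond_exp \<Omega> ?F (indicator (A \<sigma>)) \<omega> \<partial>\<Omega>)"
      using I(2) by simp
    also have "\<dots> = (\<integral>\<^sup>+\<omega>. ennreal (indicator (B \<sigma>) \<omega> * real_cond_exp \<Omega> ?F (indicator (A \<sigma>)) \<omega>) \<partial>\<Omega>)"
    proof (rule nn_integral_eq_integral[symmetric, OF I(1)])
      show "AE \<omega> in \<Omega>. 0 \<le> indicator (B \<sigma>) \<omega> * real_cond_exp \<Omega> ?F (indicator (A \<sigma>)) \<omega>"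
        using ae by eventually_elim (auto intro!: mult_nonneg_nonneg prod_nonneg pp0)
    qed
    also have "\<dots> = (\<integral>\<^sup>+\<omega>. ennreal ((\<Prod>j=1..M. perm_prob p n (?d \<omega>) (\<sigma> j)) * of_bool (Q \<sigma> (?d \<omega>))) \<partial>\<Omega>)"
      using ae AE_space by (intro nn_integral_cong_AE, eventually_elim) (auto simp: B_def indicator_def)
    finally show ?thesis .
  qed
  have meas: "(\<lambda>\<omega>. ennreal ((\<Prod>j=1..M. perm_prob p n (?d \<omega>) (\<sigma> j)) * of_bool (Q \<sigma> (?d \<omega>)))) \<in> borel_measurable \<Omega>" if \<sigma>: "\<sigma> \<in> ?T" for \<sigma>
  proof -
    note measurable_compose[OF dm Q[OF \<sigma>], measurable]
    have [measurable]: "(\<lambda>\<omega>. \<Prod>j=1..M. perm_prob p n (?d \<omega>) (\<sigma> j)) \<in> borel_measurable \<Omega>"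
      using \<sigma> by (intro borel_measurable_prod measurable_compose[OF dm ppm]) (auto simp: PiE_iff)
    show ?thesis by measurable
  qed
  have "emeasure \<Omega> {\<omega>\<in>space \<Omega>. Q (\<lambda>j\<in>{1..M}. \<pi> j \<omega>) (?d \<omega>)} = (\<Sum>\<sigma>\<in>?T. emeasure \<Omega> (A \<sigma> \<inter> B \<sigma>))"
    unfolding event using fT dj A B by (intro sum_emeasure[symmetric]) auto
  also have "\<dots> = (\<Sum>\<sigma>\<in>?T. \<integral>\<^sup>+\<omega>. ennreal ((\<Prod>j=1..M. perm_prob p n (?d \<omega>) (\<sigma> j)) * of_bool (Q \<sigma> (?d \<omega>))) \<partial>\<Omega>)"
    by (intro sum.cong refl step)
  also have "\<dots> = (\<integral>\<^sup>+\<omega>. (\<Sum>\<sigma>\<in>?T. ennreal ((\<Prod>j=1..M. perm_prob p n (?d \<omega>) (\<sigma> j)) * of_bool (Q \<sigma> (?d \<omega>)))) \<partial>\<Omega>)"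
    using meas by (intro nn_integral_sum[symmetric])
  also have "\<dots> = (\<integral>\<^sup>+\<omega>. ennreal (\<Sum>\<sigma>\<in>?T. (\<Prod>j=1..M. perm_prob p n (?d \<omega>) (\<sigma> j)) * of_bool (Q \<sigma> (?d \<omega>))) \<partial>\<Omega>)"
    by (intro nn_integral_cong sum_ennreal) (auto intro!: mult_nonneg_nonneg prod_nonneg pp0)
  finally show "emeasure \<Omega> {\<omega>\<in>space \<Omega>. Q (\<lambda>j\<in>{1..M}. \<pi> j \<omega>) (?d \<omega>)} =
     (\<integral>\<^sup>+\<omega>. ennreal (\<Sum>\<sigma>\<in>?T. (\<Prod>j=1..M. perm_prob p n (?d \<omega>) (\<sigma> j)) * of_bool (Q \<sigma> (?d \<omega>))) \<partial>\<Omega>)" .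
qed

section \<open>Kernel estimates\<close>

locale cpt_data = cond_model p C \<Omega> X Y Z +
  KW: smoothing_kernel K \<kappa> R "TYPE('y::euclidean_space \<times> 'z::euclidean_space)" +
  KZ: smoothing_kernel K \<kappa> R "TYPE('z)"
  for p :: "'x::euclidean_space \<times> 'y::euclidean_space \<times> 'z::euclidean_space \<Rightarrow> real" and C :: real and \<Omega> :: "'w measure"
    and X :: "'w \<Rightarrow> 'x" and Y :: "'w \<Rightarrow> 'y" and Z :: "'w \<Rightarrow> 'z"
    and K :: "real \<Rightarrow> real" and \<kappa> R :: real +
  fixes D :: "nat \<Rightarrow> 'w \<Rightarrow> 'x \<times> 'y \<times> 'z" and h1 h2 :: "nat \<Rightarrow> real"
    and a :: "'y \<times> 'z \<Rightarrow> real" and amax :: real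
  assumes D_ind: "indep_vars (\<lambda>_. borel) D {1..}"
    and D_law: "\<And>i. i \<in> {1..} \<Longrightarrow> distr \<Omega> borel (D i) = density lborel (\<lambda>w. ennreal (p w))"
    and h1_pos: "\<And>n. 0 < h1 n" and h2_pos: "\<And>n. 0 < h2 n"
    and h1_0: "h1 \<longlonglongrightarrow> 0" and h2_0: "h2 \<longlonglongrightarrow> 0"
    and nh1: "filterlim (\<lambda>n. real n * h1 n ^ DIM('y \<times> 'z)) at_top sequentially"
    and nh2: "filterlim (\<lambda>n. real n * h2 n ^ DIM('z)) at_top sequentially"
    and a_meas[measurable]: "a \<in> borel_measurable borel" and a0: "\<And>w. 0 \<le> a w" and a_le: "\<And>w. a w \<le> amax"
    and a_pos: "\<And>w. 0 < marg_YZ p w \<Longrightarrow> 0 < a w" and amax_pos: "0 < amax"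
begin

abbreviation "DX i \<omega> \<equiv> fst (D i \<omega>)"
abbreviation "DW i \<omega> \<equiv> snd (D i \<omega>)"
abbreviation "DZ i \<omega> \<equiv> snd (snd (D i \<omega>))"
abbreviation "sample \<omega> \<equiv> \<lambda>i. D i \<omega>"
abbreviation "sample_upto n \<omega> \<equiv> \<lambda>i\<in>{1..n}. D i \<omega>"
abbreviation stat :: "nat \<Rightarrow> (nat \<Rightarrow> 'x \<times> 'y \<times> 'z) \<Rightarrow> real"
  where "stat n \<equiv> zeta_hat K (h1 n) (h2 n) a n"
abbreviation borelXYZ :: "nat \<Rightarrow> ('x \<times> 'y \<times> 'z) measure" where "borelXYZ \<equiv> \<lambda>_. borel"
abbreviation borelXZ :: "nat \<Rightarrow> ('x \<times> 'z) measure" where "borelXZ \<equiv> \<lambda>_. borel"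

lemma D_meas[measurable]: "i \<in> {1..} \<Longrightarrow> D i \<in> measurable \<Omega> borel"
  using D_ind by (auto simp: indep_vars_def)

lemma D_components_meas:
  assumes "i \<in> {1..}"
  shows "(\<lambda>\<omega>. DX i \<omega>) \<in> measurable \<Omega> borel" "(\<lambda>\<omega>. DW i \<omega>) \<in> measurable \<Omega> borel"
    "(\<lambda>\<omega>. DZ i \<omega>) \<in> measurable \<Omega> borel"
  using measurable_compose[OF D_meas[OF assms] borel_fst_snd(1)] measurable_compose[OF D_meas[OF assms] borel_fst_snd(2)]
    measurable_compose[OF measurable_compose[OF D_meas[OF assms] borel_fst_snd(2)] borel_fst_snd(2)] by auto

lemma nn_integral_D:
  assumes "i \<in> {1..}" "f \<in> borel_measurable borel"
  shows "(\<integral>\<^sup>+\<omega>. f (D i \<omega>) \<partial>\<Omega>) = (\<integral>\<^sup>+e. f e \<partial>law)"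
  using assms by (intro nn_integral_indep1[OF D_meas D_law]) auto

lemma sample_YZ:
  assumes A[measurable]: "A \<in> sets borel"
  shows "kernel_sample K \<kappa> R \<Omega> borel D law snd (\<lambda>e. indicator A (fst e)) (numYZ A) C"
proof unfold_locales
  show "indep_vars (\<lambda>_. borel) D {1..}" by (rule D_ind)
  show "integrable lborel (numYZ A)"
    using num_le(1)[OF A] num_nonneg(1)[of A] marg_nonneg
    by (intro Bochner_Integration.integrable_bound[OF marg_integrable(1)]) auto
  show "numYZ A u \<le> C" for u using num_le(1)[OF A, of u] marg_le(2)[of u] by linarith
  fix \<psi> :: "'y \<times> 'z \<Rightarrow> ennreal" assume [measurable]: "\<psi> \<in> borel_measurable borel"
  have "(\<integral>\<^sup>+e. ennreal (indicator A (fst e)) * \<psi> (snd e) \<partial>law) =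
    (\<integral>\<^sup>+z. \<integral>\<^sup>+y. \<integral>\<^sup>+x. ennreal (p (x, y, z)) * (ennreal (indicator A x) * \<psi> (y, z)) \<partial>lborel \<partial>lborel \<partial>lborel)"
    by (subst nn_integral_joint) auto
  also have "\<dots> = (\<integral>\<^sup>+z. \<integral>\<^sup>+y. ennreal (numYZ A (y, z)) * \<psi> (y, z) \<partial>lborel \<partial>lborel)"
    by (simp add: numYZ_eq nn_integral_multc mult.assoc[symmetric] ennreal_indicator)
  also have "\<dots> = (\<integral>\<^sup>+u. ennreal (numYZ A u) * \<psi> u \<partial>lborel)"
    by (subst nn_integral_lborel_prod(2)) auto
  finally show "(\<integral>\<^sup>+e. ennreal (indicator A (fst e)) * \<psi> (snd e) \<partial>law) = (\<integral>\<^sup>+u. ennreal (numYZ A u) * \<psi> u \<partial>lborel)" .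
  have "(\<integral>\<^sup>+e. \<psi> (snd e) \<partial>law) = (\<integral>\<^sup>+u. ennreal (marg_YZ p u) * \<psi> u \<partial>lborel)" by (rule nn_integral_joint_YZ) measurable
  also have "\<dots> \<le> (\<integral>\<^sup>+u. ennreal C * \<psi> u \<partial>lborel)"
    by (intro nn_integral_mono mult_right_mono ennreal_leI marg_le) auto
  also have "\<dots> = ennreal C * (\<integral>\<^sup>+u. \<psi> u \<partial>lborel)" by (rule nn_integral_cmult) measurable
  finally show "(\<integral>\<^sup>+e. \<psi> (snd e) \<partial>law) \<le> ennreal C * (\<integral>\<^sup>+u. \<psi> u \<partial>lborel)" .
qed (use num_nonneg C_pos D_law in \<open>auto simp: indicator_def\<close>)

lemma sample_Z:
  assumes A[measurable]: "A \<in> sets borel"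
  shows "kernel_sample K \<kappa> R \<Omega> borel D law (\<lambda>e. snd (snd e)) (\<lambda>e. indicator A (fst e)) (numZ A) C"
proof unfold_locales
  show "indep_vars (\<lambda>_. borel) D {1..}" by (rule D_ind)
  show "integrable lborel (numZ A)"
    using num_le(2)[OF A] num_nonneg(2)[of A] marg_nonneg
    by (intro Bochner_Integration.integrable_bound[OF marg_integrable(3)]) auto
  show "numZ A u \<le> C" for u using num_le(2)[OF A, of u] marg_le(3)[of u] by linarith
  fix \<psi> :: "'z \<Rightarrow> ennreal" assume [measurable]: "\<psi> \<in> borel_measurable borel"
  have "(\<integral>\<^sup>+e. ennreal (indicator A (fst e)) * \<psi> (snd (snd e)) \<partial>law) =
    (\<integral>\<^sup>+u. ennreal (marg_XZ p u) * (ennreal (indicator A (fst u)) * \<psi> (snd u)) \<partial>lborel)"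
    using nn_integral_joint_XZ[of "\<lambda>u. ennreal (indicator A (fst u)) * \<psi> (snd u)"] by simp
  also have "\<dots> = (\<integral>\<^sup>+z. \<integral>\<^sup>+x. ennreal (marg_XZ p (x, z)) * (ennreal (indicator A x) * \<psi> z) \<partial>lborel \<partial>lborel)"
    by (subst nn_integral_lborel_prod(2)) auto
  also have "\<dots> = (\<integral>\<^sup>+z. ennreal (numZ A z) * \<psi> z \<partial>lborel)"
    by (simp add: numZ_eq nn_integral_multc mult.assoc[symmetric] ennreal_indicator)
  finally show "(\<integral>\<^sup>+e. ennreal (indicator A (fst e)) * \<psi> (snd (snd e)) \<partial>law) = (\<integral>\<^sup>+u. ennreal (numZ A u) * \<psi> u \<partial>lborel)" .
  have "(\<integral>\<^sup>+e. \<psi> (snd (snd e)) \<partial>law) = (\<integral>\<^sup>+u. ennreal (marg_Z p u) * \<psi> u \<partial>lborel)" by (rule nn_integral_joint_Z) measurable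
  also have "\<dots> \<le> (\<integral>\<^sup>+u. ennreal C * \<psi> u \<partial>lborel)"
    by (intro nn_integral_mono mult_right_mono ennreal_leI marg_le) auto
  also have "\<dots> = ennreal C * (\<integral>\<^sup>+u. \<psi> u \<partial>lborel)" by (rule nn_integral_cmult) measurable
  finally show "(\<integral>\<^sup>+e. \<psi> (snd (snd e)) \<partial>law) \<le> ennreal C * (\<integral>\<^sup>+u. \<psi> u \<partial>lborel)" .
qed (use num_nonneg C_pos D_law in \<open>auto simp: indicator_def\<close>)

text \<open>Estimates \<open>numYZ A\<close>; for \<open>A = UNIV\<close> it is the kernel density
  estimate of the law of (Y,Z).\<close>

definition estYZ :: "nat \<Rightarrow> 'x set \<Rightarrow> nat \<Rightarrow> 'w \<Rightarrow> real"
  where "estYZ n A s \<omega> = (\<Sum>i=1..n. KW.Kh (h1 n) (DW s \<omega>) (DW i \<omega>) * indicator A (DX i \<omega>)) / real n"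

definition estZ :: "nat \<Rightarrow> 'x set \<Rightarrow> nat \<Rightarrow> 'w \<Rightarrow> real"
  where "estZ n A s \<omega> = (\<Sum>i=1..n. KZ.Kh (h2 n) (DZ s \<omega>) (DZ i \<omega>) * indicator A (DX i \<omega>)) / real n"

lemma estYZ_L1:
  assumes A: "A \<in> sets borel" and \<epsilon>: "0 < \<epsilon>"
  shows "eventually (\<lambda>n. \<forall>s\<in>{1..n}. (\<integral>\<^sup>+\<omega>. ennreal \<bar>estYZ n A s \<omega> - numYZ A (DW s \<omega>)\<bar> \<partial>\<Omega>) \<le> ennreal \<epsilon>) sequentially"
  using kernel_sample.kernel_estimate_L1[OF sample_YZ[OF A], OF h1_pos h1_0 nh1 \<epsilon>]
  unfolding estYZ_def eventually_sequentially by blast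

lemma estZ_L1:
  assumes A: "A \<in> sets borel" and \<epsilon>: "0 < \<epsilon>"
  shows "eventually (\<lambda>n. \<forall>s\<in>{1..n}. (\<integral>\<^sup>+\<omega>. ennreal \<bar>estZ n A s \<omega> - numZ A (DZ s \<omega>)\<bar> \<partial>\<Omega>) \<le> ennreal \<epsilon>) sequentially"
  using kernel_sample.kernel_estimate_L1[OF sample_Z[OF A], OF h2_pos h2_0 nh2 \<epsilon>]
  unfolding estZ_def eventually_sequentially by blast

lemma est_meas:
  assumes A[measurable]: "A \<in> sets borel" and s: "s \<in> {1..n}"
  shows "estYZ n A s \<in> borel_measurable \<Omega>" "estZ n A s \<in> borel_measurable \<Omega>"
proof -
  have s1: "s \<in> {1..}" using s by auto
  note [measurable] = D_components_meas[OF s1]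
  have m: "(\<lambda>\<omega>. KW.Kh (h1 n) (DW s \<omega>) (DW i \<omega>) * indicator A (DX i \<omega>)) \<in> borel_measurable \<Omega>"
    "(\<lambda>\<omega>. KZ.Kh (h2 n) (DZ s \<omega>) (DZ i \<omega>) * indicator A (DX i \<omega>)) \<in> borel_measurable \<Omega>"
    if "i \<in> {1..n}" for i
  proof -
    have i1: "i \<in> {1..}" using that by auto
    note [measurable] = D_components_meas[OF i1]
    have [measurable]: "(\<lambda>\<omega>. indicator A (DX i \<omega>) :: real) \<in> borel_measurable \<Omega>"
      by (rule measurable_compose[OF D_components_meas(1)[OF i1] borel_measurable_indicator[OF A]])
    show "(\<lambda>\<omega>. KW.Kh (h1 n) (DW s \<omega>) (DW i \<omega>) * indicator A (DX i \<omega>)) \<in> borel_measurable \<Omega>"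
      using D_components_meas[OF s1] D_components_meas[OF i1]
      by (intro borel_measurable_times KW.Kh_meas) auto
    show "(\<lambda>\<omega>. KZ.Kh (h2 n) (DZ s \<omega>) (DZ i \<omega>) * indicator A (DX i \<omega>)) \<in> borel_measurable \<Omega>"
      using D_components_meas[OF s1] D_components_meas[OF i1]
      by (intro borel_measurable_times KZ.Kh_meas) auto
  qed
  show "estYZ n A s \<in> borel_measurable \<Omega>"
    unfolding estYZ_def by (intro borel_measurable_divide borel_measurable_sum borel_measurable_const m(1))
  show "estZ n A s \<in> borel_measurable \<Omega>"
    unfolding estZ_def by (intro borel_measurable_divide borel_measurable_sum borel_measurable_const m(2))
qed

definition wYZ :: "nat \<Rightarrow> nat \<Rightarrow> 'w \<Rightarrow> nat \<Rightarrow> real"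
  where "wYZ n s \<omega> i = KW.Kh (h1 n) (DW s \<omega>) (DW i \<omega>) / (\<Sum>j=1..n. KW.Kh (h1 n) (DW s \<omega>) (DW j \<omega>))"

definition wZ :: "nat \<Rightarrow> nat \<Rightarrow> 'w \<Rightarrow> nat \<Rightarrow> real"
  where "wZ n s \<omega> i = KZ.Kh (h2 n) (DZ s \<omega>) (DZ i \<omega>) / (\<Sum>j=1..n. KZ.Kh (h2 n) (DZ s \<omega>) (DZ j \<omega>))"

abbreviation "bdiv_perm n s \<sigma> \<omega> \<equiv> bdiv {1..n} (wYZ n s \<omega>) (wZ n s \<omega>) (\<lambda>i. DX (\<sigma> i) \<omega>)"

lemma w_nonneg: "0 \<le> wYZ n s \<omega> i" "0 \<le> wZ n s \<omega> i"
  unfolding wYZ_def wZ_def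
  by (intro divide_nonneg_nonneg sum_nonneg KW.Kh_nonneg KZ.Kh_nonneg h1_pos h2_pos)+

lemma sum_w_le: "(\<Sum>i=1..n. wYZ n s \<omega> i) \<le> 1" "(\<Sum>i=1..n. wZ n s \<omega> i) \<le> 1"
  unfolding wYZ_def wZ_def sum_divide_distrib[symmetric] by simp_all

text \<open>Permuting the \<open>X\<close>-values leaves (Y,Z) and hence all kernel weights
  unchanged, so the permutation acts only on the points of \<open>bdiv\<close>. The power of the
  bandwidth in \<open>Kh\<close> cancels in the weights.\<close>

lemma zeta_hat_eq:
  "stat n (permute_data \<sigma> (sample \<omega>)) =
    (1 / real n) * (\<Sum>s=1..n. bdiv_perm n s \<sigma> \<omega> * a (DW s \<omega>))"
proof -
  have c: "K u / h ^ m / (\<Sum>j=1..n. K (v j) / h ^ m) = K u / (\<Sum>j=1..n. K (v j))" if "0 < h"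
    for u h :: real and m :: nat and v :: "nat \<Rightarrow> real"
    using that by (simp add: sum_divide_distrib[symmetric])
  show ?thesis
    unfolding zeta_hat_bdiv[of K, OF KW.K_nonneg] permute_data_def wYZ_def wZ_def KW.Kh_def KZ.Kh_def
    by (simp only: c[OF h1_pos] c[OF h2_pos] snd_conv fst_conv)
qed

lemma zeta_hat_eq_id:
  "stat n (sample \<omega>) =
    (1 / real n) * (\<Sum>s=1..n. bdiv {1..n} (wYZ n s \<omega>) (wZ n s \<omega>) (\<lambda>i. DX i \<omega>) * a (DW s \<omega>))"
  using zeta_hat_eq[of n id \<omega>] by (simp add: permute_data_def)

lemma sum_w_indicator:
  assumes "0 < n"
  shows "(\<Sum>i=1..n. wYZ n s \<omega> i * indicator A (DX i \<omega>)) = estYZ n A s \<omega> / estYZ n UNIV s \<omega>"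
    "(\<Sum>i=1..n. wZ n s \<omega> i * indicator A (DX i \<omega>)) = estZ n A s \<omega> / estZ n UNIV s \<omega>"
  using assms unfolding wYZ_def wZ_def estYZ_def estZ_def by (simp_all add: sum_divide_distrib[symmetric])

end

section \<open>The statistic of the original data\<close>

lemma (in prob_space) prob_ge_le_of_L1:
  fixes f :: "'a \<Rightarrow> real"
  assumes [measurable]: "f \<in> borel_measurable M" and c: "0 < c" and e: "0 \<le> e"
    and L1: "(\<integral>\<^sup>+\<omega>. ennreal \<bar>f \<omega>\<bar> \<partial>M) \<le> ennreal e"
  shows "prob {\<omega>\<in>space M. c \<le> f \<omega>} \<le> e / c"
proof -
  have "ennreal (c * prob {\<omega>\<in>space M. c \<le> f \<omega>}) = (\<integral>\<^sup>+\<omega>. ennreal c * indicator {\<omega>\<in>space M. c \<le> f \<omega>} \<omega> \<partial>M)"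
    using c by (subst nn_integral_cmult_indicator) (auto simp: emeasure_eq_measure ennreal_mult)
  also have "\<dots> \<le> (\<integral>\<^sup>+\<omega>. ennreal \<bar>f \<omega>\<bar> \<partial>M)"
    by (intro nn_integral_mono) (auto simp: indicator_def intro!: ennreal_leI)
  also note L1
  finally have "c * prob {\<omega>\<in>space M. c \<le> f \<omega>} \<le> e" using e by (simp add: ennreal_le_iff)
  then show ?thesis using c by (simp add: field_simps)
qed

context cpt_data
begin

text \<open>The inequalities of \<open>separated\<close>, and positivity of the weight function,
  with a common gap \<eta>.\<close>

definition margin :: "'x \<Rightarrow> 'x \<Rightarrow> real \<Rightarrow> real \<Rightarrow> 'y \<times> 'z \<Rightarrow> bool"
  where "margin u v r \<eta> w \<longleftrightarrow> \<eta> \<le> a w \<and> \<eta> \<le> marg_YZ p w \<and> \<eta> \<le> marg_Z p (snd w) \<and>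
    \<eta> \<le> numYZ (ball u r) w \<and> \<eta> \<le> numYZ (ball v r) w \<and>
    (\<eta> \<le> numYZ (cball u (dist u v - 3 * r)) w * marg_Z p (snd w) - numZ (cball u (dist u v + 3 * r)) (snd w) * marg_YZ p w \<or>
     \<eta> \<le> numZ (cball u (dist u v - 3 * r)) (snd w) * marg_YZ p w - numYZ (cball u (dist u v + 3 * r)) w * marg_Z p (snd w))"

lemma margin_meas[measurable]: "Measurable.pred borel (margin u v r \<eta>)"
proof -
  have [measurable]: "numYZ (ball c s) \<in> borel_measurable borel" "numYZ (cball c s) \<in> borel_measurable borel"
    "(\<lambda>w. numZ (cball c s) (snd w)) \<in> borel_measurable (borel :: ('y \<times> 'z) measure)" for c s
    by (rule numYZ_meas[OF borel_open[OF open_ball]] numYZ_meas[OF borel_closed[OF closed_cball]]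
      measurable_compose[OF borel_fst_snd(2) numZ_meas[OF borel_closed[OF closed_cball]]])+
  show ?thesis unfolding margin_def by measurable
qed

lemma separated_imp_margin:
  assumes "separated u v r w"
  shows "\<exists>k. margin u v r (1 / real (Suc k)) w"
proof -
  define d1 where "d1 = numYZ (cball u (dist u v - 3 * r)) w * marg_Z p (snd w) - numZ (cball u (dist u v + 3 * r)) (snd w) * marg_YZ p w"
  define d2 where "d2 = numZ (cball u (dist u v - 3 * r)) (snd w) * marg_YZ p w - numYZ (cball u (dist u v + 3 * r)) w * marg_Z p (snd w)"
  define d where "d = max d1 d2"
  define m where "m = Min {a w, marg_YZ p w, marg_Z p (snd w), numYZ (ball u r) w, numYZ (ball v r) w, d}"
  have m: "0 < m"
  proof -
    have "0 < a w" "0 < marg_YZ p w" "0 < marg_Z p (snd w)" "0 < numYZ (ball u r) w" "0 < numYZ (ball v r) w"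
      using assms a_pos[of w] unfolding separated_def by auto
    moreover have "0 < d"
      using assms unfolding separated_def d_def less_max_iff_disj d1_def d2_def by (elim conjE) (simp only: diff_gt_0_iff_gt)
    ultimately show ?thesis unfolding m_def by simp
  qed
  have mle: "m \<le> a w" "m \<le> marg_YZ p w" "m \<le> marg_Z p (snd w)" "m \<le> numYZ (ball u r) w" "m \<le> numYZ (ball v r) w"
    "m \<le> d" unfolding m_def by auto
  obtain k where "1 / real (Suc k) < m" using nat_approx_posE[OF m] by (metis inverse_eq_divide)
  then have "1 / real (Suc k) \<le> m" by simp
  then have "margin u v r (1 / real (Suc k)) w"
    using mle order_trans[of "1 / real (Suc k)" m] unfolding margin_def d1_def[symmetric] d2_def[symmetric] le_max_iff_disj[symmetric] d_def[symmetric] by blast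
  then show ?thesis ..
qed

text \<open>Every separated point has a margin 1/(k+1) for some k. If all these sets had probability
  zero, so would their countable union, and separation would occur only on a null set.\<close>

lemma exists_margin:
  assumes "\<not> (AE w in lborel. \<not> separated u v r w)"
  obtains \<eta> where "0 < \<eta>" "0 < measure law {e. margin u v r \<eta> (snd e)}"
proof -
  interpret L: prob_space law
    using p_int by (intro prob_spaceI) (simp add: emeasure_density)
  have sp: "space law = UNIV" by simp
  have ms: "{e. margin u v r \<eta> (snd e)} \<in> sets law" for \<eta>
  proof -
    have "Measurable.pred (borel :: ('x \<times> 'y \<times> 'z) measure) (\<lambda>e. margin u v r \<eta> (snd e))"
      by (rule measurable_compose[OF borel_fst_snd(2) margin_meas])
    then show ?thesis by (simp add: pred_def)
  qed
  have "\<exists>k. measure law {e. margin u v r (1 / real (Suc k)) (snd e)} \<noteq> 0"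
  proof (rule ccontr)
    assume "\<not> ?thesis"
    then have "{e. margin u v r (1 / real (Suc k)) (snd e)} \<in> null_sets law" for k
      using ms by (intro null_setsI) (auto simp: L.emeasure_eq_measure)
    then have "AE e in law. e \<notin> {e. margin u v r (1 / real (Suc k)) (snd e)}" for k
      by (rule AE_not_in)
    then have "AE e in law. \<forall>k. \<not> margin u v r (1 / real (Suc k)) (snd e)"
      by (simp add: AE_all_countable)
    then have "(\<integral>\<^sup>+e. indicator {w. \<exists>k. margin u v r (1 / real (Suc k)) w} (snd e) \<partial>law) = (\<integral>\<^sup>+e. 0 \<partial>law)"
      by (intro nn_integral_cong_AE) (auto simp: indicator_def)
    then have "(\<integral>\<^sup>+w. ennreal (marg_YZ p w) * indicator {w. \<exists>k. margin u v r (1 / real (Suc k)) w} w \<partial>lborel) = 0"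
      by (subst nn_integral_joint_YZ[symmetric]) auto
    then have "AE w in lborel. ennreal (marg_YZ p w) * indicator {w. \<exists>k. margin u v r (1 / real (Suc k)) w} w = 0"
      by (subst (asm) nn_integral_0_iff_AE) auto
    then have "AE w in lborel. \<not> separated u v r w"
    proof eventually_elim
      case (elim w)
      show ?case
      proof
        assume s: "separated u v r w"
        then have "0 < marg_YZ p w" by (simp add: separated_def)
        then show False using separated_imp_margin[OF s] elim by (auto simp: indicator_def)
      qed
    qed
    then show False using assms by simp
  qed
  then obtain k where "measure law {e. margin u v r (1 / real (Suc k)) (snd e)} \<noteq> 0" by blast
  then show ?thesis using that[of "1 / real (Suc k)"] by (simp add: zero_less_measure_iff)
qed

text \<open>The five sets are those whose estimated masses enter \<open>bdiv_lower\<close>: the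
  whole space for the normalisation, the two small balls for the choice of the pair, and the shrunk
  and the enlarged ball for the comparison.\<close>

definition deviation :: "'x \<Rightarrow> 'x \<Rightarrow> real \<Rightarrow> nat \<Rightarrow> nat \<Rightarrow> 'w \<Rightarrow> real"
  where "deviation u v r n s \<omega> =
    (\<Sum>A\<in>{UNIV, ball u r, ball v r, cball u (dist u v - 3 * r), cball u (dist u v + 3 * r)}.
      \<bar>estYZ n A s \<omega> - numYZ A (DW s \<omega>)\<bar> + \<bar>estZ n A s \<omega> - numZ A (DZ s \<omega>)\<bar>)"

text \<open>Estimates within \<delta> lose at most half of every gap \<eta>, and the estimated
  densities are at most C+1. Division gives masses at least \<eta>/(2(C+1)) for the small balls and
  a mass difference at least \<eta>/(2(C+1)^2), which \<open>bdiv_lower\<close> multiplies.\<close>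

lemma bdiv_lower_of_estimates:
  assumes n: "0 < n" and \<eta>: "0 < \<eta>" and \<delta>: "0 < \<delta>" "\<delta> \<le> 1" "2 * \<delta> \<le> \<eta>" "8 * (C + 1) * \<delta> \<le> \<eta>"
    and w: "margin u v r \<eta> (DW s \<omega>)" and dev: "deviation u v r n s \<omega> \<le> \<delta>"
  shows "(\<eta> / (2 * (C + 1)))\<^sup>2 * (\<eta> / (2 * (C + 1)\<^sup>2))\<^sup>2 \<le> bdiv {1..n} (wYZ n s \<omega>) (wZ n s \<omega>) (\<lambda>i. DX i \<omega>)"
proof -
  let ?w = "DW s \<omega>" and ?z = "DZ s \<omega>"
  let ?S = "{UNIV, ball u r, ball v r, cball u (dist u v - 3 * r), cball u (dist u v + 3 * r)}"
  let ?Bm = "cball u (dist u v - 3 * r)" and ?Bp = "cball u (dist u v + 3 * r)"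
  have C1: "1 \<le> C + 1" using C_pos by simp
  have dev1: "\<bar>estYZ n A s \<omega> - numYZ A ?w\<bar> \<le> \<delta>" "\<bar>estZ n A s \<omega> - numZ A ?z\<bar> \<le> \<delta>" if "A \<in> ?S" for A
  proof -
    have "\<bar>estYZ n A s \<omega> - numYZ A ?w\<bar> + \<bar>estZ n A s \<omega> - numZ A ?z\<bar> \<le> deviation u v r n s \<omega>"
      unfolding deviation_def using that
      by (intro member_le_sum[where f="\<lambda>A. \<bar>estYZ n A s \<omega> - numYZ A ?w\<bar> + \<bar>estZ n A s \<omega> - numZ A ?z\<bar>"]) auto
    then show "\<bar>estYZ n A s \<omega> - numYZ A ?w\<bar> \<le> \<delta>" "\<bar>estZ n A s \<omega> - numZ A ?z\<bar> \<le> \<delta>" using dev by linarith+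
  qed
  define f g where "f = estYZ n UNIV s \<omega>" and "g = estZ n UNIV s \<omega>"
  have f: "\<bar>f - marg_YZ p ?w\<bar> \<le> \<delta>" and g: "\<bar>g - marg_Z p ?z\<bar> \<le> \<delta>"
    using dev1[of UNIV] by (auto simp: f_def g_def num_UNIV)
  have mf: "\<eta> \<le> marg_YZ p ?w" and mg: "\<eta> \<le> marg_Z p ?z" and mu: "\<eta> \<le> numYZ (ball u r) ?w" and mv: "\<eta> \<le> numYZ (ball v r) ?w"
    using w by (auto simp: margin_def)
  have f1: "0 < f" "f \<le> C + 1" using f mf \<eta> \<delta> marg_le(2)[of ?w] by linarith+
  have g1: "0 < g" "g \<le> C + 1" using g mg \<eta> \<delta> marg_le(3)[of ?z] by linarith+
  have mass: "\<eta> / (2 * (C + 1)) \<le> (\<Sum>i=1..n. wYZ n s \<omega> i * indicator A (DX i \<omega>))"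
    if A: "A \<in> ?S" "\<eta> \<le> numYZ A ?w" for A
  proof -
    have "\<eta> / 2 \<le> estYZ n A s \<omega>" using dev1(1)[OF A(1)] A(2) \<delta> by linarith
    then have "\<eta> / 2 / (C + 1) \<le> estYZ n A s \<omega> / f" using f1 \<eta> by (intro frac_le) auto
    then show ?thesis unfolding sum_w_indicator(1)[OF n] f_def by simp
  qed
  \<comment> \<open>Each product of estimates is off by at most 2(C+1)\<delta>. Two products are
    compared, and 8(C+1)\<delta> \<le> \<eta> keeps the total error below \<eta>/2.\<close>
  have prod: "\<bar>x * y - x' * y'\<bar> \<le> 2 * (C + 1) * \<delta>"
    if "\<bar>x - x'\<bar> \<le> \<delta>" "\<bar>y - y'\<bar> \<le> \<delta>" "0 \<le> y" "y \<le> C + 1" "0 \<le> x'" "x' \<le> C" for x y x' y' :: real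
  proof -
    have "x * y - x' * y' = (x - x') * y + x' * (y - y')" by (simp add: algebra_simps)
    then have "\<bar>x * y - x' * y'\<bar> \<le> \<bar>x - x'\<bar> * \<bar>y\<bar> + \<bar>x'\<bar> * \<bar>y - y'\<bar>" by (metis abs_mult abs_triangle_ineq)
    also have "\<dots> \<le> \<delta> * (C + 1) + C * \<delta>" using that \<delta> C_pos by (intro add_mono mult_mono) auto
    finally show ?thesis using \<delta> by (simp add: algebra_simps)
  qed
  have nb: "numYZ A ?w \<le> C" "numZ A ?z \<le> C" if "A \<in> sets borel" for A
    using num_le[OF that] marg_le(2)[of ?w] marg_le(3)[of ?z] order_trans by blast+
  have p1: "\<bar>estYZ n A s \<omega> * g - numYZ A ?w * marg_Z p ?z\<bar> \<le> 2 * (C + 1) * \<delta>"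
    and p2: "\<bar>estZ n A s \<omega> * f - numZ A ?z * marg_YZ p ?w\<bar> \<le> 2 * (C + 1) * \<delta>" if "A \<in> {?Bm, ?Bp}" for A
  proof -
    have A: "A \<in> ?S" "A \<in> sets borel" using that by auto
    show "\<bar>estYZ n A s \<omega> * g - numYZ A ?w * marg_Z p ?z\<bar> \<le> 2 * (C + 1) * \<delta>"
      by (rule prod[OF dev1(1)[OF A(1)] g less_imp_le[OF g1(1)] g1(2) num_nonneg(1) nb(1)[OF A(2)]])
    show "\<bar>estZ n A s \<omega> * f - numZ A ?z * marg_YZ p ?w\<bar> \<le> 2 * (C + 1) * \<delta>"
      by (rule prod[OF dev1(2)[OF A(1)] f less_imp_le[OF f1(1)] f1(2) num_nonneg(2) nb(2)[OF A(2)]])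
  qed
  have fg: "0 < f * g" "f * g \<le> (C + 1)\<^sup>2"
    using f1 g1 C1 by (auto simp: power2_eq_square intro!: mult_mono)
  have quot: "\<eta> / (2 * (C + 1)\<^sup>2) \<le> x / f - y / g" if "\<eta> / 2 \<le> x * g - y * f" for x y
  proof -
    have "\<eta> / 2 / (C + 1)\<^sup>2 \<le> (x * g - y * f) / (f * g)" using that fg \<eta> by (intro frac_le) auto
    also have "\<dots> = x / f - y / g" using f1 g1 by (simp add: field_simps)
    finally show ?thesis by simp
  qed
  have quot': "\<eta> / (2 * (C + 1)\<^sup>2) \<le> y / g - x / f" if "\<eta> / 2 \<le> y * f - x * g" for x y
  proof -
    have "\<eta> / 2 / (C + 1)\<^sup>2 \<le> (y * f - x * g) / (f * g)" using that fg \<eta> by (intro frac_le) auto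
    also have "\<dots> = y / g - x / f" using f1 g1 by (simp add: field_simps)
    finally show ?thesis by simp
  qed
  let ?m = "\<lambda>A. \<Sum>i=1..n. wYZ n s \<omega> i * indicator A (DX i \<omega>)"
  let ?m' = "\<lambda>A. \<Sum>i=1..n. wZ n s \<omega> i * indicator A (DX i \<omega>)"
  have "\<eta> / (2 * (C + 1)\<^sup>2) \<le> ?m ?Bm - ?m' ?Bp \<or> \<eta> / (2 * (C + 1)\<^sup>2) \<le> ?m' ?Bm - ?m ?Bp"
  proof -
    have "4 * (C + 1) * \<delta> = 8 * (C + 1) * \<delta> / 2" by simp
    then have d4: "4 * (C + 1) * \<delta> \<le> \<eta> / 2" using \<delta>(4) by linarith
    consider "\<eta> \<le> numYZ ?Bm ?w * marg_Z p ?z - numZ ?Bp ?z * marg_YZ p ?w"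
      | "\<eta> \<le> numZ ?Bm ?z * marg_YZ p ?w - numYZ ?Bp ?w * marg_Z p ?z" using w by (auto simp: margin_def)
    then show ?thesis
    proof cases
      case 1
      have "\<eta> / 2 \<le> estYZ n ?Bm s \<omega> * g - estZ n ?Bp s \<omega> * f"
      proof -
        have "\<bar>estYZ n ?Bm s \<omega> * g - numYZ ?Bm ?w * marg_Z p ?z\<bar> \<le> 2 * (C + 1) * \<delta>" by (rule p1) simp
        moreover have "\<bar>estZ n ?Bp s \<omega> * f - numZ ?Bp ?z * marg_YZ p ?w\<bar> \<le> 2 * (C + 1) * \<delta>" by (rule p2) simp
        ultimately show ?thesis using 1 d4 by linarith
      qed
      from quot[OF this] show ?thesis unfolding sum_w_indicator[OF n] f_def g_def by simp
    next
      case 2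
      have "\<eta> / 2 \<le> estZ n ?Bm s \<omega> * f - estYZ n ?Bp s \<omega> * g"
      proof -
        have "\<bar>estZ n ?Bm s \<omega> * f - numZ ?Bm ?z * marg_YZ p ?w\<bar> \<le> 2 * (C + 1) * \<delta>" by (rule p2) simp
        moreover have "\<bar>estYZ n ?Bp s \<omega> * g - numYZ ?Bp ?w * marg_Z p ?z\<bar> \<le> 2 * (C + 1) * \<delta>" by (rule p1) simp
        ultimately show ?thesis using 2 d4 by linarith
      qed
      from quot'[OF this] show ?thesis unfolding sum_w_indicator[OF n] f_def g_def by simp
    qed
  qed
  then have "?m (ball u r) * ?m (ball v r) * (\<eta> / (2 * (C + 1)\<^sup>2))\<^sup>2 \<le> bdiv {1..n} (wYZ n s \<omega>) (wZ n s \<omega>) (\<lambda>i. DX i \<omega>)"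
    using \<eta> by (intro bdiv_lower) (auto simp: w_nonneg)
  moreover have "(\<eta> / (2 * (C + 1)))\<^sup>2 * (\<eta> / (2 * (C + 1)\<^sup>2))\<^sup>2 \<le> ?m (ball u r) * ?m (ball v r) * (\<eta> / (2 * (C + 1)\<^sup>2))\<^sup>2"
    unfolding power2_eq_square[of "\<eta> / (2 * (C + 1))"] using mass[of "ball u r"] mass[of "ball v r"] mu mv \<eta> C_pos
    by (intro mult_right_mono mult_mono) (auto intro!: sum_nonneg mult_nonneg_nonneg w_nonneg)
  ultimately show ?thesis by linarith
qed

lemma deviation_meas: "s \<in> {1..n} \<Longrightarrow> deviation u v r n s \<in> borel_measurable \<Omega>"
proof -
  assume s: "s \<in> {1..n}"
  then have s1: "s \<in> {1..}" by auto
  have "(\<lambda>\<omega>. \<bar>estYZ n A s \<omega> - numYZ A (DW s \<omega>)\<bar> + \<bar>estZ n A s \<omega> - numZ A (DZ s \<omega>)\<bar>) \<in> borel_measurable \<Omega>"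
    if "A \<in> sets borel" for A
    using est_meas[OF that s] measurable_compose[OF D_components_meas(2)[OF s1] numYZ_meas[OF that]]
      measurable_compose[OF D_components_meas(3)[OF s1] numZ_meas[OF that]]
    by (intro borel_measurable_add borel_measurable_abs borel_measurable_diff)
  then show ?thesis unfolding deviation_def by (intro borel_measurable_sum) auto
qed

lemma deviation_L1:
  assumes \<epsilon>: "0 < \<epsilon>"
  shows "eventually (\<lambda>n. \<forall>s\<in>{1..n}. (\<integral>\<^sup>+\<omega>. ennreal \<bar>deviation u v r n s \<omega>\<bar> \<partial>\<Omega>) \<le> ennreal (10 * \<epsilon>)) sequentially"
proof -
  let ?S = "{UNIV, ball u r, ball v r, cball u (dist u v - 3 * r), cball u (dist u v + 3 * r)}"
  have Sb: "A \<in> sets borel" if "A \<in> ?S" for A using that by auto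
  have fS: "finite ?S" by simp
  \<comment> \<open>Some of the five sets may coincide, hence only an inequality for the
    cardinality.\<close>
  have cS: "card ?S \<le> 5" by (simp add: card_insert_if)
  have "eventually (\<lambda>n. \<forall>A\<in>?S. (\<forall>s\<in>{1..n}. (\<integral>\<^sup>+\<omega>. ennreal \<bar>estYZ n A s \<omega> - numYZ A (DW s \<omega>)\<bar> \<partial>\<Omega>) \<le> ennreal \<epsilon>) \<and>
      (\<forall>s\<in>{1..n}. (\<integral>\<^sup>+\<omega>. ennreal \<bar>estZ n A s \<omega> - numZ A (DZ s \<omega>)\<bar> \<partial>\<Omega>) \<le> ennreal \<epsilon>)) sequentially"
    using fS by (intro eventually_ball_finite ballI eventually_conj estYZ_L1 estZ_L1 Sb \<epsilon>)
  then show ?thesis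
  proof eventually_elim
    case (elim n)
    show ?case
    proof
      fix s assume s: "s \<in> {1..n}"
      then have s1: "s \<in> {1..}" by auto
      let ?f = "\<lambda>A \<omega>. \<bar>estYZ n A s \<omega> - numYZ A (DW s \<omega>)\<bar>" and ?g = "\<lambda>A \<omega>. \<bar>estZ n A s \<omega> - numZ A (DZ s \<omega>)\<bar>"
      have m: "(\<lambda>\<omega>. ennreal (?f A \<omega>)) \<in> borel_measurable \<Omega>" "(\<lambda>\<omega>. ennreal (?g A \<omega>)) \<in> borel_measurable \<Omega>" if "A \<in> ?S" for A
        using est_meas[OF Sb[OF that] s] measurable_compose[OF D_components_meas(2)[OF s1] numYZ_meas[OF Sb[OF that]]]
          measurable_compose[OF D_components_meas(3)[OF s1] numZ_meas[OF Sb[OF that]]]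
        by (auto intro!: measurable_compose[OF _ measurable_ennreal] borel_measurable_abs borel_measurable_diff)
      have "(\<integral>\<^sup>+\<omega>. ennreal \<bar>deviation u v r n s \<omega>\<bar> \<partial>\<Omega>) = (\<integral>\<^sup>+\<omega>. (\<Sum>A\<in>?S. ennreal (?f A \<omega>) + ennreal (?g A \<omega>)) \<partial>\<Omega>)"
      proof (intro nn_integral_cong)
        fix \<omega>
        have "\<bar>deviation u v r n s \<omega>\<bar> = (\<Sum>A\<in>?S. ?f A \<omega> + ?g A \<omega>)"
          unfolding deviation_def by (intro abs_of_nonneg sum_nonneg) auto
        also have "ennreal \<dots> = (\<Sum>A\<in>?S. ennreal (?f A \<omega> + ?g A \<omega>))" by (intro sum_ennreal[symmetric]) auto
        also have "\<dots> = (\<Sum>A\<in>?S. ennreal (?f A \<omega>) + ennreal (?g A \<omega>))" by (intro sum.cong refl ennreal_plus) auto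
        finally show "ennreal \<bar>deviation u v r n s \<omega>\<bar> = (\<Sum>A\<in>?S. ennreal (?f A \<omega>) + ennreal (?g A \<omega>))" .
      qed
      also have "\<dots> = (\<Sum>A\<in>?S. \<integral>\<^sup>+\<omega>. ennreal (?f A \<omega>) + ennreal (?g A \<omega>) \<partial>\<Omega>)"
        using m by (intro nn_integral_sum borel_measurable_add)
      also have "\<dots> = (\<Sum>A\<in>?S. (\<integral>\<^sup>+\<omega>. ennreal (?f A \<omega>) \<partial>\<Omega>) + (\<integral>\<^sup>+\<omega>. ennreal (?g A \<omega>) \<partial>\<Omega>))"
        using m by (intro sum.cong refl nn_integral_add)
      also have "\<dots> \<le> (\<Sum>A\<in>?S. ennreal \<epsilon> + ennreal \<epsilon>)"
        using elim s by (intro sum_mono add_mono) auto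
      also have "\<dots> = ennreal (real (card ?S) * (2 * \<epsilon>))"
        using \<epsilon> by (simp only: sum_constant) (simp add: ennreal_mult flip: ennreal_plus ennreal_of_nat_eq_real_of_nat)
      also have "\<dots> \<le> ennreal (10 * \<epsilon>)"
        using cS \<epsilon> by (intro ennreal_leI) (simp add: mult_right_mono)
      finally show "(\<integral>\<^sup>+\<omega>. ennreal \<bar>deviation u v r n s \<omega>\<bar> \<partial>\<Omega>) \<le> ennreal (10 * \<epsilon>)" .
    qed
  qed
qed

text \<open>Hoeffding's inequality for a deviation n\<beta>/2 from the mean n\<beta> of summands
  with values in [0,1]; the exponent is -2(n\<beta>/2)^2/n.\<close>

lemma frequency_lower_tail:
  assumes G: "Measurable.pred borel G" and n: "0 < n" and \<beta>: "\<beta> = measure law {e. G (snd e)}"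
  shows "prob {\<omega>\<in>space \<Omega>. (\<Sum>s=1..n. of_bool (G (DW s \<omega>))) \<le> real n * \<beta> / 2} \<le> exp (- (real n * \<beta>\<^sup>2 / 2))"
proof -
  have Gm: "(\<lambda>e. of_bool (G (snd e)) :: real) \<in> borel_measurable (borel :: ('x \<times> 'y \<times> 'z) measure)"
    using measurable_compose[OF borel_fst_snd(2) G] by measurable
  interpret B: indep_interval_bounded_random_variables \<Omega> "{1..n}" "\<lambda>s \<omega>. of_bool (G (DW s \<omega>))" "\<lambda>_. 0" "\<lambda>_. 1"
  proof unfold_locales
    have "indep_vars (\<lambda>_. borel) D {1..n}" by (rule indep_vars_subset[OF D_ind]) auto
    then show "indep_vars (\<lambda>_. borel) (\<lambda>s \<omega>. of_bool (G (DW s \<omega>)) :: real) {1..n}"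
      using Gm by (rule indep_vars_compose2)
  qed auto
  have E: "expectation (\<lambda>\<omega>. of_bool (G (DW s \<omega>))) = \<beta>" if s: "s \<in> {1..n}" for s
  proof -
    have s1: "s \<in> {1..}" using s by auto
    have "expectation (\<lambda>\<omega>. of_bool (G (DW s \<omega>))) = (\<integral>e. (of_bool (G (snd e)) :: real) \<partial>distr \<Omega> borel (D s))"
      by (rule integral_distr[OF D_meas[OF s1] Gm, symmetric])
    also have "\<dots> = (\<integral>e. indicator {e. G (snd e)} e \<partial>law)"
      unfolding D_law[OF s1] by (intro Bochner_Integration.integral_cong) (auto simp: indicator_def)
    also have "\<dots> = \<beta>" unfolding \<beta> by simp
    finally show ?thesis .
  qed
  interpret H: Hoeffding_ineq \<Omega> "{1..n}" "\<lambda>s \<omega>. of_bool (G (DW s \<omega>))" "\<lambda>_. 0" "\<lambda>_. 1"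
    "\<Sum>s=1..n. expectation (\<lambda>\<omega>. of_bool (G (DW s \<omega>)))"
    by unfold_locales simp
  have \<mu>: "(\<Sum>s=1..n. expectation (\<lambda>\<omega>. of_bool (G (DW s \<omega>)))) = real n * \<beta>" using E by simp
  have "0 \<le> \<beta>" unfolding \<beta> by simp
  then have "prob {\<omega>\<in>space \<Omega>. (\<Sum>s=1..n. of_bool (G (DW s \<omega>))) \<le> real n * \<beta> - real n * \<beta> / 2} \<le>
      exp (- 2 * (real n * \<beta> / 2)\<^sup>2 / (\<Sum>s=1..n. (1 - 0)\<^sup>2))"
    using H.Hoeffding_ineq_le[of "real n * \<beta> / 2"] n unfolding \<mu> by simp
  also have "- 2 * (real n * \<beta> / 2)\<^sup>2 / (\<Sum>s=1..n. (1 - 0)\<^sup>2) = - (real n * \<beta>\<^sup>2 / 2)"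
    using n by (simp add: power2_eq_square field_simps)
  finally show ?thesis by (simp add: field_simps)
qed

lemma zeta_hat_D_meas: "(\<lambda>\<omega>. stat n (sample \<omega>)) \<in> borel_measurable \<Omega>"
proof -
  have "(\<lambda>\<omega>. sample_upto n \<omega>) \<in> measurable \<Omega> (PiM {1..n} (\<lambda>_. borel))"
    by (intro measurable_restrict D_meas) auto
  from measurable_compose[OF this zeta_hat_measurable[OF KW.K_nonneg KW.K_meas a_meas]]
  have "(\<lambda>\<omega>. stat n (sample_upto n \<omega>)) \<in> borel_measurable \<Omega>" .
  moreover have "stat n (sample_upto n \<omega>) = stat n (sample \<omega>)" for \<omega>
    by (rule zeta_hat_cong[OF KW.K_nonneg]) simp
  ultimately show ?thesis by simp
qed

text \<open>An index whose observation has a margin and whose estimates are accurate contributes a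
  fixed positive amount. With high probability more than n\<beta>/2 indices have a margin, and
  Markov's inequality shows that inaccurate estimates spoil less than n\<beta>/4 of them.\<close>

lemma zeta_hat_bounded_below:
  assumes nci: "\<not> cond_indep \<Omega> X Y Z"
  obtains \<kappa>0 where "0 < \<kappa>0"
    "\<And>\<epsilon>. 0 < \<epsilon> \<Longrightarrow> eventually (\<lambda>n. prob {\<omega>\<in>space \<Omega>. stat n (sample \<omega>) < \<kappa>0} \<le> \<epsilon>) sequentially"
proof -
  obtain u v r where "0 < r" and nae: "\<not> (AE w in lborel. \<not> separated u v r w)"
    using not_cond_indep_separated[OF nci] by blast
  obtain \<eta> where \<eta>: "0 < \<eta>" "0 < measure law {e. margin u v r \<eta> (snd e)}" using exists_margin[OF nae] by blast
  define \<beta> where "\<beta> = measure law {e. margin u v r \<eta> (snd e)}"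
  have \<beta>: "0 < \<beta>" using \<eta>(2) by (simp add: \<beta>_def)
  define \<delta> where "\<delta> = min 1 (\<eta> / (8 * (C + 1)))"
  have \<delta>: "0 < \<delta>" "\<delta> \<le> 1" "8 * (C + 1) * \<delta> \<le> \<eta>" "2 * \<delta> \<le> \<eta>"
  proof -
    show d: "0 < \<delta>" "\<delta> \<le> 1" using \<eta>(1) C_pos by (auto simp: \<delta>_def)
    have "\<delta> \<le> \<eta> / (8 * (C + 1))" by (simp add: \<delta>_def)
    then show e: "8 * (C + 1) * \<delta> \<le> \<eta>" using C_pos by (simp add: field_simps)
    have "2 * \<delta> \<le> 8 * (C + 1) * \<delta>" using d C_pos by (intro mult_right_mono) auto
    then show "2 * \<delta> \<le> \<eta>" using e by linarith
  qed
  define m where "m = (\<eta> / (2 * (C + 1)))\<^sup>2 * (\<eta> / (2 * (C + 1)\<^sup>2))\<^sup>2"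
  have m: "0 < m" using \<eta>(1) C_pos by (simp add: m_def)
  \<comment> \<open>\<open>m\<close> bounds the divergence and \<eta> the weight function from
    below; \<beta>/4 is the surviving fraction of indices.\<close>
  define \<kappa>0 where "\<kappa>0 = m * \<eta> * (\<beta> / 4)"
  show ?thesis
  proof
    show "0 < \<kappa>0" using m \<eta> \<beta> by (simp add: \<kappa>0_def)
    fix \<epsilon> :: real assume \<epsilon>: "0 < \<epsilon>"
    \<comment> \<open>Chosen to make the Markov bound 10 n\<epsilon>'/\<delta> divided by n\<beta>/4
      equal to \<epsilon>/2.\<close>
    define \<epsilon>' where "\<epsilon>' = \<epsilon> * \<delta> * \<beta> / 80"
    have \<epsilon>': "0 < \<epsilon>'" using \<epsilon> \<delta> \<beta> by (simp add: \<epsilon>'_def)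
    have "(\<lambda>n. exp (- (real n * (\<beta>\<^sup>2 / 2)))) \<longlonglongrightarrow> 0"
      using \<beta> by (intro filterlim_compose[OF exp_at_bot] filterlim_compose[OF filterlim_uminus_at_bot_at_top]
        filterlim_tendsto_pos_mult_at_top[OF tendsto_const, of "\<beta>\<^sup>2 / 2", unfolded mult.commute[of "\<beta>\<^sup>2 / 2"]] filterlim_real_sequentially) auto
    then have "eventually (\<lambda>n. exp (- (real n * (\<beta>\<^sup>2 / 2))) < \<epsilon> / 2) sequentially"
      using \<epsilon> by (intro order_tendstoD) auto
    moreover note deviation_L1[OF \<epsilon>', of u v r] eventually_gt_at_top[of "0::nat"]
    ultimately show "eventually (\<lambda>n. prob {\<omega>\<in>space \<Omega>. stat n (sample \<omega>) < \<kappa>0} \<le> \<epsilon>) sequentially"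
    proof eventually_elim
      case (elim n)
      then have n: "0 < n" by simp
      let ?G = "\<lambda>\<omega>. \<Sum>s=1..n. of_bool (margin u v r \<eta> (DW s \<omega>)) :: real"
      let ?B = "\<lambda>\<omega>. \<Sum>s=1..n. deviation u v r n s \<omega> / \<delta>"
      have dev0: "0 \<le> deviation u v r n s \<omega>" for s \<omega> unfolding deviation_def by (intro sum_nonneg) auto
      have Bm: "?B \<in> borel_measurable \<Omega>" by (intro borel_measurable_sum borel_measurable_divide deviation_meas) auto
      have Gm: "?G \<in> borel_measurable \<Omega>"
      proof (rule borel_measurable_sum)
        fix s assume "s \<in> {1..n}"
        then have "s \<in> {1..}" by auto
        from measurable_compose[OF D_components_meas(2)[OF this] margin_meas]
        show "(\<lambda>\<omega>. of_bool (margin u v r \<eta> (DW s \<omega>)) :: real) \<in> borel_measurable \<Omega>" by measurable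
      qed
      have lower: "m * \<eta> * ((?G \<omega> - ?B \<omega>) / real n) \<le> stat n (sample \<omega>)" for \<omega>
      proof -
        \<comment> \<open>The bracket is at most 1 and is positive only if the observation has a
          margin and its deviation is below \<delta>. Being linear in the deviation, it needs no
          more than a bound on the mean.\<close>
        have t: "m * \<eta> * (of_bool (margin u v r \<eta> (DW s \<omega>)) - deviation u v r n s \<omega> / \<delta>) \<le>
            bdiv {1..n} (wYZ n s \<omega>) (wZ n s \<omega>) (\<lambda>i. DX i \<omega>) * a (DW s \<omega>)" (is "?l \<le> ?r") for s
        proof (cases "margin u v r \<eta> (DW s \<omega>) \<and> deviation u v r n s \<omega> \<le> \<delta>")
          case True
          then have b: "m \<le> bdiv {1..n} (wYZ n s \<omega>) (wZ n s \<omega>) (\<lambda>i. DX i \<omega>)"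
            unfolding m_def using n \<eta>(1) \<delta> by (intro bdiv_lower_of_estimates) auto
          have "0 \<le> deviation u v r n s \<omega> / \<delta>" using dev0 \<delta>(1) by (intro divide_nonneg_nonneg) auto
          then have "of_bool (margin u v r \<eta> (DW s \<omega>)) - deviation u v r n s \<omega> / \<delta> \<le> 1"
            by (simp add: of_bool_def)
          then have "?l \<le> m * \<eta> * 1" using m \<eta>(1) by (intro mult_left_mono) auto
          also have "\<dots> \<le> ?r" using b m \<eta>(1) True by (simp, intro mult_mono) (auto simp: margin_def)
          finally show ?thesis .
        next
          case False
          have "of_bool (margin u v r \<eta> (DW s \<omega>)) - deviation u v r n s \<omega> / \<delta> \<le> 0"
          proof (cases "margin u v r \<eta> (DW s \<omega>)")
            case True
            then show ?thesis using False \<delta>(1) by simp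
          next
            case no: False
            have "0 \<le> deviation u v r n s \<omega> / \<delta>" using dev0 \<delta>(1) by (intro divide_nonneg_nonneg) auto
            then show ?thesis using no by simp
          qed
          then have "?l \<le> 0" using m \<eta>(1) by (intro mult_nonneg_nonpos) auto
          also have "0 \<le> ?r" by (intro mult_nonneg_nonneg bdiv_nonneg w_nonneg a0)
          finally show ?thesis .
        qed
        have "m * \<eta> * ((?G \<omega> - ?B \<omega>) / real n) =
          1 / real n * (\<Sum>s=1..n. m * \<eta> * (of_bool (margin u v r \<eta> (DW s \<omega>)) - deviation u v r n s \<omega> / \<delta>))"
          unfolding sum_distrib_left[symmetric] sum_subtractf by simp
        also have "\<dots> \<le> stat n (sample \<omega>)"
          unfolding zeta_hat_eq_id by (intro mult_left_mono sum_mono t) auto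
        finally show ?thesis .
      qed
      have sub: "{\<omega>\<in>space \<Omega>. stat n (sample \<omega>) < \<kappa>0} \<subseteq>
        {\<omega>\<in>space \<Omega>. ?G \<omega> \<le> real n * \<beta> / 2} \<union> {\<omega>\<in>space \<Omega>. real n * \<beta> / 4 \<le> ?B \<omega>}"
      proof (intro subsetI, rule ccontr)
        fix \<omega> assume \<omega>: "\<omega> \<in> {\<omega>\<in>space \<Omega>. stat n (sample \<omega>) < \<kappa>0}"
          and no: "\<omega> \<notin> {\<omega>\<in>space \<Omega>. ?G \<omega> \<le> real n * \<beta> / 2} \<union> {\<omega>\<in>space \<Omega>. real n * \<beta> / 4 \<le> ?B \<omega>}"
        have "real n * \<beta> / 4 \<le> ?G \<omega> - ?B \<omega>" using \<omega> no by simp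
        then have "\<beta> / 4 \<le> (?G \<omega> - ?B \<omega>) / real n" using n by (simp add: field_simps)
        then have "\<kappa>0 \<le> m * \<eta> * ((?G \<omega> - ?B \<omega>) / real n)"
          unfolding \<kappa>0_def using m \<eta>(1) by (intro mult_left_mono) auto
        then show False using lower[of \<omega>] \<omega> by simp
      qed
      have S1: "{\<omega>\<in>space \<Omega>. ?G \<omega> \<le> real n * \<beta> / 2} \<in> events"
        by (rule borel_measurable_le[OF Gm borel_measurable_const])
      have S2: "{\<omega>\<in>space \<Omega>. real n * \<beta> / 4 \<le> ?B \<omega>} \<in> events"
        by (rule borel_measurable_le[OF borel_measurable_const Bm])
      have "prob {\<omega>\<in>space \<Omega>. stat n (sample \<omega>) < \<kappa>0} \<le>
        prob ({\<omega>\<in>space \<Omega>. ?G \<omega> \<le> real n * \<beta> / 2} \<union> {\<omega>\<in>space \<Omega>. real n * \<beta> / 4 \<le> ?B \<omega>})"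
        by (rule finite_measure_mono[OF sub sets.Un[OF S1 S2]])
      also have "\<dots> \<le> prob {\<omega>\<in>space \<Omega>. ?G \<omega> \<le> real n * \<beta> / 2} + prob {\<omega>\<in>space \<Omega>. real n * \<beta> / 4 \<le> ?B \<omega>}"
        by (rule measure_Un_le[OF S1 S2])
      also have "prob {\<omega>\<in>space \<Omega>. ?G \<omega> \<le> real n * \<beta> / 2} \<le> \<epsilon> / 2"
        using frequency_lower_tail[OF margin_meas n \<beta>_def] elim by simp
      also have "prob {\<omega>\<in>space \<Omega>. real n * \<beta> / 4 \<le> ?B \<omega>} \<le> real n * (10 * \<epsilon>' / \<delta>) / (real n * \<beta> / 4)"
      proof (rule prob_ge_le_of_L1[OF Bm])
        have "(\<integral>\<^sup>+\<omega>. ennreal \<bar>?B \<omega>\<bar> \<partial>\<Omega>) = (\<integral>\<^sup>+\<omega>. (\<Sum>s=1..n. ennreal \<bar>deviation u v r n s \<omega>\<bar> * ennreal (1 / \<delta>)) \<partial>\<Omega>)"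
        proof (intro nn_integral_cong)
          fix \<omega>
          have "\<bar>?B \<omega>\<bar> = (\<Sum>s=1..n. \<bar>deviation u v r n s \<omega>\<bar> * (1 / \<delta>))"
          proof -
            have "0 \<le> ?B \<omega>" using dev0 \<delta>(1) by (intro sum_nonneg divide_nonneg_nonneg) simp_all
            then have "\<bar>?B \<omega>\<bar> = ?B \<omega>" by (rule abs_of_nonneg)
            also have "\<dots> = (\<Sum>s=1..n. \<bar>deviation u v r n s \<omega>\<bar> * (1 / \<delta>))"
              by (intro sum.cong refl) (simp only: abs_of_nonneg[OF dev0] times_divide_eq_right mult_1_right)
            finally show ?thesis .
          qed
          also have "ennreal \<dots> = (\<Sum>s=1..n. ennreal (\<bar>deviation u v r n s \<omega>\<bar> * (1 / \<delta>)))"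
          proof (rule sum_ennreal[symmetric])
            show "0 \<le> \<bar>deviation u v r n s \<omega>\<bar> * (1 / \<delta>)" for s
              using \<delta>(1) by (intro mult_nonneg_nonneg) simp_all
          qed
          also have "\<dots> = (\<Sum>s=1..n. ennreal \<bar>deviation u v r n s \<omega>\<bar> * ennreal (1 / \<delta>))"
            using \<delta>(1) by (intro sum.cong refl ennreal_mult) auto
          finally show "ennreal \<bar>?B \<omega>\<bar> = (\<Sum>s=1..n. ennreal \<bar>deviation u v r n s \<omega>\<bar> * ennreal (1 / \<delta>))" .
        qed
        also have "\<dots> = (\<Sum>s=1..n. (\<integral>\<^sup>+\<omega>. ennreal \<bar>deviation u v r n s \<omega>\<bar> \<partial>\<Omega>) * ennreal (1 / \<delta>))"
        proof -
          have dm: "(\<lambda>\<omega>. ennreal \<bar>deviation u v r n s \<omega>\<bar>) \<in> borel_measurable \<Omega>" if "s \<in> {1..n}" for s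
            using deviation_meas[OF that] by measurable
          show ?thesis using dm by (subst nn_integral_sum) (auto intro!: sum.cong nn_integral_multc)
        qed
        also have "\<dots> \<le> (\<Sum>s=1..n. ennreal (10 * \<epsilon>') * ennreal (1 / \<delta>))"
          using elim by (intro sum_mono mult_right_mono) auto
        also have "\<dots> = ennreal (real n * (10 * \<epsilon>' / \<delta>))"
          using \<epsilon>' \<delta>(1) by (simp add: ennreal_mult[symmetric] ennreal_of_nat_eq_real_of_nat)
        finally show "(\<integral>\<^sup>+\<omega>. ennreal \<bar>?B \<omega>\<bar> \<partial>\<Omega>) \<le> ennreal (real n * (10 * \<epsilon>' / \<delta>))" .
      qed (use n \<beta> \<epsilon>' \<delta>(1) in auto)
      also have "real n * (10 * \<epsilon>' / \<delta>) / (real n * \<beta> / 4) = \<epsilon> / 2"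
        using n \<delta>(1) \<beta> by (simp add: \<epsilon>'_def field_simps)
      finally show ?case by simp
    qed
  qed
qed

end

section \<open>Exchanging two observations\<close>

context permutation_model
begin

text \<open>
  The relative loss of likelihood when the first components of the observations \<open>j\<close> and \<open>k\<close> are exchanged;
  it is at most 1 also when the likelihood vanishes, because of \<^prop>\<open>(x::real) / 0 = 0\<close>.
\<close>

definition swap_defect :: "nat \<Rightarrow> nat \<Rightarrow> (nat \<Rightarrow> 'x \<times> 'w) \<Rightarrow> real"
  where "swap_defect j k d = max 0 (1 - q (fst (d k), snd (d j)) * q (fst (d j), snd (d k)) / (q (d j) * q (d k)))"

lemma swap_defect_bounds: "0 \<le> swap_defect j k d" "swap_defect j k d \<le> 1"
  using q_nonneg by (auto simp: swap_defect_def)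

lemma swap_defect_meas:
  assumes "j \<in> I" "k \<in> I"
  shows "swap_defect j k \<in> borel_measurable base"
proof -
  have [measurable]: "(\<lambda>d. d j) \<in> measurable base (M \<Otimes>\<^sub>M N)" "(\<lambda>d. d k) \<in> measurable base (M \<Otimes>\<^sub>M N)"
    using assms by (auto intro: measurable_component_singleton)
  show ?thesis unfolding swap_defect_def by measurable
qed

text \<open>All factors except those at \<open>j\<close> and \<open>k\<close> agree in the two
  likelihoods. If one of the two original factors vanishes, so does \<open>lik d\<close>, and both
  sides are 0.\<close>

lemma lik_swap_defect:
  assumes jk: "j \<in> I" "k \<in> I" "j \<noteq> k"
  shows "lik d * swap_defect j k d = max 0 (lik d - lik (permute_fst (Transposition.transpose j k) d))"
proof -
  let ?T = "Transposition.transpose j k"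
  define r where "r = (\<Prod>i\<in>I - {j} - {k}. q (d i))"
  have r0: "0 \<le> r" unfolding r_def by (intro prod_nonneg) (simp add: q_nonneg)
  define u where "u = q (d j) * q (d k)"
  define v where "v = q (fst (d k), snd (d j)) * q (fst (d j), snd (d k))"
  have uv0: "0 \<le> u" "0 \<le> v" by (simp_all add: u_def v_def q_nonneg)
  have k: "k \<in> I - {j}" using jk by auto
  have l: "lik d = u * r"
    unfolding lik_def r_def u_def using fin by (simp add: prod.remove[OF fin jk(1)] prod.remove[OF _ k] mult.assoc)
  have "lik (permute_fst ?T d) = q (permute_fst ?T d j) * (q (permute_fst ?T d k) * (\<Prod>i\<in>I - {j} - {k}. q (permute_fst ?T d i)))"
    unfolding lik_def using fin by (simp add: prod.remove[OF fin jk(1)] prod.remove[OF _ k])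
  also have "(\<Prod>i\<in>I - {j} - {k}. q (permute_fst ?T d i)) = r"
    unfolding r_def by (intro prod.cong refl) (auto simp: permute_fst_def transpose_apply_other)
  finally have l': "lik (permute_fst ?T d) = v * r"
    by (simp add: permute_fst_def v_def mult.assoc)
  show ?thesis
  proof (cases "u = 0")
    case True
    then show ?thesis using uv0 r0 by (simp add: l l')
  next
    case False
    then have u: "0 < u" using uv0 by simp
    have "lik d * swap_defect j k d = (u * r) * max 0 (1 - v / u)" unfolding l swap_defect_def u_def v_def ..
    also have "\<dots> = max ((u * r) * 0) ((u * r) * (1 - v / u))"
      using u r0 by (simp add: max_mult_distrib_left)
    also have "(u * r) * (1 - v / u) = u * r - v * r" using u by (simp add: field_simps)
    finally show ?thesis by (simp add: l l')
  qed
qed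

text \<open>Composing with the transposition exchanges two observations of the already permuted
  data, while the orbit sum is unchanged; the loss of weight is then the relative loss of likelihood
  there.\<close>

lemma perm_weight_swap:
  assumes jk: "j \<in> I" "k \<in> I" "j \<noteq> k"
  shows "max 0 (perm_weight \<sigma> d - perm_weight (\<sigma> \<circ> Transposition.transpose j k) d) = perm_weight \<sigma> d * swap_defect j k (permute_fst \<sigma> d)"
proof -
  let ?T = "Transposition.transpose j k"
  let ?S = "\<Sum>\<tau> | \<tau> permutes I. lik (permute_fst \<tau> d)"
  have S0: "0 \<le> ?S" by (intro sum_nonneg lik_nonneg)
  have "max 0 (perm_weight \<sigma> d - perm_weight (\<sigma> \<circ> ?T) d) =
      max 0 ((lik (permute_fst \<sigma> d) - lik (permute_fst ?T (permute_fst \<sigma> d))) / ?S)"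
    unfolding perm_weight_def permute_fst_permute_fst by (simp add: diff_divide_distrib)
  also have "\<dots> = max 0 (lik (permute_fst \<sigma> d) - lik (permute_fst ?T (permute_fst \<sigma> d))) / ?S"
    using S0 by (simp add: max_divide_distrib_right)
  also have "\<dots> = perm_weight \<sigma> d * swap_defect j k (permute_fst \<sigma> d)"
    unfolding lik_swap_defect[OF jk, symmetric] perm_weight_def by simp
  finally show ?thesis .
qed

text \<open>By \<open>perm_weight_swap\<close> this is, for distinct \<open>j\<close> and
  \<open>k\<close>, the sum of positive parts that appears in
  \<open>permuted_bdiv_bound\<close>.\<close>

definition mean_defect :: "nat \<Rightarrow> nat \<Rightarrow> (nat \<Rightarrow> 'x \<times> 'w) \<Rightarrow> real"
  where "mean_defect j k d = (\<Sum>\<sigma> | \<sigma> permutes I. perm_weight \<sigma> d * swap_defect j k (permute_fst \<sigma> d))"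

lemma mean_defect_bounds: "0 \<le> mean_defect j k d" "mean_defect j k d \<le> 1"
proof -
  show "0 \<le> mean_defect j k d" unfolding mean_defect_def
    by (intro sum_nonneg mult_nonneg_nonneg perm_weight_nonneg swap_defect_bounds)
  have "mean_defect j k d \<le> (\<Sum>\<sigma> | \<sigma> permutes I. perm_weight \<sigma> d * 1)"
    unfolding mean_defect_def by (intro sum_mono mult_left_mono perm_weight_nonneg swap_defect_bounds)
  also have "\<dots> \<le> 1" using sum_perm_weight_le_1 by simp
  finally show "mean_defect j k d \<le> 1" .
qed

lemma mean_defect_meas:
  assumes jk: "j \<in> I" "k \<in> I"
  shows "mean_defect j k \<in> borel_measurable base"
  unfolding mean_defect_def
  by (intro borel_measurable_sum borel_measurable_times perm_weight_meas
    measurable_compose[OF measurable_permute_fst swap_defect_meas[OF jk]]) auto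

text \<open>A factor that depends on second components only is constant on orbits, so the resampling
  invariance applies to its product with the defect. The random permutation disappears, and two
  observations of the original sample remain.\<close>

lemma nn_integral_mean_defect:
  assumes jk: "j \<in> I" "k \<in> I"
    and [measurable]: "\<psi> \<in> borel_measurable base" and inv: "\<And>\<sigma> d. \<psi> (permute_fst \<sigma> d) = \<psi> d"
  shows "(\<integral>\<^sup>+d. ennreal (lik d) * (\<psi> d * ennreal (mean_defect j k d)) \<partial>base) =
    (\<integral>\<^sup>+d. ennreal (lik d) * (\<psi> d * ennreal (swap_defect j k d)) \<partial>base)"
proof -
  note [measurable] = swap_defect_meas[OF jk]
  have "(\<integral>\<^sup>+d. ennreal (lik d) * (\<psi> d * ennreal (mean_defect j k d)) \<partial>base) =
    (\<integral>\<^sup>+d. ennreal (lik d) * (\<Sum>\<sigma> | \<sigma> permutes I. ennreal (perm_weight \<sigma> d) * (\<psi> (permute_fst \<sigma> d) * ennreal (swap_defect j k (permute_fst \<sigma> d)))) \<partial>base)"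
  proof (intro nn_integral_cong arg_cong2[of _ _ _ _ "(*)"] refl)
    fix d
    have "ennreal (mean_defect j k d) = (\<Sum>\<sigma> | \<sigma> permutes I. ennreal (perm_weight \<sigma> d) * ennreal (swap_defect j k (permute_fst \<sigma> d)))"
      unfolding mean_defect_def
      by (subst sum_ennreal[symmetric]) (auto simp: ennreal_mult perm_weight_nonneg swap_defect_bounds)
    then show "\<psi> d * ennreal (mean_defect j k d) =
      (\<Sum>\<sigma> | \<sigma> permutes I. ennreal (perm_weight \<sigma> d) * (\<psi> (permute_fst \<sigma> d) * ennreal (swap_defect j k (permute_fst \<sigma> d))))"
      unfolding inv by (simp add: sum_distrib_left mult.left_commute)
  qed
  also have "\<dots> = (\<integral>\<^sup>+d. ennreal (lik d) * (\<psi> d * ennreal (swap_defect j k d)) \<partial>base)"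
    by (rule nn_integral_random_permutation) measurable
  finally show ?thesis .
qed

end

section \<open>Conditional densities and slices of p_{X,Z}\<close>

context joint_density
begin

lemma cond_density_meas[measurable]: "qXZ \<in> borel_measurable borel"
  unfolding cond_density_def by measurable

lemma cond_density_meas_x[measurable]: "(\<lambda>x. cond_density p x z) \<in> borel_measurable borel"
  unfolding cond_density_def by measurable

lemma cond_density_nonneg: "0 \<le> cond_density p x z"
  unfolding cond_density_def by (simp add: marg_nonneg)

text \<open>The integral is 0 instead of 1 where the marginal density of \<open>Z\<close> vanishes,
  hence an inequality.\<close>

lemma cond_density_int: "(\<integral>\<^sup>+x. ennreal (cond_density p x z) \<partial>lborel) \<le> 1"
proof -
  have "(\<integral>\<^sup>+x. ennreal (cond_density p x z) \<partial>lborel) = (\<integral>\<^sup>+x. ennreal (marg_XZ p (x, z)) * ennreal (1 / marg_Z p z) \<partial>lborel)"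
    by (intro nn_integral_cong) (simp add: cond_density_def marg_nonneg flip: ennreal_mult)
  also have "\<dots> = ennreal (marg_Z p z) * ennreal (1 / marg_Z p z)"
    by (subst nn_integral_multc) (auto simp: marg_Z_eq_x)
  also have "\<dots> = ennreal (marg_Z p z * (1 / marg_Z p z))" by (simp add: marg_nonneg flip: ennreal_mult)
  also have "\<dots> \<le> 1" by (cases "marg_Z p z = 0") auto
  finally show ?thesis .
qed

text \<open>Where the marginal density of \<open>Z\<close> vanishes, the slice of p_{X,Z} integrates
  to 0; it is then 0 only almost everywhere, which limits the factorisation to almost all
  \<open>x\<close>.\<close>

lemma marg_XZ_factor: "AE x in lborel. ennreal (marg_XZ p (x, z)) = ennreal (marg_Z p z) * ennreal (cond_density p x z)"
proof (cases "marg_Z p z = 0")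
  case True
  have "(\<integral>\<^sup>+x. ennreal (marg_XZ p (x, z)) \<partial>lborel) = 0" using True marg_Z_eq_x[of z] by simp
  then have "AE x in lborel. ennreal (marg_XZ p (x, z)) = 0" by (subst (asm) nn_integral_0_iff_AE) auto
  then show ?thesis using True by simp
next
  case False
  then show ?thesis by (simp add: cond_density_def marg_nonneg flip: ennreal_mult)
qed

lemma nn_integral_lawXZ:
  assumes [measurable]: "f \<in> borel_measurable borel"
  shows "(\<integral>\<^sup>+e. f e \<partial>lawXZ) = (\<integral>\<^sup>+z. \<integral>\<^sup>+x. ennreal (marg_Z p z) * ennreal (cond_density p x z) * f (x, z) \<partial>lborel \<partial>lborel)"
proof -
  have "(\<integral>\<^sup>+e. f e \<partial>lawXZ) = (\<integral>\<^sup>+z. \<integral>\<^sup>+x. ennreal (marg_XZ p (x, z)) * f (x, z) \<partial>lborel \<partial>lborel)"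
    by (subst nn_integral_density, simp, simp, subst nn_integral_lborel_prod(2)) auto
  also have "\<dots> = (\<integral>\<^sup>+z. \<integral>\<^sup>+x. ennreal (marg_Z p z) * ennreal (cond_density p x z) * f (x, z) \<partial>lborel \<partial>lborel)"
  proof (rule nn_integral_cong)
    fix z
    show "(\<integral>\<^sup>+x. ennreal (marg_XZ p (x, z)) * f (x, z) \<partial>lborel) =
      (\<integral>\<^sup>+x. ennreal (marg_Z p z) * ennreal (cond_density p x z) * f (x, z) \<partial>lborel)"
      by (rule nn_integral_cong_AE) (use marg_XZ_factor[of z] in eventually_elim, simp)
  qed
  finally show ?thesis .
qed

lemma prob_lawZ: "prob_space lawZ"
  using marg_int(3) by (intro prob_spaceI) (simp add: emeasure_density)

lemma sets_XZ_base: "sets (lborel \<Otimes>\<^sub>M lawZ) = sets (borel :: ('x \<times> 'z) measure)"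
proof -
  have "sets (lborel \<Otimes>\<^sub>M lawZ) = sets ((borel :: 'x measure) \<Otimes>\<^sub>M (borel :: 'z measure))"
    by (intro sets_pair_measure_cong) auto
  then show ?thesis by (simp only: borel_prod)
qed

text \<open>Disintegration of p_{X,Z} along \<open>Z\<close>, valid under null hypothesis and
  alternative alike. It makes the pairs (X_i,Z_i) an instance of \<open>permutation_model\<close>
  and so provides the resampling invariance for the power.\<close>

lemma lawXZ_density: "distr M (lborel \<Otimes>\<^sub>M lawZ) E = density (lborel \<Otimes>\<^sub>M lawZ) (\<lambda>e. ennreal (cond_density p (fst e) (snd e)))"
  if E: "distr M borel E = lawXZ" and Em: "E \<in> measurable M borel"
proof (rule measure_eqI)
  interpret N: prob_space lawZ by (rule prob_lawZ)
  interpret LN: pair_sigma_finite lborel lawZ ..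
  fix A assume "A \<in> sets (distr M (lborel \<Otimes>\<^sub>M lawZ) E)"
  then have A': "A \<in> sets (lborel \<Otimes>\<^sub>M lawZ)" by simp
  then have A[measurable]: "A \<in> sets (borel :: ('x \<times> 'z) measure)" unfolding sets_XZ_base .
  have cm: "(\<lambda>e. ennreal (cond_density p (fst e) (snd e))) \<in> borel_measurable (lborel \<Otimes>\<^sub>M lawZ)"
    using cond_density_meas unfolding measurable_cong_sets[OF sets_XZ_base refl] by measurable
  have "emeasure (distr M (lborel \<Otimes>\<^sub>M lawZ) E) A = emeasure (distr M borel E) A"
  proof -
    have "E \<in> measurable M (lborel \<Otimes>\<^sub>M lawZ)" using Em unfolding measurable_cong_sets[OF refl sets_XZ_base] .
    then show ?thesis by (simp add: emeasure_distr[OF _ A'] emeasure_distr[OF Em A])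
  qed
  also have "\<dots> = (\<integral>\<^sup>+e. indicator A e \<partial>lawXZ)" unfolding E by simp
  also have "\<dots> = (\<integral>\<^sup>+z. ennreal (marg_Z p z) * (\<integral>\<^sup>+x. ennreal (cond_density p x z) * indicator A (x, z) \<partial>lborel) \<partial>lborel)"
  proof (subst nn_integral_lawXZ)
    show "(\<integral>\<^sup>+z. \<integral>\<^sup>+x. ennreal (marg_Z p z) * ennreal (cond_density p x z) * indicator A (x, z) \<partial>lborel \<partial>lborel) =
      (\<integral>\<^sup>+z. ennreal (marg_Z p z) * (\<integral>\<^sup>+x. ennreal (cond_density p x z) * indicator A (x, z) \<partial>lborel) \<partial>lborel)"
      unfolding mult.assoc by (intro nn_integral_cong nn_integral_cmult) measurable
  qed measurable
  also have "\<dots> = (\<integral>\<^sup>+z. \<integral>\<^sup>+x. ennreal (cond_density p x z) * indicator A (x, z) \<partial>lborel \<partial>lawZ)"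
  proof -
    have "(\<lambda>z. \<integral>\<^sup>+x. ennreal (cond_density p x z) * indicator A (x, z) \<partial>lborel) \<in> borel_measurable lborel"
      unfolding cond_density_def by measurable
    then show ?thesis by (intro nn_integral_density[symmetric]) auto
  qed
  also have "\<dots> = (\<integral>\<^sup>+e. ennreal (cond_density p (fst e) (snd e)) * indicator A e \<partial>(lborel \<Otimes>\<^sub>M lawZ))"
    using cm A' by (subst LN.nn_integral_snd[symmetric]) auto
  also have "\<dots> = emeasure (density (lborel \<Otimes>\<^sub>M lawZ) (\<lambda>e. ennreal (cond_density p (fst e) (snd e)))) A"
    using cm A' by (intro emeasure_density[symmetric])
  finally show "emeasure (distr M (lborel \<Otimes>\<^sub>M lawZ) E) A = emeasure (density (lborel \<Otimes>\<^sub>M lawZ) (\<lambda>e. ennreal (cond_density p (fst e) (snd e)))) A" .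
qed simp

lemma permutation_model_XZ: "permutation_model {1..n} lborel lawZ qXZ"
proof unfold_locales
  interpret N: prob_space lawZ by (rule prob_lawZ)
  show "\<exists>A. countable A \<and> A \<subseteq> sets lawZ \<and> \<Union> A = space lawZ \<and> (\<forall>a\<in>A. emeasure lawZ a \<noteq> \<infinity>)"
    by (rule N.sigma_finite_countable)
  show "qXZ \<in> borel_measurable (lborel \<Otimes>\<^sub>M lawZ)"
    using cond_density_meas unfolding measurable_cong_sets[OF sets_XZ_base refl] .
qed (auto simp: cond_density_nonneg intro: lborel.sigma_finite_countable)

text \<open>The slices are not normalised: integrated over \<open>z\<close>, their distance becomes
  the mean distance of p_{X,Z} from a translate of itself, see
  \<open>slice_dist_shift\<close>.\<close>

definition slice_dist :: "'z \<Rightarrow> 'z \<Rightarrow> ennreal"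
  where "slice_dist z z' = (\<integral>\<^sup>+x. ennreal \<bar>marg_XZ p (x, z) - marg_XZ p (x, z')\<bar> \<partial>lborel)"

lemma slice_dist_meas[measurable]:
  assumes [measurable]: "f \<in> borel_measurable M" "g \<in> borel_measurable M"
  shows "(\<lambda>t. slice_dist (f t) (g t)) \<in> borel_measurable M"
  unfolding slice_dist_def by measurable

lemma marg_Z_diff_le: "ennreal \<bar>marg_Z p z - marg_Z p z'\<bar> \<le> slice_dist z z'"
proof -
  have i: "integrable lborel (\<lambda>x. marg_XZ p (x, z))" for z
    using marg_Z_eq_x[of z, symmetric] by (intro integrableI_nonneg) (auto simp: marg_nonneg)
  have m: "marg_Z p z = (\<integral>x. marg_XZ p (x, z) \<partial>lborel)" for z
  proof -
    have "ennreal (marg_Z p z) = ennreal (\<integral>x. marg_XZ p (x, z) \<partial>lborel)"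
      unfolding marg_Z_eq_x by (intro nn_integral_eq_integral i) (auto simp: marg_nonneg)
    then show ?thesis by (subst (asm) ennreal_inj) (auto simp: marg_nonneg intro!: integral_nonneg_AE)
  qed
  have "marg_Z p z - marg_Z p z' = (\<integral>x. marg_XZ p (x, z) - marg_XZ p (x, z') \<partial>lborel)"
    unfolding m by (intro Bochner_Integration.integral_diff[symmetric] i)
  then show ?thesis
    unfolding slice_dist_def real_norm_def[symmetric] using i by (simp only:) (intro integral_norm_bound_ennreal, auto)
qed

text \<open>The loss is the positive part of a 2 x 2 determinant of conditional densities. It splits
  into two products, in each of which one factor integrates to at most one and the other is a
  difference of conditional densities at \<open>z\<close> and \<open>z'\<close>; each product
  contributes 2C times the slice distance.\<close>

lemma defect_slice_bound:
  "(\<integral>\<^sup>+x. \<integral>\<^sup>+x'. ennreal (marg_Z p z * marg_Z p z' * max 0 (cond_density p x z * cond_density p x' z' - cond_density p x' z * cond_density p x z')) \<partial>lborel \<partial>lborel)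
    \<le> ennreal (4 * C) * slice_dist z z'"
proof (cases "marg_Z p z = 0 \<or> marg_Z p z' = 0")
  case True
  then show ?thesis by auto
next
  case False
  let ?m = "marg_Z p z" and ?m' = "marg_Z p z'"
  let ?q = "cond_density p" and ?\<mu> = "\<lambda>x z. marg_XZ p (x, z)"
  have mpos: "0 < ?m" "0 < ?m'" using False marg_nonneg(3)[of z] marg_nonneg(3)[of z'] by auto
  have \<mu>: "?\<mu> x z = ?m * ?q x z" "?\<mu> x z' = ?m' * ?q x z'" for x using mpos by (auto simp: cond_density_def)
  have q0: "0 \<le> ?q x z" for x z by (rule cond_density_nonneg)
  define A where "A x = \<bar>?\<mu> x z - ?\<mu> x z'\<bar>" for x
  have A0: "0 \<le> A x" for x by (simp add: A_def)
  have [measurable]: "A \<in> borel_measurable borel" unfolding A_def by measurable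
  define dm where "dm = \<bar>?m - ?m'\<bar>"
  have dm0: "0 \<le> dm" by (simp add: dm_def)
  \<comment> \<open>Multiplication by both marginal densities clears the denominators. The
    difference of slices then appears together with the difference of the marginals, which is
    bounded by the same slice distance.\<close>
  have mm: "?m * ?m' * \<bar>?q x z - ?q x z'\<bar> \<le> C * A x + ?\<mu> x z * dm" for x
  proof -
    have "?m * ?m' * \<bar>?q x z - ?q x z'\<bar> = \<bar>?m' * ?\<mu> x z - ?m * ?\<mu> x z'\<bar>"
      using mpos by (simp add: \<mu> abs_mult[symmetric] right_diff_distrib mult_ac) (simp add: abs_mult mpos less_imp_le right_diff_distrib[symmetric] mult.assoc[symmetric])
    also have "?m' * ?\<mu> x z - ?m * ?\<mu> x z' = ?m * (?\<mu> x z - ?\<mu> x z') + ?\<mu> x z * (?m' - ?m)" by (simp add: algebra_simps)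
    also have "\<bar>\<dots>\<bar> \<le> ?m * A x + ?\<mu> x z * dm"
      unfolding A_def dm_def by (rule order_trans[OF abs_triangle_ineq]) (simp add: abs_mult marg_nonneg abs_minus_commute)
    also have "\<dots> \<le> C * A x + ?\<mu> x z * dm" using marg_le(3)[of z] A0 dm0 by (intro add_mono mult_right_mono) auto
    finally show ?thesis .
  qed
  define B where "B x = C * A x + ?\<mu> x z * dm" for x
  have B0: "0 \<le> B x" for x unfolding B_def dm_def using A0 C_pos by (simp add: marg_nonneg)
  have [measurable]: "B \<in> borel_measurable borel" unfolding B_def by measurable
  have intB: "(\<integral>\<^sup>+x. ennreal (B x) \<partial>lborel) \<le> ennreal (2 * C) * slice_dist z z'"
  proof -
    have "(\<integral>\<^sup>+x. ennreal (B x) \<partial>lborel) = (\<integral>\<^sup>+x. ennreal C * ennreal (A x) + ennreal (?\<mu> x z) * ennreal dm \<partial>lborel)"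
      unfolding B_def using A0 C_pos by (intro nn_integral_cong) (simp add: dm_def marg_nonneg ennreal_mult)
    also have "\<dots> = ennreal C * slice_dist z z' + ennreal ?m * ennreal dm"
      unfolding slice_dist_def A_def[symmetric] by (subst nn_integral_add) (auto simp: nn_integral_cmult nn_integral_multc marg_Z_eq_x)
    also have "\<dots> \<le> ennreal C * slice_dist z z' + ennreal C * slice_dist z z'"
      unfolding dm_def by (intro add_mono mult_mono ennreal_leI marg_le marg_Z_diff_le) auto
    also have "\<dots> = ennreal (2 * C) * slice_dist z z'"
      using C_pos by (simp add: distrib_right[symmetric] ennreal_plus[symmetric] del: ennreal_plus)
    finally show ?thesis .
  qed
  have pw: "?m * ?m' * max 0 (?q x z * ?q x' z' - ?q x' z * ?q x z') \<le> ?q x z * B x' + ?q x' z * B x" for x x'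
  proof -
    have "?q x z * ?q x' z' - ?q x' z * ?q x z' = ?q x z * (?q x' z' - ?q x' z) + ?q x' z * (?q x z - ?q x z')"
      by (simp add: algebra_simps)
    also have "\<dots> \<le> ?q x z * \<bar>?q x' z - ?q x' z'\<bar> + ?q x' z * \<bar>?q x z - ?q x z'\<bar>"
      using q0 by (intro add_mono mult_left_mono) auto
    finally have "max 0 (?q x z * ?q x' z' - ?q x' z * ?q x z') \<le> ?q x z * \<bar>?q x' z - ?q x' z'\<bar> + ?q x' z * \<bar>?q x z - ?q x z'\<bar>"
      using q0 by simp
    then have "?m * ?m' * max 0 (?q x z * ?q x' z' - ?q x' z * ?q x z') \<le> ?m * ?m' * (?q x z * \<bar>?q x' z - ?q x' z'\<bar> + ?q x' z * \<bar>?q x z - ?q x z'\<bar>)"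
      using mpos by (intro mult_left_mono) auto
    also have "\<dots> = ?q x z * (?m * ?m' * \<bar>?q x' z - ?q x' z'\<bar>) + ?q x' z * (?m * ?m' * \<bar>?q x z - ?q x z'\<bar>)"
      by (simp add: algebra_simps)
    also have "\<dots> \<le> ?q x z * B x' + ?q x' z * B x"
      unfolding B_def using q0 by (intro add_mono mult_left_mono mm) auto
    finally show ?thesis .
  qed
  have "(\<integral>\<^sup>+x. \<integral>\<^sup>+x'. ennreal (?m * ?m' * max 0 (?q x z * ?q x' z' - ?q x' z * ?q x z')) \<partial>lborel \<partial>lborel) \<le>
    (\<integral>\<^sup>+x. \<integral>\<^sup>+x'. ennreal (?q x z) * ennreal (B x') + ennreal (?q x' z) * ennreal (B x) \<partial>lborel \<partial>lborel)"
    using pw q0 B0 by (intro nn_integral_mono) (simp add: ennreal_leI flip: ennreal_mult ennreal_plus)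
  also have "\<dots> = (\<integral>\<^sup>+x. ennreal (?q x z) * (\<integral>\<^sup>+x'. ennreal (B x') \<partial>lborel) + (\<integral>\<^sup>+x'. ennreal (?q x' z) \<partial>lborel) * ennreal (B x) \<partial>lborel)"
    by (intro nn_integral_cong) (simp add: nn_integral_add nn_integral_cmult nn_integral_multc)
  also have "\<dots> = (\<integral>\<^sup>+x. ennreal (?q x z) \<partial>lborel) * (\<integral>\<^sup>+x. ennreal (B x) \<partial>lborel) + (\<integral>\<^sup>+x. ennreal (?q x z) \<partial>lborel) * (\<integral>\<^sup>+x. ennreal (B x) \<partial>lborel)"
    by (subst nn_integral_add) (auto simp: nn_integral_cmult nn_integral_multc)
  also have "\<dots> \<le> 1 * (ennreal (2 * C) * slice_dist z z') + 1 * (ennreal (2 * C) * slice_dist z z')"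
    by (intro add_mono mult_mono cond_density_int intB) auto
  also have "\<dots> = ennreal (4 * C) * slice_dist z z'"
    using C_pos by (simp add: distrib_right[symmetric] ennreal_plus[symmetric] del: ennreal_plus)
  finally show ?thesis .
qed

text \<open>A shift of the integration variable and Fubini turn the left side into the mean distance
  of p_{X,Z} from its translate by \<open>(0, b - c)\<close>.\<close>

lemma slice_dist_shift:
  assumes \<delta>: "\<And>t. norm t < \<delta> \<Longrightarrow> (\<integral>\<^sup>+w. ennreal \<bar>marg_XZ p (w + t) - marg_XZ p w\<bar> \<partial>lborel) \<le> ennreal \<epsilon>"
    and t: "norm (b - c :: 'z) < \<delta>"
  shows "(\<integral>\<^sup>+z. slice_dist (z + b) (z + c) \<partial>lborel) \<le> ennreal \<epsilon>"
proof -
  have "(\<integral>\<^sup>+z. slice_dist (z + b) (z + c) \<partial>lborel) = (\<integral>\<^sup>+z. slice_dist (c + z + (b - c)) (c + z) \<partial>lborel)"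
    by (intro nn_integral_cong) (simp add: algebra_simps)
  also have "\<dots> = (\<integral>\<^sup>+z. slice_dist (z + (b - c)) z \<partial>lborel)"
    by (rule nn_integral_lborel_translate[where f="\<lambda>z. slice_dist (z + (b - c)) z"]) measurable
  also have "\<dots> = (\<integral>\<^sup>+w. ennreal \<bar>marg_XZ p (w + (0, b - c)) - marg_XZ p w\<bar> \<partial>lborel)"
    unfolding slice_dist_def by (subst nn_integral_lborel_prod(2)) auto
  also have "\<dots> \<le> ennreal \<epsilon>" using t by (intro \<delta>) (simp add: norm_Pair)
  finally show ?thesis .
qed

end

lemma (in prob_space) small_values:
  fixes f :: "'a \<Rightarrow> real"
  assumes [measurable]: "f \<in> borel_measurable M" and pos: "AE x in M. 0 < f x" and e: "0 < e"
  obtains c where "0 < c" "emeasure M {x\<in>space M. f x < c} \<le> ennreal e"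
proof -
  let ?A = "\<lambda>k. {x\<in>space M. f x < 1 / real (Suc k)}"
  have "(\<lambda>k. measure M (?A k)) \<longlonglongrightarrow> measure M (\<Inter>k. ?A k)"
  proof (rule finite_Lim_measure_decseq)
    show "decseq ?A"
      by (intro antimonoI subsetI) (auto intro: less_le_trans simp: frac_le)
  qed auto
  moreover have "measure M (\<Inter>k. ?A k) = 0"
  proof -
    have "(\<Inter>k. ?A k) = {x\<in>space M. \<not> 0 < f x}"
    proof (intro set_eqI iffI)
      fix x assume x: "x \<in> (\<Inter>k. ?A k)"
      have "\<not> 0 < f x"
      proof
        assume "0 < f x"
        then obtain k where "1 / real (Suc k) < f x" using nat_approx_posE by (metis inverse_eq_divide)
        then show False using x by (auto dest!: spec[of _ k])
      qed
      then show "x \<in> {x\<in>space M. \<not> 0 < f x}" using x by auto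
    next
      fix x assume x: "x \<in> {x\<in>space M. \<not> 0 < f x}"
      have "f x < 1 / real (Suc k)" for k using x by (auto intro: le_less_trans[of _ 0])
      then show "x \<in> (\<Inter>k. ?A k)" using x by auto
    qed
    then show ?thesis using pos by (simp add: prob_eq_0)
  qed
  ultimately have "eventually (\<lambda>k. measure M (?A k) < e) sequentially"
    using e by (intro order_tendstoD(2)[of _ 0]) auto
  then obtain k where "measure M (?A k) < e" by (auto simp: eventually_sequentially)
  then show ?thesis using that[of "1 / real (Suc k)"] by (simp add: emeasure_eq_measure ennreal_leI)
qed

section \<open>The sample of pairs (X,Z) and the kernel in Y\<close>

context cpt_data
begin

definition datXZ :: "nat \<Rightarrow> 'w \<Rightarrow> nat \<Rightarrow> 'x \<times> 'z"
  where "datXZ n \<omega> = (\<lambda>i\<in>{1..n}. (DX i \<omega>, DZ i \<omega>))"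

definition XZ :: "nat \<Rightarrow> 'w \<Rightarrow> 'x \<times> 'z" where "XZ i \<omega> = (DX i \<omega>, DZ i \<omega>)"

lemma XZ_proj_meas: "(\<lambda>e. (fst e, snd (snd e))) \<in> measurable (borel :: ('x \<times> 'y \<times> 'z) measure) (borel :: ('x \<times> 'z) measure)"
  by measurable

lemma XZ_meas: "i \<in> {1..} \<Longrightarrow> XZ i \<in> measurable \<Omega> borel"
  unfolding XZ_def using measurable_compose[OF D_meas XZ_proj_meas] by simp

lemma XZ_ind: "indep_vars (\<lambda>_. borel) XZ {1..}"
  unfolding XZ_def using D_ind XZ_proj_meas by (rule indep_vars_compose2)

lemma XZ_law:
  assumes i: "i \<in> {1..}"
  shows "distr \<Omega> borel (XZ i) = lawXZ"
proof (rule measure_eqI)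
  fix A assume "A \<in> sets (distr \<Omega> borel (XZ i))"
  then have A[measurable]: "A \<in> sets borel" by simp
  have "emeasure (distr \<Omega> borel (XZ i)) A = (\<integral>\<^sup>+\<omega>. indicator A (XZ i \<omega>) \<partial>\<Omega>)"
    using XZ_meas[OF i] by (subst nn_integral_indicator[symmetric]) (auto simp: nn_integral_distr simp del: nn_integral_indicator)
  also have "\<dots> = (\<integral>\<^sup>+e. indicator A (fst e, snd (snd e)) \<partial>law)"
    unfolding XZ_def by (rule nn_integral_D[OF i]) measurable
  also have "\<dots> = (\<integral>\<^sup>+w. ennreal (marg_XZ p w) * indicator A w \<partial>lborel)"
    by (rule nn_integral_joint_XZ) measurable
  also have "\<dots> = emeasure lawXZ A" by (intro emeasure_density[symmetric]) auto
  finally show "emeasure (distr \<Omega> borel (XZ i)) A = emeasure lawXZ A" .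
qed simp

text \<open>The conditional density involves no \<open>Y\<close>, so the weights are those of the
  model for the pairs (X,Z).\<close>

lemma perm_prob_eq:
  assumes \<sigma>: "\<sigma> permutes {1..n}"
  shows "perm_prob p n (sample \<omega>) \<sigma> = permutation_model.perm_weight {1..n} qXZ \<sigma> (datXZ n \<omega>)"
proof -
  interpret P: permutation_model "{1..n}" lborel lawZ qXZ by (rule permutation_model_XZ)
  have "P.lik (permute_fst \<tau> (datXZ n \<omega>)) = (\<Prod>l=1..n. cond_density p (fst (D (\<tau> l) \<omega>)) (DZ l \<omega>))"
    if "\<tau> permutes {1..n}" for \<tau>
    unfolding P.lik_def
  proof (intro prod.cong refl)
    fix l assume l: "l \<in> {1..n}"
    then have "\<tau> l \<in> {1..n}" using permutes_in_image[OF that] by simp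
    then show "cond_density p (fst (permute_fst \<tau> (datXZ n \<omega>) l)) (snd (permute_fst \<tau> (datXZ n \<omega>) l)) =
      cond_density p (fst (D (\<tau> l) \<omega>)) (DZ l \<omega>)" using l by (simp add: permute_fst_def datXZ_def)
  qed
  then show ?thesis unfolding P.perm_weight_def perm_prob_def using \<sigma> by simp
qed

lemma datXZ_law:
  assumes n: "0 < n"
  shows "distr \<Omega> (PiM {1..n} (\<lambda>_. lborel \<Otimes>\<^sub>M lawZ)) (datXZ n) =
    density (PiM {1..n} (\<lambda>_. lborel \<Otimes>\<^sub>M lawZ)) (\<lambda>d. ennreal (permutation_model.lik {1..n} qXZ d))"
proof -
  interpret P: permutation_model "{1..n}" lborel lawZ qXZ by (rule permutation_model_XZ)
  have id: "(\<lambda>e. e) \<in> measurable borel ((lborel :: 'x measure) \<Otimes>\<^sub>M lawZ)"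
    by (rule measurable_ident_sets) (simp only: sets_XZ_base)
  have "indep_vars (\<lambda>_. borel) XZ {1..n}" by (rule indep_vars_subset[OF XZ_ind]) auto
  from indep_vars_compose2[OF this, of "\<lambda>_ e. e" "\<lambda>_. (lborel :: 'x measure) \<Otimes>\<^sub>M lawZ"] id
  have "indep_vars (\<lambda>_. (lborel :: 'x measure) \<Otimes>\<^sub>M lawZ) XZ {1..n}" by simp
  moreover have "distr \<Omega> (lborel \<Otimes>\<^sub>M lawZ) (XZ i) = density (lborel \<Otimes>\<^sub>M lawZ) (\<lambda>e. ennreal (cond_density p (fst e) (snd e)))"
    if "i \<in> {1..n}" for i using that by (intro lawXZ_density XZ_law XZ_meas) auto
  moreover have "datXZ n = (\<lambda>\<omega>. \<lambda>i\<in>{1..n}. XZ i \<omega>)" unfolding datXZ_def XZ_def ..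
  ultimately show ?thesis using P.distr_iid[OF prob_space_axioms, of XZ] n by simp
qed

lemma base_sets: "sets (PiM {1..n} (\<lambda>_. lborel \<Otimes>\<^sub>M lawZ)) = sets (PiM {1..n} borelXZ)"
  by (intro sets_PiM_cong refl sets_XZ_base)

lemma datXZ_meas: "datXZ n \<in> measurable \<Omega> (PiM {1..n} (\<lambda>_. lborel \<Otimes>\<^sub>M lawZ))"
  unfolding measurable_cong_sets[OF refl base_sets] datXZ_def XZ_def[symmetric]
  by (intro measurable_restrict XZ_meas) auto

abbreviation "mdef n \<equiv> permutation_model.mean_defect {1..n} qXZ"
abbreviation "sdef \<equiv> permutation_model.swap_defect qXZ"

text \<open>A flat kernel in \<open>z\<close>, not normalised: its mass is the volume of the ball of
  radius \<open>R\<close>.\<close>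

definition box :: "real \<Rightarrow> 'z \<Rightarrow> 'z \<Rightarrow> real"
  where "box h z z' = (if norm (z - z') \<le> R * h then 1 / h ^ DIM('z) else 0)"

lemma box_meas[measurable]: "(\<lambda>x. box h (f x) (g x)) \<in> borel_measurable N"
  if [measurable]: "f \<in> borel_measurable N" "g \<in> borel_measurable N"
  unfolding box_def by measurable

lemma box_nonneg: "0 < h \<Longrightarrow> 0 \<le> box h z z'" by (simp add: box_def)

abbreviation vol :: "'d::euclidean_space \<Rightarrow> real" where "vol c \<equiv> measure lborel (cball c R)"

lemma vol_eq: "emeasure lborel (cball c R) = ennreal (vol c)"
  using emeasure_lborel_cball_finite[of c R] by (intro emeasure_eq_ennreal_measure) auto

lemma nn_integral_box:
  assumes [measurable]: "f \<in> borel_measurable borel" and h: "0 < h"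
  shows "(\<integral>\<^sup>+z'. ennreal (box h z z') * f z' \<partial>lborel) = (\<integral>\<^sup>+v. indicator (cball 0 R) v * f (z + h *\<^sub>R v) \<partial>lborel)"
proof -
  have "(\<integral>\<^sup>+v. indicator (cball 0 R) v * f (z + h *\<^sub>R v) \<partial>lborel) =
      (\<integral>\<^sup>+v. (\<lambda>z'. indicator (cball z (R * h)) z' * f z') (z + h *\<^sub>R v) \<partial>lborel)"
    using h by (intro nn_integral_cong) (auto simp: indicator_def dist_norm mult.commute)
  also have "\<dots> = (\<integral>\<^sup>+z'. indicator (cball z (R * h)) z' * f z' * ennreal (1 / h ^ DIM('z)) \<partial>lborel)"
    by (intro nn_integral_lborel_affine h borel_measurable_times_ennreal borel_measurable_indicator assms) auto
  also have "\<dots> = (\<integral>\<^sup>+z'. ennreal (box h z z') * f z' \<partial>lborel)"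
    by (intro nn_integral_cong) (auto simp: box_def indicator_def dist_norm mult.commute)
  finally show ?thesis ..
qed

text \<open>The support of the kernel in (y,z) lies in a product of two balls of radius Rh, and
  h^(d_Y+d_Z) factors accordingly. Integration over \<open>y\<close> uses up the first ball and its
  power of \<open>h\<close>.\<close>

lemma Kh_slice:
  assumes h: "0 < h"
  shows "(\<integral>\<^sup>+y. ennreal (KW.Kh h w (y, z)) \<partial>lborel) \<le> ennreal (\<kappa> * vol (0 :: 'y)) * ennreal (box h (snd w) z)"
proof -
  have K: "KW.Kh h w (y, z) \<le> \<kappa> * indicator (cball (fst w) (R * h)) y * (1 / h ^ DIM('y)) * box h (snd w) z" for y
  proof (cases "K (norm (w - (y, z)) / h) = 0")
    case True
    then show ?thesis using h KW.\<kappa>_pos box_nonneg[OF h] by (simp add: KW.Kh_def)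
  next
    case False
    then have "norm (w - (y, z)) \<le> R * h" using KW.K_supp[OF False] h by (simp add: divide_le_eq)
    moreover have "w - (y, z) = (fst w - y, snd w - z)" by (cases w) simp
    ultimately have "norm (fst w - y) \<le> R * h" "norm (snd w - z) \<le> R * h"
      using norm_fst_le[of "fst w - y" "snd w - z"] norm_snd_le[of "snd w - z" "fst w - y"] by auto
    then have "\<kappa> * indicator (cball (fst w) (R * h)) y * (1 / h ^ DIM('y)) * box h (snd w) z = \<kappa> / h ^ DIM('y \<times> 'z)"
      using h by (simp add: box_def dist_norm power_add)
    then show ?thesis using KW.Kh_le[OF h, of w "(y, z)"] by simp
  qed
  have "(\<integral>\<^sup>+y. ennreal (KW.Kh h w (y, z)) \<partial>lborel) \<le>
      (\<integral>\<^sup>+y. ennreal (\<kappa> * box h (snd w) z) * (indicator (cball (fst w) (R * h)) y * ennreal (1 / h ^ DIM('y))) \<partial>lborel)"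
  proof (intro nn_integral_mono)
    fix y
    have "ennreal (KW.Kh h w (y, z)) \<le> ennreal (\<kappa> * box h (snd w) z * (indicator (cball (fst w) (R * h)) y * (1 / h ^ DIM('y))))"
      using K[of y] by (intro ennreal_leI) (simp add: mult_ac)
    also have "\<dots> = ennreal (\<kappa> * box h (snd w) z) * (indicator (cball (fst w) (R * h)) y * ennreal (1 / h ^ DIM('y)))"
      unfolding ennreal_indicator[symmetric] using h KW.\<kappa>_pos box_nonneg[OF h] by (intro trans[OF ennreal_mult] arg_cong2[of _ _ _ _ "(*)"] refl ennreal_mult) auto
    finally show "ennreal (KW.Kh h w (y, z)) \<le> ennreal (\<kappa> * box h (snd w) z) * (indicator (cball (fst w) (R * h)) y * ennreal (1 / h ^ DIM('y)))" .
  qed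
  also have "\<dots> = ennreal (\<kappa> * box h (snd w) z) * (\<integral>\<^sup>+y. indicator (cball (fst w) (R * h)) y * ennreal (1 / h ^ DIM('y)) \<partial>lborel)"
    by (intro nn_integral_cmult borel_measurable_times_ennreal borel_measurable_indicator) auto
  also have "(\<integral>\<^sup>+y. indicator (cball (fst w) (R * h)) y * ennreal (1 / h ^ DIM('y)) \<partial>lborel) = (\<integral>\<^sup>+v. indicator (cball (fst w) (R * h)) (fst w + h *\<^sub>R v) \<partial>lborel)"
    by (intro nn_integral_lborel_affine[symmetric] h borel_measurable_indicator) auto
  also have "\<dots> = (\<integral>\<^sup>+v. indicator (cball (0 :: 'y) R) v \<partial>lborel)"
    using h by (intro nn_integral_cong) (auto simp: indicator_def dist_norm mult.commute)
  also have "\<dots> = ennreal (vol (0 :: 'y))" by (simp add: vol_eq)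
  finally show ?thesis using KW.\<kappa>_pos box_nonneg[OF h] by (simp add: ennreal_mult mult_ac)
qed

text \<open>Bounding p_{X,Y,Z} by \<open>C\<close> frees the kernel for integration over
  \<open>y\<close>. This destroys the density of (X,Z), which is restored by the factor p_{X,Z}/c,
  at least 1 on the set under the indicator.\<close>

lemma integrate_out_Y_one:
  assumes G[measurable]: "G \<in> borel_measurable (borel :: ('x \<times> 'z) measure)" and h: "0 < h" and c: "0 < c"
  shows "(\<integral>\<^sup>+e. ennreal (KW.Kh h w (snd e)) * (indicator {v. c \<le> marg_XZ p v} (fst e, snd (snd e)) * G (fst e, snd (snd e))) \<partial>law) \<le>
    ennreal (C * \<kappa> * vol (0 :: 'y) / c) * (\<integral>\<^sup>+e. ennreal (box h (snd w) (snd (snd e))) * G (fst e, snd (snd e)) \<partial>law)"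
proof -
  let ?ind = "indicator {v. c \<le> marg_XZ p v} :: 'x \<times> 'z \<Rightarrow> ennreal"
  have "(\<integral>\<^sup>+e. ennreal (KW.Kh h w (snd e)) * (?ind (fst e, snd (snd e)) * G (fst e, snd (snd e))) \<partial>law) =
    (\<integral>\<^sup>+z. \<integral>\<^sup>+y. \<integral>\<^sup>+x. ennreal (p (x, y, z)) * (ennreal (KW.Kh h w (y, z)) * (?ind (x, z) * G (x, z))) \<partial>lborel \<partial>lborel \<partial>lborel)"
    by (subst nn_integral_joint) auto
  also have "\<dots> = (\<integral>\<^sup>+z. \<integral>\<^sup>+x. \<integral>\<^sup>+y. ennreal (p (x, y, z)) * (ennreal (KW.Kh h w (y, z)) * (?ind (x, z) * G (x, z))) \<partial>lborel \<partial>lborel \<partial>lborel)"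
    by (intro nn_integral_cong lborel_pair.Fubini') measurable
  also have "\<dots> \<le> (\<integral>\<^sup>+z. \<integral>\<^sup>+x. ennreal (C * \<kappa> * vol (0 :: 'y) / c) * (ennreal (marg_XZ p (x, z)) * (ennreal (box h (snd w) z) * G (x, z))) \<partial>lborel \<partial>lborel)"
  proof (intro nn_integral_mono)
    fix z x
    have "(\<integral>\<^sup>+y. ennreal (p (x, y, z)) * (ennreal (KW.Kh h w (y, z)) * (?ind (x, z) * G (x, z))) \<partial>lborel) \<le>
      (\<integral>\<^sup>+y. ennreal (KW.Kh h w (y, z)) * (ennreal C * (?ind (x, z) * G (x, z))) \<partial>lborel)"
      by (intro nn_integral_mono) (simp add: mult.left_commute mult_left_mono mult_right_mono ennreal_leI pC)
    also have "\<dots> = (\<integral>\<^sup>+y. ennreal (KW.Kh h w (y, z)) \<partial>lborel) * (ennreal C * (?ind (x, z) * G (x, z)))"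
      by (intro nn_integral_multc) measurable
    also have "\<dots> \<le> (ennreal (\<kappa> * vol (0 :: 'y)) * ennreal (box h (snd w) z)) * (ennreal C * (?ind (x, z) * G (x, z)))"
      by (intro mult_right_mono Kh_slice h) auto
    also have "\<dots> \<le> (ennreal (\<kappa> * vol (0 :: 'y)) * ennreal (box h (snd w) z)) * (ennreal C * (ennreal (marg_XZ p (x, z) / c) * G (x, z)))"
      using c by (intro mult_left_mono mult_right_mono) (auto simp: indicator_def ennreal_1[symmetric] simp del: ennreal_1 intro!: ennreal_leI)
    also have "\<dots> = (ennreal (\<kappa> * vol (0 :: 'y)) * ennreal C * ennreal (1 / c)) * (ennreal (marg_XZ p (x, z)) * (ennreal (box h (snd w) z) * G (x, z)))"
    proof -
      have "ennreal (marg_XZ p (x, z) / c) = ennreal (1 / c) * ennreal (marg_XZ p (x, z))"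
        using c by (simp add: marg_nonneg flip: ennreal_mult)
      then show ?thesis by (simp only: mult_ac)
    qed
    also have "ennreal (\<kappa> * vol (0 :: 'y)) * ennreal C * ennreal (1 / c) = ennreal (C * \<kappa> * vol (0 :: 'y) / c)"
      using c C_pos KW.\<kappa>_pos by (simp add: mult_ac flip: ennreal_mult)
    finally show "(\<integral>\<^sup>+y. ennreal (p (x, y, z)) * (ennreal (KW.Kh h w (y, z)) * (?ind (x, z) * G (x, z))) \<partial>lborel) \<le>
      ennreal (C * \<kappa> * vol (0 :: 'y) / c) * (ennreal (marg_XZ p (x, z)) * (ennreal (box h (snd w) z) * G (x, z)))" .
  qed
  also have "\<dots> = ennreal (C * \<kappa> * vol (0 :: 'y) / c) * (\<integral>\<^sup>+z. \<integral>\<^sup>+x. ennreal (marg_XZ p (x, z)) * (ennreal (box h (snd w) z) * G (x, z)) \<partial>lborel \<partial>lborel)"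
    by (simp add: nn_integral_cmult)
  also have "(\<integral>\<^sup>+z. \<integral>\<^sup>+x. ennreal (marg_XZ p (x, z)) * (ennreal (box h (snd w) z) * G (x, z)) \<partial>lborel \<partial>lborel) =
    (\<integral>\<^sup>+v. ennreal (marg_XZ p v) * (ennreal (box h (snd w) (snd v)) * G v) \<partial>lborel)"
    by (subst nn_integral_lborel_prod(2)) auto
  also have "\<dots> = (\<integral>\<^sup>+e. ennreal (box h (snd w) (snd (snd e))) * G (fst e, snd (snd e)) \<partial>law)"
    using nn_integral_joint_XZ[of "\<lambda>v. ennreal (box h (snd w) (snd v)) * G v"] by simp
  finally show ?thesis .
qed

text \<open>
  The mean defect does not involve the \<open>Y\<close>-values, so the kernel in $(Y_j,Z_j)$ may be integrated over
  $Y_j$.  Where $p_{X,Z}(X_j,Z_j) \ge c$, this leaves a box kernel in $Z_j$ and a bounded factor.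
\<close>

lemma integrate_out_Y:
  assumes s: "s \<in> {1..n}" and j: "j \<in> {1..n}" "s \<noteq> j"
    and \<Psi>[measurable]: "\<Psi> \<in> borel_measurable (PiM {1..n} borelXZ)" and h: "0 < h" and c: "0 < c"
  shows "(\<integral>\<^sup>+\<omega>. ennreal (KW.Kh h (DW s \<omega>) (DW j \<omega>)) * (indicator {v. c \<le> marg_XZ p v} (XZ j \<omega>) * \<Psi> (datXZ n \<omega>)) \<partial>\<Omega>) \<le>
    ennreal (C * \<kappa> * vol (0 :: 'y) / c) * (\<integral>\<^sup>+\<omega>. ennreal (box h (DZ s \<omega>) (DZ j \<omega>)) * \<Psi> (datXZ n \<omega>) \<partial>\<Omega>)"
proof -
  let ?I = "{1..n}" let ?J = "?I - {j}"
  let ?PB = "PiM ?I borelXYZ"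
  let ?x = "\<lambda>d. \<lambda>i\<in>?I. (fst (d i), snd (snd (d i))) :: 'x \<times> 'z"
  let ?r = "\<lambda>\<omega>. \<lambda>i\<in>?I. D i \<omega>"
  have pl: "prob_space law" using p_int by (intro prob_spaceI) (simp add: emeasure_density)
  interpret L: prob_space law by (rule pl)
  interpret P: product_sigma_finite "\<lambda>_::nat. law" by standard
  have I: "insert j ?J = ?I" using j by auto
  have ind: "indep_vars (\<lambda>_. borel) D ?I" by (rule indep_vars_subset[OF D_ind]) auto
  have "distr \<Omega> ?PB ?r = PiM ?I (\<lambda>i. distr \<Omega> borel (D i))"
    by (rule iffD1[OF indep_vars_iff_distr_eq_PiM' ind]) (use s in \<open>auto intro: D_meas\<close>)
  also have "\<dots> = PiM ?I (\<lambda>_. law)" by (intro PiM_cong refl D_law) auto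
  finally have dl: "distr \<Omega> ?PB ?r = PiM ?I (\<lambda>_. law)" .
  have rm: "?r \<in> measurable \<Omega> ?PB" by (intro measurable_restrict D_meas) auto
  have sl: "sets (PiM J (\<lambda>_. law)) = sets (PiM J borelXYZ)" for J :: "nat set" by (intro sets_PiM_cong) auto
  have key: "(\<integral>\<^sup>+\<omega>. F (?r \<omega>) \<partial>\<Omega>) = (\<integral>\<^sup>+d. \<integral>\<^sup>+e. F (d(j := e)) \<partial>law \<partial>PiM ?J (\<lambda>_. law))"
    if F: "F \<in> borel_measurable ?PB" for F
  proof -
    have "(\<integral>\<^sup>+\<omega>. F (?r \<omega>) \<partial>\<Omega>) = (\<integral>\<^sup>+d. F d \<partial>distr \<Omega> ?PB ?r)" using F by (intro nn_integral_distr[symmetric] rm) auto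
    also have "\<dots> = (\<integral>\<^sup>+d. F d \<partial>PiM (insert j ?J) (\<lambda>_. law))" unfolding dl I ..
    also have "\<dots> = (\<integral>\<^sup>+d. \<integral>\<^sup>+e. F (d(j := e)) \<partial>law \<partial>PiM ?J (\<lambda>_. law))"
      by (rule P.product_nn_integral_insert, simp, simp, unfold I measurable_cong_sets[OF sl refl], rule F)
    finally show ?thesis .
  qed
  have cm: "(\<lambda>d. d i) \<in> measurable ?PB borel" if "i \<in> ?I" for i using that by (rule measurable_component_singleton)
  have c1: "(\<lambda>d. snd (d i)) \<in> measurable ?PB borel" and c2: "(\<lambda>d. snd (snd (d i))) \<in> measurable ?PB borel"
    and c3: "(\<lambda>d. (fst (d i), snd (snd (d i)))) \<in> measurable ?PB (borel :: ('x \<times> 'z) measure)" if "i \<in> ?I" for i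
    using measurable_compose[OF cm[OF that] borel_fst_snd(2)] measurable_compose[OF measurable_compose[OF cm[OF that] borel_fst_snd(2)] borel_fst_snd(2)]
      measurable_compose[OF cm[OF that] XZ_proj_meas] by auto
  have xm: "?x \<in> measurable ?PB (PiM ?I borelXZ)" by (intro measurable_restrict c3)
  have \<Psi>x: "(\<lambda>d. \<Psi> (?x d)) \<in> borel_measurable ?PB" by (rule measurable_compose[OF xm \<Psi>])
  let ?F1 = "\<lambda>d. ennreal (KW.Kh h (snd (d s)) (snd (d j))) * (indicator {v. c \<le> marg_XZ p v} (fst (d j), snd (snd (d j))) * \<Psi> (?x d))"
  let ?F2 = "\<lambda>d. ennreal (box h (snd (snd (d s))) (snd (snd (d j)))) * \<Psi> (?x d)"
  have F1: "?F1 \<in> borel_measurable ?PB"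
  proof (intro borel_measurable_times_ennreal \<Psi>x)
    show "(\<lambda>d. ennreal (KW.Kh h (snd (d s)) (snd (d j)))) \<in> borel_measurable ?PB"
      by (rule measurable_compose[OF KW.Kh_meas[OF c1[OF s] c1[OF j(1)]] measurable_ennreal])
    have "(indicator {v. c \<le> marg_XZ p v} :: 'x \<times> 'z \<Rightarrow> ennreal) \<in> borel_measurable borel" by measurable
    from measurable_compose[OF c3[OF j(1)] this]
    show "(\<lambda>d. indicator {v. c \<le> marg_XZ p v} (fst (d j), snd (snd (d j))) :: ennreal) \<in> borel_measurable ?PB" .
  qed
  have F2: "?F2 \<in> borel_measurable ?PB"
    by (intro borel_measurable_times_ennreal \<Psi>x measurable_compose[OF box_meas[OF c2[OF s] c2[OF j(1)]] measurable_ennreal])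
  have rx: "?x (?r \<omega>) = datXZ n \<omega>" for \<omega> by (auto simp: datXZ_def)
  have "(\<integral>\<^sup>+\<omega>. ennreal (KW.Kh h (DW s \<omega>) (DW j \<omega>)) * (indicator {v. c \<le> marg_XZ p v} (XZ j \<omega>) * \<Psi> (datXZ n \<omega>)) \<partial>\<Omega>) =
    (\<integral>\<^sup>+\<omega>. ?F1 (?r \<omega>) \<partial>\<Omega>)" unfolding rx using s j by (intro nn_integral_cong) (simp add: XZ_def)
  also have "\<dots> = (\<integral>\<^sup>+d. \<integral>\<^sup>+e. ?F1 (d(j := e)) \<partial>law \<partial>PiM ?J (\<lambda>_. law))" by (rule key[OF F1])
  also have "\<dots> \<le> (\<integral>\<^sup>+d. ennreal (C * \<kappa> * vol (0 :: 'y) / c) * (\<integral>\<^sup>+e. ?F2 (d(j := e)) \<partial>law) \<partial>PiM ?J (\<lambda>_. law))"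
  proof (intro nn_integral_mono)
    fix d :: "nat \<Rightarrow> 'x \<times> 'y \<times> 'z"
    \<comment> \<open>As a function of observation \<open>j\<close> alone, the factor \<Psi> sees
      only its (X,Z)-part, so \<open>integrate_out_Y_one\<close> applies with all other observations
      frozen.\<close>
    define G where "G v = \<Psi> (\<lambda>i\<in>?I. if i = j then v else (fst (d i), snd (snd (d i))))" for v
    have Gm: "G \<in> borel_measurable borel"
      unfolding G_def by (intro measurable_compose[OF _ \<Psi>] measurable_restrict) simp
    have Gx: "\<Psi> (?x (d(j := e))) = G (fst e, snd (snd e))" for e :: "'x \<times> 'y \<times> 'z"
      unfolding G_def by (intro arg_cong[of _ _ \<Psi>]) (auto simp: fun_eq_iff restrict_def)
    show "(\<integral>\<^sup>+e. ?F1 (d(j := e)) \<partial>law) \<le> ennreal (C * \<kappa> * vol (0 :: 'y) / c) * (\<integral>\<^sup>+e. ?F2 (d(j := e)) \<partial>law)"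
      unfolding Gx using integrate_out_Y_one[OF Gm h c, of "snd (d s)"] j by simp
  qed
  also have "\<dots> = ennreal (C * \<kappa> * vol (0 :: 'y) / c) * (\<integral>\<^sup>+d. (\<integral>\<^sup>+e. ?F2 (d(j := e)) \<partial>law) \<partial>PiM ?J (\<lambda>_. law))"
  proof (rule nn_integral_cmult)
    have "(\<lambda>(d, e). ?F2 (d(j := e))) \<in> borel_measurable (PiM ?J (\<lambda>_. law) \<Otimes>\<^sub>M law)"
    proof -
      have ad: "(\<lambda>(d, e). d(j := e)) \<in> measurable (PiM ?J (\<lambda>_. law) \<Otimes>\<^sub>M law) (PiM (insert j ?J) (\<lambda>_. law))"
        by (rule measurable_add_dim)
      have F2': "?F2 \<in> borel_measurable (PiM (insert j ?J) (\<lambda>_. law))"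
        unfolding I measurable_cong_sets[OF sl refl] by (rule F2)
      show ?thesis using measurable_compose[OF ad F2'] by (simp only: case_prod_unfold)
    qed
    then show "(\<lambda>d. \<integral>\<^sup>+e. ?F2 (d(j := e)) \<partial>law) \<in> borel_measurable (PiM ?J (\<lambda>_. law))"
      by (rule L.borel_measurable_nn_integral)
  qed
  also have "(\<integral>\<^sup>+d. (\<integral>\<^sup>+e. ?F2 (d(j := e)) \<partial>law) \<partial>PiM ?J (\<lambda>_. law)) = (\<integral>\<^sup>+\<omega>. ?F2 (?r \<omega>) \<partial>\<Omega>)" by (rule key[OF F2, symmetric])
  also have "\<dots> = (\<integral>\<^sup>+\<omega>. ennreal (box h (DZ s \<omega>) (DZ j \<omega>)) * \<Psi> (datXZ n \<omega>) \<partial>\<Omega>)"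
    unfolding rx using s j by (intro nn_integral_cong) simp
  finally show ?thesis .
qed

end

section \<open>The mean loss for two independent observations\<close>

context joint_density
begin

lemma cond_density_measurable[measurable]:
  assumes [measurable]: "f \<in> borel_measurable N" "g \<in> borel_measurable N"
  shows "(\<lambda>t. cond_density p (f t) (g t)) \<in> borel_measurable N"
  unfolding cond_density_def by measurable

text \<open>The quantity \<open>swap_defect\<close> as a function of just the two observations that
  it involves.\<close>

definition pair_defect :: "'x \<times> 'z \<Rightarrow> 'x \<times> 'z \<Rightarrow> real"
  where "pair_defect b c = max 0 (1 - cond_density p (fst c) (snd b) * cond_density p (fst b) (snd c) /
    (cond_density p (fst b) (snd b) * cond_density p (fst c) (snd c)))"

lemma pair_defect_meas[measurable]:
  assumes [measurable]: "f \<in> borel_measurable N" "g \<in> borel_measurable N"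
  shows "(\<lambda>t. pair_defect (f t) (g t)) \<in> borel_measurable N"
proof -
  have [measurable]: "(\<lambda>t. fst (f t)) \<in> borel_measurable N" "(\<lambda>t. snd (f t)) \<in> borel_measurable N"
    "(\<lambda>t. fst (g t)) \<in> borel_measurable N" "(\<lambda>t. snd (g t)) \<in> borel_measurable N"
    using measurable_compose[OF assms(1) borel_fst_snd(1)] measurable_compose[OF assms(1) borel_fst_snd(2)]
      measurable_compose[OF assms(2) borel_fst_snd(1)] measurable_compose[OF assms(2) borel_fst_snd(2)] by auto
  show ?thesis unfolding pair_defect_def by measurable
qed

lemma nn_integral_lawXZ_snd_le:
  assumes [measurable]: "g \<in> borel_measurable borel"
  shows "(\<integral>\<^sup>+e. g (snd e) \<partial>lawXZ) \<le> ennreal C * (\<integral>\<^sup>+z. g z \<partial>lborel)"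
proof -
  have "(\<integral>\<^sup>+e. g (snd e) \<partial>lawXZ) = (\<integral>\<^sup>+z. \<integral>\<^sup>+x. ennreal (marg_Z p z) * ennreal (cond_density p x z) * g z \<partial>lborel \<partial>lborel)"
    by (subst nn_integral_lawXZ) auto
  also have "\<dots> = (\<integral>\<^sup>+z. (\<integral>\<^sup>+x. ennreal (cond_density p x z) \<partial>lborel) * (ennreal (marg_Z p z) * g z) \<partial>lborel)"
  proof (rule nn_integral_cong)
    fix z
    have "(\<integral>\<^sup>+x. ennreal (marg_Z p z) * ennreal (cond_density p x z) * g z \<partial>lborel) =
      (\<integral>\<^sup>+x. ennreal (cond_density p x z) * (ennreal (marg_Z p z) * g z) \<partial>lborel)"
      by (intro nn_integral_cong) (simp only: mult_ac)
    then show "(\<integral>\<^sup>+x. ennreal (marg_Z p z) * ennreal (cond_density p x z) * g z \<partial>lborel) =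
      (\<integral>\<^sup>+x. ennreal (cond_density p x z) \<partial>lborel) * (ennreal (marg_Z p z) * g z)"
      by (simp add: nn_integral_multc)
  qed
  also have "\<dots> \<le> (\<integral>\<^sup>+z. 1 * (ennreal C * g z) \<partial>lborel)"
    by (intro nn_integral_mono mult_mono cond_density_int mult_right_mono ennreal_leI marg_le) auto
  also have "\<dots> = ennreal C * (\<integral>\<^sup>+z. g z \<partial>lborel)" by (simp add: nn_integral_cmult)
  finally show ?thesis .
qed

text \<open>The density of the two observations cancels the denominator of the defect; what is left
  is the determinant estimated in \<open>defect_slice_bound\<close>.\<close>

lemma nn_integral_pair_defect_le:
  assumes \<psi>[measurable]: "(\<lambda>(z, z'). \<psi> z z') \<in> borel_measurable (borel \<Otimes>\<^sub>M borel)"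
  shows "(\<integral>\<^sup>+b. \<integral>\<^sup>+c. \<psi> (snd b) (snd c) * ennreal (pair_defect b c) \<partial>lawXZ \<partial>lawXZ) \<le>
    ennreal (4 * C) * (\<integral>\<^sup>+z. \<integral>\<^sup>+z'. \<psi> z z' * slice_dist z z' \<partial>lborel \<partial>lborel)"
proof -
  let ?m = "marg_Z p" and ?q = "cond_density p"
  define D where "D x z x' z' = max 0 (?q x z * ?q x' z' - ?q x' z * ?q x z')" for x z x' z'
  have D0: "0 \<le> D x z x' z'" for x z x' z' by (simp add: D_def)
  have Dm[measurable]: "(\<lambda>t. D (f1 t) (f2 t) (f3 t) (f4 t)) \<in> borel_measurable N"
    if [measurable]: "f1 \<in> borel_measurable N" "f2 \<in> borel_measurable N" "f3 \<in> borel_measurable N" "f4 \<in> borel_measurable N"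
    for f1 f2 f3 f4 and N :: "'n measure" unfolding D_def by measurable
  have \<psi>'[measurable]: "(\<lambda>t. \<psi> (f t) (g t)) \<in> borel_measurable N" if f: "f \<in> borel_measurable N" and g: "g \<in> borel_measurable N"
    for f g and N :: "'n measure" using measurable_compose[OF measurable_Pair[OF f g] \<psi>] by simp
  have \<psi>''[measurable]: "(\<lambda>t. \<psi> (f t) (g t)) \<in> borel_measurable N" if f: "f \<in> borel_measurable N" and g: "g \<in> borel_measurable N"
    for f g and N :: "('x \<times> 'z) measure" using measurable_compose[OF measurable_Pair[OF f g] \<psi>] by simp
  have pd: "?q x z * ?q x' z' * pair_defect (x, z) (x', z') \<le> D x z x' z'" for x z x' z'
  proof (cases "?q x z * ?q x' z' = 0")
    case True
    then show ?thesis unfolding True by (simp add: D0)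
  next
    case False
    then have pos: "0 < ?q x z * ?q x' z'" using cond_density_nonneg[of x z] cond_density_nonneg[of x' z'] by (simp add: less_le)
    then have "?q x z * ?q x' z' * pair_defect (x, z) (x', z') =
      max (?q x z * ?q x' z' * 0) (?q x z * ?q x' z' * (1 - ?q x' z * ?q x z' / (?q x z * ?q x' z')))"
      unfolding pair_defect_def fst_conv snd_conv by (intro max_mult_distrib_left[THEN trans]) auto
    also have "?q x z * ?q x' z' * (1 - ?q x' z * ?q x z' / (?q x z * ?q x' z')) = ?q x z * ?q x' z' - ?q x' z * ?q x z'"
      unfolding right_diff_distrib using False by (simp only: times_divide_eq_right nonzero_mult_div_cancel_left mult_1_right if_False) simp
    finally show ?thesis by (simp add: D_def)
  qed
  have inner: "(\<integral>\<^sup>+c. \<psi> z (snd c) * ennreal (pair_defect (x, z) c) \<partial>lawXZ) =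
    (\<integral>\<^sup>+z'. \<integral>\<^sup>+x'. ennreal (?m z') * ennreal (?q x' z') * (\<psi> z z' * ennreal (pair_defect (x, z) (x', z'))) \<partial>lborel \<partial>lborel)" for x z
    by (subst nn_integral_lawXZ) auto
  have "(\<integral>\<^sup>+b. \<integral>\<^sup>+c. \<psi> (snd b) (snd c) * ennreal (pair_defect b c) \<partial>lawXZ \<partial>lawXZ) =
    (\<integral>\<^sup>+z. \<integral>\<^sup>+x. ennreal (?m z) * ennreal (?q x z) * (\<integral>\<^sup>+z'. \<integral>\<^sup>+x'. ennreal (?m z') * ennreal (?q x' z') * (\<psi> z z' * ennreal (pair_defect (x, z) (x', z'))) \<partial>lborel \<partial>lborel) \<partial>lborel \<partial>lborel)"
  proof (subst nn_integral_lawXZ)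
    have "sigma_finite_measure lawXZ"
      using marg_int(2) by (intro prob_space_imp_sigma_finite prob_spaceI) (simp add: emeasure_density)
    moreover have "(\<lambda>(b, c). \<psi> (snd b) (snd c) * ennreal (pair_defect b c)) \<in> borel_measurable ((borel :: ('x \<times> 'z) measure) \<Otimes>\<^sub>M lawXZ)"
    proof -
      have f: "fst \<in> measurable (borel \<Otimes>\<^sub>M lawXZ) (borel :: ('x \<times> 'z) measure)" "snd \<in> measurable (borel \<Otimes>\<^sub>M lawXZ) (borel :: ('x \<times> 'z) measure)"
      proof -
        show "fst \<in> measurable (borel \<Otimes>\<^sub>M lawXZ) (borel :: ('x \<times> 'z) measure)" by (rule measurable_fst)
        have "snd \<in> measurable (borel \<Otimes>\<^sub>M lawXZ) lawXZ" by (rule measurable_snd)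
        then show "snd \<in> measurable (borel \<Otimes>\<^sub>M lawXZ) (borel :: ('x \<times> 'z) measure)"
          unfolding measurable_def by simp
      qed
      show ?thesis unfolding case_prod_unfold
        by (intro borel_measurable_times_ennreal measurable_compose[OF pair_defect_meas[OF f] measurable_ennreal])
          (use measurable_compose[OF measurable_Pair[OF measurable_compose[OF f(1) borel_fst_snd(2)] measurable_compose[OF f(2) borel_fst_snd(2)]] \<psi>] in simp)
    qed
    ultimately show "(\<lambda>b. \<integral>\<^sup>+c. \<psi> (snd b) (snd c) * ennreal (pair_defect b c) \<partial>lawXZ) \<in> borel_measurable borel"
      by (rule sigma_finite_measure.borel_measurable_nn_integral)
  qed (simp only: snd_conv inner)
  also have "\<dots> \<le> (\<integral>\<^sup>+z. \<integral>\<^sup>+x. \<integral>\<^sup>+z'. \<integral>\<^sup>+x'. \<psi> z z' * ennreal (?m z * ?m z' * D x z x' z') \<partial>lborel \<partial>lborel \<partial>lborel \<partial>lborel)"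
  proof (intro nn_integral_mono)
    fix z x
    have "ennreal (?m z) * ennreal (?q x z) * (\<integral>\<^sup>+z'. \<integral>\<^sup>+x'. ennreal (?m z') * ennreal (?q x' z') * (\<psi> z z' * ennreal (pair_defect (x, z) (x', z'))) \<partial>lborel \<partial>lborel) =
      (\<integral>\<^sup>+z'. \<integral>\<^sup>+x'. ennreal (?m z) * ennreal (?q x z) * (ennreal (?m z') * ennreal (?q x' z') * (\<psi> z z' * ennreal (pair_defect (x, z) (x', z')))) \<partial>lborel \<partial>lborel)"
      by (simp add: nn_integral_cmult)
    also have "\<dots> \<le> (\<integral>\<^sup>+z'. \<integral>\<^sup>+x'. \<psi> z z' * ennreal (?m z * ?m z' * D x z x' z') \<partial>lborel \<partial>lborel)"
    proof (intro nn_integral_mono)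
      fix z' x'
      have pd0: "0 \<le> pair_defect (x, z) (x', z')" by (simp add: pair_defect_def)
      have "ennreal (?m z) * ennreal (?q x z) * (ennreal (?m z') * ennreal (?q x' z') * (\<psi> z z' * ennreal (pair_defect (x, z) (x', z')))) =
        \<psi> z z' * (ennreal (?m z) * ennreal (?m z') * (ennreal (?q x z) * ennreal (?q x' z') * ennreal (pair_defect (x, z) (x', z'))))"
        by (simp only: mult_ac)
      also have "\<dots> = \<psi> z z' * ennreal (?m z * ?m z' * (?q x z * ?q x' z' * pair_defect (x, z) (x', z')))"
        using pd0 by (simp only: ennreal_mult[symmetric] marg_nonneg cond_density_nonneg mult_nonneg_nonneg)
      also have "\<dots> \<le> \<psi> z z' * ennreal (?m z * ?m z' * D x z x' z')"
        by (intro mult_left_mono ennreal_leI pd) (auto simp: marg_nonneg)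
      finally show "ennreal (?m z) * ennreal (?q x z) * (ennreal (?m z') * ennreal (?q x' z') * (\<psi> z z' * ennreal (pair_defect (x, z) (x', z')))) \<le> \<psi> z z' * ennreal (?m z * ?m z' * D x z x' z')" .
    qed
    finally show "ennreal (?m z) * ennreal (?q x z) * (\<integral>\<^sup>+z'. \<integral>\<^sup>+x'. ennreal (?m z') * ennreal (?q x' z') * (\<psi> z z' * ennreal (pair_defect (x, z) (x', z'))) \<partial>lborel \<partial>lborel) \<le>
      (\<integral>\<^sup>+z'. \<integral>\<^sup>+x'. \<psi> z z' * ennreal (?m z * ?m z' * D x z x' z') \<partial>lborel \<partial>lborel)" .
  qed
  also have "\<dots> = (\<integral>\<^sup>+z. \<integral>\<^sup>+z'. \<integral>\<^sup>+x. \<integral>\<^sup>+x'. \<psi> z z' * ennreal (?m z * ?m z' * D x z x' z') \<partial>lborel \<partial>lborel \<partial>lborel \<partial>lborel)"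
    by (intro nn_integral_cong lborel_pair.Fubini') measurable
  also have "\<dots> = (\<integral>\<^sup>+z. \<integral>\<^sup>+z'. \<psi> z z' * (\<integral>\<^sup>+x. \<integral>\<^sup>+x'. ennreal (?m z * ?m z' * D x z x' z') \<partial>lborel \<partial>lborel) \<partial>lborel \<partial>lborel)"
    by (simp add: nn_integral_cmult)
  also have "\<dots> \<le> (\<integral>\<^sup>+z. \<integral>\<^sup>+z'. \<psi> z z' * (ennreal (4 * C) * slice_dist z z') \<partial>lborel \<partial>lborel)"
    unfolding D_def by (intro nn_integral_mono mult_left_mono defect_slice_bound) auto
  also have "\<dots> = (\<integral>\<^sup>+z. \<integral>\<^sup>+z'. ennreal (4 * C) * (\<psi> z z' * slice_dist z z') \<partial>lborel \<partial>lborel)"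
    by (simp only: mult_ac)
  also have "\<dots> = ennreal (4 * C) * (\<integral>\<^sup>+z. \<integral>\<^sup>+z'. \<psi> z z' * slice_dist z z' \<partial>lborel \<partial>lborel)"
    by (simp add: nn_integral_cmult)
  finally show ?thesis .
qed

end

section \<open>The mean loss weighted by the kernels\<close>

context cpt_data
begin

abbreviation "swap_term n s j k \<omega> \<equiv> KW.Kh (h1 n) (DW s \<omega>) (DW j \<omega>) * KZ.Kh (h2 n) (DZ s \<omega>) (DZ k \<omega>) * mdef n j k (datXZ n \<omega>)"

lemma swap_defect_datXZ:
  assumes "j \<in> {1..n}" "k \<in> {1..n}"
  shows "sdef j k (datXZ n \<omega>) = pair_defect (XZ j \<omega>) (XZ k \<omega>)"
proof -
  interpret P: permutation_model "{1..n}" lborel lawZ qXZ by (rule permutation_model_XZ)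
  show ?thesis using assms unfolding P.swap_defect_def pair_defect_def by (simp add: datXZ_def XZ_def)
qed

text \<open>Both points are within a bandwidth of \<open>u\<close>: substituting z = u + hv and z' =
  u + h'v' makes their difference independent of \<open>u\<close> and smaller than \<delta>. The
  integral over \<open>u\<close> is at most \<epsilon>, and \<open>v\<close> and \<open>v'\<close>
  contribute the masses of the two kernels.\<close>

lemma swap_expectation_slices:
  assumes h: "0 < h" "0 < h'" and \<epsilon>: "0 \<le> \<epsilon>"
    and \<delta>: "\<And>t. norm t < \<delta> \<Longrightarrow> (\<integral>\<^sup>+w. ennreal \<bar>marg_XZ p (w + t) - marg_XZ p w\<bar> \<partial>lborel) \<le> ennreal \<epsilon>"
    and hR: "R * (h + h') < \<delta>"
  shows "(\<integral>\<^sup>+u. \<integral>\<^sup>+z. \<integral>\<^sup>+z'. ennreal (box h u z) * ennreal (KZ.Kh h' u z') * slice_dist z z' \<partial>lborel \<partial>lborel \<partial>lborel) \<le>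
    ennreal (vol (0 :: 'z) * \<epsilon>)"
proof -
  have cb[measurable]: "indicator (cball 0 R) \<in> borel_measurable (borel :: 'z measure)" by (intro borel_measurable_indicator) auto
  have "(\<integral>\<^sup>+u. \<integral>\<^sup>+z. \<integral>\<^sup>+z'. ennreal (box h u z) * ennreal (KZ.Kh h' u z') * slice_dist z z' \<partial>lborel \<partial>lborel \<partial>lborel) =
    (\<integral>\<^sup>+u. \<integral>\<^sup>+z. ennreal (box h u z) * (\<integral>\<^sup>+z'. ennreal (KZ.Kh h' u z') * slice_dist z z' \<partial>lborel) \<partial>lborel \<partial>lborel)"
    unfolding mult.assoc by (intro nn_integral_cong nn_integral_cmult) measurable
  also have "\<dots> = (\<integral>\<^sup>+u. \<integral>\<^sup>+v. indicator (cball 0 R) v * (\<integral>\<^sup>+v'. ennreal (K (norm v')) * slice_dist (u + h *\<^sub>R v) (u + h' *\<^sub>R v') \<partial>lborel) \<partial>lborel \<partial>lborel)"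
  proof (rule nn_integral_cong)
    fix u :: 'z
    have "(\<integral>\<^sup>+z. ennreal (box h u z) * (\<integral>\<^sup>+z'. ennreal (KZ.Kh h' u z') * slice_dist z z' \<partial>lborel) \<partial>lborel) =
      (\<integral>\<^sup>+z. ennreal (box h u z) * (\<integral>\<^sup>+v'. ennreal (K (norm v')) * slice_dist z (u + h' *\<^sub>R v') \<partial>lborel) \<partial>lborel)"
      by (intro nn_integral_cong arg_cong2[of _ _ _ _ "(*)"] refl KZ.nn_integral_Kh h) measurable
    also have "\<dots> = (\<integral>\<^sup>+v. indicator (cball 0 R) v * (\<integral>\<^sup>+v'. ennreal (K (norm v')) * slice_dist (u + h *\<^sub>R v) (u + h' *\<^sub>R v') \<partial>lborel) \<partial>lborel)"
      by (rule nn_integral_box[OF _ h(1)]) measurable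
    finally show "(\<integral>\<^sup>+z. ennreal (box h u z) * (\<integral>\<^sup>+z'. ennreal (KZ.Kh h' u z') * slice_dist z z' \<partial>lborel) \<partial>lborel) =
      (\<integral>\<^sup>+v. indicator (cball 0 R) v * (\<integral>\<^sup>+v'. ennreal (K (norm v')) * slice_dist (u + h *\<^sub>R v) (u + h' *\<^sub>R v') \<partial>lborel) \<partial>lborel)" .
  qed
  also have "\<dots> = (\<integral>\<^sup>+v. \<integral>\<^sup>+u. indicator (cball 0 R) v * (\<integral>\<^sup>+v'. ennreal (K (norm v')) * slice_dist (u + h *\<^sub>R v) (u + h' *\<^sub>R v') \<partial>lborel) \<partial>lborel \<partial>lborel)"
    by (rule lborel_pair.Fubini') measurable
  also have "\<dots> = (\<integral>\<^sup>+v. indicator (cball 0 R) v * (\<integral>\<^sup>+u. (\<integral>\<^sup>+v'. ennreal (K (norm v')) * slice_dist (u + h *\<^sub>R v) (u + h' *\<^sub>R v') \<partial>lborel) \<partial>lborel) \<partial>lborel)"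
    by (intro nn_integral_cong nn_integral_cmult) measurable
  also have "\<dots> = (\<integral>\<^sup>+v. indicator (cball 0 R) v * (\<integral>\<^sup>+v'. ennreal (K (norm v')) * (\<integral>\<^sup>+u. slice_dist (u + h *\<^sub>R v) (u + h' *\<^sub>R v') \<partial>lborel) \<partial>lborel) \<partial>lborel)"
  proof (rule nn_integral_cong, rule arg_cong2[of _ _ _ _ "(*)"], rule refl)
    fix v :: 'z
    have "(\<integral>\<^sup>+u. \<integral>\<^sup>+v'. ennreal (K (norm v')) * slice_dist (u + h *\<^sub>R v) (u + h' *\<^sub>R v') \<partial>lborel \<partial>lborel) =
      (\<integral>\<^sup>+v'. \<integral>\<^sup>+u. ennreal (K (norm v')) * slice_dist (u + h *\<^sub>R v) (u + h' *\<^sub>R v') \<partial>lborel \<partial>lborel)"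
      by (rule lborel_pair.Fubini') measurable
    also have "\<dots> = (\<integral>\<^sup>+v'. ennreal (K (norm v')) * (\<integral>\<^sup>+u. slice_dist (u + h *\<^sub>R v) (u + h' *\<^sub>R v') \<partial>lborel) \<partial>lborel)"
      by (intro nn_integral_cong nn_integral_cmult) measurable
    finally show "(\<integral>\<^sup>+u. \<integral>\<^sup>+v'. ennreal (K (norm v')) * slice_dist (u + h *\<^sub>R v) (u + h' *\<^sub>R v') \<partial>lborel \<partial>lborel) =
      (\<integral>\<^sup>+v'. ennreal (K (norm v')) * (\<integral>\<^sup>+u. slice_dist (u + h *\<^sub>R v) (u + h' *\<^sub>R v') \<partial>lborel) \<partial>lborel)" .
  qed
  also have "\<dots> \<le> (\<integral>\<^sup>+v. indicator (cball (0 :: 'z) R) v * (\<integral>\<^sup>+v'. ennreal (K (norm (v' :: 'z))) * ennreal \<epsilon> \<partial>lborel) \<partial>lborel)"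
  proof (intro nn_integral_mono)
    fix v :: 'z
    show "indicator (cball 0 R) v * (\<integral>\<^sup>+v'. ennreal (K (norm v')) * (\<integral>\<^sup>+u. slice_dist (u + h *\<^sub>R v) (u + h' *\<^sub>R v') \<partial>lborel) \<partial>lborel) \<le>
      indicator (cball 0 R) v * (\<integral>\<^sup>+v'. ennreal (K (norm (v' :: 'z))) * ennreal \<epsilon> \<partial>lborel)"
    proof (cases "norm v \<le> R")
      case v: True
      have "ennreal (K (norm v')) * (\<integral>\<^sup>+u. slice_dist (u + h *\<^sub>R v) (u + h' *\<^sub>R v') \<partial>lborel) \<le> ennreal (K (norm v')) * ennreal \<epsilon>" for v' :: 'z
      proof (cases "K (norm v') = 0")
        case False
        then have v': "norm v' \<le> R" using KZ.K_supp[OF False] by simp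
        have "norm (h *\<^sub>R v - h' *\<^sub>R v') \<le> h * norm v + h' * norm v'"
          using h by (intro order_trans[OF norm_triangle_ineq4]) simp
        also have "\<dots> \<le> h * R + h' * R" using h v v' by (intro add_mono mult_left_mono) auto
        also have "\<dots> < \<delta>" using hR by (simp add: algebra_simps)
        finally show ?thesis by (intro mult_left_mono slice_dist_shift[OF \<delta>]) auto
      qed simp
      then show ?thesis by (intro mult_left_mono[OF nn_integral_mono]) auto
    qed simp
  qed
  also have "\<dots> = ennreal (vol (0 :: 'z)) * ennreal \<epsilon>"
    by (simp add: nn_integral_multc KZ.K_int vol_eq)
  also have "\<dots> = ennreal (vol (0 :: 'z) * \<epsilon>)" using \<epsilon> by (simp add: ennreal_mult)
  finally show ?thesis .
qed

lemma mean_defect_bounds: "0 \<le> mdef n j k d" "mdef n j k d \<le> 1"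
proof -
  interpret P: permutation_model "{1..n}" lborel lawZ qXZ by (rule permutation_model_XZ)
  show "0 \<le> mdef n j k d" "mdef n j k d \<le> 1" by (rule P.mean_defect_bounds)+
qed

lemma mean_defect_meas:
  assumes "j \<in> {1..n}" "k \<in> {1..n}"
  shows "mdef n j k \<in> borel_measurable (PiM {1..n} borelXZ)"
proof -
  interpret P: permutation_model "{1..n}" lborel lawZ qXZ by (rule permutation_model_XZ)
  show ?thesis using P.mean_defect_meas[OF assms] unfolding measurable_cong_sets[OF base_sets refl] .
qed

lemma mean_defect_datXZ_meas:
  assumes "j \<in> {1..n}" "k \<in> {1..n}"
  shows "(\<lambda>\<omega>. mdef n j k (datXZ n \<omega>)) \<in> borel_measurable \<Omega>"
  using measurable_compose[OF datXZ_meas] mean_defect_meas[OF assms] unfolding measurable_cong_sets[OF base_sets refl] by auto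

text \<open>Once \<open>Y\<close> is gone, the kernel weights depend on the \<open>Z\<close>-values
  only and are constant on orbits, so the mean defect may be replaced by the defect of the two
  original observations. Independence of \<open>s\<close>, \<open>j\<close>, \<open>k\<close>
  reduces the rest to an integral of slice distances; the constants are 4C from the pair and
  \<open>C\<close> from the density of \<open>Z_s\<close>.\<close>

lemma box_mean_defect:
  assumes J: "s \<in> {1..n}" "j \<in> {1..n}" "k \<in> {1..n}" "s \<noteq> j" "s \<noteq> k" "j \<noteq> k"
    and h: "0 < h" "0 < h'" and \<epsilon>: "0 \<le> \<epsilon>"
    and \<delta>: "\<And>t. norm t < \<delta> \<Longrightarrow> (\<integral>\<^sup>+w. ennreal \<bar>marg_XZ p (w + t) - marg_XZ p w\<bar> \<partial>lborel) \<le> ennreal \<epsilon>"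
    and hR: "R * (h + h') < \<delta>"
  shows "(\<integral>\<^sup>+\<omega>. ennreal (box h (DZ s \<omega>) (DZ j \<omega>)) *
      (ennreal (KZ.Kh h' (DZ s \<omega>) (DZ k \<omega>)) * ennreal (mdef n j k (datXZ n \<omega>))) \<partial>\<Omega>) \<le>
    ennreal (4 * C * C * (vol (0 :: 'z) * \<epsilon>))"
proof -
  interpret P: permutation_model "{1..n}" lborel lawZ qXZ by (rule permutation_model_XZ)
  define \<psi> where "\<psi> d = ennreal (box h (snd (d s)) (snd (d j))) * ennreal (KZ.Kh h' (snd (d s)) (snd (d k)))"
    for d :: "nat \<Rightarrow> 'x \<times> 'z"
  have n: "0 < n" using J(1) by auto
  let ?PB = "PiM {1..n} borelXZ"
  have cm: "(\<lambda>d. snd (d i)) \<in> measurable ?PB borel" if "i \<in> {1..n}" for i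
    using measurable_compose[OF measurable_component_singleton[OF that] borel_fst_snd(2)] .
  have "\<psi> \<in> borel_measurable ?PB" unfolding \<psi>_def
    by (intro borel_measurable_times_ennreal measurable_compose[OF box_meas[OF cm cm] measurable_ennreal]
      measurable_compose[OF KZ.Kh_meas[OF cm cm] measurable_ennreal] J)
  then have \<psi>m: "\<psi> \<in> borel_measurable P.base" unfolding measurable_cong_sets[OF base_sets refl] .
  have \<psi>p: "\<psi> (permute_fst \<sigma> d) = \<psi> d" for \<sigma> d by (simp add: \<psi>_def permute_fst_def)
  have law: "(\<integral>\<^sup>+\<omega>. F (datXZ n \<omega>) \<partial>\<Omega>) = (\<integral>\<^sup>+d. ennreal (P.lik d) * F d \<partial>P.base)" if F: "F \<in> borel_measurable P.base" for F
  proof -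
    have "(\<integral>\<^sup>+\<omega>. F (datXZ n \<omega>) \<partial>\<Omega>) = (\<integral>\<^sup>+d. F d \<partial>distr \<Omega> P.base (datXZ n))" using F by (intro nn_integral_distr[symmetric] datXZ_meas) auto
    also have "\<dots> = (\<integral>\<^sup>+d. ennreal (P.lik d) * F d \<partial>P.base)"
      unfolding datXZ_law[OF n] by (rule nn_integral_density) (use F P.lik_meas in \<open>auto\<close>)
    finally show ?thesis .
  qed
  have dat: "\<psi> (datXZ n \<omega>) = ennreal (box h (snd (XZ s \<omega>)) (snd (XZ j \<omega>))) * ennreal (KZ.Kh h' (snd (XZ s \<omega>)) (snd (XZ k \<omega>)))" for \<omega>
    using J by (simp add: \<psi>_def datXZ_def XZ_def)
  have md: "(\<lambda>d. ennreal (mdef n j k d)) \<in> borel_measurable P.base" "(\<lambda>d. ennreal (sdef j k d)) \<in> borel_measurable P.base"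
    by (rule measurable_compose[OF P.mean_defect_meas measurable_ennreal] measurable_compose[OF P.swap_defect_meas measurable_ennreal]; rule J)+
  have "(\<integral>\<^sup>+\<omega>. ennreal (box h (DZ s \<omega>) (DZ j \<omega>)) *
      (ennreal (KZ.Kh h' (DZ s \<omega>) (DZ k \<omega>)) * ennreal (mdef n j k (datXZ n \<omega>))) \<partial>\<Omega>) =
    (\<integral>\<^sup>+\<omega>. \<psi> (datXZ n \<omega>) * ennreal (mdef n j k (datXZ n \<omega>)) \<partial>\<Omega>)"
    unfolding dat by (simp only: XZ_def snd_conv mult.assoc)
  also have "\<dots> = (\<integral>\<^sup>+d. ennreal (P.lik d) * (\<psi> d * ennreal (mdef n j k d)) \<partial>P.base)"
    by (rule law) (intro borel_measurable_times_ennreal \<psi>m md)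
  also have "\<dots> = (\<integral>\<^sup>+d. ennreal (P.lik d) * (\<psi> d * ennreal (sdef j k d)) \<partial>P.base)"
    by (rule P.nn_integral_mean_defect[OF J(2,3) \<psi>m \<psi>p])
  also have "\<dots> = (\<integral>\<^sup>+\<omega>. \<psi> (datXZ n \<omega>) * ennreal (sdef j k (datXZ n \<omega>)) \<partial>\<Omega>)"
    by (rule law[symmetric]) (intro borel_measurable_times_ennreal \<psi>m md)
  also have "\<dots> = (\<integral>\<^sup>+\<omega>. (\<lambda>a b c. ennreal (box h (snd a) (snd b)) * ennreal (KZ.Kh h' (snd a) (snd c)) * ennreal (pair_defect b c))
      (XZ s \<omega>) (XZ j \<omega>) (XZ k \<omega>) \<partial>\<Omega>)"
    unfolding dat swap_defect_datXZ[OF J(2,3)] ..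
  also have "\<dots> = (\<integral>\<^sup>+a. \<integral>\<^sup>+b. \<integral>\<^sup>+c. ennreal (box h (snd a) (snd b)) * ennreal (KZ.Kh h' (snd a) (snd c)) * ennreal (pair_defect b c) \<partial>lawXZ \<partial>lawXZ \<partial>lawXZ)"
  proof (rule nn_integral_indep3[OF XZ_ind _ _ _ J(4,5,6) XZ_law])
    let ?B = "borel :: ('x \<times> 'z) measure"
    have f: "fst \<in> measurable (?B \<Otimes>\<^sub>M (?B \<Otimes>\<^sub>M ?B)) ?B" "(\<lambda>t. fst (snd t)) \<in> measurable (?B \<Otimes>\<^sub>M (?B \<Otimes>\<^sub>M ?B)) ?B"
      "(\<lambda>t. snd (snd t)) \<in> measurable (?B \<Otimes>\<^sub>M (?B \<Otimes>\<^sub>M ?B)) ?B"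
      by (intro measurable_fst measurable_compose[OF measurable_snd measurable_fst] measurable_compose[OF measurable_snd measurable_snd])+
    note g = f[THEN measurable_compose, OF borel_fst_snd(2)]
    show "(\<lambda>(a, b, c). ennreal (box h (snd a) (snd b)) * ennreal (KZ.Kh h' (snd a) (snd c)) * ennreal (pair_defect b c)) \<in> borel_measurable (?B \<Otimes>\<^sub>M (?B \<Otimes>\<^sub>M ?B))"
      unfolding case_prod_unfold
      by (intro borel_measurable_times_ennreal measurable_compose[OF pair_defect_meas measurable_ennreal]
        measurable_compose[OF box_meas measurable_ennreal] measurable_compose[OF KZ.Kh_meas measurable_ennreal] f g)
  qed (use J in auto)
  also have "\<dots> \<le> (\<integral>\<^sup>+a. (\<lambda>u. ennreal (4 * C) * (\<integral>\<^sup>+z. \<integral>\<^sup>+z'. ennreal (box h u z) * ennreal (KZ.Kh h' u z') * slice_dist z z' \<partial>lborel \<partial>lborel)) (snd a) \<partial>lawXZ)"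
    by (intro nn_integral_mono nn_integral_pair_defect_le) measurable
  also have "\<dots> \<le> ennreal C * (\<integral>\<^sup>+u. ennreal (4 * C) * (\<integral>\<^sup>+z. \<integral>\<^sup>+z'. ennreal (box h u z) * ennreal (KZ.Kh h' u z') * slice_dist z z' \<partial>lborel \<partial>lborel) \<partial>lborel)"
    by (rule nn_integral_lawXZ_snd_le) measurable
  also have "\<dots> = ennreal C * (ennreal (4 * C) * (\<integral>\<^sup>+u. \<integral>\<^sup>+z. \<integral>\<^sup>+z'. ennreal (box h u z) * ennreal (KZ.Kh h' u z') * slice_dist z z' \<partial>lborel \<partial>lborel \<partial>lborel))"
    by (subst nn_integral_cmult) auto
  also have "\<dots> \<le> ennreal C * (ennreal (4 * C) * ennreal (vol (0 :: 'z) * \<epsilon>))"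
    by (intro mult_left_mono swap_expectation_slices[OF h \<epsilon> \<delta> hR]) auto
  also have "\<dots> = ennreal (4 * C * C * (vol (0 :: 'z) * \<epsilon>))"
    using C_pos \<epsilon> by (simp add: mult_ac flip: ennreal_mult)
  finally show ?thesis .
qed

lemma kernel_mean_defect_good:
  assumes J: "s \<in> {1..n}" "j \<in> {1..n}" "k \<in> {1..n}" "s \<noteq> j" "s \<noteq> k" "j \<noteq> k"
    and h: "0 < h" "0 < h'" and \<epsilon>: "0 \<le> \<epsilon>" and c: "0 < c"
    and \<delta>: "\<And>t. norm t < \<delta> \<Longrightarrow> (\<integral>\<^sup>+w. ennreal \<bar>marg_XZ p (w + t) - marg_XZ p w\<bar> \<partial>lborel) \<le> ennreal \<epsilon>"
    and hR: "R * (h + h') < \<delta>"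
  shows "(\<integral>\<^sup>+\<omega>. ennreal (KW.Kh h (DW s \<omega>) (DW j \<omega>)) * (indicator {v. c \<le> marg_XZ p v} (XZ j \<omega>) *
      (ennreal (KZ.Kh h' (DZ s \<omega>) (DZ k \<omega>)) * ennreal (mdef n j k (datXZ n \<omega>)))) \<partial>\<Omega>) \<le>
    ennreal (C * \<kappa> * vol (0 :: 'y) / c * (4 * C * C * (vol (0 :: 'z) * \<epsilon>)))"
proof -
  let ?PB = "PiM {1..n} borelXZ"
  define \<Psi> where "\<Psi> d = ennreal (KZ.Kh h' (snd (d s)) (snd (d k))) * ennreal (mdef n j k d)" for d :: "nat \<Rightarrow> 'x \<times> 'z"
  have cm: "(\<lambda>d. snd (d i)) \<in> measurable ?PB borel" if "i \<in> {1..n}" for i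
    using measurable_compose[OF measurable_component_singleton[OF that] borel_fst_snd(2)] .
  have \<Psi>m: "\<Psi> \<in> borel_measurable ?PB" unfolding \<Psi>_def
    by (intro borel_measurable_times_ennreal measurable_compose[OF KZ.Kh_meas[OF cm cm] measurable_ennreal]
      measurable_compose[OF mean_defect_meas measurable_ennreal] J)
  have dat: "\<Psi> (datXZ n \<omega>) = ennreal (KZ.Kh h' (DZ s \<omega>) (DZ k \<omega>)) * ennreal (mdef n j k (datXZ n \<omega>))" for \<omega>
    using J by (simp add: \<Psi>_def datXZ_def)
  have "(\<integral>\<^sup>+\<omega>. ennreal (KW.Kh h (DW s \<omega>) (DW j \<omega>)) * (indicator {v. c \<le> marg_XZ p v} (XZ j \<omega>) * \<Psi> (datXZ n \<omega>)) \<partial>\<Omega>) \<le>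
    ennreal (C * \<kappa> * vol (0 :: 'y) / c) * ennreal (4 * C * C * (vol (0 :: 'z) * \<epsilon>))"
    by (rule order_trans[OF integrate_out_Y[OF J(1,2,4) \<Psi>m h(1) c] mult_left_mono])
      (unfold dat, rule box_mean_defect[OF J h \<epsilon> \<delta> hR], simp_all)
  then show ?thesis unfolding dat using C_pos \<epsilon> c KW.\<kappa>_pos by (simp add: mult_ac flip: ennreal_mult)
qed

text \<open>The defect is bounded by 1. Each kernel has mean at most \<open>C\<close> given the
  observation at its other end, so only the probability of a small density remains.\<close>

lemma kernel_mean_defect_bad:
  assumes J: "s \<in> {1..n}" "j \<in> {1..n}" "k \<in> {1..n}" "s \<noteq> j" "s \<noteq> k" "j \<noteq> k"
    and h: "0 < h" "0 < h'"
  shows "(\<integral>\<^sup>+\<omega>. ennreal (KW.Kh h (DW s \<omega>) (DW j \<omega>)) * (indicator {v. marg_XZ p v < c} (XZ j \<omega>) *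
      (ennreal (KZ.Kh h' (DZ s \<omega>) (DZ k \<omega>)) * ennreal (mdef n j k (datXZ n \<omega>)))) \<partial>\<Omega>) \<le>
    ennreal (C * C) * emeasure lawXZ {v. marg_XZ p v < c}"
proof -
  interpret SY: kernel_sample K \<kappa> R "TYPE('y \<times> 'z)" \<Omega> borel D law snd "\<lambda>e. indicator UNIV (fst e)" "numYZ UNIV" C by (rule sample_YZ) simp
  interpret SZ: kernel_sample K \<kappa> R "TYPE('z)" \<Omega> borel D law "\<lambda>e. snd (snd e)" "\<lambda>e. indicator UNIV (fst e)" "numZ UNIV" C by (rule sample_Z) simp
  let ?i = "\<lambda>e :: 'x \<times> 'y \<times> 'z. indicator {v. marg_XZ p v < c} (fst e, snd (snd e)) :: ennreal"
  have ind: "(indicator {v. marg_XZ p v < c} :: 'x \<times> 'z \<Rightarrow> ennreal) \<in> borel_measurable borel" by measurable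
  have im[measurable]: "?i \<in> borel_measurable borel" by (rule measurable_compose[OF XZ_proj_meas ind])
  have "(\<integral>\<^sup>+\<omega>. ennreal (KW.Kh h (DW s \<omega>) (DW j \<omega>)) * (indicator {v. marg_XZ p v < c} (XZ j \<omega>) *
      (ennreal (KZ.Kh h' (DZ s \<omega>) (DZ k \<omega>)) * ennreal (mdef n j k (datXZ n \<omega>)))) \<partial>\<Omega>) \<le>
    (\<integral>\<^sup>+\<omega>. (\<lambda>b a c. ?i b * (ennreal (KW.Kh h (snd b) (snd a)) * ennreal (KZ.Kh h' (snd (snd a)) (snd (snd c))))) (D j \<omega>) (D s \<omega>) (D k \<omega>) \<partial>\<Omega>)"
  proof (intro nn_integral_mono)
    fix \<omega>
    let ?A = "ennreal (KW.Kh h (DW s \<omega>) (DW j \<omega>))" and ?B = "ennreal (KZ.Kh h' (DZ s \<omega>) (DZ k \<omega>))"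
    have "?A * (indicator {v. marg_XZ p v < c} (XZ j \<omega>) * (?B * ennreal (mdef n j k (datXZ n \<omega>)))) \<le> ?A * (?i (D j \<omega>) * (?B * 1))"
      unfolding XZ_def by (intro mult_left_mono) (auto simp: mean_defect_bounds simp del: One_nat_def)
    \<comment> \<open>Symmetry of the kernel allows integrating over \<open>k\<close>, then
      \<open>s\<close>, then \<open>j\<close>, which keeps the indicator at \<open>j\<close> for the
      last integration.\<close>
    also have "\<dots> = ?i (D j \<omega>) * (ennreal (KW.Kh h (DW j \<omega>) (DW s \<omega>)) * ?B)"
      by (simp only: mult_ac mult_1_left mult_1_right KW.Kh_commute[of h "DW s \<omega>"])
    finally show "?A * (indicator {v. marg_XZ p v < c} (XZ j \<omega>) * (?B * ennreal (mdef n j k (datXZ n \<omega>)))) \<le>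
      (\<lambda>b a c. ?i b * (ennreal (KW.Kh h (snd b) (snd a)) * ennreal (KZ.Kh h' (snd (snd a)) (snd (snd c))))) (D j \<omega>) (D s \<omega>) (D k \<omega>)" .
  qed
  also have "\<dots> = (\<integral>\<^sup>+b. \<integral>\<^sup>+a. \<integral>\<^sup>+e. ?i b * (ennreal (KW.Kh h (snd b) (snd a)) * ennreal (KZ.Kh h' (snd (snd a)) (snd (snd e)))) \<partial>law \<partial>law \<partial>law)"
  proof (rule nn_integral_indep3[OF D_ind])
    let ?B = "borel :: ('x \<times> 'y \<times> 'z) measure"
    have f: "fst \<in> measurable (?B \<Otimes>\<^sub>M (?B \<Otimes>\<^sub>M ?B)) ?B" "(\<lambda>t. fst (snd t)) \<in> measurable (?B \<Otimes>\<^sub>M (?B \<Otimes>\<^sub>M ?B)) ?B"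
      "(\<lambda>t. snd (snd t)) \<in> measurable (?B \<Otimes>\<^sub>M (?B \<Otimes>\<^sub>M ?B)) ?B"
      by (intro measurable_fst measurable_compose[OF measurable_snd measurable_fst] measurable_compose[OF measurable_snd measurable_snd])+
    note g = f[THEN measurable_compose, OF borel_fst_snd(2)]
    note g' = g[THEN measurable_compose, OF borel_fst_snd(2)]
    show "(\<lambda>(b, a, e). ?i b * (ennreal (KW.Kh h (snd b) (snd a)) * ennreal (KZ.Kh h' (snd (snd a)) (snd (snd e))))) \<in> borel_measurable (?B \<Otimes>\<^sub>M (?B \<Otimes>\<^sub>M ?B))"
      unfolding case_prod_unfold
      by (intro borel_measurable_times_ennreal measurable_compose[OF _ im]
        measurable_compose[OF KW.Kh_meas measurable_ennreal] measurable_compose[OF KZ.Kh_meas measurable_ennreal] f g g')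
  qed (use J D_law in auto)
  also have "\<dots> \<le> (\<integral>\<^sup>+b. ?i b * ennreal (C * C) \<partial>law)"
  proof (intro nn_integral_mono)
    fix b :: "'x \<times> 'y \<times> 'z"
    have "(\<integral>\<^sup>+a. \<integral>\<^sup>+e. ?i b * (ennreal (KW.Kh h (snd b) (snd a)) * ennreal (KZ.Kh h' (snd (snd a)) (snd (snd e)))) \<partial>law \<partial>law) =
      (\<integral>\<^sup>+a. ?i b * (ennreal (KW.Kh h (snd b) (snd a)) * (\<integral>\<^sup>+e. ennreal (KZ.Kh h' (snd (snd a)) (snd (snd e))) \<partial>law)) \<partial>law)"
    proof (rule nn_integral_cong)
      fix a :: "'x \<times> 'y \<times> 'z"
      have m: "(\<lambda>e :: 'x \<times> 'y \<times> 'z. ennreal (KZ.Kh h' (snd (snd a)) (snd (snd e)))) \<in> borel_measurable law"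
        using measurable_compose[OF KZ.Kh_meas[OF borel_measurable_const measurable_compose[OF borel_fst_snd(2) borel_fst_snd(2)]] measurable_ennreal] by simp
      show "(\<integral>\<^sup>+e. ?i b * (ennreal (KW.Kh h (snd b) (snd a)) * ennreal (KZ.Kh h' (snd (snd a)) (snd (snd e)))) \<partial>law) =
        ?i b * (ennreal (KW.Kh h (snd b) (snd a)) * (\<integral>\<^sup>+e. ennreal (KZ.Kh h' (snd (snd a)) (snd (snd e))) \<partial>law))"
        unfolding mult.assoc[symmetric] by (rule nn_integral_cmult[OF m])
    qed
    also have "\<dots> \<le> (\<integral>\<^sup>+a. ?i b * (ennreal (KW.Kh h (snd b) (snd a)) * ennreal C) \<partial>law)"
    proof (intro nn_integral_mono mult_left_mono)
      fix a :: "'x \<times> 'y \<times> 'z"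
      have "(\<integral>\<^sup>+e. ennreal (KZ.Kh h' (snd (snd a)) (snd (snd e))) \<partial>law) \<le> ennreal C * (\<integral>\<^sup>+u. ennreal (KZ.Kh h' (snd (snd a)) u) \<partial>lborel)"
        by (rule SZ.dom) measurable
      then show "(\<integral>\<^sup>+e. ennreal (KZ.Kh h' (snd (snd a)) (snd (snd e))) \<partial>law) \<le> ennreal C" by (simp add: KZ.nn_integral_Kh_1 h)
    qed auto
    also have "\<dots> = (\<integral>\<^sup>+a. (?i b * ennreal C) * ennreal (KW.Kh h (snd b) (snd a)) \<partial>law)" by (simp only: mult_ac)
    also have "\<dots> = (?i b * ennreal C) * (\<integral>\<^sup>+a. ennreal (KW.Kh h (snd b) (snd a)) \<partial>law)"
    proof (rule nn_integral_cmult)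
      show "(\<lambda>a :: 'x \<times> 'y \<times> 'z. ennreal (KW.Kh h (snd b) (snd a))) \<in> borel_measurable law"
        using measurable_compose[OF KW.Kh_meas[OF borel_measurable_const borel_fst_snd(2)] measurable_ennreal] by simp
    qed
    also have "\<dots> \<le> (?i b * ennreal C) * ennreal C"
    proof (intro mult_left_mono)
      have "(\<integral>\<^sup>+a. ennreal (KW.Kh h (snd b) (snd a)) \<partial>law) \<le> ennreal C * (\<integral>\<^sup>+u. ennreal (KW.Kh h (snd b) u) \<partial>lborel)"
        by (rule SY.dom) measurable
      then show "(\<integral>\<^sup>+a. ennreal (KW.Kh h (snd b) (snd a)) \<partial>law) \<le> ennreal C" by (simp add: KW.nn_integral_Kh_1 h)
    qed auto
    also have "\<dots> = ?i b * ennreal (C * C)" using C_pos by (simp add: ennreal_mult mult.assoc)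
    finally show "(\<integral>\<^sup>+a. \<integral>\<^sup>+e. ?i b * (ennreal (KW.Kh h (snd b) (snd a)) * ennreal (KZ.Kh h' (snd (snd a)) (snd (snd e)))) \<partial>law \<partial>law) \<le> ?i b * ennreal (C * C)" .
  qed
  also have "\<dots> = ennreal (C * C) * (\<integral>\<^sup>+b. ?i b \<partial>law)"
    unfolding mult.commute[of _ "ennreal (C * C)"] by (rule nn_integral_cmult) (use im in simp)
  also have "(\<integral>\<^sup>+b. ?i b \<partial>law) = (\<integral>\<^sup>+w. ennreal (marg_XZ p w) * indicator {v. marg_XZ p v < c} w \<partial>lborel)"
    by (rule nn_integral_joint_XZ[OF ind])
  also have "\<dots> = emeasure lawXZ {v. marg_XZ p v < c}" by (intro emeasure_density[symmetric]) auto
  finally show ?thesis .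
qed

text \<open>The threshold \<open>c\<close> is fixed first, making the contribution of small
  densities at most \<epsilon>/2. The constant \<open>A\<close> of the good part depends on
  \<open>c\<close>, and the modulus of continuity is chosen afterwards to compensate it.\<close>

lemma kernel_mean_defect_small:
  assumes \<epsilon>: "0 < \<epsilon>"
  shows "eventually (\<lambda>n. \<forall>s\<in>{1..n}. \<forall>j\<in>{1..n}. \<forall>k\<in>{1..n}. s \<noteq> j \<longrightarrow> s \<noteq> k \<longrightarrow> j \<noteq> k \<longrightarrow>
    (\<integral>\<^sup>+\<omega>. ennreal (swap_term n s j k \<omega>) \<partial>\<Omega>) \<le> ennreal \<epsilon>) sequentially"
proof -
  interpret XZ: prob_space lawXZ using marg_int(2) by (intro prob_spaceI) (simp add: emeasure_density)
  have CC: "0 < C * C" using C_pos by simp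
  have "AE v in lawXZ. 0 < marg_XZ p v" by (subst AE_density) (auto simp: marg_nonneg)
  then obtain c where c: "0 < c" "emeasure lawXZ {v\<in>space lawXZ. marg_XZ p v < c} \<le> ennreal (\<epsilon> / 2 / (C * C))"
    using XZ.small_values[of "marg_XZ p" "\<epsilon> / 2 / (C * C)"] \<epsilon> CC by auto
  define A where "A = C * \<kappa> * vol (0 :: 'y) / c * (4 * C * C * vol (0 :: 'z))"
  have A0: "0 \<le> A" unfolding A_def using C_pos c KW.\<kappa>_pos by simp
  define \<epsilon>' where "\<epsilon>' = \<epsilon> / 2 / (A + 1)"
  have \<epsilon>': "0 < \<epsilon>'" "A * \<epsilon>' \<le> \<epsilon> / 2" unfolding \<epsilon>'_def using A0 \<epsilon> by (auto simp: field_simps)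
  obtain \<delta> where \<delta>: "0 < \<delta>" "\<And>t. norm t < \<delta> \<Longrightarrow> (\<integral>\<^sup>+w. ennreal \<bar>marg_XZ p (w + t) - marg_XZ p w\<bar> \<partial>lborel) \<le> ennreal \<epsilon>'"
    using L1_translation_continuous_nn[OF marg_integrable(2) \<epsilon>'(1)] by blast
  have "(\<lambda>n. R * (h1 n + h2 n)) \<longlonglongrightarrow> R * (0 + 0)" by (intro tendsto_intros h1_0 h2_0)
  then have "eventually (\<lambda>n. R * (h1 n + h2 n) < \<delta>) sequentially" using \<delta>(1) by (intro order_tendstoD) auto
  then show ?thesis
  proof eventually_elim
    case (elim n)
    show ?case
    proof (intro ballI impI)
      fix s j k assume J: "s \<in> {1..n}" "j \<in> {1..n}" "k \<in> {1..n}" "s \<noteq> j" "s \<noteq> k" "j \<noteq> k"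
      let ?A = "\<lambda>\<omega>. ennreal (KW.Kh (h1 n) (DW s \<omega>) (DW j \<omega>))" and ?B = "\<lambda>\<omega>. ennreal (KZ.Kh (h2 n) (DZ s \<omega>) (DZ k \<omega>))"
        and ?m = "\<lambda>\<omega>. ennreal (mdef n j k (datXZ n \<omega>))"
      have s1: "s \<in> {1..}" "j \<in> {1..}" "k \<in> {1..}" using J by auto
      have Am: "?A \<in> borel_measurable \<Omega>" "?B \<in> borel_measurable \<Omega>" "?m \<in> borel_measurable \<Omega>"
        by (intro measurable_compose[OF KW.Kh_meas measurable_ennreal] measurable_compose[OF KZ.Kh_meas measurable_ennreal]
          measurable_compose[OF mean_defect_datXZ_meas measurable_ennreal] D_components_meas s1 J)+
      have im: "(\<lambda>\<omega>. indicator U (XZ j \<omega>) :: ennreal) \<in> borel_measurable \<Omega>" if "U \<in> sets borel" for U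
        by (rule measurable_compose[OF XZ_meas[OF s1(2)] borel_measurable_indicator[OF that]])
      have U: "{v. c \<le> marg_XZ p v} \<in> sets borel" "{v. marg_XZ p v < c} \<in> sets borel" by measurable
      have split: "ennreal (swap_term n s j k \<omega>) =
        ?A \<omega> * (indicator {v. c \<le> marg_XZ p v} (XZ j \<omega>) * (?B \<omega> * ?m \<omega>)) + ?A \<omega> * (indicator {v. marg_XZ p v < c} (XZ j \<omega>) * (?B \<omega> * ?m \<omega>))" for \<omega>
        by (cases "c \<le> marg_XZ p (XZ j \<omega>)")
          (auto simp: ennreal_mult mean_defect_bounds KW.Kh_nonneg KZ.Kh_nonneg h1_pos h2_pos mult.assoc simp del: One_nat_def)
      have "(\<integral>\<^sup>+\<omega>. ennreal (swap_term n s j k \<omega>) \<partial>\<Omega>) =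
        (\<integral>\<^sup>+\<omega>. ?A \<omega> * (indicator {v. c \<le> marg_XZ p v} (XZ j \<omega>) * (?B \<omega> * ?m \<omega>)) \<partial>\<Omega>) + (\<integral>\<^sup>+\<omega>. ?A \<omega> * (indicator {v. marg_XZ p v < c} (XZ j \<omega>) * (?B \<omega> * ?m \<omega>)) \<partial>\<Omega>)"
        unfolding split by (intro nn_integral_add borel_measurable_times_ennreal Am im U)
      also have "\<dots> \<le> ennreal (C * \<kappa> * vol (0 :: 'y) / c * (4 * C * C * (vol (0 :: 'z) * \<epsilon>'))) + ennreal (C * C) * emeasure lawXZ {v. marg_XZ p v < c}"
        using \<epsilon>' by (intro add_mono kernel_mean_defect_good[OF J h1_pos h2_pos _ c(1) \<delta>(2) elim] kernel_mean_defect_bad[OF J h1_pos h2_pos]) auto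
      also have "\<dots> \<le> ennreal (A * \<epsilon>') + ennreal (C * C) * ennreal (\<epsilon> / 2 / (C * C))"
        using c(2) by (intro add_mono mult_left_mono) (auto simp: A_def mult_ac)
      also have "\<dots> = ennreal (A * \<epsilon>' + \<epsilon> / 2)"
        using C_pos \<epsilon> \<epsilon>' A0 by (simp flip: ennreal_mult ennreal_plus)
      also have "\<dots> \<le> ennreal \<epsilon>" using \<epsilon>' by (intro ennreal_leI) simp
      finally show "(\<integral>\<^sup>+\<omega>. ennreal (swap_term n s j k \<omega>) \<partial>\<Omega>) \<le> ennreal \<epsilon>" .
    qed
  qed
qed

section \<open>The statistic of the permuted data\<close>

text \<open>Only pairwise distinct \<open>s\<close>, \<open>j\<close>, \<open>k\<close> enter, since
  the mean bound on \<open>swap_term\<close> rests on three independent observations.\<close>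

definition swap_sum :: "nat \<Rightarrow> nat \<Rightarrow> 'w \<Rightarrow> real"
  where "swap_sum n s \<omega> = (\<Sum>j\<in>{1..n}. \<Sum>k\<in>{1..n}. of_bool (s \<noteq> j \<and> s \<noteq> k \<and> j \<noteq> k) *
    (swap_term n s j k \<omega>))"

text \<open>A common bound for all normalised weights when both density estimates are at least
  \<eta>; it tends to 0 because n h^d tends to infinity for both bandwidths.\<close>

definition max_weight :: "nat \<Rightarrow> real \<Rightarrow> real"
  where "max_weight n \<eta> = \<kappa> / \<eta> / (real n * h1 n ^ DIM('y \<times> 'z)) + \<kappa> / \<eta> / (real n * h2 n ^ DIM('z))"

lemma swap_sum_nonneg: "0 \<le> swap_sum n s \<omega>"
  unfolding swap_sum_def
  by (intro sum_nonneg mult_nonneg_nonneg KW.Kh_nonneg KZ.Kh_nonneg h1_pos h2_pos mean_defect_bounds) simp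

lemma max_weight_nonneg: "0 < \<eta> \<Longrightarrow> 0 \<le> max_weight n \<eta>"
  unfolding max_weight_def using KW.\<kappa>_pos h1_pos[of n] h2_pos[of n]
  by (intro add_nonneg_nonneg divide_nonneg_nonneg mult_nonneg_nonneg) auto

text \<open>The bound for permuted divergences, with the denominators of the weights replaced by
  n\<eta>. The constant 32 is 4 times 8: six maximal weights come from
  \<open>permuted_bdiv_bound\<close> and one each from the pairs with \<open>k = s\<close> and with
  \<open>j = s\<close>.\<close>

lemma permuted_bdiv_bound_est:
  assumes s: "s \<in> {1..n}" and \<eta>: "0 < \<eta>" "\<eta> \<le> estYZ n UNIV s \<omega>" "\<eta> \<le> estZ n UNIV s \<omega>"
  shows "(\<Sum>\<sigma> | \<sigma> permutes {1..n}. perm_prob p n (sample \<omega>) \<sigma> * bdiv_perm n s \<sigma> \<omega>) \<le>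
    32 * max_weight n \<eta> + 4 / (real n ^ 2 * \<eta> ^ 2) * swap_sum n s \<omega>"
proof -
  interpret P: permutation_model "{1..n}" lborel lawZ qXZ by (rule permutation_model_XZ)
  let ?I = "{1..n}" and ?d = "datXZ n \<omega>" and ?c = "wYZ n s \<omega>" and ?c' = "wZ n s \<omega>" and ?\<kappa> = "max_weight n \<eta>"
  let ?K = "\<lambda>j. KW.Kh (h1 n) (DW s \<omega>) (DW j \<omega>)" and ?K' = "\<lambda>k. KZ.Kh (h2 n) (DZ s \<omega>) (DZ k \<omega>)"
  have n: "0 < n" using s by auto
  have S: "(\<Sum>j=1..n. ?K j) = real n * estYZ n UNIV s \<omega>" "(\<Sum>j=1..n. ?K' j) = real n * estZ n UNIV s \<omega>"
    using n by (auto simp: estYZ_def estZ_def)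
  have pos: "0 < real n * \<eta>" using n \<eta> by simp
  have S_ge: "real n * \<eta> \<le> (\<Sum>j=1..n. ?K j)" "real n * \<eta> \<le> (\<Sum>j=1..n. ?K' j)" unfolding S using \<eta> by (auto intro!: mult_left_mono)
  then have S_pos: "0 < (\<Sum>j=1..n. ?K j)" "0 < (\<Sum>j=1..n. ?K' j)" using pos by linarith+
  have w: "?c j \<le> ?K j / (real n * \<eta>)" "?c' j \<le> ?K' j / (real n * \<eta>)" for j
    unfolding wYZ_def wZ_def
    by (rule divide_left_mono[OF S_ge(1) KW.Kh_nonneg[OF h1_pos] mult_pos_pos[OF S_pos(1) pos]]
      divide_left_mono[OF S_ge(2) KZ.Kh_nonneg[OF h2_pos] mult_pos_pos[OF S_pos(2) pos]])+
  have wle: "?c j \<le> ?\<kappa>" "?c' j \<le> ?\<kappa>" for j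
  proof -
    have "?c j \<le> \<kappa> / h1 n ^ DIM('y \<times> 'z) / (real n * \<eta>)"
      using w(1)[of j] divide_right_mono[OF KW.Kh_le[OF h1_pos[of n], of "DW s \<omega>" "DW j \<omega>"], of "real n * \<eta>"] pos by linarith
    moreover have "?c' j \<le> \<kappa> / h2 n ^ DIM('z) / (real n * \<eta>)"
      using w(2)[of j] divide_right_mono[OF KZ.Kh_le[OF h2_pos[of n], of "DZ s \<omega>" "DZ j \<omega>"], of "real n * \<eta>"] pos by linarith
    moreover have "0 \<le> \<kappa> / h1 n ^ DIM('y \<times> 'z) / (real n * \<eta>)" "0 \<le> \<kappa> / h2 n ^ DIM('z) / (real n * \<eta>)"
      using pos KW.\<kappa>_pos h1_pos[of n] h2_pos[of n] by (auto intro!: divide_nonneg_nonneg mult_nonneg_nonneg)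
    moreover have "?\<kappa> = \<kappa> / h1 n ^ DIM('y \<times> 'z) / (real n * \<eta>) + \<kappa> / h2 n ^ DIM('z) / (real n * \<eta>)"
      unfolding max_weight_def by (simp only: divide_divide_eq_left mult_ac)
    ultimately show "?c j \<le> ?\<kappa>" "?c' j \<le> ?\<kappa>" by linarith+
  qed
  have sum1: "(\<Sum>i\<in>?I. ?c i) = 1" "(\<Sum>i\<in>?I. ?c' i) = 1"
    unfolding wYZ_def wZ_def sum_divide_distrib[symmetric] using S_pos by simp_all
  define \<rho> where "\<rho> j k = (\<Sum>\<sigma> | \<sigma> permutes ?I. max 0 (P.perm_weight \<sigma> ?d - P.perm_weight (\<sigma> \<circ> Transposition.transpose j k) ?d))" for j k
  have \<rho>_diag: "\<rho> j j = 0" for j by (simp add: \<rho>_def)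
  have \<rho>: "\<rho> j k = mdef n j k ?d" if "j \<in> ?I" "k \<in> ?I" "j \<noteq> k" for j k
    unfolding \<rho>_def P.mean_defect_def using P.perm_weight_swap[OF that] by (intro sum.cong) auto
  have \<rho>01: "0 \<le> \<rho> j k" "\<rho> j k \<le> 1" if "j \<in> ?I" "k \<in> ?I" for j k
    using \<rho>_diag \<rho>[OF that] mean_defect_bounds[of n j k ?d] by (cases "j = k"; simp)+
  \<comment> \<open>Pairs that involve \<open>s\<close> cannot be handled in mean and are bounded by
    the maximal weight; equal indices contribute nothing, because their transposition is the
    identity.\<close>
  have term_le: "?c j * ?c' k * \<rho> j k \<le> of_bool (k = s) * (?\<kappa> * ?c j) + of_bool (j = s) * (?\<kappa> * ?c' k) +
      1 / (real n ^ 2 * \<eta> ^ 2) * (of_bool (s \<noteq> j \<and> s \<noteq> k \<and> j \<noteq> k) * (?K j * ?K' k * mdef n j k ?d))"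
    if jk: "j \<in> ?I" "k \<in> ?I" for j k
  proof -
    have nn: "0 \<le> ?\<kappa> * ?c j" "0 \<le> ?\<kappa> * ?c' k" "0 \<le> 1 / (real n ^ 2 * \<eta> ^ 2) * (of_bool (s \<noteq> j \<and> s \<noteq> k \<and> j \<noteq> k) * (?K j * ?K' k * mdef n j k ?d))"
      using max_weight_nonneg[OF \<eta>(1)] w_nonneg mean_defect_bounds KW.Kh_nonneg[OF h1_pos] KZ.Kh_nonneg[OF h2_pos] by (auto simp del: One_nat_def)
    have b1: "?c j * ?c' k * \<rho> j k \<le> ?c j * ?c' k"
      using \<rho>01(2)[OF jk] by (intro mult_left_le) (auto intro: mult_nonneg_nonneg w_nonneg)
    consider "k = s" | "j = s" | "j = k" | "s \<noteq> j \<and> s \<noteq> k \<and> j \<noteq> k" by auto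
    then show ?thesis
    proof cases
      case 1
      have "?c j * ?c' k \<le> ?\<kappa> * ?c j" using mult_left_mono[OF wle(2) w_nonneg(1)] by (simp add: mult.commute)
      then show ?thesis using b1 nn 1 by (cases "j = s") auto
    next
      case 2
      have "?c j * ?c' k \<le> ?\<kappa> * ?c' k" using mult_right_mono[OF wle(1) w_nonneg(2)] by (simp add: mult.commute)
      then show ?thesis using b1 nn 2 by (cases "k = s") auto
    next
      case 3
      then show ?thesis using \<rho>_diag nn by (cases "k = s") auto
    next
      case 4
      have "?c j * ?c' k * \<rho> j k \<le> (?K j / (real n * \<eta>)) * (?K' k / (real n * \<eta>)) * mdef n j k ?d"
        unfolding \<rho>[OF jk conjunct2[OF conjunct2[OF 4]]] using pos
        by (intro mult_right_mono mult_mono w w_nonneg mean_defect_bounds divide_nonneg_nonneg KW.Kh_nonneg h1_pos) auto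
      also have "\<dots> = 1 / (real n ^ 2 * \<eta> ^ 2) * (?K j * ?K' k * mdef n j k ?d)"
        by (simp only: power2_eq_square times_divide_eq_left times_divide_eq_right divide_divide_eq_left mult_1_left mult_ac)
      finally show ?thesis using 4 by (simp del: One_nat_def)
    qed
  qed
  have "(\<Sum>\<sigma> | \<sigma> permutes ?I. perm_prob p n (sample \<omega>) \<sigma> * bdiv ?I ?c ?c' (\<lambda>i. DX (\<sigma> i) \<omega>)) =
    (\<Sum>\<sigma> | \<sigma> permutes ?I. P.perm_weight \<sigma> ?d * bdiv ?I ?c ?c' (\<lambda>i. DX (\<sigma> i) \<omega>))"
    by (intro sum.cong) (auto simp: perm_prob_eq simp del: One_nat_def)
  also have "\<dots> \<le> 4 * ((\<Sum>j\<in>?I. \<Sum>k\<in>?I. ?c j * ?c' k * \<rho> j k) + 6 * ?\<kappa>)"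
    unfolding \<rho>_def
    by (intro permuted_bdiv_bound[where x="\<lambda>i. DX i \<omega>"] w_nonneg sum1 wle P.perm_weight_nonneg P.sum_perm_weight_le_1) auto
  also have "(\<Sum>j\<in>?I. \<Sum>k\<in>?I. ?c j * ?c' k * \<rho> j k) \<le> (\<Sum>j\<in>?I. \<Sum>k\<in>?I. of_bool (k = s) * (?\<kappa> * ?c j) + of_bool (j = s) * (?\<kappa> * ?c' k) +
      1 / (real n ^ 2 * \<eta> ^ 2) * (of_bool (s \<noteq> j \<and> s \<noteq> k \<and> j \<noteq> k) * (?K j * ?K' k * mdef n j k ?d)))"
    by (intro sum_mono term_le)
  also have "\<dots> = (\<Sum>j\<in>?I. \<Sum>k\<in>?I. of_bool (k = s) * (?\<kappa> * ?c j)) + (\<Sum>j\<in>?I. \<Sum>k\<in>?I. of_bool (j = s) * (?\<kappa> * ?c' k)) +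
    1 / (real n ^ 2 * \<eta> ^ 2) * swap_sum n s \<omega>"
    by (simp only: sum.distrib swap_sum_def sum_distrib_left)
  also have "(\<Sum>j\<in>?I. \<Sum>k\<in>?I. of_bool (k = s) * (?\<kappa> * ?c j)) = ?\<kappa>"
  proof -
    have "(\<Sum>k\<in>?I. of_bool (k = s) * (?\<kappa> * ?c j)) = ?\<kappa> * ?c j" for j
      unfolding sum_distrib_right[symmetric] using s by (simp add: of_bool_def sum.delta)
    then show ?thesis by (simp only: sum_distrib_left[symmetric] sum1 mult_1_right)
  qed
  also have "(\<Sum>j\<in>?I. \<Sum>k\<in>?I. of_bool (j = s) * (?\<kappa> * ?c' k)) = ?\<kappa>"
  proof -
    have "(\<Sum>k\<in>?I. of_bool (j = s) * (?\<kappa> * ?c' k)) = of_bool (j = s) * ?\<kappa>" for j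
      by (simp only: sum_distrib_left[symmetric] sum1 mult_1_right)
    then show ?thesis using s by (simp add: sum_distrib_right[symmetric] of_bool_def sum.delta del: One_nat_def)
  qed
  finally show ?thesis by (simp add: algebra_simps)
qed

text \<open>One bound for all data: the first two groups cover the case that a density estimate is
  below \<eta>, the last one is the bound for estimates at least \<eta>.\<close>

definition bdiv_majorant :: "nat \<Rightarrow> real \<Rightarrow> nat \<Rightarrow> 'w \<Rightarrow> real"
  where "bdiv_majorant n \<eta> s \<omega> = 2 * of_bool (marg_YZ p (DW s \<omega>) < 2 * \<eta>) + 2 / \<eta> * \<bar>estYZ n UNIV s \<omega> - marg_YZ p (DW s \<omega>)\<bar> +
    (2 * of_bool (marg_Z p (DZ s \<omega>) < 2 * \<eta>) + 2 / \<eta> * \<bar>estZ n UNIV s \<omega> - marg_Z p (DZ s \<omega>)\<bar>) +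
    (32 * max_weight n \<eta> + 4 / (real n ^ 2 * \<eta> ^ 2) * swap_sum n s \<omega>)"

lemma permuted_bdiv_bound_all:
  assumes s: "s \<in> {1..n}" and \<eta>: "0 < \<eta>"
  shows "(\<Sum>\<sigma> | \<sigma> permutes {1..n}. perm_prob p n (sample \<omega>) \<sigma> * bdiv_perm n s \<sigma> \<omega>) \<le> bdiv_majorant n \<eta> s \<omega>"
  (is "?L \<le> _")
proof -
  let ?a = "2 * of_bool (marg_YZ p (DW s \<omega>) < 2 * \<eta>) + 2 / \<eta> * \<bar>estYZ n UNIV s \<omega> - marg_YZ p (DW s \<omega>)\<bar>"
  let ?b = "2 * of_bool (marg_Z p (DZ s \<omega>) < 2 * \<eta>) + 2 / \<eta> * \<bar>estZ n UNIV s \<omega> - marg_Z p (DZ s \<omega>)\<bar>"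
  let ?c = "32 * max_weight n \<eta> + 4 / (real n ^ 2 * \<eta> ^ 2) * swap_sum n s \<omega>"
  interpret P: permutation_model "{1..n}" lborel lawZ qXZ by (rule permutation_model_XZ)
  have c0: "0 \<le> ?c" by (intro add_nonneg_nonneg mult_nonneg_nonneg max_weight_nonneg[OF \<eta>] swap_sum_nonneg) auto
  have ab0: "0 \<le> ?a" "0 \<le> ?b" using \<eta> by auto
  \<comment> \<open>A density estimate below \<eta> means that the density is below 2\<eta> or that
    the estimate is wrong by at least \<eta>. Either alternative already yields 2, the trivial bound
    for the divergence.\<close>
  have small: "2 \<le> 2 * of_bool (m < 2 * \<eta>) + 2 / \<eta> * \<bar>f - m\<bar>" if "f < \<eta>" for f m :: real
  proof (cases "m < 2 * \<eta>")
    case False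
    then have "\<eta> \<le> \<bar>f - m\<bar>" using that by linarith
    then have "2 / \<eta> * \<eta> \<le> 2 / \<eta> * \<bar>f - m\<bar>" using \<eta> by (intro mult_left_mono) auto
    then show ?thesis using \<eta> False by simp
  qed (use \<eta> in auto)
  have L2: "?L \<le> 2"
  proof -
    have "?L = (\<Sum>\<sigma> | \<sigma> permutes {1..n}. P.perm_weight \<sigma> (datXZ n \<omega>) * bdiv_perm n s \<sigma> \<omega>)"
      by (intro sum.cong) (auto simp: perm_prob_eq simp del: One_nat_def)
    also have "\<dots> \<le> (\<Sum>\<sigma> | \<sigma> permutes {1..n}. P.perm_weight \<sigma> (datXZ n \<omega>) * 2)"
      by (intro sum_mono mult_left_mono bdiv_le_2 w_nonneg sum_w_le P.perm_weight_nonneg) auto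
    also have "\<dots> \<le> 2" unfolding sum_distrib_right[symmetric] using P.sum_perm_weight_le_1[of "datXZ n \<omega>"] by simp
    finally show ?thesis .
  qed
  consider "estYZ n UNIV s \<omega> < \<eta>" | "estZ n UNIV s \<omega> < \<eta>" | "\<eta> \<le> estYZ n UNIV s \<omega>" "\<eta> \<le> estZ n UNIV s \<omega>" by linarith
  then have "?L \<le> ?a + ?b + ?c"
  proof cases
    case 1
    then show ?thesis using small[OF 1, of "marg_YZ p (DW s \<omega>)"] ab0 c0 L2 by linarith
  next
    case 2
    then show ?thesis using small[OF 2, of "marg_Z p (DZ s \<omega>)"] ab0 c0 L2 by linarith
  next
    case 3
    then show ?thesis using permuted_bdiv_bound_est[OF s \<eta> 3] ab0 by linarith
  qed
  then show ?thesis unfolding bdiv_majorant_def .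
qed

lemma expectation_bdiv_majorant:
  assumes s: "s \<in> {1..n}" and \<eta>: "0 < \<eta>" and e: "0 \<le> e1" "0 \<le> e2" "0 \<le> e3"
    and Y: "(\<integral>\<^sup>+\<omega>. ennreal \<bar>estYZ n UNIV s \<omega> - marg_YZ p (DW s \<omega>)\<bar> \<partial>\<Omega>) \<le> ennreal e2"
    and Z: "(\<integral>\<^sup>+\<omega>. ennreal \<bar>estZ n UNIV s \<omega> - marg_Z p (DZ s \<omega>)\<bar> \<partial>\<Omega>) \<le> ennreal e2"
    and mY: "emeasure (lawYZ) {w. marg_YZ p w < 2 * \<eta>} \<le> ennreal e1"
    and mZ: "emeasure lawZ {z. marg_Z p z < 2 * \<eta>} \<le> ennreal e1"
    and sw: "\<And>j k. j \<in> {1..n} \<Longrightarrow> k \<in> {1..n} \<Longrightarrow> s \<noteq> j \<Longrightarrow> s \<noteq> k \<Longrightarrow> j \<noteq> k \<Longrightarrow>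
      (\<integral>\<^sup>+\<omega>. ennreal (swap_term n s j k \<omega>) \<partial>\<Omega>) \<le> ennreal e3"
  shows "bdiv_majorant n \<eta> s \<in> borel_measurable \<Omega>"
    "(\<integral>\<^sup>+\<omega>. ennreal (bdiv_majorant n \<eta> s \<omega>) \<partial>\<Omega>) \<le>
    ennreal (4 * e1 + 4 / \<eta> * e2 + 32 * max_weight n \<eta> + 4 / \<eta> ^ 2 * e3)"
proof -
  have n: "0 < n" using s by auto
  have s1: "s \<in> {1..}" using s by auto
  let ?u1 = "\<lambda>\<omega>. of_bool (marg_YZ p (DW s \<omega>) < 2 * \<eta>) :: real"
  let ?u2 = "\<lambda>\<omega>. \<bar>estYZ n UNIV s \<omega> - marg_YZ p (DW s \<omega>)\<bar>"
  let ?u3 = "\<lambda>\<omega>. of_bool (marg_Z p (DZ s \<omega>) < 2 * \<eta>) :: real"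
  let ?u4 = "\<lambda>\<omega>. \<bar>estZ n UNIV s \<omega> - marg_Z p (DZ s \<omega>)\<bar>"
  have mm: "(\<lambda>\<omega>. marg_YZ p (DW s \<omega>)) \<in> borel_measurable \<Omega>" "(\<lambda>\<omega>. marg_Z p (DZ s \<omega>)) \<in> borel_measurable \<Omega>"
    by (rule measurable_compose[OF D_components_meas(2)[OF s1] marg_meas(2)] measurable_compose[OF D_components_meas(3)[OF s1] marg_meas(3)])+
  note em = est_meas[OF _ s, of UNIV]
  have u2: "?u2 \<in> borel_measurable \<Omega>" and u4: "?u4 \<in> borel_measurable \<Omega>"
    using em mm by (auto intro!: borel_measurable_abs borel_measurable_diff)
  have u1: "?u1 \<in> borel_measurable \<Omega>" and u3: "?u3 \<in> borel_measurable \<Omega>" using mm by measurable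
  have tm: "(\<lambda>\<omega>. swap_term n s j k \<omega>) \<in> borel_measurable \<Omega>"
    if "j \<in> {1..n}" "k \<in> {1..n}" for j k
    using that by (intro borel_measurable_times KW.Kh_meas KZ.Kh_meas D_components_meas s1 mean_defect_datXZ_meas) auto
  have u5: "swap_sum n s \<in> borel_measurable \<Omega>"
    unfolding swap_sum_def by (intro borel_measurable_sum borel_measurable_times[OF borel_measurable_const tm])
  have i1: "(\<integral>\<^sup>+\<omega>. ennreal (?u1 \<omega>) \<partial>\<Omega>) \<le> ennreal e1"
  proof -
    have "(\<integral>\<^sup>+\<omega>. ennreal (?u1 \<omega>) \<partial>\<Omega>) = (\<integral>\<^sup>+\<omega>. (\<lambda>e. indicator {w. marg_YZ p w < 2 * \<eta>} (snd e)) (D s \<omega>) \<partial>\<Omega>)"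
      by (intro nn_integral_cong) (auto simp: indicator_def)
    also have "\<dots> = (\<integral>\<^sup>+e. indicator {w. marg_YZ p w < 2 * \<eta>} (snd e) \<partial>law)" by (rule nn_integral_D[OF s1]) measurable
    also have "\<dots> = (\<integral>\<^sup>+w. ennreal (marg_YZ p w) * indicator {w. marg_YZ p w < 2 * \<eta>} w \<partial>lborel)" by (rule nn_integral_joint_YZ) measurable
    also have "\<dots> = emeasure (lawYZ) {w. marg_YZ p w < 2 * \<eta>}" by (intro emeasure_density[symmetric]) auto
    finally show ?thesis using mY by simp
  qed
  have i3: "(\<integral>\<^sup>+\<omega>. ennreal (?u3 \<omega>) \<partial>\<Omega>) \<le> ennreal e1"
  proof -
    have "(\<integral>\<^sup>+\<omega>. ennreal (?u3 \<omega>) \<partial>\<Omega>) = (\<integral>\<^sup>+\<omega>. (\<lambda>e. indicator {w. marg_Z p w < 2 * \<eta>} (snd (snd e))) (D s \<omega>) \<partial>\<Omega>)"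
      by (intro nn_integral_cong) (auto simp: indicator_def)
    also have "\<dots> = (\<integral>\<^sup>+e. indicator {w. marg_Z p w < 2 * \<eta>} (snd (snd e)) \<partial>law)" by (rule nn_integral_D[OF s1]) measurable
    also have "\<dots> = (\<integral>\<^sup>+w. ennreal (marg_Z p w) * indicator {w. marg_Z p w < 2 * \<eta>} w \<partial>lborel)" by (rule nn_integral_joint_Z) measurable
    also have "\<dots> = emeasure lawZ {w. marg_Z p w < 2 * \<eta>}" by (intro emeasure_density[symmetric]) auto
    finally show ?thesis using mZ by simp
  qed
  have i5: "(\<integral>\<^sup>+\<omega>. ennreal (swap_sum n s \<omega>) \<partial>\<Omega>) \<le> ennreal (real n ^ 2 * e3)"
  proof -
    let ?t = "\<lambda>j k \<omega>. of_bool (s \<noteq> j \<and> s \<noteq> k \<and> j \<noteq> k) * (swap_term n s j k \<omega>)"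
    have t0: "0 \<le> ?t j k \<omega>" for j k \<omega>
      by (intro mult_nonneg_nonneg KW.Kh_nonneg KZ.Kh_nonneg h1_pos h2_pos mean_defect_bounds) simp
    have tle: "(\<integral>\<^sup>+\<omega>. ennreal (?t j k \<omega>) \<partial>\<Omega>) \<le> ennreal e3" if "j \<in> {1..n}" "k \<in> {1..n}" for j k
      using sw[OF that] by (cases "s \<noteq> j \<and> s \<noteq> k \<and> j \<noteq> k") auto
    have "(\<integral>\<^sup>+\<omega>. ennreal (swap_sum n s \<omega>) \<partial>\<Omega>) = (\<integral>\<^sup>+\<omega>. (\<Sum>j\<in>{1..n}. \<Sum>k\<in>{1..n}. ennreal (?t j k \<omega>)) \<partial>\<Omega>)"
      unfolding swap_sum_def by (intro nn_integral_cong) (simp only: sum_ennreal t0 sum_nonneg)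
    also have "\<dots> = (\<Sum>j\<in>{1..n}. \<integral>\<^sup>+\<omega>. (\<Sum>k\<in>{1..n}. ennreal (?t j k \<omega>)) \<partial>\<Omega>)"
      by (intro nn_integral_sum borel_measurable_sum measurable_compose[OF borel_measurable_times[OF borel_measurable_const tm] measurable_ennreal])
    also have "\<dots> = (\<Sum>j\<in>{1..n}. \<Sum>k\<in>{1..n}. \<integral>\<^sup>+\<omega>. ennreal (?t j k \<omega>) \<partial>\<Omega>)"
      by (intro sum.cong refl nn_integral_sum measurable_compose[OF borel_measurable_times[OF borel_measurable_const tm] measurable_ennreal])
    also have "\<dots> \<le> (\<Sum>j\<in>{1..n}. \<Sum>k\<in>{1..n}. ennreal e3)" by (intro sum_mono tle)
    also have "\<dots> = ennreal (real n ^ 2 * e3)"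
      using e by (simp add: power2_eq_square ennreal_mult mult.assoc ennreal_of_nat_eq_real_of_nat)
    finally show ?thesis .
  qed
  have comb: "ennreal (b * x1 + c * x2 + (b * x3 + c * x4) + (d + e * x5)) =
      ennreal b * ennreal x1 + ennreal c * ennreal x2 + (ennreal b * ennreal x3 + ennreal c * ennreal x4) + (ennreal d + ennreal e * ennreal x5)"
    if "0 \<le> b" "0 \<le> c" "0 \<le> d" "0 \<le> e" "0 \<le> x1" "0 \<le> x2" "0 \<le> x3" "0 \<le> x4" "0 \<le> x5" for b c d e x1 x2 x3 x4 x5
    using that by (simp only: ennreal_mult ennreal_plus add_nonneg_nonneg mult_nonneg_nonneg)
  note ms = measurable_compose[OF u1 measurable_ennreal] measurable_compose[OF u2 measurable_ennreal] measurable_compose[OF u3 measurable_ennreal]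
    measurable_compose[OF u4 measurable_ennreal] measurable_compose[OF u5 measurable_ennreal]
  show "bdiv_majorant n \<eta> s \<in> borel_measurable \<Omega>"
    unfolding bdiv_majorant_def by (intro borel_measurable_add borel_measurable_times borel_measurable_const u1 u2 u3 u4 u5)
  have "(\<integral>\<^sup>+\<omega>. ennreal (bdiv_majorant n \<eta> s \<omega>) \<partial>\<Omega>) = (\<integral>\<^sup>+\<omega>. ennreal 2 * ennreal (?u1 \<omega>) + ennreal (2 / \<eta>) * ennreal (?u2 \<omega>) + (ennreal 2 * ennreal (?u3 \<omega>) + ennreal (2 / \<eta>) * ennreal (?u4 \<omega>)) +
      (ennreal (32 * max_weight n \<eta>) + ennreal (4 / (real n ^ 2 * \<eta> ^ 2)) * ennreal (swap_sum n s \<omega>)) \<partial>\<Omega>)"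
    unfolding bdiv_majorant_def using \<eta> max_weight_nonneg[OF \<eta>, of n] swap_sum_nonneg[of n s]
    by (intro nn_integral_cong comb) auto
  also have "\<dots> = ennreal 2 * (\<integral>\<^sup>+\<omega>. ennreal (?u1 \<omega>) \<partial>\<Omega>) + ennreal (2 / \<eta>) * (\<integral>\<^sup>+\<omega>. ennreal (?u2 \<omega>) \<partial>\<Omega>) +
      (ennreal 2 * (\<integral>\<^sup>+\<omega>. ennreal (?u3 \<omega>) \<partial>\<Omega>) + ennreal (2 / \<eta>) * (\<integral>\<^sup>+\<omega>. ennreal (?u4 \<omega>) \<partial>\<Omega>)) +
      (ennreal (32 * max_weight n \<eta>) + ennreal (4 / (real n ^ 2 * \<eta> ^ 2)) * (\<integral>\<^sup>+\<omega>. ennreal (swap_sum n s \<omega>) \<partial>\<Omega>))"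
    by (simp only: nn_integral_add nn_integral_cmult ms borel_measurable_times_ennreal borel_measurable_add borel_measurable_const
      nn_integral_const emeasure_space_1 mult_1_right)
  also have "\<dots> \<le> ennreal 2 * ennreal e1 + ennreal (2 / \<eta>) * ennreal e2 + (ennreal 2 * ennreal e1 + ennreal (2 / \<eta>) * ennreal e2) +
      (ennreal (32 * max_weight n \<eta>) + ennreal (4 / (real n ^ 2 * \<eta> ^ 2)) * ennreal (real n ^ 2 * e3))"
    by (intro add_mono mult_left_mono i1 i3 i5 Y Z order_refl) auto
  also have "\<dots> = ennreal (2 * e1 + 2 / \<eta> * e2 + (2 * e1 + 2 / \<eta> * e2) + (32 * max_weight n \<eta> + 4 / (real n ^ 2 * \<eta> ^ 2) * (real n ^ 2 * e3)))"
    using \<eta> e max_weight_nonneg[OF \<eta>, of n]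
    by (intro comb[symmetric]) auto
  also have "2 * e1 + 2 / \<eta> * e2 + (2 * e1 + 2 / \<eta> * e2) + (32 * max_weight n \<eta> + 4 / (real n ^ 2 * \<eta> ^ 2) * (real n ^ 2 * e3)) =
    4 * e1 + 4 / \<eta> * e2 + 32 * max_weight n \<eta> + 4 / \<eta> ^ 2 * e3"
    using n by simp
  finally show "(\<integral>\<^sup>+\<omega>. ennreal (bdiv_majorant n \<eta> s \<omega>) \<partial>\<Omega>) \<le>
    ennreal (4 * e1 + 4 / \<eta> * e2 + 32 * max_weight n \<eta> + 4 / \<eta> ^ 2 * e3)" .
qed

lemma max_weight_tendsto: "(\<lambda>n. max_weight n \<eta>) \<longlonglongrightarrow> 0"
proof -
  have "(\<lambda>n. \<kappa> / \<eta> / (real n * h1 n ^ DIM('y \<times> 'z)) + \<kappa> / \<eta> / (real n * h2 n ^ DIM('z))) \<longlonglongrightarrow> 0 + 0"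
    by (intro tendsto_add real_tendsto_divide_at_top[OF tendsto_const] nh1 nh2)
  then show ?thesis unfolding max_weight_def by simp
qed

text \<open>The threshold \<eta> is fixed first, so that low densities have small probability; only
  then are the errors of the estimates and of the exchange terms made small relative to \<eta>, for
  they are divided by \<eta> and its square.\<close>

lemma permuted_zeta_hat_small:
  assumes \<epsilon>: "0 < \<epsilon>"
  shows "eventually (\<lambda>n. (\<integral>\<^sup>+\<omega>. ennreal (\<Sum>\<sigma> | \<sigma> permutes {1..n}. perm_prob p n (sample \<omega>) \<sigma> *
    stat n (permute_data \<sigma> (sample \<omega>))) \<partial>\<Omega>) \<le> ennreal \<epsilon>) sequentially"
proof -
  define \<tau> where "\<tau> = \<epsilon> / amax / 4"
  have \<tau>: "0 < \<tau>" unfolding \<tau>_def using \<epsilon> amax_pos by simp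
  interpret LZ: prob_space lawZ by (rule prob_lawZ)
  let ?lY = "lawYZ"
  interpret LY: prob_space ?lY using marg_int(1) by (intro prob_spaceI) (simp add: emeasure_density)
  have "AE w in ?lY. 0 < marg_YZ p w" by (subst AE_density) (auto simp: marg_nonneg)
  then obtain c where c: "0 < c" "emeasure ?lY {w. marg_YZ p w < c} \<le> ennreal (\<tau> / 4)"
    using LY.small_values[of "marg_YZ p" "\<tau> / 4"] \<tau> by auto
  have "AE w in lawZ. 0 < marg_Z p w" by (subst AE_density) (auto simp: marg_nonneg)
  then obtain c' where c': "0 < c'" "emeasure lawZ {w. marg_Z p w < c'} \<le> ennreal (\<tau> / 4)"
    using LZ.small_values[of "marg_Z p" "\<tau> / 4"] \<tau> by auto
  define \<eta> where "\<eta> = min c c' / 2"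
  have \<eta>: "0 < \<eta>" "2 * \<eta> \<le> c" "2 * \<eta> \<le> c'" using c c' by (auto simp: \<eta>_def)
  have mY: "emeasure ?lY {w. marg_YZ p w < 2 * \<eta>} \<le> ennreal (\<tau> / 4)"
    by (rule order_trans[OF emeasure_mono c(2)]) (use \<eta> in auto)
  have mZ: "emeasure lawZ {w. marg_Z p w < 2 * \<eta>} \<le> ennreal (\<tau> / 4)"
    by (rule order_trans[OF emeasure_mono c'(2)]) (use \<eta> in auto)
  \<comment> \<open>\<open>e2\<close> and \<open>e3\<close> balance the majorant: low densities,
    estimation errors, maximal weight and exchange terms contribute at most \<tau> each, and 4\<tau>
    = \<epsilon>/amax.\<close>
  define e2 where "e2 = \<eta> * \<tau> / 4"
  define e3 where "e3 = \<eta> ^ 2 * \<tau> / 4"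
  have e: "0 < e2" "0 < e3" using \<eta> \<tau> by (auto simp: e2_def e3_def)
  have U: "UNIV \<in> sets (borel :: 'x measure)" by simp
  have "eventually (\<lambda>n. max_weight n \<eta> < \<tau> / 32) sequentially"
    using \<tau> by (intro order_tendstoD(2)[OF max_weight_tendsto]) auto
  moreover note estYZ_L1[OF U e(1)] estZ_L1[OF U e(1)] kernel_mean_defect_small[OF e(2)] eventually_gt_at_top[of "0::nat"]
  ultimately show ?thesis
  proof eventually_elim
    case (elim n)
    let ?B = "\<lambda>s \<omega>. \<Sum>\<sigma> | \<sigma> permutes {1..n}. perm_prob p n (sample \<omega>) \<sigma> * bdiv_perm n s \<sigma> \<omega>"
    have n: "0 < n" using elim by simp
    have G: "bdiv_majorant n \<eta> s \<in> borel_measurable \<Omega>" "(\<integral>\<^sup>+\<omega>. ennreal (bdiv_majorant n \<eta> s \<omega>) \<partial>\<Omega>) \<le> ennreal (4 * \<tau>)"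
      if s: "s \<in> {1..n}" for s
    proof -
      have Y: "(\<integral>\<^sup>+\<omega>. ennreal \<bar>estYZ n UNIV s \<omega> - marg_YZ p (DW s \<omega>)\<bar> \<partial>\<Omega>) \<le> ennreal e2"
        and Z: "(\<integral>\<^sup>+\<omega>. ennreal \<bar>estZ n UNIV s \<omega> - marg_Z p (DZ s \<omega>)\<bar> \<partial>\<Omega>) \<le> ennreal e2"
        using elim(2,3) s unfolding num_UNIV by blast+
      have sw: "(\<integral>\<^sup>+\<omega>. ennreal (swap_term n s j k \<omega>) \<partial>\<Omega>) \<le> ennreal e3"
        if "j \<in> {1..n}" "k \<in> {1..n}" "s \<noteq> j" "s \<noteq> k" "j \<noteq> k" for j k
        using elim(4) s that by blast
      note E = expectation_bdiv_majorant[OF s \<eta>(1) _ _ _ Y Z mY mZ sw]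
      show "bdiv_majorant n \<eta> s \<in> borel_measurable \<Omega>" by (rule E(1)) (use \<tau> e in auto)
      have "(\<integral>\<^sup>+\<omega>. ennreal (bdiv_majorant n \<eta> s \<omega>) \<partial>\<Omega>) \<le> ennreal (4 * (\<tau> / 4) + 4 / \<eta> * e2 + 32 * max_weight n \<eta> + 4 / \<eta> ^ 2 * e3)"
        by (rule E(2)) (use \<tau> e in auto)
      also have "4 * (\<tau> / 4) + 4 / \<eta> * e2 + 32 * max_weight n \<eta> + 4 / \<eta> ^ 2 * e3 \<le> 4 * \<tau>"
      proof -
        have "4 / \<eta> * e2 = \<tau>" "4 / \<eta> ^ 2 * e3 = \<tau>" using \<eta> by (auto simp: e2_def e3_def)
        then show ?thesis using elim(1) by linarith
      qed
      finally show "(\<integral>\<^sup>+\<omega>. ennreal (bdiv_majorant n \<eta> s \<omega>) \<partial>\<Omega>) \<le> ennreal (4 * \<tau>)" by (simp add: ennreal_leI)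
    qed
    have pp0: "0 \<le> perm_prob p n (sample \<omega>) \<sigma>" for \<sigma> \<omega>
      unfolding perm_prob_def by (intro divide_nonneg_nonneg sum_nonneg prod_nonneg) (auto simp: cond_density_nonneg)
    have B0: "0 \<le> ?B s \<omega>" for s \<omega> by (intro sum_nonneg mult_nonneg_nonneg pp0 bdiv_nonneg w_nonneg)
    have "(\<integral>\<^sup>+\<omega>. ennreal (\<Sum>\<sigma> | \<sigma> permutes {1..n}. perm_prob p n (sample \<omega>) \<sigma> * stat n (permute_data \<sigma> (sample \<omega>))) \<partial>\<Omega>) \<le>
      (\<integral>\<^sup>+\<omega>. (\<Sum>s=1..n. ennreal (amax / real n) * ennreal (bdiv_majorant n \<eta> s \<omega>)) \<partial>\<Omega>)"
    proof (rule nn_integral_mono)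
      fix \<omega>
      have "(\<Sum>\<sigma> | \<sigma> permutes {1..n}. perm_prob p n (sample \<omega>) \<sigma> * stat n (permute_data \<sigma> (sample \<omega>))) =
        (\<Sum>\<sigma> | \<sigma> permutes {1..n}. \<Sum>s=1..n. (a (DW s \<omega>) / real n) * (perm_prob p n (sample \<omega>) \<sigma> * bdiv_perm n s \<sigma> \<omega>))"
        unfolding zeta_hat_eq sum_distrib_left by (intro sum.cong refl) (simp del: One_nat_def)
      also have "\<dots> = (\<Sum>s=1..n. \<Sum>\<sigma> | \<sigma> permutes {1..n}. (a (DW s \<omega>) / real n) * (perm_prob p n (sample \<omega>) \<sigma> * bdiv_perm n s \<sigma> \<omega>))"
        by (rule sum.swap)
      also have "\<dots> = (\<Sum>s=1..n. (a (DW s \<omega>) / real n) * ?B s \<omega>)" by (simp only: sum_distrib_left)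
      also have "\<dots> \<le> (\<Sum>s=1..n. amax / real n * bdiv_majorant n \<eta> s \<omega>)"
        using amax_pos by (intro sum_mono mult_mono permuted_bdiv_bound_all \<eta> divide_right_mono a_le B0) auto
      finally have "ennreal (\<Sum>\<sigma> | \<sigma> permutes {1..n}. perm_prob p n (sample \<omega>) \<sigma> * stat n (permute_data \<sigma> (sample \<omega>))) \<le>
        ennreal (\<Sum>s=1..n. amax / real n * bdiv_majorant n \<eta> s \<omega>)" by (rule ennreal_leI)
      also have "\<dots> = (\<Sum>s=1..n. ennreal (amax / real n * bdiv_majorant n \<eta> s \<omega>))"
      proof (rule sum_ennreal[symmetric])
        fix s assume s: "s \<in> {1..n}"
        show "0 \<le> amax / real n * bdiv_majorant n \<eta> s \<omega>"
          using amax_pos order_trans[OF B0 permuted_bdiv_bound_all[OF s \<eta>(1)]] by (intro mult_nonneg_nonneg) auto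
      qed
      also have "\<dots> = (\<Sum>s=1..n. ennreal (amax / real n) * ennreal (bdiv_majorant n \<eta> s \<omega>))"
        using amax_pos by (intro sum.cong refl ennreal_mult') auto
      finally show "ennreal (\<Sum>\<sigma> | \<sigma> permutes {1..n}. perm_prob p n (sample \<omega>) \<sigma> * stat n (permute_data \<sigma> (sample \<omega>))) \<le>
        (\<Sum>s=1..n. ennreal (amax / real n) * ennreal (bdiv_majorant n \<eta> s \<omega>))" .
    qed
    also have "\<dots> = (\<Sum>s=1..n. ennreal (amax / real n) * (\<integral>\<^sup>+\<omega>. ennreal (bdiv_majorant n \<eta> s \<omega>) \<partial>\<Omega>))"
      using G(1) by (subst nn_integral_sum) (auto intro!: sum.cong nn_integral_cmult)
    also have "\<dots> \<le> (\<Sum>s=1..n. ennreal (amax / real n) * ennreal (4 * \<tau>))"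
      by (intro sum_mono mult_left_mono G(2)) auto
    also have "\<dots> = ennreal (\<Sum>s=1..n. amax / real n * (4 * \<tau>))"
    proof -
      have "0 \<le> amax / real n" "0 \<le> 4 * \<tau>" using amax_pos \<tau> by auto
      then show ?thesis by (simp only: ennreal_mult[symmetric] sum_ennreal mult_nonneg_nonneg)
    qed
    also have "(\<Sum>s=1..n. amax / real n * (4 * \<tau>)) = \<epsilon>" using n amax_pos by (simp add: \<tau>_def)
    finally show ?case .
  qed
qed

section \<open>Level and power\<close>

lemma sets_XYZ_base: "sets (lborel \<Otimes>\<^sub>M lawYZ) = sets (borel :: ('x \<times> 'y \<times> 'z) measure)"
proof -
  have "sets (lborel \<Otimes>\<^sub>M lawYZ) = sets ((borel :: 'x measure) \<Otimes>\<^sub>M (borel :: ('y \<times> 'z) measure))"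
    by (intro sets_pair_measure_cong) auto
  then show ?thesis by (simp only: borel_prod)
qed

lemma base_sets_YZ: "sets (PiM {1..n} (\<lambda>_. lborel \<Otimes>\<^sub>M lawYZ)) = sets (PiM {1..n} borelXYZ)"
  by (intro sets_PiM_cong refl sets_XYZ_base)

lemma permutation_model_YZ: "permutation_model {1..n} lborel lawYZ qXYZ"
proof
  interpret N: prob_space lawYZ using marg_int(1) by (intro prob_spaceI) (simp add: emeasure_density)
  show "\<exists>A. countable A \<and> A \<subseteq> sets lawYZ \<and> \<Union> A = space lawYZ \<and> (\<forall>a\<in>A. emeasure lawYZ a \<noteq> \<infinity>)"
    by (rule N.sigma_finite_countable)
  have "(\<lambda>e :: 'x \<times> 'y \<times> 'z. cond_density p (fst e) (snd (snd e))) \<in> borel_measurable borel" by measurable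
  then show "qXYZ \<in> borel_measurable (lborel \<Otimes>\<^sub>M lawYZ)"
    unfolding measurable_cong_sets[OF sets_XYZ_base refl] .
qed (auto simp: cond_density_nonneg intro: lborel.sigma_finite_countable)

abbreviation "low_rank \<equiv> permutation_model.rank_event"

lemma perm_prob_weight:
  assumes "\<sigma> permutes {1..n}"
  shows "perm_prob p n d \<sigma> = permutation_model.perm_weight {1..n} qXYZ \<sigma> d"
proof -
  interpret P: permutation_model "{1..n}" lborel lawYZ qXYZ by (rule permutation_model_YZ)
  show ?thesis unfolding perm_prob_def P.perm_weight_def P.lik_def permute_fst_def by simp
qed

lemma perm_prob_nonneg: "0 \<le> perm_prob p n d \<sigma>"
  unfolding perm_prob_def by (intro divide_nonneg_nonneg sum_nonneg prod_nonneg) (auto simp: cond_density_nonneg)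

lemma perm_prob_meas:
  assumes "\<sigma> permutes {1..n}"
  shows "(\<lambda>d. perm_prob p n d \<sigma>) \<in> borel_measurable (PiM {1..n} (\<lambda>_. borel))"
proof -
  interpret P: permutation_model "{1..n}" lborel lawYZ qXYZ by (rule permutation_model_YZ)
  show ?thesis unfolding perm_prob_weight[OF assms] using P.perm_weight_meas[OF assms]
    unfolding measurable_cong_sets[OF base_sets_YZ refl] .
qed

lemma sum_perm_prob_le_1: "(\<Sum>\<sigma> | \<sigma> permutes {1..n}. perm_prob p n d \<sigma>) \<le> 1"
proof -
  interpret P: permutation_model "{1..n}" lborel lawYZ qXYZ by (rule permutation_model_YZ)
  show ?thesis using P.sum_perm_weight_le_1[of d] by (simp add: perm_prob_weight del: One_nat_def)
qed

lemma zeta_hat_permuted_meas: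
  assumes \<sigma>: "\<sigma> permutes {1..n}"
  shows "(\<lambda>d. stat n (permute_data \<sigma> d)) \<in> borel_measurable (PiM {1..n} borelXYZ)"
proof -
  interpret P: permutation_model "{1..n}" lborel lawYZ qXYZ by (rule permutation_model_YZ)
  have "permute_data \<sigma> \<in> measurable (PiM {1..n} (\<lambda>_. borel)) (PiM {1..n} borelXYZ)"
    using measurable_permute_fst[OF \<sigma>, where M="lborel :: 'x measure" and N=lawYZ] unfolding measurable_cong_sets[OF base_sets_YZ base_sets_YZ] permute_fst_def permute_data_def .
  from measurable_compose[OF this zeta_hat_measurable[OF KW.K_nonneg KW.K_meas a_meas]] show ?thesis .
qed

lemma zeta_hat_permuted_restrict:
  assumes "\<sigma> permutes {1..n}"
  shows "stat n (permute_data \<sigma> (\<lambda>i\<in>{1..n}. d i)) = stat n (permute_data \<sigma> d)"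
  by (intro zeta_hat_cong KW.K_nonneg) (use permutes_in_image[OF assms] in \<open>simp add: permute_data_def\<close>)

lemma perm_permutes:
  assumes "cpt_permutations \<Omega> p n D M \<pi>" "j \<in> {1..M}" "\<omega> \<in> space \<Omega>"
  shows "\<pi> j \<omega> permutes {1..n}"
proof -
  have "\<pi> j \<in> measurable \<Omega> (count_space {\<pi>. \<pi> permutes {1..n}})"
    using assms(1,2) unfolding cpt_permutations_def Let_def by blast
  from measurable_space[OF this assms(3)] show ?thesis by simp
qed

abbreviation "rejected n \<alpha> M \<pi> \<equiv> {\<omega>\<in>space \<Omega>. phi_CPT \<alpha> (stat n) M (\<lambda>j. \<pi> j \<omega>) (sample \<omega>) = 1}"

lemma phi_CPT_iff:
  assumes perms: "cpt_permutations \<Omega> p n D M \<pi>" and \<omega>: "\<omega> \<in> space \<Omega>"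
  shows "phi_CPT \<alpha> (stat n) M (\<lambda>j. \<pi> j \<omega>) (sample \<omega>) = 1 \<longleftrightarrow>
    low_rank (stat n) \<alpha> M (\<lambda>j\<in>{1..M}. \<pi> j \<omega>) (sample_upto n \<omega>)"
proof -
  interpret P: permutation_model "{1..n}" lborel lawYZ qXYZ by (rule permutation_model_YZ)
  have D: "stat n (sample_upto n \<omega>) = stat n (sample \<omega>)"
    by (intro zeta_hat_cong KW.K_nonneg) simp
  have "stat n (permute_fst ((\<lambda>j\<in>{1..M}. \<pi> j \<omega>) j) (sample_upto n \<omega>)) =
    stat n (permute_data (\<pi> j \<omega>) (sample \<omega>))" if j: "j \<in> {1..M}" for j
    using zeta_hat_permuted_restrict[OF perm_permutes[OF perms j \<omega>], of "sample \<omega>"] j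
    unfolding permute_fst_def permute_data_def by (simp del: One_nat_def)
  then have "(\<Sum>j=1..M. of_bool (stat n (permute_fst ((\<lambda>j\<in>{1..M}. \<pi> j \<omega>) j) (sample_upto n \<omega>)) \<ge> stat n (sample_upto n \<omega>)) :: real) =
    (\<Sum>j=1..M. of_bool (stat n (permute_data (\<pi> j \<omega>) (sample \<omega>)) \<ge> stat n (sample \<omega>)))"
    unfolding D by (intro sum.cong refl) (simp only:)
  then show ?thesis unfolding phi_CPT_def p_CPT_def P.rank_event_def by simp
qed

lemma rank_event_pred:
  assumes \<tau>: "\<tau> \<in> {1..M} \<rightarrow>\<^sub>E {\<sigma>. \<sigma> permutes {1..n}}"
  shows "Measurable.pred (PiM {1..n} borelXYZ) (low_rank (stat n) \<alpha> M \<tau>)"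
proof -
  interpret P: permutation_model "{1..n}" lborel lawYZ qXYZ by (rule permutation_model_YZ)
  let ?PB = "PiM {1..n} borelXYZ"
  note zm = zeta_hat_measurable[OF KW.K_nonneg KW.K_meas a_meas, of "h1 n" "h2 n" n]
  have m: "(\<lambda>d. of_bool (stat n (permute_fst (\<tau> j) d) \<ge> stat n d) :: real) \<in> borel_measurable ?PB"
    if j: "j \<in> {1..M}" for j
  proof -
    have z: "(\<lambda>d. stat n (permute_fst (\<tau> j) d)) \<in> borel_measurable ?PB"
    proof -
      have "\<tau> j permutes {1..n}" using \<tau> j by (auto simp: PiE_iff)
      from zeta_hat_permuted_meas[OF this] show ?thesis unfolding permute_fst_def permute_data_def .
    qed
    have "{d \<in> space ?PB. stat n d \<le> stat n (permute_fst (\<tau> j) d)} \<in> sets ?PB"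
      by (rule borel_measurable_le[OF zm z])
    then have "Measurable.pred ?PB (\<lambda>d. stat n d \<le> stat n (permute_fst (\<tau> j) d))"
      by (simp add: pred_def)
    then show ?thesis by measurable
  qed
  have "(\<lambda>d. (1 + (\<Sum>j=1..M. of_bool (stat n (permute_fst (\<tau> j) d) \<ge> stat n d))) / (1 + real M)) \<in> borel_measurable ?PB"
    by (intro borel_measurable_divide borel_measurable_add borel_measurable_const borel_measurable_sum m)
  from borel_measurable_less[OF this borel_measurable_const[of \<alpha>]]
  show ?thesis by (simp only: pred_def P.rank_event_def)
qed

lemma rejection_event:
  assumes perms: "cpt_permutations \<Omega> p n D M \<pi>"
  shows "(rejected n \<alpha> M \<pi>) \<in> events" (is ?meas)
    "emeasure \<Omega> (rejected n \<alpha> M \<pi>) =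
      (\<integral>\<^sup>+\<omega>. ennreal (permutation_model.rejection {1..n} qXYZ (stat n) \<alpha> M (sample_upto n \<omega>)) \<partial>\<Omega>)" (is ?em)
proof -
  interpret P: permutation_model "{1..n}" lborel lawYZ qXYZ by (rule permutation_model_YZ)
  have S: "(rejected n \<alpha> M \<pi>) =
    {\<omega>\<in>space \<Omega>. low_rank (stat n) \<alpha> M (\<lambda>j\<in>{1..M}. \<pi> j \<omega>) (sample_upto n \<omega>)}"
    using phi_CPT_iff[OF perms] by blast
  have Dm: "D i \<in> measurable \<Omega> borel" if "i \<in> {1..n}" for i using that by (intro D_meas) auto
  note E = emeasure_cpt_event[where Q="low_rank (stat n) \<alpha> M",
      OF prob_space_axioms perms Dm rank_event_pred perm_prob_nonneg perm_prob_meas]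
  show ?meas unfolding S by (rule E(1)) auto
  have R: "(\<Sum>\<sigma>\<in>{1..M} \<rightarrow>\<^sub>E {\<sigma>. \<sigma> permutes {1..n}}. (\<Prod>j=1..M. perm_prob p n d (\<sigma> j)) * of_bool (low_rank (stat n) \<alpha> M \<sigma> d)) =
    P.rejection (stat n) \<alpha> M d" for d
    unfolding P.rejection_def
  proof (intro sum.cong refl arg_cong2[of _ _ _ _ "(*)"] prod.cong)
    fix \<sigma> j assume "\<sigma> \<in> {1..M} \<rightarrow>\<^sub>E {\<sigma>. \<sigma> permutes {1..n}}" "j \<in> {1..M}"
    then show "perm_prob p n d (\<sigma> j) = P.perm_weight (\<sigma> j) d" by (intro perm_prob_weight) auto
  qed
  show ?em unfolding S R[symmetric] by (rule E(2)) auto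
qed

text \<open>Under the null hypothesis the full sample is an instance of
  \<open>permutation_model\<close> with second component (Y,Z), so the statistic may depend on all
  the data and \<open>rejection_probability_le\<close> applies for every \<open>n\<close>.\<close>

lemma type_I_error:
  assumes perms: "cpt_permutations \<Omega> p n D M \<pi>" and n: "1 \<le> n" and ci: "cond_indep \<Omega> X Y Z" and \<alpha>: "0 < \<alpha>"
  shows "prob (rejected n \<alpha> M \<pi>) \<le> \<alpha>"
proof -
  interpret P: permutation_model "{1..n}" lborel lawYZ qXYZ by (rule permutation_model_YZ)
  let ?r = "\<lambda>\<omega>. sample_upto n \<omega>"
  have id: "(\<lambda>e. e) \<in> measurable borel ((lborel :: 'x measure) \<Otimes>\<^sub>M lawYZ)"
    by (rule measurable_ident_sets) (simp only: sets_XYZ_base)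
  have "indep_vars (\<lambda>_. borel) D {1..n}" by (rule indep_vars_subset[OF D_ind]) auto
  from indep_vars_compose2[OF this, of "\<lambda>_ e. e" "\<lambda>_. (lborel :: 'x measure) \<Otimes>\<^sub>M lawYZ"] id
  have ind: "indep_vars (\<lambda>_. (lborel :: 'x measure) \<Otimes>\<^sub>M lawYZ) D {1..n}" by simp
  have law: "distr \<Omega> (lborel \<Otimes>\<^sub>M lawYZ) (D i) = density (lborel \<Otimes>\<^sub>M lawYZ) (\<lambda>e. ennreal (cond_density p (fst e) (snd (snd e))))"
    if i: "i \<in> {1..n}" for i
  proof -
    have "distr \<Omega> (lborel \<Otimes>\<^sub>M lawYZ) (D i) = distr \<Omega> borel (D i)" by (intro distr_cong refl sets_XYZ_base)
    also have "\<dots> = distr \<Omega> borel (\<lambda>\<omega>. (X \<omega>, Y \<omega>, Z \<omega>))" using D_law[of i] law_XYZ i by simp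
    also note law_of_cond_indep[OF ci]
    finally show ?thesis .
  qed
  have base: "distr \<Omega> P.base ?r = density P.base (\<lambda>d. ennreal (P.lik d))"
    using P.distr_iid[OF prob_space_axioms _ ind law] n by simp
  have rm: "?r \<in> measurable \<Omega> P.base"
    unfolding measurable_cong_sets[OF refl base_sets_YZ] by (intro measurable_restrict D_meas) auto
  have T: "stat n \<in> borel_measurable P.base"
    using zeta_hat_measurable[OF KW.K_nonneg KW.K_meas a_meas] unfolding measurable_cong_sets[OF base_sets_YZ refl] .
  have "(\<integral>\<^sup>+d. ennreal (P.lik d) \<partial>P.base) = emeasure (distr \<Omega> P.base ?r) (space P.base)"
    unfolding base emeasure_density[OF measurable_compose[OF P.lik_meas measurable_ennreal] sets.top]
    by (intro nn_integral_cong) simp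
  also have "\<dots> = 1" using prob_space.emeasure_space_1[OF prob_space_distr[OF rm]] by simp
  finally have total: "(\<integral>\<^sup>+d. ennreal (P.lik d) \<partial>P.base) = 1" .
  let ?\<rho> = "\<lambda>d. ennreal (P.rejection (stat n) \<alpha> M d)"
  have \<rho>m: "?\<rho> \<in> borel_measurable P.base" by (rule measurable_compose[OF P.rejection_meas[OF T] measurable_ennreal])
  have "emeasure \<Omega> (rejected n \<alpha> M \<pi>) = (\<integral>\<^sup>+d. ?\<rho> d \<partial>distr \<Omega> P.base ?r)"
    unfolding rejection_event(2)[OF perms] using \<rho>m by (intro nn_integral_distr[symmetric] rm) auto
  also have "\<dots> = (\<integral>\<^sup>+d. ennreal (P.lik d) * ?\<rho> d \<partial>P.base)"
    unfolding base by (rule nn_integral_density[OF measurable_compose[OF P.lik_meas measurable_ennreal] \<rho>m])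
  also have "\<dots> \<le> ennreal \<alpha>" by (rule P.rejection_probability_le[OF T \<alpha> total])
  finally show ?thesis using \<alpha> by (simp add: emeasure_eq_measure)
qed

text \<open>Union bound over the \<open>M\<close> draws and Markov's inequality, both conditionally
  on the data; the mean of one permuted statistic given the data is small in expectation by
  \<open>permuted_zeta_hat_small\<close>.\<close>

lemma permuted_statistic_small:
  assumes perms: "\<forall>n\<ge>1. cpt_permutations \<Omega> p n D M (\<pi> n)" and \<kappa>0: "0 < \<kappa>0" and \<epsilon>: "0 < \<epsilon>"
  shows "eventually (\<lambda>n. {\<omega>\<in>space \<Omega>. \<exists>j\<in>{1..M}. \<kappa>0 \<le> stat n (permute_data (\<pi> n j \<omega>) (sample \<omega>))} \<in> events \<and>
    prob {\<omega>\<in>space \<Omega>. \<exists>j\<in>{1..M}. \<kappa>0 \<le> stat n (permute_data (\<pi> n j \<omega>) (sample \<omega>))} \<le> \<epsilon>) sequentially"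
proof -
  \<comment> \<open>The loss is M/\<kappa>0 times \<epsilon>'. The denominator M+1 also covers the
    case M = 0.\<close>
  define \<epsilon>' where "\<epsilon>' = \<epsilon> * \<kappa>0 / (real M + 1)"
  have \<epsilon>': "0 < \<epsilon>'" using \<epsilon> \<kappa>0 by (simp add: \<epsilon>'_def)
  from permuted_zeta_hat_small[OF \<epsilon>'] eventually_ge_at_top[of "1::nat"] show ?thesis
  proof eventually_elim
    case (elim n)
    let ?S = "{\<sigma>. \<sigma> permutes {1..n}}" and ?T = "stat n"
    let ?Q = "\<lambda>\<sigma> (d :: nat \<Rightarrow> 'x \<times> 'y \<times> 'z). \<exists>j\<in>{1..M}. \<kappa>0 \<le> ?T (permute_data (\<sigma> j) d)"
    let ?r = "\<lambda>\<omega>. sample_upto n \<omega>"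
    let ?V = "\<lambda>d. \<Sum>\<sigma>\<in>?S. perm_prob p n d \<sigma> * ?T (permute_data \<sigma> d)"
    note pn = perms[rule_format, OF elim(2)]
    have fin: "finite ?S" by (rule finite_permutations) simp
    have T0: "0 \<le> ?T d" for d
      unfolding zeta_hat_bdiv[of K, OF KW.K_nonneg]
      by (intro mult_nonneg_nonneg sum_nonneg bdiv_nonneg divide_nonneg_nonneg KW.K_nonneg a0) auto
    have S: "{\<omega>\<in>space \<Omega>. \<exists>j\<in>{1..M}. \<kappa>0 \<le> ?T (permute_data (\<pi> n j \<omega>) (sample \<omega>))} =
      {\<omega>\<in>space \<Omega>. ?Q (\<lambda>j\<in>{1..M}. \<pi> n j \<omega>) (?r \<omega>)}"
    proof (intro Collect_cong conj_cong refl bex_cong)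
      fix \<omega> j assume "\<omega> \<in> space \<Omega>" "j \<in> {1..M}"
      then show "(\<kappa>0 \<le> ?T (permute_data (\<pi> n j \<omega>) (sample \<omega>))) = (\<kappa>0 \<le> ?T (permute_data ((\<lambda>j\<in>{1..M}. \<pi> n j \<omega>) j) (?r \<omega>)))"
        using zeta_hat_permuted_restrict[OF perm_permutes[OF pn], of j \<omega> "sample \<omega>"] by (simp del: One_nat_def)
    qed
    have Dm: "D i \<in> measurable \<Omega> borel" if "i \<in> {1..n}" for i using that by (intro D_meas) auto
    have Qm: "Measurable.pred (PiM {1..n} borelXYZ) (?Q \<sigma>)" if \<sigma>: "\<sigma> \<in> {1..M} \<rightarrow>\<^sub>E ?S" for \<sigma>
    proof (intro pred_intros_finite)
      fix j assume j: "j \<in> {1..M}"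
      have "(\<lambda>d. ?T (permute_data (\<sigma> j) d)) \<in> borel_measurable (PiM {1..n} borelXYZ)"
        using \<sigma> j by (intro zeta_hat_permuted_meas) auto
      from borel_measurable_le[OF borel_measurable_const this]
      show "Measurable.pred (PiM {1..n} borelXYZ) (\<lambda>d. \<kappa>0 \<le> ?T (permute_data (\<sigma> j) d))" by (simp add: pred_def)
    qed simp
    note E = emeasure_cpt_event[where Q="?Q", OF prob_space_axioms pn Dm Qm perm_prob_nonneg perm_prob_meas]
    have pw: "(\<Sum>\<sigma>\<in>{1..M} \<rightarrow>\<^sub>E ?S. (\<Prod>j=1..M. perm_prob p n d (\<sigma> j)) * of_bool (?Q \<sigma> d)) \<le> real M / \<kappa>0 * ?V d" for d
    proof -
      \<comment> \<open>Markov's inequality inside the product: the factor of draw \<open>j\<close>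
        receives the extra factor T/\<kappa>0, which is at least 1 if draw \<open>j\<close> reaches
        \<kappa>0. The sums over the other draws are at most 1.\<close>
      define f where "f j i \<tau> = perm_prob p n d \<tau> * (if i = j then ?T (permute_data \<tau> d) / \<kappa>0 else 1)" for i j :: nat and \<tau>
      have V0: "0 \<le> ?V d" by (intro sum_nonneg mult_nonneg_nonneg perm_prob_nonneg T0)
      have "(\<Sum>\<sigma>\<in>{1..M} \<rightarrow>\<^sub>E ?S. (\<Prod>j=1..M. perm_prob p n d (\<sigma> j)) * of_bool (?Q \<sigma> d)) \<le>
        (\<Sum>\<sigma>\<in>{1..M} \<rightarrow>\<^sub>E ?S. \<Sum>j=1..M. \<Prod>i=1..M. f j i (\<sigma> i))"
      proof (rule sum_mono)
        fix \<sigma>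
        have f0: "0 \<le> (\<Prod>i=1..M. f j i (\<sigma> i))" for j
          unfolding f_def using \<kappa>0 by (intro prod_nonneg mult_nonneg_nonneg perm_prob_nonneg ballI) (auto intro!: T0 divide_nonneg_nonneg)
        show "(\<Prod>j=1..M. perm_prob p n d (\<sigma> j)) * of_bool (?Q \<sigma> d) \<le> (\<Sum>j=1..M. \<Prod>i=1..M. f j i (\<sigma> i))"
        proof (cases "?Q \<sigma> d")
          case False
          then show ?thesis using f0 by (simp add: sum_nonneg)
        next
          case True
          then obtain j where j: "j \<in> {1..M}" "\<kappa>0 \<le> ?T (permute_data (\<sigma> j) d)" by auto
          have "(\<Prod>i=1..M. perm_prob p n d (\<sigma> i)) \<le> (\<Prod>i=1..M. f j i (\<sigma> i))"
          proof (intro prod_mono conjI perm_prob_nonneg)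
            fix i
            have "1 \<le> (if i = j then ?T (permute_data (\<sigma> i) d) / \<kappa>0 else 1)" using j \<kappa>0 by (simp add: le_divide_eq)
            from mult_left_mono[OF this perm_prob_nonneg[of n d "\<sigma> i"]]
            show "perm_prob p n d (\<sigma> i) \<le> f j i (\<sigma> i)" unfolding f_def by simp
          qed
          also have "\<dots> \<le> (\<Sum>j=1..M. \<Prod>i=1..M. f j i (\<sigma> i))" by (rule member_le_sum[OF j(1)]) (use f0 in auto)
          finally show ?thesis using True by simp
        qed
      qed
      also have "\<dots> = (\<Sum>j=1..M. \<Sum>\<sigma>\<in>{1..M} \<rightarrow>\<^sub>E ?S. \<Prod>i=1..M. f j i (\<sigma> i))" by (rule sum.swap)
      also have "\<dots> = (\<Sum>j=1..M. \<Prod>i=1..M. \<Sum>\<tau>\<in>?S. f j i \<tau>)"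
        using fin by (intro sum.cong refl prod_sum_PiE[symmetric]) auto
      also have "\<dots> \<le> (\<Sum>j=1..M. ?V d / \<kappa>0)"
      proof (rule sum_mono)
        fix j assume j: "j \<in> {1..M}"
        have f0: "0 \<le> f j i \<tau>" for i \<tau> unfolding f_def using \<kappa>0 by (auto intro!: mult_nonneg_nonneg perm_prob_nonneg T0 divide_nonneg_nonneg)
        have "(\<Prod>i=1..M. \<Sum>\<tau>\<in>?S. f j i \<tau>) = (\<Sum>\<tau>\<in>?S. f j j \<tau>) * (\<Prod>i\<in>{1..M} - {j}. \<Sum>\<tau>\<in>?S. f j i \<tau>)"
          using j by (intro prod.remove) auto
        also have "\<dots> \<le> (\<Sum>\<tau>\<in>?S. f j j \<tau>) * 1"
        proof (intro mult_left_mono prod_le_1 sum_nonneg f0 conjI)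
          fix i assume "i \<in> {1..M} - {j}"
          then have "(\<Sum>\<tau>\<in>?S. f j i \<tau>) = (\<Sum>\<tau>\<in>?S. perm_prob p n d \<tau>)" by (intro sum.cong) (auto simp: f_def)
          then show "(\<Sum>\<tau>\<in>?S. f j i \<tau>) \<le> 1" using sum_perm_prob_le_1[of n d] by (simp del: One_nat_def)
        qed
        also have "\<dots> = ?V d / \<kappa>0" by (simp add: f_def sum_divide_distrib)
        finally show "(\<Prod>i=1..M. \<Sum>\<tau>\<in>?S. f j i \<tau>) \<le> ?V d / \<kappa>0" .
      qed
      also have "\<dots> = real M / \<kappa>0 * ?V d" by simp
      finally show ?thesis .
    qed
    have V: "?V (?r \<omega>) = ?V (sample \<omega>)" for \<omega>
      by (intro sum.cong refl arg_cong2[of _ _ _ _ "(*)"]) (auto simp: perm_prob_restrict zeta_hat_permuted_restrict simp del: One_nat_def)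
    have "emeasure \<Omega> {\<omega>\<in>space \<Omega>. ?Q (\<lambda>j\<in>{1..M}. \<pi> n j \<omega>) (?r \<omega>)} \<le> ennreal \<epsilon>"
    proof -
      have "emeasure \<Omega> {\<omega>\<in>space \<Omega>. ?Q (\<lambda>j\<in>{1..M}. \<pi> n j \<omega>) (?r \<omega>)} =
        (\<integral>\<^sup>+\<omega>. ennreal (\<Sum>\<sigma>\<in>{1..M} \<rightarrow>\<^sub>E ?S. (\<Prod>j=1..M. perm_prob p n (?r \<omega>) (\<sigma> j)) * of_bool (?Q \<sigma> (?r \<omega>))) \<partial>\<Omega>)"
        by (rule E(2)) auto
      also have "\<dots> \<le> (\<integral>\<^sup>+\<omega>. ennreal (real M / \<kappa>0) * ennreal (?V (sample \<omega>)) \<partial>\<Omega>)"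
      proof (rule nn_integral_mono)
        fix \<omega>
        have "ennreal (\<Sum>\<sigma>\<in>{1..M} \<rightarrow>\<^sub>E ?S. (\<Prod>j=1..M. perm_prob p n (?r \<omega>) (\<sigma> j)) * of_bool (?Q \<sigma> (?r \<omega>))) \<le> ennreal (real M / \<kappa>0 * ?V (?r \<omega>))"
          by (rule ennreal_leI[OF pw])
        also have "\<dots> = ennreal (real M / \<kappa>0) * ennreal (?V (sample \<omega>))"
          unfolding V using \<kappa>0 by (intro ennreal_mult') auto
        finally show "ennreal (\<Sum>\<sigma>\<in>{1..M} \<rightarrow>\<^sub>E ?S. (\<Prod>j=1..M. perm_prob p n (?r \<omega>) (\<sigma> j)) * of_bool (?Q \<sigma> (?r \<omega>))) \<le>
          ennreal (real M / \<kappa>0) * ennreal (?V (sample \<omega>))" .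
      qed
      also have "\<dots> = ennreal (real M / \<kappa>0) * (\<integral>\<^sup>+\<omega>. ennreal (?V (sample \<omega>)) \<partial>\<Omega>)"
      proof (rule nn_integral_cmult)
        have rm: "?r \<in> measurable \<Omega> (PiM {1..n} (\<lambda>_. borel))" by (intro measurable_restrict D_meas) auto
        have "?V \<in> borel_measurable (PiM {1..n} (\<lambda>_. borel))"
          by (intro borel_measurable_sum borel_measurable_times perm_prob_meas zeta_hat_permuted_meas) auto
        from measurable_compose[OF measurable_compose[OF rm this] measurable_ennreal]
        show "(\<lambda>\<omega>. ennreal (?V (sample \<omega>))) \<in> borel_measurable \<Omega>" unfolding V .
      qed
      also have "\<dots> \<le> ennreal (real M / \<kappa>0) * ennreal \<epsilon>'" by (intro mult_left_mono elim(1)) auto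
      also have "\<dots> = ennreal (real M / \<kappa>0 * \<epsilon>')" using \<epsilon>' \<kappa>0 by (intro ennreal_mult[symmetric]) auto
      also have "\<dots> \<le> ennreal \<epsilon>"
        unfolding \<epsilon>'_def using \<epsilon> \<kappa>0 by (intro ennreal_leI) (simp add: field_simps)
      finally show ?thesis .
    qed
    moreover have "{\<omega>\<in>space \<Omega>. ?Q (\<lambda>j\<in>{1..M}. \<pi> n j \<omega>) (?r \<omega>)} \<in> events" by (rule E(1)) auto
    ultimately show ?case unfolding S using \<epsilon> by (simp add: emeasure_eq_measure del: One_nat_def)
  qed
qed

text \<open>Once the original statistic is at least \<kappa>0 and no permuted one reaches \<kappa>0,
  the p-value takes its least value and the test rejects. Each of the two exceptional events has
  small probability.\<close>

lemma power_tendsto_1: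
  assumes perms: "\<forall>n\<ge>1. cpt_permutations \<Omega> p n D M (\<pi> n)" and nci: "\<not> cond_indep \<Omega> X Y Z"
    and \<alpha>: "0 < \<alpha>" and M: "real M > (1 - \<alpha>) / \<alpha>"
  shows "(\<lambda>n. prob {\<omega>\<in>space \<Omega>. phi_CPT \<alpha> (stat n) M (\<lambda>j. \<pi> n j \<omega>) (sample \<omega>) = 1}) \<longlonglongrightarrow> 1"
proof (rule order_tendstoI)
  let ?A = "\<lambda>n. {\<omega>\<in>space \<Omega>. phi_CPT \<alpha> (stat n) M (\<lambda>j. \<pi> n j \<omega>) (sample \<omega>) = 1}"
  show "eventually (\<lambda>n. prob (?A n) < t) sequentially" if "1 < t" for t
    using that by (intro always_eventually allI) (auto intro: le_less_trans[OF prob_le_1])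
  obtain \<kappa>0 where \<kappa>0: "0 < \<kappa>0"
    "\<And>\<epsilon>. 0 < \<epsilon> \<Longrightarrow> eventually (\<lambda>n. prob {\<omega>\<in>space \<Omega>. stat n (sample \<omega>) < \<kappa>0} \<le> \<epsilon>) sequentially"
    using zeta_hat_bounded_below[OF nci] by blast
  \<comment> \<open>Equivalent to the condition on \<open>M\<close>: the least possible p-value lies
    below the level.\<close>
  have M': "1 / (1 + real M) < \<alpha>" using M \<alpha> by (simp add: field_simps)
  fix t :: real assume t: "t < 1"
  \<comment> \<open>Two exceptional events of probability at most (1-t)/3 leave a rejection
    probability strictly above \<open>t\<close>.\<close>
  define \<epsilon> where "\<epsilon> = (1 - t) / 3"
  have \<epsilon>: "0 < \<epsilon>" using t by (simp add: \<epsilon>_def)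
  from \<kappa>0(2)[OF \<epsilon>] permuted_statistic_small[OF perms \<kappa>0(1) \<epsilon>] eventually_ge_at_top[of "1::nat"]
  show "eventually (\<lambda>n. t < prob (?A n)) sequentially"
  proof eventually_elim
    case (elim n)
    let ?B = "{\<omega>\<in>space \<Omega>. stat n (sample \<omega>) < \<kappa>0}"
    let ?E = "{\<omega>\<in>space \<Omega>. \<exists>j\<in>{1..M}. \<kappa>0 \<le> stat n (permute_data (\<pi> n j \<omega>) (sample \<omega>))}"
    have A: "?A n \<in> events" by (rule rejection_event(1)[OF perms[rule_format]]) (use elim in simp)
    have B: "?B \<in> events" by (rule borel_measurable_less[OF zeta_hat_D_meas]) simp
    have E: "?E \<in> events" using elim by blast
    have "space \<Omega> \<subseteq> ?A n \<union> (?B \<union> ?E)"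
    proof
      fix \<omega> assume \<omega>: "\<omega> \<in> space \<Omega>"
      show "\<omega> \<in> ?A n \<union> (?B \<union> ?E)"
      proof (cases "\<omega> \<in> ?B \<union> ?E")
        case False
        then have "(\<Sum>j=1..M. of_bool (stat n (permute_data (\<pi> n j \<omega>) (sample \<omega>)) \<ge> stat n (sample \<omega>)) :: real) = 0"
          using \<omega> by (intro sum.neutral) force
        then have "phi_CPT \<alpha> (stat n) M (\<lambda>j. \<pi> n j \<omega>) (sample \<omega>) = 1"
          unfolding phi_CPT_def p_CPT_def using M' by simp
        then show ?thesis using \<omega> by simp
      qed simp
    qed
    then have "1 \<le> prob (?A n \<union> (?B \<union> ?E))"
      using finite_measure_mono[of "space \<Omega>" "?A n \<union> (?B \<union> ?E)"] A B E prob_space by auto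
    also have "\<dots> \<le> prob (?A n) + (prob ?B + prob ?E)"
      by (rule order_trans[OF measure_Un_le[OF A sets.Un[OF B E]] add_left_mono[OF measure_Un_le[OF B E]]])
    finally show ?case using elim(1,2) \<epsilon> by (simp add: \<epsilon>_def)
  qed
qed

end

text \<open>The fourth power of the bandwidth is the quotient of a sequence tending to 0 and one
  tending to infinity.\<close>

lemma bandwidth_tendsto_0:
  fixes h :: "nat \<Rightarrow> real"
  assumes h: "\<And>n. 0 < h n" and inf: "filterlim (\<lambda>n. real n * h n ^ d) at_top sequentially"
    and zero: "(\<lambda>n. real n * h n ^ (d + 4)) \<longlonglongrightarrow> 0"
  shows "h \<longlonglongrightarrow> 0"
proof -
  have "(\<lambda>n. (real n * h n ^ (d + 4)) / (real n * h n ^ d)) \<longlonglongrightarrow> 0"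
    by (rule real_tendsto_divide_at_top[OF zero inf])
  then have "(\<lambda>n. h n ^ 4) \<longlonglongrightarrow> 0"
  proof (rule Lim_transform_eventually)
    show "eventually (\<lambda>n. (real n * h n ^ (d + 4)) / (real n * h n ^ d) = h n ^ 4) sequentially"
      using eventually_gt_at_top[of "0::nat"]
    proof eventually_elim
      case (elim n)
      then show ?case using h[of n] by (simp add: power_add)
    qed
  qed
  then have "(\<lambda>n. root 4 (h n ^ 4)) \<longlonglongrightarrow> root 4 0" by (rule tendsto_real_root)
  then show ?thesis using h by (simp add: real_root_power_cancel less_imp_le)
qed

text \<open>A Bochner integral of a non-integrable function is 0, so the value 1 forces
  integrability.\<close>

lemma kernel_nn_integral:
  fixes T :: "'d::euclidean_space itself"
  assumes "kernel_moments T K" "\<And>t. 0 \<le> K t"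
  shows "(\<integral>\<^sup>+u. ennreal (K (norm (u :: 'd))) \<partial>lborel) = 1"
proof -
  have 1: "(\<integral>u. K (norm (u :: 'd)) \<partial>lborel) = 1" using assms(1) by (simp add: kernel_moments_def)
  then have "integrable lborel (\<lambda>u :: 'd. K (norm u))" using not_integrable_integral_eq by fastforce
  from nn_integral_eq_integral[OF this] 1 assms(2) show ?thesis by simp
qed

theorem proposition4p2:
  fixes \<Omega> :: "'w measure"
    and X :: "'w \<Rightarrow> 'x::euclidean_space"
    and Y :: "'w \<Rightarrow> 'y::euclidean_space"
    and Z :: "'w \<Rightarrow> 'z::euclidean_space"
    and p :: "'x \<times> 'y \<times> 'z \<Rightarrow> real"
    and D :: "nat \<Rightarrow> 'w \<Rightarrow> 'x \<times> 'y \<times> 'z"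
    and perm :: "nat \<Rightarrow> nat \<Rightarrow> 'w \<Rightarrow> nat \<Rightarrow> nat"
    and K :: "real \<Rightarrow> real"
    and h1 h2 :: "nat \<Rightarrow> real"
    and a :: "'y \<times> 'z \<Rightarrow> real"
    and \<alpha> :: real
    and M :: nat
  assumes prob: "prob_space \<Omega>"
    and p_nonneg: "\<And>w. 0 \<le> p w"
    and density: "distributed \<Omega> lborel (\<lambda>\<omega>. (X \<omega>, Y \<omega>, Z \<omega>)) (\<lambda>w. ennreal (p w))"
    and indep: "prob_space.indep_vars \<Omega> (\<lambda>_. borel) D {1..}"
    and ident: "\<And>i. 1 \<le> i \<Longrightarrow> distr \<Omega> borel (D i) = distr \<Omega> borel (\<lambda>\<omega>. (X \<omega>, Y \<omega>, Z \<omega>))"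
    and A1: "assumption_A1 p"
    and A2: "assumption_A2 TYPE('y) TYPE('z) K"
    and h_pos: "\<And>n. 0 < h1 n" "\<And>n. 0 < h2 n"
    and A3: "assumption_A3 (DIM('y) + DIM('z)) DIM('z) h1 h2"
    and alpha: "0 < \<alpha>" "\<alpha> < 1"
    and weight: "weight_function p a"
    and perms: "\<And>n. 1 \<le> n \<Longrightarrow> cpt_permutations \<Omega> p n D M (perm n)"
  shows "(cond_indep \<Omega> X Y Z \<longrightarrow>
           (\<forall>n\<ge>1. measure \<Omega> {\<omega>\<in>space \<Omega>.
              phi_CPT \<alpha> (zeta_hat K (h1 n) (h2 n) a n) M (\<lambda>j. perm n j \<omega>) (\<lambda>i. D i \<omega>) = 1} \<le> \<alpha>)) \<and>
         (\<not> cond_indep \<Omega> X Y Z \<and> real M > (1 - \<alpha>) / \<alpha> \<longrightarrow>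
           (\<lambda>n. measure \<Omega> {\<omega>\<in>space \<Omega>.
              phi_CPT \<alpha> (zeta_hat K (h1 n) (h2 n) a n) M (\<lambda>j. perm n j \<omega>) (\<lambda>i. D i \<omega>) = 1}) \<longlonglongrightarrow> 1)"
proof -
  interpret prob_space \<Omega> by (rule prob)
  let ?XYZ = "\<lambda>\<omega>. (X \<omega>, Y \<omega>, Z \<omega>)"
  have XYZ: "?XYZ \<in> measurable \<Omega> borel" using distributed_measurable[OF density] by simp
  have law: "distr \<Omega> borel ?XYZ = density lborel (\<lambda>w. ennreal (p w))"
    using distributed_distr_eq_density[OF density] by (simp cong: distr_cong)
  have "(\<lambda>w. enn2real (ennreal (p w))) \<in> borel_measurable lborel"
    using distributed_borel_measurable[OF density] by measurable
  then have p_meas: "p \<in> borel_measurable borel" using p_nonneg by simp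
  have p_int: "(\<integral>\<^sup>+w. ennreal (p w) \<partial>lborel) = 1"
    using prob_space.emeasure_space_1[OF prob_space_distr[OF XYZ]] p_meas unfolding law by (simp add: emeasure_density)
  obtain B where B: "\<And>x y z. p (x, y, z) \<le> B"
    "\<And>x z. (\<integral>\<^sup>+y. ennreal (p (x, y, z)) \<partial>lborel) \<le> ennreal B"
    "\<And>y z. (\<integral>\<^sup>+x. ennreal (p (x, y, z)) \<partial>lborel) \<le> ennreal B"
    "\<And>z. (\<integral>\<^sup>+(x, y). ennreal (p (x, y, z)) \<partial>lborel) \<le> ennreal B"
    using A1 unfolding assumption_A1_def bounded_marginals_def by blast
  \<comment> \<open>The maxima with 1, here and below, make the constants strictly positive, as the
    locales demand.\<close>
  define C where "C = max B 1"
  have C: "B \<le> C" "0 < C" by (simp_all add: C_def)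
  have A2': "K \<in> borel_measurable borel" "bounded (range K)" "\<And>t. 0 \<le> K t" "compact (closure {t. K t \<noteq> 0})"
    "kernel_moments TYPE('y \<times> 'z) K" "kernel_moments TYPE('z) K"
    using A2 unfolding assumption_A2_def by auto
  obtain b where b: "\<And>t. \<bar>K t\<bar> \<le> b" using A2'(2) unfolding bounded_iff by auto
  define \<kappa> where "\<kappa> = max b 1"
  have "bounded {t. K t \<noteq> 0}" using compact_imp_bounded[OF A2'(4)] closure_subset bounded_subset by blast
  then obtain r where r: "\<And>t. K t \<noteq> 0 \<Longrightarrow> \<bar>t\<bar> \<le> r" unfolding bounded_iff by auto
  define R where "R = max r 1"
  have kernel: "smoothing_kernel TYPE('d) K \<kappa> R" if "kernel_moments TYPE('d::euclidean_space) K"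
  proof
    show "K t \<le> \<kappa>" for t using b[of t] by (simp add: \<kappa>_def)
    show "\<bar>t\<bar> \<le> R" if "K t \<noteq> 0" for t using r[OF that] by (simp add: R_def)
    show "(\<integral>\<^sup>+u. ennreal (K (norm (u :: 'd))) \<partial>lborel) = 1" by (rule kernel_nn_integral[OF that A2'(3)])
  qed (use A2' in \<open>auto simp: \<kappa>_def R_def\<close>)
  have W: "a \<in> borel_measurable borel" "\<And>w. 0 \<le> a w" "bounded (range a)" "\<And>w. 0 < marg_YZ p w \<Longrightarrow> 0 < a w"
    using weight unfolding weight_function_def by auto
  obtain c where c: "\<And>w. \<bar>a w\<bar> \<le> c" using W(3) unfolding bounded_iff by auto
  note A3' = A3[unfolded assumption_A3_def]
  interpret joint_density p C
  proof
    show "p w \<le> C" for w using B(1)[of "fst w" "fst (snd w)" "snd (snd w)"] C by simp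
  qed (use p_meas p_nonneg p_int C in \<open>auto intro: order_trans[OF B(2)] order_trans[OF B(3)] order_trans[OF B(4)] ennreal_leI\<close>)
  interpret cond_model p C \<Omega> X Y Z
    by unfold_locales (use XYZ law in auto)
  interpret KW: smoothing_kernel K \<kappa> R "TYPE('y \<times> 'z)" by (rule kernel[OF A2'(5)])
  interpret KZ: smoothing_kernel K \<kappa> R "TYPE('z)" by (rule kernel[OF A2'(6)])
  interpret cpt_data p C \<Omega> X Y Z K \<kappa> R D h1 h2 a "max c 1"
  proof
    show "indep_vars (\<lambda>_. borel) D {1..}" by (rule indep)
    show "distr \<Omega> borel (D i) = density lborel (\<lambda>w. ennreal (p w))" if "i \<in> {1..}" for i
      using ident[of i] law that by simp
    show "0 < h1 n" "0 < h2 n" for n by (rule h_pos)+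
    show "h1 \<longlonglongrightarrow> 0" by (rule bandwidth_tendsto_0[OF h_pos(1)]) (use A3' in auto)
    show "h2 \<longlonglongrightarrow> 0" by (rule bandwidth_tendsto_0[OF h_pos(2)]) (use A3' in auto)
    show "filterlim (\<lambda>n. real n * h1 n ^ DIM('y \<times> 'z)) at_top sequentially" using A3' by simp
    show "filterlim (\<lambda>n. real n * h2 n ^ DIM('z)) at_top sequentially" using A3' by simp
    show "a w \<le> max c 1" for w using c[of w] by simp
  qed (use W in auto)
  show ?thesis
    using type_I_error[OF perms _ _ alpha(1)] power_tendsto_1[of M perm \<alpha>] perms alpha(1) by blast
qed

end
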